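(* Let $\epsilon>0$. For every real $x>0$, every integer $q\ge 1$ and every integer $l$ with $(l,q)=1$, \[ T_q(x;l) = \frac{C_q(l)}{\zeta(3)} \prod_{p\mid q}\Bigl(\frac{p^3}{p^3-1}\Bigr)\frac{x^{1/2}}{q} + \frac{D_q(l)}{\zeta(2)}\prod_{p\mid q}\Bigl(\frac{p^2}{p^2-1}\Bigr)\frac{x^{1/3}}{q} + O_\epsilon\Bigl(\Bigl(x^{1/6}q^{1/12}+\frac{x^{1/5}}{q^{1/5}}\Bigr)q^{\epsilon}\Bigr), \] where the implied constant depends at most on $\epsilon$.
   Context: A positive integer $n$ is squarefull if $n=1$ or, for every prime $p$ dividing $n$, $p^2$ also divides $n$. For real $x$, \[ T_q(x;l) := \#\{\, n\le x : n \text{ is a squarefull positive integer},\ n\equiv l \pmod q \,\}. \] Here $(l,q)$ is the greatest common divisor, $p$ denotes a prime, $\zeta$ is the Riemann zeta function, and $\phi$ is Euler's totient function. For integers $n$ and $q\ge1$, \[ N_2(n;q) := \#\{x \bmod q : x^2\equiv n \pmod q,\ (x,q)=1\},\qquad N_3(n;q) := \#\{x \bmod q : x^3\equiv n \pmod q,\ (x,q)=1\}. \] For $(l,q)=1$, \[ C_q(l) := \sum_{b=1}^{\infty}\frac{N_2(lb;q)}{b^{3/2}},\qquad D_q(l) := -2\frac{\phi(q)}{q} + \frac23\int_1^\infty \frac{\sum_{1\le a\le u} N_3(la;q) - \frac{\phi(q)}{q}u}{u^{5/3}}\,du . \] $f=O_\epsilon(g)$ means $|f|\le C g$ for some constant $C>0$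 that may depend on $\epsilon$. *)

theory Defs
  imports "HOL-Analysis.Analysis" "HOL-Number_Theory.Number_Theory"
begin

definition squarefull :: "nat \<Rightarrow> bool" where
  "squarefull n \<longleftrightarrow> n > 0 \<and> (\<forall>p. prime p \<longrightarrow> p dvd n \<longrightarrow> p\<^sup>2 dvd n)"

definition squarefull_count :: "nat \<Rightarrow> real \<Rightarrow> int \<Rightarrow> nat" where
  "squarefull_count q x l =
     card {n :: nat. squarefull n \<and> real n \<le> x \<and> [int n = l] (mod int q)}"

text \<open>The Riemann zeta function on the half-line \<open>s > 1\<close>, by its Dirichlet series;
  only the values at 2 and 3 are needed.\<close>

definition zeta :: "real \<Rightarrow> real" where
  "zeta s = (\<Sum>n. 1 / real (Suc n) powr s)"

definition unit_root_count :: "nat \<Rightarrow> int \<Rightarrow> nat \<Rightarrow> nat" where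
  "unit_root_count k n q =
     card {x :: int. 0 \<le> x \<and> x < int q \<and> [x ^ k = n] (mod int q) \<and> coprime x (int q)}"

abbreviation N2 :: "int \<Rightarrow> nat \<Rightarrow> nat" where
  "N2 n q \<equiv> unit_root_count 2 n q"

abbreviation N3 :: "int \<Rightarrow> nat \<Rightarrow> nat" where
  "N3 n q \<equiv> unit_root_count 3 n q"

text \<open>The series is shifted so that \<open>b = Suc k\<close> runs over the positive integers.
  It converges because \<open>N2\<close> is at most \<open>q\<close>.\<close>

definition C_coeff :: "nat \<Rightarrow> int \<Rightarrow> real" where
  "C_coeff q l = (\<Sum>k. real (N2 (l * int (Suc k)) q) / real (Suc k) powr (3/2))"

text \<open>For \<open>q \<ge> 1\<close> and \<open>l\<close> coprime to \<open>q\<close>, the map \<open>a \<mapsto> N3 (l * a) q\<close> is periodic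
  modulo \<open>q\<close> with mean value \<open>totient q / q\<close>. The numerator of the integrand is therefore
  bounded in \<open>u\<close>, and the integral converges absolutely.\<close>

definition D_coeff :: "nat \<Rightarrow> int \<Rightarrow> real" where
  "D_coeff q l =
     - 2 * (real (totient q) / real q) +
     2 / 3 * (LBINT u:{1..}.
       ((\<Sum>a\<in>{1..nat \<lfloor>u\<rfloor>}. real (N3 (l * int a) q)) - real (totient q) / real q * u)
         / u powr (5/3))"

end

theory Submission
 imports Defs "HOL-Real_Asymp.Real_Asymp" "HOL-Library.FuncSet" "HOL-Library.Discrete_Functions"
  "HOL-Computational_Algebra.Squarefree"
begin

text \<open>Write a squarefull number uniquely as \<open>a\<^sup>2b\<^sup>3\<close> with \<open>b\<close> squarefree and remove the squarefreeness by
 Moebius inversion. For the remaining pairs, Dirichlet's hyperbola method at \<open>Y = y\<^bsup>1/5\<^esup>\<close> turns the error into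
 sums of a sawtooth over the curve \<open>a\<^sup>2b\<^sup>3 \<equiv> l\<close> modulo \<open>q\<close>. Expanding in additive characters leaves the sums
 \<open>S(h, k)\<close> over the curve; they are invariant under \<open>(h, k) \<mapsto> (hr\<^sup>3, kr\<^sup>-\<^sup>2)\<close>, so averaging over the units \<open>r\<close> and
 Hoelder's inequality bound them on average by the additive energy of the curve, which is
 \<open>O(q\<^bsup>2+\<epsilon>\<^esup>)\<close>. The dual sums are estimated by Kuzmin-Landau and by the second derivative test.\<close>

text \<open>Two requirements shape the argument. The constant may depend on \<epsilon> alone, so no
  factor log x is allowed; a bound of size (x / m^6)^(1/6) summed over the Moebius variable m would
  produce one. For this reason the hyperbola method uses only about log q dyadic blocks, and
  \<open>profile_bound\<close> trades t for t^(1 - \<sigma>), where t = x^(1/6) / m, charging the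
  difference to a small power of q or to the term in x^(1/5). Moreover, the cancellation in
  \<open>S h k\<close> is extracted on average. This works because the curve is rational with
  parameter t = ab: at primes its energy is a count of polynomial roots, and at prime powers the
  frequencies prime to p yield to stationary phase while those divisible by p lead back to the
  previous power. The two error terms mark two thresholds: y^(1/6) q^(1/12) equals the trivial bound
  Y at Y = q^(1/2), and y^(1/5) q^(-1/5) is about the least T for which the resonant frequencies of
  the shortest blocks stay below q^(1/2).\<close>

section \<open>Submultiplicative functions and counts of roots modulo q\<close>

lemma coprime_prime_power_split:
 fixes n :: nat
 assumes "n > 1"
 obtains p k m where "prime p" "k > 0" "n = p ^ k * m" "coprime p m" "m < n" "m > 0"
proof -
 obtain p where p: "prime p" "p dvd n"
  using assms prime_factor_nat[of n] by auto
 define k where "k = multiplicity p n"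
 have "p ^ k dvd n" unfolding k_def by (rule multiplicity_dvd)
 then obtain m where m: "n = p ^ k * m" by blast
 have k: "k > 0" unfolding k_def
  using p assms by (simp add: prime_multiplicity_gt_zero_iff)
 have m0: "m > 0" using m assms by (cases m) auto
 have "~ p dvd m"
 proof
  assume "p dvd m"
  then have "p ^ Suc k dvd n" using m by (auto simp: mult.commute)
  then have "Suc k <= multiplicity p n"
   using assms p by (intro multiplicity_geI) auto
  then show False by (simp add: k_def)
 qed
 then have cop: "coprime p m" using p prime_imp_coprime by blast
 have "p ^ k > 1" using one_less_power[OF prime_gt_1_nat[OF p(1)] k] .
 then have "m < n" using m m0 by simp
 then show ?thesis using that p k m cop m0 by blast
qed

text \<open>A prime power p^n contributes at most C (n+1)^e. For all but finitely many p this is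
  below p^(n\<epsilon>), and the finitely many small primes each cost one bounded factor. The second
  argument of \<open>P\<close> carries a residue class, so that the constant is uniform in
  it.\<close>

lemma submultiplicative_bound:
 fixes P :: "nat => 'c => real" and e :: nat
 assumes eps: "\<epsilon> > 0" and C: "C >= 1"
  and mult: "\<And>a b c. a > 0 ==> b > 0 ==> coprime a b ==> P (a * b) c <= P a c * P b c"
  and nonneg: "\<And>a c. P a c >= 0"
  and pp: "\<And>p n c. prime p ==> n > 0 ==> P (p ^ n) c <= C * (real n + 1) ^ e"
  and one: "\<And>c. P 1 c <= 1"
 shows "\<exists>K\<ge>1. \<forall>n>0. \<forall>c. P n c <= K * real n powr \<epsilon>"
proof -
 have "((%n::nat. C * (real n + 1) ^ e * 2 powr (- (\<epsilon> * real n))) \<longlongrightarrow> 0) sequentially"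
 proof -
  define r where "r = 2 powr (-\<epsilon>)"
  have r: "0 < r" "r < 1" using eps by (auto simp: r_def powr_less_one)
  have "(%n. C * (real (Suc n) ^ e * r ^ n)) \<longlonglongrightarrow> C * 0"
  proof (intro tendsto_mult tendsto_const)
   have "summable (%n. real n ^ e * r ^ n)"
   proof (rule summable_comparison_test_ev[OF _ summable_geometric[of "sqrt r"]])
    have "(%n. real n ^ e * (sqrt r) ^ n) \<longlonglongrightarrow> 0"
     using r by real_asymp
    then have "\<forall>\<^sub>F n in sequentially. real n ^ e * (sqrt r) ^ n < 1"
     by (rule order_tendstoD) simp
    then show "\<forall>\<^sub>F n in sequentially. norm (real n ^ e * r ^ n) <= sqrt r ^ n"
    proof eventually_elim
     case (elim n)
     have "real n ^ e * r ^ n = (real n ^ e * (sqrt r) ^ n) * (sqrt r) ^ n"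
      using r by (simp add: power_mult_distrib[symmetric] mult.assoc)
     also have "... <= 1 * (sqrt r) ^ n"
      using elim r by (intro mult_right_mono) auto
     finally show ?case using r by simp
    qed
    show "norm (sqrt r) < 1" using r by simp
   qed
   then have "(%n. real (Suc n) ^ e * r ^ Suc n) \<longlonglongrightarrow> 0"
    using summable_LIMSEQ_zero LIMSEQ_Suc by blast
   then have "(%n. (real (Suc n) ^ e * r ^ Suc n) * (1 / r)) \<longlonglongrightarrow> 0 * (1 / r)"
    by (intro tendsto_mult tendsto_const)
   then show "(%n. real (Suc n) ^ e * r ^ n) \<longlonglongrightarrow> 0"
    using r by simp
  qed
  moreover have "r ^ n = 2 powr (- (\<epsilon> * real n))" for n
   by (simp add: r_def powr_realpow[symmetric] powr_powr)
  ultimately show ?thesis by (simp add: mult.assoc add.commute)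
 qed
 then have "Bseq (%n::nat. C * (real n + 1) ^ e * 2 powr (- (\<epsilon> * real n)))"
  using convergent_imp_Bseq convergentI by blast
 then obtain B where B: "B > 0" and Bn: "\<And>n::nat. norm (C * (real n + 1) ^ e * 2 powr (- (\<epsilon> * real n))) <= B"
  using BseqE by blast
 define B1 where "B1 = max 1 B"
 \<comment> \<open>From this threshold on p^\<epsilon> >= C 2^e, and n + 1 <= 2^n gives C (n+1)^e <=
   (C 2^e)^n <= p^(n\<epsilon>). Below it the bound \<open>B1\<close> applies, because p >=
   2.\<close>
 obtain N :: nat where N: "N > (C * 2 ^ e) powr (1 / \<epsilon>)"
  using reals_Archimedean2 by blast
 define g :: "nat => real" where "g = (%p. if p < N then B1 else 1)"
 have g1: "g p >= 1" for p by (simp add: g_def B1_def)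
 have key: "P (p ^ k) c <= g p * real (p ^ k) powr \<epsilon>" if p: "prime p" and k: "k > 0" for p k c
 proof (cases "p < N")
  case True
  have "C * (real k + 1) ^ e * 2 powr (- (\<epsilon> * real k)) <= B1"
   using Bn[of k] by (simp add: B1_def)
  then have "C * (real k + 1) ^ e <= B1 * 2 powr (\<epsilon> * real k)"
   by (simp add: powr_minus field_simps)
  also have "... <= B1 * real p powr (\<epsilon> * real k)"
   using eps prime_ge_2_nat[OF p] by (intro mult_left_mono powr_mono2) (auto simp: B1_def)
  also have "real p powr (\<epsilon> * real k) = real (p ^ k) powr \<epsilon>"
   using prime_gt_0_nat[OF p] by (simp add: powr_realpow[symmetric] powr_powr mult.commute)
  finally show ?thesis using pp[OF p k, of c] True by (simp add: g_def)
 next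
  case False
  have "C * 2 ^ e = ((C * 2 ^ e) powr (1 / \<epsilon>)) powr \<epsilon>"
   using eps C by (simp add: powr_powr)
  also have "... <= real p powr \<epsilon>"
   using False N eps by (intro powr_mono2) auto
  finally have 1: "C * 2 ^ e <= real p powr \<epsilon>" .
  have "real k + 1 <= 2 ^ k"
   by (metis Suc_leI less_exp of_nat_Suc of_nat_le_iff of_nat_numeral of_nat_power add.commute)
  then have "(real k + 1) ^ e <= (2 ^ k) ^ e" by (intro power_mono) auto
  moreover have "C <= C ^ k" using C k by (simp add: self_le_power)
  ultimately have "C * (real k + 1) ^ e <= C ^ k * (2 ^ k) ^ e"
   using C by (intro mult_mono) auto
  also have "... = (C * 2 ^ e) ^ k" by (simp add: power_mult_distrib power_mult[symmetric] mult.commute)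
  also have "... <= (real p powr \<epsilon>) ^ k" using 1 C by (intro power_mono) auto
  also have "... = real (p ^ k) powr \<epsilon>"
   using prime_gt_0_nat[OF p] by (simp add: powr_realpow[symmetric] powr_powr mult.commute)
  finally show ?thesis using pp[OF p k, of c] False by (simp add: g_def)
 qed
 have main: "P n c <= (\<Prod>p\<in>prime_factors n. g p) * real n powr \<epsilon>" if "n > 0" for n c
  using that
 proof (induction n rule: less_induct)
  case (less n)
  show ?case
  proof (cases "n = 1")
   case True
   then show ?thesis using one[of c] by simp
  next
   case False
   then have "n > 1" using less by auto
   then obtain p k m where pkm: "prime p" "k > 0" "n = p ^ k * m" "coprime p m" "m < n" "m > 0"
    using coprime_prime_power_split by blast
   have pf: "prime_factors n = insert p (prime_factors m)"
    using pkm by (simp add: prime_factors_product prime_factors_power prime_prime_factors)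
   have notin: "p \<notin> prime_factors m" using pkm
    by (metis coprime_absorb_left in_prime_factors_iff not_prime_unit)
   have "P n c <= P (p ^ k) c * P m c"
    using pkm prime_gt_0_nat[OF pkm(1)] by (auto intro!: mult)
   also have "... <= (g p * real (p ^ k) powr \<epsilon>) * ((\<Prod>p\<in>prime_factors m. g p) * real m powr \<epsilon>)"
    using key[OF pkm(1,2), of c] less.IH[OF pkm(5,6)] nonneg g1
    by (intro mult_mono) (auto intro!: mult_nonneg_nonneg simp: g_def B1_def)
   also have "... = (\<Prod>p\<in>prime_factors n. g p) * real n powr \<epsilon>"
    using notin by (simp add: pf powr_mult pkm(3)[symmetric]) (simp add: pkm(3) powr_mult)
   finally show ?thesis .
  qed
 qed
 have gb: "(\<Prod>p\<in>S. g p) <= B1 ^ N" if "finite S" for S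
 proof -
  have "(\<Prod>p\<in>S. g p) = (\<Prod>p\<in>S \<inter> {..<N}. B1)"
   using that by (auto simp: g_def prod.If_cases Int_def lessThan_def)
  also have "... = B1 ^ card (S \<inter> {..<N})" by simp
  also have "... <= B1 ^ N"
   by (intro power_increasing) (auto simp: B1_def intro: order_trans[OF card_mono[of "{..<N}"]])
  finally show ?thesis .
 qed
 show ?thesis
 proof (intro exI[of _ "B1 ^ N"] conjI allI impI)
  show "1 <= B1 ^ N" by (simp add: B1_def)
  fix n :: nat and c assume "n > 0"
  have "P n c <= (\<Prod>p\<in>prime_factors n. g p) * real n powr \<epsilon>" using main \<open>n > 0\<close> by blast
  also have "... <= B1 ^ N * real n powr \<epsilon>" by (intro mult_right_mono gb) auto
  finally show "P n c <= B1 ^ N * real n powr \<epsilon>" .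
 qed
qed

lemma card_prod_bound:
 assumes "finite A" "finite B" "inj_on (%x. (f x, g x)) S"
  and "\<And>x. x \<in> S ==> f x \<in> A" "\<And>x. x \<in> S ==> g x \<in> B"
 shows "card S <= card A * card B"
proof -
 have "card S = card ((%x. (f x, g x)) ` S)" using assms(3) by (simp add: card_image)
 also have "... <= card (A \<times> B)" using assms by (intro card_mono) auto
 finally show ?thesis by (simp add: card_cartesian_product)
qed

lemma divisor_count_bound:
 assumes "\<epsilon> > 0"
 shows "\<exists>K\<ge>1. \<forall>n>0. real (card {d::nat. d dvd n}) <= K * real n powr \<epsilon>"
proof -
 have "\<exists>K\<ge>1. \<forall>n>0. \<forall>c::unit. real (card {d::nat. d dvd n}) <= K * real n powr \<epsilon>"
 proof (rule submultiplicative_bound[where C = 1 and e = 1, OF assms])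
  fix a b :: nat and c :: unit assume ab: "a > 0" "b > 0" "coprime a b"
  have "{d. d dvd a * b} \<subseteq> (%(x, y). x * y) ` ({d. d dvd a} \<times> {d. d dvd b})"
   by (auto simp: image_iff dest!: division_decomp)
  then have "card {d. d dvd a * b} <= card ((%(x, y). x * y) ` ({d. d dvd a} \<times> {d. d dvd b}))"
   using ab by (intro card_mono) auto
  also have "... <= card ({d. d dvd a} \<times> {d. d dvd b})"
   using ab by (intro card_image_le) auto
  finally have "card {d. d dvd a * b} <= card {d. d dvd a} * card {d. d dvd b}"
   by (simp add: card_cartesian_product)
  then show "real (card {d. d dvd a * b}) <= real (card {d. d dvd a}) * real (card {d. d dvd b})"
   by (metis of_nat_le_iff of_nat_mult)
 next
  fix p n :: nat and c :: unit assume "prime p"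
  then have "{d. d dvd p ^ n} = (^) p ` {..n}"
   by (auto simp: divides_primepow_nat)
  then have "card {d. d dvd p ^ n} <= n + 1"
   using card_image_le[of "{..n}" "(^) p"] by simp
  then show "real (card {d. d dvd p ^ n}) <= 1 * (real n + 1) ^ 1" by simp
 qed auto
 then show ?thesis by blast
qed

lemma totient_lower_bound:
 assumes "\<epsilon> > 0"
 shows "\<exists>K\<ge>1. \<forall>n>0. real n / real (totient n) <= K * real n powr \<epsilon>"
proof -
 have "\<exists>K\<ge>1. \<forall>n>0. \<forall>c::unit. real n / real (totient n) <= K * real n powr \<epsilon>"
 proof (rule submultiplicative_bound[where C = 2 and e = 0, OF assms])
  fix p n :: nat and c :: unit assume p: "prime p" "n > 0"
  then have "totient (p ^ n) = p ^ (n - 1) * (p - 1)" by (simp add: totient_prime_power)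
  moreover have "p ^ n = p ^ (n - 1) * p" using p by (metis power_minus_mult)
  ultimately have "real (p ^ n) / real (totient (p ^ n)) = real p / real (p - 1)"
   using prime_gt_0_nat[OF p(1)] by simp
  also have "... <= 2" using prime_ge_2_nat[OF p(1)] by (simp add: field_simps of_nat_diff)
  finally show "real (p ^ n) / real (totient (p ^ n)) <= 2 * (real n + 1) ^ 0" by simp
 qed (auto simp: totient_mult_coprime)
 then show ?thesis by blast
qed

lemma unit_root_count_mult:
 assumes "a > 0" "b > 0" "coprime a b"
 shows "unit_root_count k c (a * b) <= unit_root_count k c a * unit_root_count k c b"
 unfolding unit_root_count_def
proof (rule card_prod_bound[where f = "%x. x mod int a" and g = "%x. x mod int b"])
 show "inj_on (%x. (x mod int a, x mod int b)) {x. 0 <= x & x < int (a * b) & [x ^ k = c] (mod int (a * b)) & coprime x (int (a * b))}"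
 proof (rule inj_onI)
  fix x y assume x: "x \<in> {x. 0 <= x & x < int (a * b) & [x ^ k = c] (mod int (a * b)) & coprime x (int (a * b))}"
   and y: "y \<in> {x. 0 <= x & x < int (a * b) & [x ^ k = c] (mod int (a * b)) & coprime x (int (a * b))}"
   and eq: "(x mod int a, x mod int b) = (y mod int a, y mod int b)"
  then have "[x = y] (mod int a)" "[x = y] (mod int b)" by (auto simp: cong_def)
  then have "[x = y] (mod int a * int b)" using assms by (intro coprime_cong_mult) auto
  then show "x = y" using x y by (auto simp: cong_def)
 qed
next
 fix x assume "x \<in> {x. 0 <= x & x < int (a * b) & [x ^ k = c] (mod int (a * b)) & coprime x (int (a * b))}"
 then have x: "[x ^ k = c] (mod int a * int b)" "coprime x (int a)" "coprime x (int b)" by auto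
 have *: "[x ^ k = c] (mod int a)" "[x ^ k = c] (mod int b)"
  using x(1) cong_modulus_mult by (auto intro: cong_dvd_modulus)
 show "x mod int a \<in> {x. 0 <= x & x < int a & [x ^ k = c] (mod int a) & coprime x (int a)}"
  using * x assms by (auto simp: cong_def power_mod)
 show "x mod int b \<in> {x. 0 <= x & x < int b & [x ^ k = c] (mod int b) & coprime x (int b)}"
  using * x assms by (auto simp: cong_def power_mod)
qed (auto intro: finite_subset[of _ "{0..<int a}"] finite_subset[of _ "{0..<int b}"])

text \<open>The Hensel step: the difference quotient of the k-th power is congruent to the
  derivative, so its p-divisibility is known as soon as x and y agree to a low power of p.\<close>

lemma power_diff_quotient_cong:
 fixes x y M :: int
 assumes "[x = y] (mod M)" "k > 0"
 obtains s where "x ^ k - y ^ k = (x - y) * s" "[s = int k * y ^ (k - 1)] (mod M)"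
proof -
 define s where "s = (\<Sum>i<k. x ^ i * y ^ (k - 1 - i))"
 have "x ^ k - y ^ k = (x - y) * s"
  using diff_power_eq_sum[of x "k - 1" y] assms(2) by (simp add: s_def)
 moreover have "[s = (\<Sum>i<k. y ^ (k - 1))] (mod M)"
  unfolding s_def
 proof (rule cong_sum)
  fix i assume "i \<in> {..<k}"
  then have "y ^ (k - 1) = y ^ i * y ^ (k - 1 - i)" by (simp add: power_add[symmetric])
  then show "[x ^ i * y ^ (k - 1 - i) = y ^ (k - 1)] (mod M)"
   using cong_pow[OF assms(1), of i] by (simp add: cong_mult)
 qed
 ultimately show ?thesis using that[of s] by simp
qed

text \<open>If p differs from k, the difference quotient is a unit, hence roots are determined by
  their residue modulo p, where there are at most k of them. If p = k, the quotient contains exactly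
  one factor p for roots that agree modulo p^2; such roots agree modulo p^(n-1), which leaves p^2
  residues and p top digits, that is k^3 possibilities.\<close>

lemma unit_root_count_prime_power:
 assumes p: "prime p" and k: "prime k" and n: "n > 0"
 shows "unit_root_count k c (p ^ n) <= k ^ 3"
proof -
 define S where "S = {x::int. 0 <= x & x < int (p ^ n) & [x ^ k = c] (mod int (p ^ n)) & coprime x (int (p ^ n))}"
 have fin: "finite S" by (rule finite_subset[of _ "{0..<int (p ^ n)}"]) (auto simp: S_def)
 have k0: "k > 0" using k prime_gt_0_nat by blast
 have pi: "prime (int p)" using p by simp
 have pn: "int p dvd int (p ^ n)" using n by (simp add: dvd_power)
 have cop: "~ int p dvd x" if "x \<in> S" for x
  using that pn pi by (auto simp: S_def)
 show ?thesis
 proof (cases "p = k")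
  case False
  have "card S <= card {x. x < p & [x ^ k = nat (c mod int p)] (mod p)}"
  proof (rule card_inj_on_le[where f = "%x. nat (x mod int p)"])
   show "inj_on (%x. nat (x mod int p)) S"
   proof (rule inj_onI)
    fix x y assume xy: "x \<in> S" "y \<in> S" and "nat (x mod int p) = nat (y mod int p)"
    then have "[x = y] (mod int p)" using prime_gt_0_nat[OF p] by (simp add: cong_def eq_nat_nat_iff)
    then obtain s where s: "x ^ k - y ^ k = (x - y) * s" "[s = int k * y ^ (k - 1)] (mod int p)"
     using power_diff_quotient_cong k0 by blast
    have "~ int p dvd int k * y ^ (k - 1)"
     using cop[OF xy(2)] pi False p k
     by (metis int_dvd_int_iff prime_dvd_mult_iff prime_dvd_power_int primes_dvd_imp_eq)
    then have "~ int p dvd s" using s(2) cong_dvd_iff by blast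
    then have "coprime (int (p ^ n)) s"
     using pi by (simp add: prime_imp_coprime)
    moreover have "int (p ^ n) dvd (x - y) * s"
     using xy s(1) by (auto simp: S_def) (metis cong_iff_dvd_diff cong_trans cong_sym)
    ultimately have "int (p ^ n) dvd x - y" using coprime_dvd_mult_left_iff by blast
    then have "[x = y] (mod int (p ^ n))" by (simp add: cong_iff_dvd_diff)
    then show "x = y" using xy by (auto simp: S_def cong_def)
   qed
   show "(%x. nat (x mod int p)) ` S \<subseteq> {x. x < p & [x ^ k = nat (c mod int p)] (mod p)}"
   proof clarify
    fix x assume x: "x \<in> S"
    have "[x ^ k = c] (mod int p)" using x pn cong_dvd_modulus by (auto simp: S_def)
    then have "[(x mod int p) ^ k = c mod int p] (mod int p)" by (simp add: cong_def power_mod)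
    then have "[int (nat (x mod int p) ^ k) = int (nat (c mod int p))] (mod int p)"
     using prime_gt_0_nat[OF p] by simp
    then have "[nat (x mod int p) ^ k = nat (c mod int p)] (mod p)"
     using cong_int_iff by blast
    moreover have "nat (x mod int p) < p" using prime_gt_0_nat[OF p]
     by (simp add: nat_less_iff)
    ultimately show "nat (x mod int p) < p & [nat (x mod int p) ^ k = nat (c mod int p)] (mod p)" by simp
   qed
  qed auto
  also have "... <= k" using roots_mod_prime_bound[OF p k0] by simp
  also have "k <= k ^ 3" using k0 by (simp add: self_le_power)
  finally show ?thesis by (simp add: S_def unit_root_count_def)
 next
  case True
  have "card S <= card ({0..<int p ^ 2} \<times> {0..<int p})"
  proof (rule card_inj_on_le[where f = "%x. (x mod (int p)^2, x div int p ^ (n - 1))"])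
   have ppos: "int p > 0" using p prime_gt_0_nat by simp
   have pneq: "int p ^ n = int p ^ (n - 1) * int p" using n by (metis power_minus_mult)
   show "inj_on (%x. (x mod (int p)^2, x div int p ^ (n - 1))) S"
   proof (rule inj_onI)
    fix x y assume xy: "x \<in> S" "y \<in> S"
     and eq: "(x mod (int p)^2, x div int p ^ (n - 1)) = (y mod (int p)^2, y div int p ^ (n - 1))"
    then have "[x = y] (mod (int p)^2)" by (auto simp: cong_def)
    then obtain s where s: "x ^ k - y ^ k = (x - y) * s" "[s = int k * y ^ (k - 1)] (mod (int p)^2)"
     using power_diff_quotient_cong k0 by blast
    from s(2) obtain j where j: "s = int k * y ^ (k - 1) + (int p)^2 * j"
     by (metis cong_iff_lin cong_sym)
    define s' where "s' = y ^ (k - 1) + int p * j"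
    have ss': "s = int p * s'" using j True by (simp add: s'_def algebra_simps power2_eq_square)
    have "~ int p dvd y ^ (k - 1)" using cop[OF xy(2)] pi prime_dvd_power_int by blast
    then have "~ int p dvd s'" unfolding s'_def by (metis dvd_add_left_iff dvd_triv_left)
    then have cs: "coprime (int p ^ (n - 1)) s'"
     using pi by (simp add: prime_imp_coprime)
    have "int (p ^ n) dvd (x - y) * s"
     using xy s(1) by (auto simp: S_def) (metis cong_iff_dvd_diff cong_trans cong_sym)
    then have "int p ^ (n - 1) * int p dvd ((x - y) * s') * int p"
     using pneq ss' by (simp add: mult_ac)
    then have "int p ^ (n - 1) dvd (x - y) * s'" using ppos by (simp only: dvd_mult_cancel_right) auto
    then have "int p ^ (n - 1) dvd x - y" using cs coprime_dvd_mult_left_iff by blast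
    then have "x mod int p ^ (n - 1) = y mod int p ^ (n - 1)" by (simp add: mod_eq_dvd_iff)
    then show "x = y" using eq by (metis div_mult_mod_eq prod.inject)
   qed
   show "(%x. (x mod (int p)^2, x div int p ^ (n - 1))) ` S \<subseteq> {0..<int p ^ 2} \<times> {0..<int p}"
   proof clarify
    fix x assume "x \<in> S"
    then have x: "0 <= x" "x < int p ^ (n - 1) * int p" using pneq by (auto simp: S_def)
    have "x div int p ^ (n - 1) < int p"
    proof (rule ccontr)
     assume "~ ?thesis"
     then have "int p ^ (n - 1) * int p <= int p ^ (n - 1) * (x div int p ^ (n - 1))"
      using ppos by (intro mult_left_mono) auto
     also have "... <= x" using ppos by (simp add: minus_mod_eq_mult_div[symmetric])
     finally show False using x by simp
    qed
    then show "x mod (int p)^2 \<in> {0..<int p ^ 2} & x div int p ^ (n - 1) \<in> {0..<int p}"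
     using x ppos by (simp add: pos_imp_zdiv_nonneg_iff)
   qed
  qed auto
  also have "... = k ^ 3" using True by (simp add: card_cartesian_product nat_power_eq nat_mult_distrib power3_eq_cube power2_eq_square)
  finally show ?thesis by (simp add: S_def unit_root_count_def)
 qed
qed

lemma unit_root_count_bound:
 assumes "\<epsilon> > 0" and k: "prime k"
 shows "\<exists>K\<ge>1. \<forall>q>0. \<forall>c. real (unit_root_count k c q) <= K * real q powr \<epsilon>"
proof (rule submultiplicative_bound[where C = "real (k ^ 3)" and e = 0, OF assms(1)])
 show "1 <= real (k ^ 3)" using prime_gt_0_nat[OF k] by simp
 fix a b :: nat and c :: int assume "a > 0" "b > 0" "coprime a b"
 then show "real (unit_root_count k c (a * b)) <= real (unit_root_count k c a) * real (unit_root_count k c b)"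
  by (metis of_nat_le_iff of_nat_mult unit_root_count_mult)
next
 fix p n :: nat and c :: int assume "prime p" "n > 0"
 then show "real (unit_root_count k c (p ^ n)) <= real (k ^ 3) * (real n + 1) ^ 0"
  using unit_root_count_prime_power[OF _ k, of p n c] by (simp only: of_nat_le_iff power_0 mult_1_right)
next
 fix c :: int
 have "{x::int. 0 <= x & x < int 1 & [x ^ k = c] (mod int 1) & coprime x (int 1)} \<subseteq> {0}" by auto
 then have "unit_root_count k c 1 <= card {0::int}" unfolding unit_root_count_def by (intro card_mono) auto
 then show "real (unit_root_count k c 1) <= 1" by simp
qed auto

text \<open>Lagrange's theorem by synthetic division. Only some coefficient is required to be prime
  to p, because it is applied to polynomials whose leading coefficient may vanish modulo p.\<close>

lemma poly_roots_mod_prime: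
 fixes f :: "int poly" and p :: nat
 assumes p: "prime p" and "\<exists>i. ~ int p dvd Polynomial.coeff f i"
 shows "card {x. 0 <= x & x < int p & int p dvd poly f x} <= Polynomial.degree f"
 using assms(2)
proof (induction "Polynomial.degree f" arbitrary: f)
 case 0
 then obtain c where c: "f = [:c:]" using degree_eq_zeroE by metis
 have "~ int p dvd c" using 0(2) c
  by (metis Polynomial.coeff_pCons Polynomial.coeff_0 dvd_0_right not0_implies_Suc old.nat.simps(4) old.nat.simps(5))
 then have "{x. 0 <= x & x < int p & int p dvd poly f x} = {}" using c by auto
 then show ?case by (metis card.empty le0)
next
 case (Suc d)
 show ?case
 proof (cases "\<exists>a. 0 <= a & a < int p & int p dvd poly f a")
  case False
  then have "{x. 0 <= x & x < int p & int p dvd poly f x} = {}" by blast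
  then show ?thesis by (metis card.empty le0)
 next
  case True
  then obtain a where a: "0 <= a" "a < int p" "int p dvd poly f a" by blast
  define g where "g = synthetic_div f a"
  have fg: "f = [:-a, 1:] * g + [:poly f a:]"
   using synthetic_div_correct'[of a f] by (simp add: g_def)
  have dg: "Polynomial.degree g = d" using Suc(2) by (simp add: g_def degree_synthetic_div)
  have "\<exists>i. ~ int p dvd Polynomial.coeff g i"
  proof (rule ccontr)
   assume "~ ?thesis"
   then have *: "\<And>i. int p dvd Polynomial.coeff g i" by blast
   have "int p dvd Polynomial.coeff f i" for i
    by (subst fg) (use * a in \<open>auto simp: Polynomial.coeff_pCons mult_pCons_left split: nat.splits\<close>)
   then show False using Suc(3) by blast
  qed
  then have IH: "card {x. 0 <= x & x < int p & int p dvd poly g x} <= d"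
   using Suc(1)[of g] dg by simp
  have "{x. 0 <= x & x < int p & int p dvd poly f x} \<subseteq> insert a {x. 0 <= x & x < int p & int p dvd poly g x}"
  proof
   fix x assume "x \<in> {x. 0 <= x & x < int p & int p dvd poly f x}"
   then have x: "0 <= x" "x < int p" "int p dvd poly f x" by auto
   have "poly f x = (x - a) * poly g x + poly f a"
    by (subst fg) (simp add: algebra_simps)
   then have "int p dvd (x - a) * poly g x" using x(3) a(3) by (metis dvd_add_left_iff)
   then have "int p dvd x - a \<or> int p dvd poly g x" using p by (simp add: prime_dvd_mult_iff)
   moreover have "x = a" if "int p dvd x - a"
   proof -
    have "x mod int p = a mod int p" using that by (simp add: mod_eq_dvd_iff)
    then show "x = a" using x a by simp
   qed
   ultimately show "x \<in> insert a {x. 0 <= x & x < int p & int p dvd poly g x}" using x by blast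
  qed
  then have "card {x. 0 <= x & x < int p & int p dvd poly f x}
    <= card (insert a {x. 0 <= x & x < int p & int p dvd poly g x})"
   by (intro card_mono) (auto intro: finite_subset[of _ "{0..<int p}"])
  also have "... <= Suc (card {x. 0 <= x & x < int p & int p dvd poly g x})"
   by (rule card_insert_le_m1[where n = "Suc (card {x. 0 <= x & x < int p & int p dvd poly g x})", simplified]) simp
  also have "... <= Suc d" using IH by simp
  finally show ?thesis using Suc(2) by simp
 qed
qed

section \<open>Additive characters and Parseval's identity\<close>

definition ee :: "real => complex" where
 "ee x = cis (2 * pi * x)"

lemma norm_ee [simp]: "norm (ee x) = 1"
 by (simp add: ee_def)

lemma ee_add: "ee (x + y) = ee x * ee y"
 by (simp add: ee_def cis_mult algebra_simps)

lemma ee_minus: "ee (- x) = cnj (ee x)"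
 by (simp add: ee_def cis_cnj)

lemma ee_0 [simp]: "ee 0 = 1"
 by (simp add: ee_def)

lemma ee_of_int [simp]: "ee (of_int n) = 1"
 by (simp add: ee_def cis_multiple_2pi)

lemma ee_eq_1_iff: "ee x = 1 \<longleftrightarrow> x \<in> \<int>"
proof
 assume "ee x = 1"
 then have "cos (2 * pi * x) = 1" by (simp add: ee_def complex_eq_iff)
 then obtain n :: int where "2 * pi * x = of_int n * 2 * pi"
  by (auto simp: cos_one_2pi_int)
 then have "x = of_int n" by simp
 then show "x \<in> \<int>" by simp
next
 assume "x \<in> \<int>"
 then show "ee x = 1" by (auto elim: Ints_cases)
qed

definition eexp :: "nat => int => complex" where
 "eexp q n = ee (of_int n / of_nat q)"

lemma norm_eexp [simp]: "norm (eexp q n) = 1"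
 by (simp add: eexp_def)

lemma eexp_0 [simp]: "eexp q 0 = 1"
 by (simp add: eexp_def)

lemma eexp_add: "eexp q (m + n) = eexp q m * eexp q n"
 by (simp add: eexp_def add_divide_distrib ee_add)

lemma eexp_minus: "eexp q (- n) = cnj (eexp q n)"
 by (simp add: eexp_def ee_minus)

lemma eexp_diff: "eexp q (m - n) = eexp q m * cnj (eexp q n)"
 using eexp_add[of q m "- n"] by (simp add: eexp_minus)

lemma eexp_1_iff: "q > 0 ==> eexp q n = 1 \<longleftrightarrow> int q dvd n"
proof
 assume q: "q > 0" and "eexp q n = 1"
 then obtain k :: int where "of_int n / of_nat q = (of_int k :: real)"
  by (auto simp: eexp_def ee_eq_1_iff elim: Ints_cases)
 then have "real_of_int n = of_int (k * int q)" using q by (simp add: field_simps)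
 then show "int q dvd n" by (simp only: of_int_eq_iff) simp
next
 assume q: "q > 0" and "int q dvd n"
 then obtain k where "n = int q * k" by blast
 then show "eexp q n = 1" using q by (simp add: eexp_def)
qed

lemma eexp_cong:
 assumes "[m = n] (mod int q)" "q > 0"
 shows "eexp q m = eexp q n"
proof -
 have "eexp q (m - n) = 1" using assms by (simp add: eexp_1_iff cong_iff_dvd_diff)
 moreover have "eexp q m = eexp q (m - n) * eexp q n" by (simp add: eexp_add[symmetric])
 ultimately show ?thesis by simp
qed

lemma eexp_pow: "eexp q (int k * n) = eexp q n ^ k"
 by (induction k) (simp_all add: eexp_add algebra_simps)

lemma sum_eexp:
 assumes "q > 0"
 shows "(\<Sum>k\<in>{0..<int q}. eexp q (k * n)) = (if int q dvd n then of_nat q else 0)"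
proof -
 have "(\<Sum>k\<in>{0..<int q}. eexp q (k * n)) = (\<Sum>k<q. eexp q (int k * n))"
  by (rule sum.reindex_bij_witness[of _ int nat]) auto
 also have "... = (\<Sum>k<q. eexp q n ^ k)" by (simp add: eexp_pow)
 also have "... = (if int q dvd n then of_nat q else 0)"
 proof (cases "int q dvd n")
  case True
  then have "eexp q n = 1" using assms by (simp add: eexp_1_iff)
  then show ?thesis using True by simp
 next
  case False
  then have "eexp q n \<noteq> 1" using assms by (simp add: eexp_1_iff)
  moreover have "eexp q n ^ q = 1"
   using assms by (simp add: eexp_pow[symmetric] eexp_1_iff)
  ultimately show ?thesis using False by (simp add: sum_gp_strict)
 qed
 finally show ?thesis .
qed

lemma sum_if_pairs:
 assumes "finite I"
 shows "(\<Sum>i\<in>I. \<Sum>j\<in>I. if P i j then c else (0::'a::semiring_1)) = of_nat (card {(i, j) \<in> I \<times> I. P i j}) * c"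
proof -
 have "(\<Sum>i\<in>I. \<Sum>j\<in>I. if P i j then c else 0) = (\<Sum>z\<in>I \<times> I. if P (fst z) (snd z) then c else 0)"
  by (simp add: sum.cartesian_product case_prod_beta)
 also have "... = (\<Sum>z\<in>(I \<times> I) \<inter> {z. P (fst z) (snd z)}. c)"
  using assms by (subst sum.inter_restrict) auto
 also have "(I \<times> I) \<inter> {z. P (fst z) (snd z)} = {(i, j) \<in> I \<times> I. P i j}" by auto
 finally show ?thesis by simp
qed

lemma parseval1:
 fixes u :: "'i => int"
 assumes "q > 0" "finite I"
 shows "(\<Sum>h\<in>{0..<int q}. (norm (\<Sum>i\<in>I. eexp q (h * u i)))\<^sup>2)
   = real q * real (card {(i, j) \<in> I \<times> I. [u i = u j] (mod int q)})"
proof -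
 have "of_real (\<Sum>h\<in>{0..<int q}. (norm (\<Sum>i\<in>I. eexp q (h * u i)))\<^sup>2)
   = (\<Sum>h\<in>{0..<int q}. (\<Sum>i\<in>I. \<Sum>j\<in>I. eexp q (h * (u i - u j))))"
  by (simp add: complex_norm_square sum_product eexp_diff right_diff_distrib del: of_real_power)
 also have "... = (\<Sum>i\<in>I. \<Sum>h\<in>{0..<int q}. \<Sum>j\<in>I. eexp q (h * (u i - u j)))"
  by (rule sum.swap)
 also have "... = (\<Sum>i\<in>I. \<Sum>j\<in>I. \<Sum>h\<in>{0..<int q}. eexp q (h * (u i - u j)))"
  by (intro sum.cong refl sum.swap)
 also have "... = (\<Sum>i\<in>I. \<Sum>j\<in>I. if [u i = u j] (mod int q) then of_nat q else 0)"
  using assms by (simp add: sum_eexp cong_iff_dvd_diff)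
 also have "... = of_nat (card {(i, j) \<in> I \<times> I. [u i = u j] (mod int q)}) * of_nat q"
  using assms by (simp only: sum_if_pairs)
 also have "... = of_real (real q * real (card {(i, j) \<in> I \<times> I. [u i = u j] (mod int q)}))"
  by simp
 finally show ?thesis by (simp only: of_real_eq_iff)
qed

lemma parseval2:
 fixes u v :: "'i => int"
 assumes "q > 0" "finite I"
 shows "(\<Sum>h\<in>{0..<int q}. \<Sum>k\<in>{0..<int q}. (norm (\<Sum>i\<in>I. eexp q (h * u i + k * v i)))\<^sup>2)
   = real q ^ 2 * real (card {(i, j) \<in> I \<times> I. [u i = u j] (mod int q) & [v i = v j] (mod int q)})"
proof -
 let ?R = "{0..<int q}"
 have "of_real (\<Sum>h\<in>?R. \<Sum>k\<in>?R. (norm (\<Sum>i\<in>I. eexp q (h * u i + k * v i)))\<^sup>2)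
   = (\<Sum>h\<in>?R. \<Sum>k\<in>?R. (\<Sum>i\<in>I. \<Sum>j\<in>I. eexp q (h * (u i - u j)) * eexp q (k * (v i - v j))))"
  by (simp add: complex_norm_square sum_product eexp_diff eexp_add right_diff_distrib mult_ac del: of_real_power)
 also have "... = (\<Sum>h\<in>?R. \<Sum>i\<in>I. \<Sum>j\<in>I. \<Sum>k\<in>?R. eexp q (h * (u i - u j)) * eexp q (k * (v i - v j)))"
 proof (intro sum.cong refl)
  fix h
  have "(\<Sum>k\<in>?R. (\<Sum>i\<in>I. \<Sum>j\<in>I. eexp q (h * (u i - u j)) * eexp q (k * (v i - v j))))
   = (\<Sum>i\<in>I. \<Sum>k\<in>?R. \<Sum>j\<in>I. eexp q (h * (u i - u j)) * eexp q (k * (v i - v j)))"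
   by (rule sum.swap)
  also have "... = (\<Sum>i\<in>I. \<Sum>j\<in>I. \<Sum>k\<in>?R. eexp q (h * (u i - u j)) * eexp q (k * (v i - v j)))"
   by (intro sum.cong refl sum.swap)
  finally show "(\<Sum>k\<in>?R. (\<Sum>i\<in>I. \<Sum>j\<in>I. eexp q (h * (u i - u j)) * eexp q (k * (v i - v j))))
   = (\<Sum>i\<in>I. \<Sum>j\<in>I. \<Sum>k\<in>?R. eexp q (h * (u i - u j)) * eexp q (k * (v i - v j)))" .
 qed
 also have "... = (\<Sum>h\<in>?R. \<Sum>i\<in>I. \<Sum>j\<in>I. eexp q (h * (u i - u j)) * (if [v i = v j] (mod int q) then of_nat q else 0))"
  using assms by (simp add: sum_distrib_left[symmetric] sum_eexp cong_iff_dvd_diff)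
 also have "... = (\<Sum>i\<in>I. \<Sum>h\<in>?R. \<Sum>j\<in>I. eexp q (h * (u i - u j)) * (if [v i = v j] (mod int q) then of_nat q else 0))"
  by (rule sum.swap)
 also have "... = (\<Sum>i\<in>I. \<Sum>j\<in>I. \<Sum>h\<in>?R. eexp q (h * (u i - u j)) * (if [v i = v j] (mod int q) then of_nat q else 0))"
  by (intro sum.cong refl sum.swap)
 also have "... = (\<Sum>i\<in>I. \<Sum>j\<in>I. (if [u i = u j] (mod int q) then of_nat q else 0) * (if [v i = v j] (mod int q) then of_nat q else 0))"
  using assms by (simp only: sum_distrib_right[symmetric] sum_eexp cong_iff_dvd_diff)
 also have "... = (\<Sum>i\<in>I. \<Sum>j\<in>I. if [u i = u j] (mod int q) & [v i = v j] (mod int q) then of_nat q * of_nat q else 0)"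
  by (intro sum.cong refl) simp
 also have "... = of_nat (card {(i, j) \<in> I \<times> I. [u i = u j] (mod int q) & [v i = v j] (mod int q)}) * (of_nat q * of_nat q)"
  using assms by (simp only: sum_if_pairs)
 also have "... = of_real (real q ^ 2 * real (card {(i, j) \<in> I \<times> I. [u i = u j] (mod int q) & [v i = v j] (mod int q)}))"
  by (simp add: power2_eq_square)
 finally show ?thesis by (simp only: of_real_eq_iff)
qed

section \<open>The curve modulo q, its symmetries and its additive energy\<close>

definition X :: "nat => int => (int \<times> int) set" where
 "X q l = {(a, b). 0 <= a & a < int q & 0 <= b & b < int q & [a ^ 2 * b ^ 3 = l] (mod int q)}"

lemma finite_X [simp, intro]: "finite (X q l)"
 by (rule finite_subset[of _ "{0..<int q} \<times> {0..<int q}"]) (auto simp: X_def)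

lemma X_coprime:
 fixes a b l m :: int
 assumes "[a ^ 2 * b ^ 3 = l] (mod m)" "coprime l m"
 shows "coprime a m" "coprime b m"
proof -
 have "coprime (a ^ 2 * b ^ 3) m" by (rule cong_imp_coprime[OF cong_sym[OF assms(1)] assms(2)])
 then show "coprime a m" "coprime b m" by (auto simp: coprime_mult_left_iff coprime_power_left_iff)
qed

text \<open>The curve is rational: t = ab determines a = t^3 / l and b = l / t^2. Most counts of
  points below are counts of values of t.\<close>

lemma X_param:
 fixes a b l m :: int
 assumes "[a ^ 2 * b ^ 3 = l] (mod m)"
 shows "[a * l = (a * b) ^ 3] (mod m)" "[b * (a * b) ^ 2 = l] (mod m)"
proof -
 have "[a * (a ^ 2 * b ^ 3) = a * l] (mod m)" using assms cong_scalar_left by blast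
 then show "[a * l = (a * b) ^ 3] (mod m)"
  by (simp add: power_mult_distrib cong_sym power3_eq_cube power2_eq_square mult_ac)
 show "[b * (a * b) ^ 2 = l] (mod m)"
  using assms by (simp add: power_mult_distrib power3_eq_cube power2_eq_square mult_ac)
qed

lemma X_inj:
 fixes a b l m :: int
 assumes "[a ^ 2 * b ^ 3 = l] (mod m)" "[a' ^ 2 * b' ^ 3 = l] (mod m)" "coprime l m"
  and "[a * b = a' * b'] (mod m)"
 shows "[a = a'] (mod m)" "[b = b'] (mod m)"
proof -
 have "[a * l = a' * l] (mod m)"
  using X_param(1)[OF assms(1)] X_param(1)[OF assms(2)] cong_pow[OF assms(4), of 3]
  by (meson cong_sym cong_trans)
 then show a: "[a = a'] (mod m)" using assms(3) by (simp add: cong_mult_rcancel)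
 have "[a * b = a * b'] (mod m)"
  using assms(4) cong_scalar_right[OF a, of b'] by (meson cong_sym cong_trans)
 then show "[b = b'] (mod m)" using X_coprime(1)[OF assms(1,3)] by (simp add: cong_mult_lcancel)
qed

text \<open>The weights 3 and 2 are chosen so that (r^3)^2 (s^2)^3 = (rs)^6 = 1.\<close>

lemma X_action:
 assumes "q > 0" "[r * s = 1] (mod int q)"
 shows "bij_betw (%(a, b). ((r ^ 3 * a) mod int q, (s ^ 2 * b) mod int q)) (X q l) (X q l)"
proof (rule bij_betwI[where g = "%(a, b). ((s ^ 3 * a) mod int q, (r ^ 2 * b) mod int q)"])
 have in_X: "((r ^ 3 * a) mod int q, (s ^ 2 * b) mod int q) \<in> X q l"
  if rs: "[r * s = 1] (mod int q)" and ab: "(a, b) \<in> X q l" for r s a b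
 proof -
  have "[((r ^ 3 * a) mod int q) ^ 2 * ((s ^ 2 * b) mod int q) ^ 3 = (r ^ 3 * a) ^ 2 * (s ^ 2 * b) ^ 3] (mod int q)"
   by (intro cong_mult cong_pow) (auto simp: cong_def)
  also have "(r ^ 3 * a) ^ 2 * (s ^ 2 * b) ^ 3 = (r * s) ^ 6 * (a ^ 2 * b ^ 3)"
   by (simp add: power_mult_distrib power_mult[symmetric] mult_ac)
  also have "[(r * s) ^ 6 * (a ^ 2 * b ^ 3) = 1 ^ 6 * l] (mod int q)"
   using rs ab by (intro cong_mult cong_pow) (auto simp: X_def)
  finally show ?thesis using assms by (simp add: X_def)
 qed
 have inv: "(s ^ e * (r ^ e * a mod int q)) mod int q = a"
  if "[r * s = 1] (mod int q)" "0 <= a" "a < int q" for r s a e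
 proof -
  have "[s ^ e * (r ^ e * a mod int q) = s ^ e * (r ^ e * a)] (mod int q)"
   by (intro cong_mult) (auto simp: cong_def)
  also have "s ^ e * (r ^ e * a) = (r * s) ^ e * a" by (simp add: power_mult_distrib mult_ac)
  also have "[(r * s) ^ e * a = 1 ^ e * a] (mod int q)"
   using that by (intro cong_mult cong_pow) auto
  finally show ?thesis using that by (simp add: cong_def)
 qed
 have sr: "[s * r = 1] (mod int q)" using assms by (simp add: mult.commute)
 show "(%(a, b). ((r ^ 3 * a) mod int q, (s ^ 2 * b) mod int q)) \<in> X q l \<rightarrow> X q l"
  using in_X[OF assms(2)] by auto
 show "(%(a, b). ((s ^ 3 * a) mod int q, (r ^ 2 * b) mod int q)) \<in> X q l \<rightarrow> X q l"
  using in_X[OF sr] by auto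
 show "(%(a, b). (s ^ 3 * a mod int q, r ^ 2 * b mod int q)) ((%(a, b). (r ^ 3 * a mod int q, s ^ 2 * b mod int q)) x) = x"
  if "x \<in> X q l" for x
  using that inv[OF assms(2)] inv[OF sr] by (auto simp: X_def)
 show "(%(a, b). (r ^ 3 * a mod int q, s ^ 2 * b mod int q)) ((%(a, b). (s ^ 3 * a mod int q, r ^ 2 * b mod int q)) x) = x"
  if "x \<in> X q l" for x
  using that inv[OF assms(2)] inv[OF sr] by (auto simp: X_def)
qed

definition expsum :: "nat => (int \<times> int) set => int => int => complex" where
 "expsum q A h k = (\<Sum>(a, b)\<in>A. eexp q (h * a + k * b))"

lemma expsum_cong:
 assumes "[h = h'] (mod int q)" "[k = k'] (mod int q)" "q > 0"
 shows "expsum q A h k = expsum q A h' k'"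
 unfolding expsum_def
 by (intro sum.cong refl) (auto intro!: eexp_cong cong_add cong_mult assms)

lemma expsum_action:
 assumes "q > 0" "[r * s = 1] (mod int q)"
 shows "expsum q (X q l) (h * r ^ 3) (k * s ^ 2) = expsum q (X q l) h k"
proof -
 let ?f = "%(a, b). ((r ^ 3 * a) mod int q, (s ^ 2 * b) mod int q)"
 have "expsum q (X q l) h k = (\<Sum>x\<in>X q l. (%(a, b). eexp q (h * a + k * b)) (?f x))"
  unfolding expsum_def by (rule sum.reindex_bij_betw[OF X_action[OF assms], symmetric])
 also have "... = (\<Sum>(a, b)\<in>X q l. eexp q (h * r ^ 3 * a + k * s ^ 2 * b))"
 proof (intro sum.cong refl, clarsimp)
  fix a b
  show "eexp q (h * (r ^ 3 * a mod int q) + k * (s\<^sup>2 * b mod int q)) = eexp q (h * r ^ 3 * a + k * s\<^sup>2 * b)"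
  proof (rule eexp_cong[OF _ assms(1)])
   have "[h * (r ^ 3 * a mod int q) + k * (s\<^sup>2 * b mod int q) = h * (r ^ 3 * a) + k * (s\<^sup>2 * b)] (mod int q)"
    by (intro cong_add cong_mult) (auto simp: cong_def)
   then show "[h * (r ^ 3 * a mod int q) + k * (s\<^sup>2 * b mod int q) = h * r ^ 3 * a + k * s\<^sup>2 * b] (mod int q)"
    by (simp add: mult.assoc)
  qed
 qed
 finally show ?thesis by (simp add: expsum_def)
qed

text \<open>Additive quadruples P1 + P2 = P3 + P4. The modulus \<open>q\<close> of the sums is
  independent of the set \<open>A\<close>, since the induction over prime powers needs points of the
  curve modulo p^(n+1) whose sums agree only modulo p^n.\<close>

definition quads :: "nat => (int \<times> int) set => (((int \<times> int) \<times> (int \<times> int)) \<times> ((int \<times> int) \<times> (int \<times> int))) set" where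
 "quads q A = {((P1, P2), (P3, P4)). ((P1, P2), (P3, P4)) \<in> (A \<times> A) \<times> (A \<times> A)
   & [fst P1 + fst P2 = fst P3 + fst P4] (mod int q) & [snd P1 + snd P2 = snd P3 + snd P4] (mod int q)}"

lemma finite_quads [simp, intro]: "finite A ==> finite (quads q A)"
 by (rule finite_subset[of _ "(A \<times> A) \<times> (A \<times> A)"]) (auto simp: quads_def)

definition energy :: "nat => int => nat" where
 "energy q l = card (quads q (X q l))"

text \<open>Parseval's identity for the square of \<open>expsum\<close>, which is an exponential sum
  over pairs of points.\<close>

lemma fourth_moment_general:
 assumes "q > 0" "finite A"
 shows "(\<Sum>h\<in>{0..<int q}. \<Sum>k\<in>{0..<int q}. norm (expsum q A h k) ^ 4) = real q ^ 2 *
  real (card (quads q A))"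
proof -
 let ?u = "%(P1, P2). fst P1 + fst P2 :: int" and ?v = "%(P1, P2). snd P1 + snd P2 :: int"
 have "norm (expsum q A h k) ^ 4 = (norm (\<Sum>i\<in>A \<times> A. eexp q (h * ?u i + k * ?v i)))\<^sup>2" for h k
 proof -
  have "expsum q A h k ^ 2 = (\<Sum>P\<in>A. \<Sum>P'\<in>A. eexp q (h * fst P + k * snd P) * eexp q (h * fst P' + k * snd P'))"
   unfolding expsum_def power2_eq_square sum_product by (simp add: case_prod_beta)
  also have "... = (\<Sum>i\<in>A \<times> A. eexp q (h * ?u i + k * ?v i))"
   by (simp add: sum.cartesian_product eexp_add[symmetric] case_prod_beta algebra_simps)
  finally have "(norm (\<Sum>i\<in>A \<times> A. eexp q (h * ?u i + k * ?v i)))\<^sup>2 = norm (expsum q A h k ^ 2) ^ 2" by simp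
  then show ?thesis by (simp add: norm_power power_mult[symmetric])
 qed
 then have "(\<Sum>h\<in>{0..<int q}. \<Sum>k\<in>{0..<int q}. norm (expsum q A h k) ^ 4) = real q ^ 2 *
   real (card {(i, j) \<in> (A \<times> A) \<times> (A \<times> A). [?u i = ?u j] (mod int q) & [?v i = ?v j] (mod int q)})"
  using parseval2[of q "A \<times> A" ?u ?v] assms by simp
 also have "{(i, j) \<in> (A \<times> A) \<times> (A \<times> A). [?u i = ?u j] (mod int q) & [?v i = ?v j] (mod int q)}
  = quads q A"
  by (auto simp: quads_def)
 finally show ?thesis .
qed

lemma fourth_moment:
 assumes "q > 0"
 shows "(\<Sum>h\<in>{0..<int q}. \<Sum>k\<in>{0..<int q}. norm (expsum q (X q l) h k) ^ 4) = real q ^ 2 * real (energy q l)"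
 unfolding energy_def by (rule fourth_moment_general) (use assms in auto)

definition red :: "int => int \<times> int => int \<times> int" where
 "red m P = (fst P mod m, snd P mod m)"

definition red4 where
 "red4 m = map_prod (map_prod (red m) (red m)) (map_prod (red m) (red m))"

lemma red_in_X:
 assumes "q > 0" "P \<in> X r l" "int q dvd int r"
 shows "red (int q) P \<in> X q l"
proof -
 obtain x y where P: "P = (x, y)" by (cases P)
 have "[x ^ 2 * y ^ 3 = l] (mod int q)" using assms P by (auto simp: X_def intro: cong_dvd_modulus)
 moreover have "[(x mod int q) ^ 2 * (y mod int q) ^ 3 = x ^ 2 * y ^ 3] (mod int q)"
  by (intro cong_mult cong_pow) (auto simp: cong_def)
 ultimately show ?thesis using assms P by (auto simp: X_def red_def intro: cong_trans)
qed

lemma red4_in_quads: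
 assumes "q > 0" "z \<in> quads s (X r l)" "int q dvd int r" "int q dvd int s"
 shows "red4 (int q) z \<in> quads q (X q l)"
proof -
 obtain P1 P2 P3 P4 where z: "z = ((P1, P2), (P3, P4))" by (cases z) auto
 have redc: "[fst (red (int q) P) = fst P] (mod int q)" "[snd (red (int q) P) = snd P] (mod int q)" for P
  by (auto simp: red_def cong_def)
 have base: "[fst P1 + fst P2 = fst P3 + fst P4] (mod int q)" "[snd P1 + snd P2 = snd P3 + snd P4] (mod int q)"
  using assms z by (auto simp: quads_def intro: cong_dvd_modulus)
 have "[fst (red (int q) P1) + fst (red (int q) P2) = fst (red (int q) P3) + fst (red (int q) P4)] (mod int q)"
  by (rule cong_trans[OF cong_add[OF redc(1) redc(1)] cong_trans[OF base(1) cong_sym[OF cong_add[OF redc(1) redc(1)]]]])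
 moreover have "[snd (red (int q) P1) + snd (red (int q) P2) = snd (red (int q) P3) + snd (red (int q) P4)] (mod int q)"
  by (rule cong_trans[OF cong_add[OF redc(2) redc(2)] cong_trans[OF base(2) cong_sym[OF cong_add[OF redc(2) redc(2)]]]])
 moreover have "P1 \<in> X r l" "P2 \<in> X r l" "P3 \<in> X r l" "P4 \<in> X r l" using assms z by (auto simp: quads_def)
 ultimately show ?thesis using red_in_X[OF assms(1) _ assms(3)] by (simp add: quads_def red4_def z)
qed

lemma energy_mult:
 assumes a: "a > 0" and b: "b > 0" and cop: "coprime a b"
 shows "energy (a * b) l <= energy a l * energy b l"
proof -
 let ?E = "%q. quads q (X q l)"
 have "card (?E (a * b)) <= card (?E a) * card (?E b)"
 proof (rule card_prod_bound[where f = "red4 (int a)" and g = "red4 (int b)"])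
  have crt: "x = y" if "0 <= x" "x < int (a * b)" "0 <= y" "y < int (a * b)" "x mod int a = y mod int a" "x mod int b = y mod int b" for x y
  proof -
   have "[x = y] (mod int a * int b)" using that cop by (intro coprime_cong_mult) (auto simp: cong_def)
   then show ?thesis using that by (simp add: cong_def)
  qed
  have crt2: "P = Q" if "P \<in> X (a * b) l" "Q \<in> X (a * b) l" "red (int a) P = red (int a) Q" "red (int b) P = red (int b) Q" for P Q
   using that by (cases P, cases Q) (auto simp: X_def red_def intro!: crt)
  show "inj_on (%x. (red4 (int a) x, red4 (int b) x)) (?E (a * b))"
  proof (rule inj_onI)
   fix z w assume zw: "z \<in> ?E (a * b)" "w \<in> ?E (a * b)"
    and eq: "(red4 (int a) z, red4 (int b) z) = (red4 (int a) w, red4 (int b) w)"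
   obtain P1 P2 P3 P4 where z: "z = ((P1, P2), (P3, P4))" by (cases z) auto
   obtain Q1 Q2 Q3 Q4 where w: "w = ((Q1, Q2), (Q3, Q4))" by (cases w) auto
   show "z = w"
    using crt2[of P1 Q1] crt2[of P2 Q2] crt2[of P3 Q3] crt2[of P4 Q4] zw eq
    by (simp add: z w quads_def red4_def)
  qed
 qed (use red4_in_quads a b in auto)
 then show ?thesis by (simp add: energy_def)
qed

lemma X_card_le:
 assumes "q > 0" "coprime l (int q)"
 shows "card (X q l) <= q"
proof -
 have "card (X q l) <= card {0..<int q}"
 proof (rule card_inj_on_le[where f = "%(a, b). (a * b) mod int q"])
  show "inj_on (%(a, b). (a * b) mod int q) (X q l)"
  proof (rule inj_onI, clarify)
   fix a b a' b' assume ab: "(a, b) \<in> X q l" "(a', b') \<in> X q l" and eq: "a * b mod int q = a' * b' mod int q"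
   then have "[a = a'] (mod int q)" "[b = b'] (mod int q)"
    using X_inj[OF _ _ assms(2), of a b a' b'] by (auto simp: X_def cong_def)
   then show "a = a' & b = b'" using ab by (auto simp: X_def cong_def)
  qed
 qed (use assms in auto)
 then show ?thesis by simp
qed

section \<open>The energy at a prime modulus\<close>

text \<open>With t = ab, t' = a'b', s = t + t' and x = tt' the two sums become U l = s^3 - 3sx and V
  x^2 = l (s^2 - 2x). Eliminating s leaves an equation of degree 6 for x; then s is a root of a
  quadratic equation, and t is a root of T^2 - sT + x. This gives 6 * 2 * 2 = 24 triples (x, s, t),
  and a triple determines both points.\<close>

lemma cong_sum_prime_count:
 fixes U V l :: int
 assumes p: "prime p" "p \<noteq> 2" and l: "coprime l (int p)"
 shows "card {(P, Q). P \<in> X p l & Q \<in> X p l & [fst P + fst Q = U] (mod int p) & [snd P + snd Q = V] (mod int p)} <= 24"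
proof -
 let ?p = "int p"
 have ppos: "?p > 0" using p prime_gt_0_nat by simp
 have pi: "prime ?p" using p by simp
 have pl: "~ ?p dvd l" using l pi by (metis coprime_common_divisor dvd_refl not_prime_unit)
 \<comment> \<open>Square U l = s (s^2 - 3x), multiply by l^3 and insert l s^2 = V x^2 + 2lx. The
   coefficient 2 l^3 of x^3 is prime to p for every U and V; this is where p = 2 is
   excluded.\<close>
 define fP :: "int poly" where "fP = [:0, 2 * l, V:] * [:0, -l, V:] ^ 2 - [:U ^ 2 * l ^ 5:]"
 define RP where "RP = {x. 0 <= x & x < ?p & ?p dvd poly fP x}"
 define fs :: "int => int poly" where "fs = (%x. [:- (V * x ^ 2 + 2 * l * x), 0, l:])"
 define Rs where "Rs = (%x. {s. 0 <= s & s < ?p & ?p dvd poly (fs x) s})"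
 define ft :: "int => int => int poly" where "ft = (%x s. [:x, - s, 1:])"
 define Rt where "Rt = (%x s. {t. 0 <= t & t < ?p & ?p dvd poly (ft x s) t})"
 have fPe: "fP = [:- (U ^ 2 * l ^ 5), 0, 0, 2 * l ^ 3, - 3 * l ^ 2 * V, 0, V ^ 3:]"
  by (simp add: fP_def power2_eq_square power3_eq_cube)
 have "Polynomial.degree fP <= 6" unfolding fPe by (auto intro: order_trans[OF Polynomial.degree_pCons_le])
 moreover have "Polynomial.coeff fP 3 = 2 * l ^ 3" by (simp add: fPe numeral_3_eq_3)
 moreover have "~ ?p dvd 2 * l ^ 3"
  using pl pi p by (metis int_dvd_int_iff of_nat_numeral prime_dvd_mult_iff prime_dvd_power primes_dvd_imp_eq two_is_prime_nat)
 ultimately have cP: "card RP <= 6"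
  unfolding RP_def using poly_roots_mod_prime[OF p(1), of fP] by (metis order_trans)
 have cs: "card (Rs x) <= 2" for x
 proof -
  have "Polynomial.coeff (fs x) 2 = l" by (simp add: fs_def numeral_2_eq_2)
  moreover have "Polynomial.degree (fs x) <= 2" unfolding fs_def by (auto intro: order_trans[OF Polynomial.degree_pCons_le])
  ultimately show ?thesis using poly_roots_mod_prime[OF p(1), of "fs x"] pl unfolding Rs_def by (metis order_trans)
 qed
 have ct: "card (Rt x s) <= 2" for x s
 proof -
  have "Polynomial.coeff (ft x s) 2 = 1" by (simp add: ft_def numeral_2_eq_2)
  moreover have "Polynomial.degree (ft x s) <= 2" unfolding ft_def by (auto intro: order_trans[OF Polynomial.degree_pCons_le])
  moreover have "~ ?p dvd 1" using pi not_prime_unit by blast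
  ultimately show ?thesis using poly_roots_mod_prime[OF p(1), of "ft x s"] unfolding Rt_def by (metis order_trans)
 qed
 have fin: "finite RP" "\<And>x. finite (Rs x)" "\<And>x s. finite (Rt x s)"
  unfolding RP_def Rs_def Rt_def by (auto intro: finite_subset[of _ "{0..<?p}"])
 define T where "T = (SIGMA x:RP. SIGMA s:Rs x. Rt x s)"
 have "card T = (\<Sum>x\<in>RP. \<Sum>s\<in>Rs x. card (Rt x s))" unfolding T_def using fin by (subst card_SigmaI) auto
 also have "... <= (\<Sum>x\<in>RP. \<Sum>s\<in>Rs x. 2)" by (intro sum_mono ct)
 also have "... <= (\<Sum>x\<in>RP. 4)" using cs by (intro sum_mono) (auto intro: order_trans[OF mult_right_mono[of _ 2]])
 also have "... <= 24" using cP by simp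
 finally have cT: "card T <= 24" .
 define S where "S = {(P, Q). P \<in> X p l & Q \<in> X p l & [fst P + fst Q = U] (mod int p) & [snd P + snd Q = V] (mod int p)}"
 define F where "F = (%((a, b), (a', b')). ((a * b * (a' * b')) mod ?p, (a * b + a' * b') mod ?p, (a * b) mod ?p))"
 have "card S <= card T"
 proof (rule card_inj_on_le[where f = F])
  show "finite T" unfolding T_def using fin by auto
  show "inj_on F S"
  proof (rule inj_onI)
   fix z w assume zw: "z \<in> S" "w \<in> S" "F z = F w"
   obtain a b a' b' where z: "z = ((a, b), (a', b'))" by (cases z) auto
   obtain c d c' d' where w: "w = ((c, d), (c', d'))" by (cases w) auto
   have in1: "((a, b), (a', b')) \<in> S" and in2: "((c, d), (c', d')) \<in> S"
    and eq: "F ((a, b), (a', b')) = F ((c, d), (c', d'))"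
    using zw z w by auto
   have 1: "[a * b = c * d] (mod ?p)" and "[a * b + a' * b' = c * d + c' * d'] (mod ?p)"
    using eq by (auto simp: F_def cong_def)
   then have "[a * b + a' * b' - a * b = c * d + c' * d' - c * d] (mod ?p)" using cong_diff by blast
   then have 2: "[a' * b' = c' * d'] (mod ?p)" by simp
   have "[a = c] (mod ?p)" "[b = d] (mod ?p)" "[a' = c'] (mod ?p)" "[b' = d'] (mod ?p)"
    using X_inj[OF _ _ l, of a b c d] X_inj[OF _ _ l, of a' b' c' d'] 1 2 in1 in2
    by (auto simp: S_def X_def)
   then show "z = w" unfolding z w using in1 in2 by (auto simp: S_def X_def cong_def)
  qed
  show "F ` S \<subseteq> T"
  proof (rule image_subsetI)
   fix z assume zS: "z \<in> S"
   obtain a b a' b' where z: "z = ((a, b), (a', b'))" by (cases z) auto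
   have XX: "[a ^ 2 * b ^ 3 = l] (mod ?p)" "[a' ^ 2 * b' ^ 3 = l] (mod ?p)"
    and UV: "[a + a' = U] (mod ?p)" "[b + b' = V] (mod ?p)"
    using zS z by (auto simp: S_def X_def)
   define t where "t = a * b"
   define t' where "t' = a' * b'"
   define x where "x = t * t'"
   define s where "s = t + t'"
   note pa = X_param[OF XX(1), folded t_def] and pa' = X_param[OF XX(2), folded t'_def]
   have e1: "[U * l = s ^ 3 - 3 * s * x] (mod ?p)"
   proof -
    have "[U * l = (a + a') * l] (mod ?p)" using UV(1) cong_scalar_right cong_sym by blast
    also have "(a + a') * l = a * l + a' * l" by (simp add: algebra_simps)
    also have "[a * l + a' * l = t ^ 3 + t' ^ 3] (mod ?p)" using pa(1) pa'(1) by (rule cong_add)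
    also have "t ^ 3 + t' ^ 3 = s ^ 3 - 3 * s * x" by (simp add: s_def x_def power3_eq_cube algebra_simps)
    finally show ?thesis .
   qed
   have e2: "[V * x ^ 2 = l * s ^ 2 - 2 * l * x] (mod ?p)"
   proof -
    have "[V * x ^ 2 = (b + b') * x ^ 2] (mod ?p)" using UV(2) cong_scalar_right cong_sym by blast
    also have "(b + b') * x ^ 2 = (b * t ^ 2) * t' ^ 2 + (b' * t' ^ 2) * t ^ 2"
     by (simp add: x_def power2_eq_square algebra_simps)
    also have "[(b * t ^ 2) * t' ^ 2 + (b' * t' ^ 2) * t ^ 2 = l * t' ^ 2 + l * t ^ 2] (mod ?p)"
     using pa(2) pa'(2) by (intro cong_add cong_mult) auto
    also have "l * t' ^ 2 + l * t ^ 2 = l * s ^ 2 - 2 * l * x" by (simp add: s_def x_def power2_eq_square algebra_simps)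
    finally show ?thesis .
   qed
   have e3: "[l * s ^ 2 = V * x ^ 2 + 2 * l * x] (mod ?p)"
    using cong_add[OF e2 cong_refl, of "2 * l * x"] by (simp add: cong_sym)
   have "[(U * l) ^ 2 * l ^ 3 = (s ^ 3 - 3 * s * x) ^ 2 * l ^ 3] (mod ?p)"
    using e1 by (intro cong_mult cong_pow) auto
   also have "(s ^ 3 - 3 * s * x) ^ 2 * l ^ 3 = (l * s ^ 2) * (l * s ^ 2 - 3 * l * x) ^ 2"
    by (simp add: power2_eq_square power3_eq_cube algebra_simps)
   also have "[(l * s ^ 2) * (l * s ^ 2 - 3 * l * x) ^ 2 = (V * x ^ 2 + 2 * l * x) * (V * x ^ 2 + 2 * l * x - 3 * l * x) ^ 2] (mod ?p)"
    using e3 by (intro cong_mult cong_pow cong_diff) auto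
   finally have "?p dvd (V * x ^ 2 + 2 * l * x) * (V * x ^ 2 + 2 * l * x - 3 * l * x) ^ 2 - (U * l) ^ 2 * l ^ 3"
    using cong_iff_dvd_diff cong_sym by blast
   also have "(V * x ^ 2 + 2 * l * x) * (V * x ^ 2 + 2 * l * x - 3 * l * x) ^ 2 - (U * l) ^ 2 * l ^ 3 = poly fP x"
    by (simp add: fPe power2_eq_square power3_eq_cube eval_nat_numeral algebra_simps)
   finally have r1: "?p dvd poly fP x" .
   have r2: "?p dvd poly (fs x) s"
    using e3 by (simp add: fs_def cong_iff_dvd_diff power2_eq_square algebra_simps)
   have r3: "?p dvd poly (ft x s) t"
    by (simp add: ft_def x_def s_def algebra_simps)
   have md: "[poly f y = poly f (y mod ?p)] (mod ?p)" for f y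
   proof (induction f)
    case (pCons a f)
    have "[y = y mod ?p] (mod ?p)" by (simp add: cong_def)
    then show ?case using cong_add[OF cong_refl cong_mult[OF _ pCons.IH]] by simp
   qed simp
   have fPx: "?p dvd poly fP (x mod ?p)" using r1 md cong_dvd_iff by blast
   have "[poly (fs (x mod ?p)) (s mod ?p) = poly (fs x) s] (mod ?p)"
   proof -
    have "[s mod ?p = s] (mod ?p)" "[x mod ?p = x] (mod ?p)" by (auto simp: cong_def)
    then show ?thesis unfolding fs_def by (auto intro!: cong_add cong_diff cong_mult cong_pow simp: cong_minus_minus_iff)
   qed
   then have fsx: "?p dvd poly (fs (x mod ?p)) (s mod ?p)" using r2 cong_dvd_iff by blast
   have "[poly (ft (x mod ?p) (s mod ?p)) (t mod ?p) = poly (ft x s) t] (mod ?p)"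
   proof -
    have "[s mod ?p = s] (mod ?p)" "[x mod ?p = x] (mod ?p)" "[t mod ?p = t] (mod ?p)" by (auto simp: cong_def)
    then show ?thesis unfolding ft_def by (auto intro!: cong_add cong_diff cong_mult cong_pow simp: cong_minus_minus_iff)
   qed
   then have ftx: "?p dvd poly (ft (x mod ?p) (s mod ?p)) (t mod ?p)" using r3 cong_dvd_iff by blast
   have "F z = (x mod ?p, s mod ?p, t mod ?p)" by (simp add: F_def z x_def s_def t_def t'_def)
   then show "F z \<in> T" using fPx fsx ftx ppos by (simp add: T_def RP_def Rs_def Rt_def)
  qed
 qed
 then show ?thesis using cT by (simp add: S_def)
qed

lemma energy_prime:
 assumes p: "prime p" and l: "coprime l (int p)"
 shows "energy p l <= 24 * p ^ 2"
proof -
 define A where "A = X p l \<times> X p l"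
 define E where "E = quads p (X p l)"
 have finA: "finite A" by (auto simp: A_def)
 have p0: "p > 0" using p prime_gt_0_nat by blast
 have cA: "card A <= p ^ 2"
  using X_card_le[OF p0 l] by (auto simp: A_def card_cartesian_product power2_eq_square intro: mult_mono)
 have eE: "energy p l = card E" by (simp add: energy_def E_def)
 show ?thesis
 proof (cases "p = 2")
  case True
  \<comment> \<open>For p = 2 the trivial bound p^4 = 16 suffices.\<close>
  have "card E <= card (A \<times> A)" using finA by (intro card_mono) (auto simp: E_def quads_def A_def)
  also have "... <= p ^ 2 * p ^ 2" using cA unfolding card_cartesian_product by (intro mult_mono) auto
  finally show ?thesis using True eE by simp
 next
  case False
  have "E \<subseteq> (SIGMA Z:A. {(P, Q). P \<in> X p l & Q \<in> X p l & [fst P + fst Q = fst (fst Z) + fst (snd Z)] (mod int p)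
    & [snd P + snd Q = snd (fst Z) + snd (snd Z)] (mod int p)})"
   by (auto simp: E_def quads_def A_def intro: cong_sym)
  moreover have fin: "finite {(P, Q). P \<in> X p l & Q \<in> X p l & [fst P + fst Q = U] (mod int p) & [snd P + snd Q = V] (mod int p)}" for U V
   by (rule finite_subset[of _ "X p l \<times> X p l"]) auto
  ultimately have "card E <= card (SIGMA Z:A. {(P, Q). P \<in> X p l & Q \<in> X p l & [fst P + fst Q = fst (fst Z) + fst (snd Z)] (mod int p)
    & [snd P + snd Q = snd (fst Z) + snd (snd Z)] (mod int p)})"
   using finA by (intro card_mono finite_SigmaI) auto
  also have "... = (\<Sum>Z\<in>A. card {(P, Q). P \<in> X p l & Q \<in> X p l & [fst P + fst Q = fst (fst Z) + fst (snd Z)] (mod int p)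
    & [snd P + snd Q = snd (fst Z) + snd (snd Z)] (mod int p)})"
   using finA fin by (intro card_SigmaI) auto
  also have "... <= (\<Sum>Z\<in>A. 24)" by (intro sum_mono cong_sum_prime_count p False l)
  also have "... <= 24 * p ^ 2" using cA by simp
  finally show ?thesis using eE by simp
 qed
qed

section \<open>Stationary phase at prime powers\<close>

lemma sum_shift_periodic:
 fixes F :: "int => 'a::comm_monoid_add"
 assumes "q > 0" "\<And>x y. [x = y] (mod int q) ==> F x = F y"
 shows "(\<Sum>z\<in>{0..<int q}. F (z + w)) = (\<Sum>z\<in>{0..<int q}. F z)"
proof (rule sum.reindex_bij_witness[where j = "%z. (z + w) mod int q" and i = "%z. (z - w) mod int q"])
 fix z assume "z \<in> {0..<int q}"
 then show "((z + w) mod int q - w) mod int q = z" by (simp add: mod_diff_left_eq)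
 show "F ((z + w) mod int q) = F (z + w)" by (rule assms(2)) (simp add: cong_def)
next
 fix z assume "z \<in> {0..<int q}"
 then show "((z - w) mod int q + w) mod int q = z" by (simp add: mod_add_left_eq)
qed (use assms in auto)

text \<open>Differencing: for a fixed difference d of the two variables the remaining sum is linear
  with frequency 2 \<beta> d, and it vanishes unless d = 0.\<close>

lemma gauss_sum_norm:
 fixes c \<beta> :: int
 assumes p: "prime p" "p \<noteq> 2" and "~ int p dvd \<beta>"
 shows "(norm (\<Sum>z\<in>{0..<int p}. eexp p (c * z + \<beta> * z ^ 2)))\<^sup>2 = real p"
proof -
 have p0: "p > 0" using p prime_gt_0_nat by blast
 let ?R = "{0..<int p}"
 let ?f = "%z::int. c * z + \<beta> * z ^ 2"
 have "of_real ((norm (\<Sum>z\<in>?R. eexp p (?f z)))\<^sup>2) = (\<Sum>z\<in>?R. \<Sum>w\<in>?R. eexp p (?f z - ?f w))"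
  by (simp add: complex_norm_square sum_product eexp_diff del: of_real_power)
 also have "... = (\<Sum>w\<in>?R. \<Sum>z\<in>?R. eexp p (?f z - ?f w))" by (rule sum.swap)
 also have "... = (\<Sum>w\<in>?R. \<Sum>d\<in>?R. eexp p (?f (d + w) - ?f w))"
 proof (rule sum.cong[OF refl])
  fix w
  show "(\<Sum>z\<in>?R. eexp p (?f z - ?f w)) = (\<Sum>d\<in>?R. eexp p (?f (d + w) - ?f w))"
   by (rule sum_shift_periodic[OF p0, symmetric]) (intro eexp_cong p0 cong_diff cong_add cong_mult cong_pow; simp)
 qed
 also have "... = (\<Sum>w\<in>?R. \<Sum>d\<in>?R. eexp p (?f d) * eexp p (w * (2 * \<beta> * d)))"
  by (intro sum.cong refl) (simp add: eexp_add[symmetric] power2_eq_square algebra_simps)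
 also have "... = (\<Sum>d\<in>?R. \<Sum>w\<in>?R. eexp p (?f d) * eexp p (w * (2 * \<beta> * d)))"
  by (rule sum.swap)
 also have "... = (\<Sum>d\<in>?R. eexp p (?f d) * (if int p dvd 2 * \<beta> * d then of_nat p else 0))"
  by (simp only: sum_distrib_left[symmetric] sum_eexp[OF p0])
 also have "... = (\<Sum>d\<in>?R. if d = 0 then of_nat p else 0)"
 proof (intro sum.cong refl)
  fix d assume d: "d \<in> ?R"
  have "~ int p dvd 2" using p primes_dvd_imp_eq[of p 2] by (metis int_dvd_int_iff of_nat_numeral two_is_prime_nat)
  then have "int p dvd 2 * \<beta> * d \<longleftrightarrow> int p dvd d"
   using assms by (simp add: prime_dvd_mult_iff)
  also have "... \<longleftrightarrow> d = 0" using d by (auto dest: zdvd_imp_le)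
  finally show "eexp p (?f d) * (if int p dvd 2 * \<beta> * d then of_nat p else 0) = (if d = 0 then of_nat p else 0)"
   by auto
 qed
 also have "... = of_real (real p)" using p0 by simp
 finally show ?thesis by (simp only: of_real_eq_iff)
qed

lemma eexp_scale:
 assumes "p > 0"
 shows "eexp (p ^ (i + j)) (int p ^ i * w) = eexp (p ^ j) w"
 using assms by (simp add: eexp_def power_add)

lemma prime_cases_5: "prime p ==> p >= 5 \<or> p = 3 \<or> p = (2::nat)"
proof -
 assume p: "prime p"
 have "p = 2" if "even p" using primes_dvd_imp_eq[OF two_is_prime_nat p that] by simp
 then show ?thesis using prime_ge_2_nat[OF p] by presburger
qed

text \<open>The stationary points modulo p^m of the phase along orbits of the unit group: 3ha - 2kb
  is the derivative at r = 1 of h a r^3 + k b r^(-2).\<close>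

definition crit :: "nat => nat => nat => int => int => int => (int \<times> int) set" where
 "crit p n m l h k = {(a, b) \<in> X (p ^ n) l. int p ^ m dvd 3 * h * a - 2 * k * b}"

lemma finite_crit [simp]: "finite (crit p n m l h k)"
 by (rule finite_subset[of _ "X (p ^ n) l"]) (auto simp: crit_def)

text \<open>Replacing \<open>(a, b)\<close> by its translates under the units \<open>1 + p\<^bsup>n-m\<^esup>z\<close> and averaging over
 \<open>z\<close> leaves only the stationary points.\<close>

lemma expsum_stationary:
 assumes p: "prime p" and m: "2 * m <= n"
 shows "expsum (p ^ n) (X (p ^ n) l) h k = (\<Sum>(a, b)\<in>crit p n m l h k. eexp (p ^ n) (h * a + k * b))"
proof -
 define m' where "m' = n - m"
 have nm: "n = m' + m" "2 * m' >= n" using m by (auto simp: m'_def)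
 let ?q = "p ^ n" and ?P = "int p" and ?X = "X (p ^ n) l"
 have p0: "p > 0" using p prime_gt_0_nat by blast
 then have q0: "?q > 0" and pm0: "p ^ m > 0" by auto
 have qd: "int ?q dvd ?P ^ (2 * m')" using nm by (simp add: le_imp_power_dvd)
 have pp: "?P ^ (2 * m') = ?P ^ m' * ?P ^ m'" "?P ^ (m' * 2) = ?P ^ m' * ?P ^ m'"
  by (simp_all add: power_add[symmetric] mult_2 mult.commute[of _ 2])
 have step: "expsum ?q ?X h k = (\<Sum>(a, b)\<in>?X. eexp ?q (h * a + k * b) * eexp (p ^ m) (z * (3 * h * a - 2 * k * b)))" for z :: int
 proof -
  \<comment> \<open>As 2m' >= n, the units \<open>r\<close> and \<open>s\<close> are inverse modulo
    p^n, and only the term linear in z survives in h r^3 a + k s^2 b.\<close>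
  define r where "r = 1 + ?P ^ m' * z"
  define s where "s = 1 - ?P ^ m' * z"
  have "r * s - 1 = ?P ^ (2 * m') * (- (z ^ 2))"
   by (simp add: r_def s_def pp algebra_simps power2_eq_square)
  then have "[r * s = 1] (mod int ?q)" using qd by (simp add: cong_iff_dvd_diff)
  then have "expsum ?q ?X h k = expsum ?q ?X (h * r ^ 3) (k * s ^ 2)" using expsum_action q0 by metis
  also have "... = (\<Sum>(a, b)\<in>?X. eexp ?q (h * a + k * b) * eexp (p ^ m) (z * (3 * h * a - 2 * k * b)))"
   unfolding expsum_def
  proof (rule sum.cong[OF refl], clarify)
   fix a b
   have "h * r ^ 3 * a + k * s\<^sup>2 * b - (h * a + k * b + ?P ^ m' * (z * (3 * h * a - 2 * k * b)))
     = ?P ^ (2 * m') * (h * a * (3 * z ^ 2 + ?P ^ m' * z ^ 3) + k * b * z ^ 2)"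
    by (simp add: r_def s_def pp algebra_simps power2_eq_square power3_eq_cube)
   then have "[h * r ^ 3 * a + k * s\<^sup>2 * b = h * a + k * b + ?P ^ m' * (z * (3 * h * a - 2 * k * b))] (mod int ?q)"
    using qd by (simp add: cong_iff_dvd_diff)
   then have "eexp ?q (h * r ^ 3 * a + k * s\<^sup>2 * b) = eexp ?q (h * a + k * b + ?P ^ m' * (z * (3 * h * a - 2 * k * b)))"
    using eexp_cong q0 by blast
   also have "... = eexp ?q (h * a + k * b) * eexp (p ^ m) (z * (3 * h * a - 2 * k * b))"
    using eexp_scale[OF p0, of m' m] by (simp add: eexp_add nm(1))
   finally show "eexp ?q (h * r ^ 3 * a + k * s\<^sup>2 * b) = eexp ?q (h * a + k * b) * eexp (p ^ m) (z * (3 * h * a - 2 * k * b))" .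
  qed
  finally show ?thesis .
 qed
 have "of_nat (p ^ m) * expsum ?q ?X h k = (\<Sum>z\<in>{0..<int (p ^ m)}. expsum ?q ?X h k)" by simp
 also have "... = (\<Sum>z\<in>{0..<int (p ^ m)}. \<Sum>(a, b)\<in>?X. eexp ?q (h * a + k * b) * eexp (p ^ m) (z * (3 * h * a - 2 * k * b)))"
  by (intro sum.cong refl step)
 also have "... = (\<Sum>(a, b)\<in>?X. \<Sum>z\<in>{0..<int (p ^ m)}. eexp ?q (h * a + k * b) * eexp (p ^ m) (z * (3 * h * a - 2 * k * b)))"
  by (subst sum.swap) (simp add: case_prod_beta)
 also have "... = (\<Sum>(a, b)\<in>?X. eexp ?q (h * a + k * b) * (if int (p ^ m) dvd 3 * h * a - 2 * k * b then of_nat (p ^ m) else 0))"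
  by (simp only: sum_distrib_left[symmetric] sum_eexp[OF pm0])
 also have "... = (\<Sum>P\<in>?X. if int (p ^ m) dvd 3 * h * fst P - 2 * k * snd P then eexp ?q (h * fst P + k * snd P) * of_nat (p ^ m) else 0)"
  by (intro sum.cong refl) auto
 also have "... = (\<Sum>P\<in>?X \<inter> {P. int (p ^ m) dvd 3 * h * fst P - 2 * k * snd P}. eexp ?q (h * fst P + k * snd P) * of_nat (p ^ m))"
  using sum.inter_restrict[of ?X "%P. eexp ?q (h * fst P + k * snd P) * of_nat (p ^ m)" "{P. int (p ^ m) dvd 3 * h * fst P - 2 * k * snd P}"] by simp
 also have "?X \<inter> {P. int (p ^ m) dvd 3 * h * fst P - 2 * k * snd P} = crit p n m l h k"
  by (auto simp: crit_def)
 also have "(\<Sum>P\<in>crit p n m l h k. eexp ?q (h * fst P + k * snd P) * of_nat (p ^ m)) = of_nat (p ^ m) * (\<Sum>(a, b)\<in>crit p n m l h k. eexp (p ^ n) (h * a + k * b))"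
  by (simp add: sum_distrib_left case_prod_beta mult.commute)
 finally have "of_nat (p ^ m) * expsum ?q ?X h k = of_nat (p ^ m) * (\<Sum>(a, b)\<in>crit p n m l h k. eexp (p ^ n) (h * a + k * b))" .
 then show ?thesis using p0 by simp
qed

text \<open>Multiplying 3ha - 2kb by l t^2 with t = ab shows that a stationary point satisfies 3h
  t^5 = 2k l^2 modulo p^m. Hence t^5 is fixed modulo p^d, there are at most 5^3 = 125 values of t
  modulo p^d, and each lifts to p^(n-d) classes modulo p^n. Giving up one power of p <= 3 turns 125
  into 375.\<close>

lemma crit_card:
 assumes p: "prime p" and m: "m > 0" "m <= n" and l: "coprime l (int p)" and hk: "~ (int p dvd h & int p dvd k)"
 shows "card (crit p n m l h k) <= 375 * p ^ (n - m)"
proof (cases "crit p n m l h k = {}")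
 case False
 let ?P = "int p"
 have p0: "p > 0" using p prime_gt_0_nat by blast
 have pi: "prime ?P" using p by simp
 have pl: "~ ?P dvd l" using l pi by (metis coprime_common_divisor dvd_refl not_prime_unit)
 have lq: "coprime l (int (p ^ n))" using l by simp
 \<comment> \<open>For p >= 5 the coefficient 3h is prime to p. For p = 3 it has the factor 3, and
   for p = 2 the frequency h may be even; one power of p is sacrificed in these cases.\<close>
 define d where "d = (if p >= 5 then m else m - 1)"
 have dm: "d <= m" by (simp add: d_def)
 have crit_eq: "?P ^ m dvd 3 * h * (a * b) ^ 5 - 2 * k * l ^ 2" if "(a, b) \<in> crit p n m l h k" for a b
 proof -
  have ab: "[a ^ 2 * b ^ 3 = l] (mod int (p ^ n))" and dv: "?P ^ m dvd 3 * h * a - 2 * k * b"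
   using that by (auto simp: crit_def X_def)
  have "?P ^ m dvd int (p ^ n)" using m by (simp add: le_imp_power_dvd)
  then have ab': "[a ^ 2 * b ^ 3 = l] (mod ?P ^ m)" using ab cong_dvd_modulus by blast
  note pa = X_param[OF ab']
  have "[3 * h * (a * b) ^ 3 * (a * b) ^ 2 - 2 * k * l * l = 3 * h * (a * l) * (a * b) ^ 2 - 2 * k * l * (b * (a * b) ^ 2)] (mod ?P ^ m)"
   using pa by (intro cong_diff cong_mult) (auto intro: cong_sym)
  also have "3 * h * (a * l) * (a * b) ^ 2 - 2 * k * l * (b * (a * b) ^ 2) = (3 * h * a - 2 * k * b) * (l * (a * b) ^ 2)"
   by (simp add: algebra_simps)
  finally have "?P ^ m dvd 3 * h * (a * b) ^ 3 * (a * b) ^ 2 - 2 * k * l * l"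
   using dv by (metis cong_dvd_iff dvd_mult2)
  then show ?thesis by (simp add: power2_eq_square eval_nat_numeral mult_ac)
 qed
 have Pm: "?P dvd ?P ^ m" using m by (simp add: dvd_power)
 have fifth: "?P ^ d dvd (a * b) ^ 5 - (a' * b') ^ 5" if "(a, b) \<in> crit p n m l h k" "(a', b') \<in> crit p n m l h k" for a b a' b'
 proof -
  let ?t = "a * b" and ?t' = "a' * b'"
  have e: "?P ^ m dvd 3 * h * ?t ^ 5 - 2 * k * l ^ 2" "?P ^ m dvd 3 * h * ?t' ^ 5 - 2 * k * l ^ 2"
   using crit_eq that by auto
  from dvd_diff[OF this] have D: "?P ^ m dvd 3 * h * (?t ^ 5 - ?t' ^ 5)" by (simp add: algebra_simps)
  have key: ?thesis if g: "3 * h = ?P ^ e * g" "~ ?P dvd g" "e + d <= m" for e g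
  proof -
   have "?P ^ (e + d) dvd 3 * h * (?t ^ 5 - ?t' ^ 5)" using D g(3) by (meson dvd_trans le_imp_power_dvd)
   then have "?P ^ e * ?P ^ d dvd ?P ^ e * (g * (?t ^ 5 - ?t' ^ 5))" by (simp add: g(1) power_add mult.assoc)
   then have "?P ^ d dvd g * (?t ^ 5 - ?t' ^ 5)" using p0 by simp
   moreover have "coprime (?P ^ d) g" using g(2) pi by (simp add: prime_imp_coprime)
   ultimately show ?thesis using coprime_dvd_mult_right_iff by blast
  qed
  have "prime (3::nat)" by simp
  then have small: "?P dvd 2 \<longleftrightarrow> p = 2" "?P dvd 3 \<longleftrightarrow> p = 3"
   using primes_dvd_imp_eq[OF p two_is_prime_nat] primes_dvd_imp_eq[OF p, of 3]
    int_dvd_int_iff[of p 2] int_dvd_int_iff[of p 3] by auto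
  have kl: "?P dvd 2 * k * l ^ 2 \<longleftrightarrow> p = 2 \<or> ?P dvd k"
   using pi pl small by (auto simp: prime_dvd_mult_iff prime_dvd_power_iff)
  have div1: "?P dvd 2 * k * l ^ 2" if "?P dvd 3 * h"
  proof -
   have "?P dvd 3 * h * ?t ^ 5 - 2 * k * l ^ 2" using e(1) Pm dvd_trans by blast
   moreover have "?P dvd 3 * h * ?t ^ 5" using that by simp
   ultimately show ?thesis by (metis dvd_diff_right_iff dvd_diff_commute)
  qed
  consider "p >= 5" | "p = 3" | "p = 2" using prime_cases_5[OF p] by blast
  then show ?thesis
  proof cases
   case 1
   have "~ ?P dvd 3 * h"
    using div1 kl hk small 1 pi by (auto simp: prime_dvd_mult_iff)
   then show ?thesis using key[of 0 "3 * h"] dm by simp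
  next
   case 2
   then have "~ ?P dvd h" using div1 kl hk by auto
   then show ?thesis using key[of 1 h] m 2 by (simp add: d_def)
  next
   case 3
   show ?thesis
   proof (cases "even h")
    case False
    then show ?thesis using key[of 0 "3 * h"] 3 dm by simp
   next
    case True
    then obtain h' where h': "h = 2 * h'" by blast
    show ?thesis
    proof (cases "m = 1")
     case True
     then show ?thesis using 3 by (simp add: d_def)
    next
     case False
     \<comment> \<open>As h is even, k is odd, so 2k l^2 contains exactly one factor 2. Since 4
       divides 3h t^5 - 2k l^2, the frequency h cannot be divisible by 4.\<close>
     then have "?P ^ 2 dvd ?P ^ m" using m by (intro le_imp_power_dvd) auto
     then have four: "4 dvd 3 * h * ?t ^ 5 - 2 * k * l ^ 2" using e(1) 3 dvd_trans by fastforce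
     have "odd h'"
     proof
      assume "even h'"
      then have "4 dvd h" using h' by auto
      then have "4 dvd 3 * h * ?t ^ 5" by simp
      then have "4 dvd 2 * k * l ^ 2" using four by (metis dvd_diff_right_iff dvd_diff_commute)
      then obtain w where "2 * k * l ^ 2 = 4 * w" by blast
      then have "k * l ^ 2 = 2 * w" by simp
      then have "2 dvd k * l ^ 2" by simp
      then show False using hk True pl 3 by auto
     qed
     then show ?thesis using key[of 1 "3 * h'"] h' 3 m by (simp add: d_def)
    qed
   qed
  qed
 qed
 obtain a0 b0 where ab0: "(a0, b0) \<in> crit p n m l h k" using False by auto
 define R where "R = {x::int. 0 <= x & x < int (p ^ d) & [x ^ 5 = (a0 * b0) ^ 5] (mod int (p ^ d)) & coprime x (int (p ^ d))}"
 have finR: "finite R" by (rule finite_subset[of _ "{0..<int (p ^ d)}"]) (auto simp: R_def)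
 have cR: "card R <= 125"
 proof (cases "d = 0")
  case True
  then have "R \<subseteq> {0}" by (auto simp: R_def)
  then have "card R <= card {0::int}" by (intro card_mono) auto
  then show ?thesis by simp
 next
  case False
  then show ?thesis using unit_root_count_prime_power[OF p, of 5 d "(a0 * b0) ^ 5"]
   by (simp add: R_def unit_root_count_def)
 qed
 define N where "N = p ^ (n - d)"
 have nd: "p ^ n = p ^ d * N" using dm m by (simp add: N_def power_add[symmetric])
 have "card (crit p n m l h k) <= card R * card {0..<int N}"
 proof (rule card_prod_bound[where f = "%(a, b). (a * b) mod int (p ^ d)" and g = "%(a, b). ((a * b) mod int (p ^ n)) div int (p ^ d)"])
  show "inj_on (%x. ((%(a, b). (a * b) mod int (p ^ d)) x, (%(a, b). ((a * b) mod int (p ^ n)) div int (p ^ d)) x)) (crit p n m l h k)"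
  proof (rule inj_onI)
   fix x y assume xy: "x \<in> crit p n m l h k" "y \<in> crit p n m l h k"
    and eq: "((%(a, b). (a * b) mod int (p ^ d)) x, (%(a, b). ((a * b) mod int (p ^ n)) div int (p ^ d)) x)
      = ((%(a, b). (a * b) mod int (p ^ d)) y, (%(a, b). ((a * b) mod int (p ^ n)) div int (p ^ d)) y)"
   obtain a b a' b' where x: "x = (a, b)" and y: "y = (a', b')" by (cases x, cases y) auto
   have "(a * b mod int (p ^ n)) mod int (p ^ d) = (a' * b' mod int (p ^ n)) mod int (p ^ d)"
    using eq by (simp add: x y nd mod_mod_cancel)
   moreover have "(a * b mod int (p ^ n)) div int (p ^ d) = (a' * b' mod int (p ^ n)) div int (p ^ d)"
    using eq by (simp add: x y)
   ultimately have "a * b mod int (p ^ n) = a' * b' mod int (p ^ n)" by (metis div_mult_mod_eq)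
   then have "[a = a'] (mod int (p ^ n))" "[b = b'] (mod int (p ^ n))"
    using X_inj[OF _ _ lq, of a b a' b'] xy x y by (auto simp: crit_def X_def cong_def)
   then show "x = y" using xy x y by (auto simp: crit_def X_def cong_def)
  qed
  show "(%(a, b). (a * b) mod int (p ^ d)) x \<in> R" if x: "x \<in> crit p n m l h k" for x
  proof -
   obtain a b where ab: "x = (a, b)" by (cases x)
   have "int (p ^ d) dvd int (p ^ n)" by (simp add: nd)
   moreover have "[a ^ 2 * b ^ 3 = l] (mod int (p ^ n))" using x ab by (auto simp: crit_def X_def)
   ultimately have "[a ^ 2 * b ^ 3 = l] (mod int (p ^ d))" using cong_dvd_modulus by blast
   moreover have "coprime l (int (p ^ d))" using l by simp
   ultimately have cab: "coprime (a * b) (int (p ^ d))" using X_coprime[of a b l "int (p ^ d)"] by (auto simp only: coprime_mult_left_iff)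
   have "[(a * b) ^ 5 = (a0 * b0) ^ 5] (mod int (p ^ d))"
    using fifth[OF x[unfolded ab] ab0] by (simp add: cong_iff_dvd_diff)
   moreover have "coprime (a * b mod int (p ^ d)) (int (p ^ d))"
    using cab p0 by (subst coprime_mod_left_iff) auto
   ultimately show ?thesis using p0 ab unfolding R_def by (simp add: cong_def power_mod)
  qed
  show "(%(a, b). ((a * b) mod int (p ^ n)) div int (p ^ d)) x \<in> {0..<int N}" for x
  proof -
   have "y div int (p ^ d) < int N" if y: "0 <= y" "y < int (p ^ n)" for y
   proof (rule ccontr)
    assume "~ ?thesis"
    then have "int (p ^ d) * int N <= int (p ^ d) * (y div int (p ^ d))" using p0 by (intro mult_left_mono) auto
    also have "... <= y" using p0 y by (simp add: minus_mod_eq_mult_div[symmetric])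
    finally show False using y nd by simp
   qed
   then show ?thesis using p0 by (auto simp: case_prod_beta pos_imp_zdiv_nonneg_iff)
  qed
 qed (use finR in auto)
 also have "... <= 125 * N" using cR by simp
 also have "... <= 375 * p ^ (n - m)"
 proof (cases "p >= 5")
  case True
  then show ?thesis by (simp add: N_def d_def)
 next
  case False
  then have "p <= 3" using prime_cases_5[OF p] by auto
  moreover have "n - d = Suc (n - m)" using False m by (simp add: d_def)
  ultimately show ?thesis by (simp add: N_def)
 qed
 finally show ?thesis .
qed simp

lemma norm_sum_eexp_le: "norm (\<Sum>(a, b)\<in>A. eexp q (f a b)) <= real (card A)"
proof -
 have "norm (\<Sum>(a, b)\<in>A. eexp q (f a b)) <= (\<Sum>x\<in>A. 1)" by (rule order_trans[OF norm_sum]) (simp add: case_prod_beta)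
 then show ?thesis by simp
qed

text \<open>For n = 2m + 1 the number of stationary points is of order p^(m+1), too large by the
  factor p^(1/2). Translating by 1 + p^m z once more, now to second order, and averaging over z
  attaches to each stationary point a quadratic Gauss sum modulo p, which recovers this factor. The
  constant is 375^2.\<close>

lemma expsum_prime_power_odd:
 assumes p: "prime p" "p > 5" and n: "n = 2 * m + 1" and m: "m > 0"
  and l: "coprime l (int p)" and hk: "~ (int p dvd h & int p dvd k)"
 shows "norm (expsum (p ^ n) (X (p ^ n) l) h k) ^ 2 <= 140625 * real p ^ n"
proof -
 let ?q = "p ^ n" and ?P = "int p" and ?X = "X (p ^ n) l" and ?C = "crit p n m l h k"
 have p0: "p > 0" using p prime_gt_0_nat by blast
 then have q0: "?q > 0" by simp
 have pi: "prime ?P" using p by simp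
 have qe: "int ?q = ?P ^ (2 * m + 1)" using n by simp
 have q3: "int ?q dvd ?P ^ (3 * m)" using m unfolding qe by (intro le_imp_power_dvd) auto
 define c where "c = (%a b. (3 * h * a - 2 * k * b) div ?P ^ m)"
 have c: "3 * h * a - 2 * k * b = ?P ^ m * c a b" if "(a, b) \<in> ?C" for a b
  using that by (simp add: crit_def c_def)
 define G where "G = (%a b. \<Sum>z\<in>{0..<?P}. eexp p (c a b * z + 3 * (h * a + k * b) * z ^ 2))"
 have pp: "?P ^ (2 * m) = ?P ^ m * ?P ^ m" "?P ^ (m * 2) = ?P ^ m * ?P ^ m"
  by (simp_all add: power_add[symmetric] mult_2 mult.commute[of _ 2])
 have step: "expsum ?q ?X h k = (\<Sum>(a, b)\<in>?C. eexp ?q (h * a + k * b) * eexp p (c a b * z + 3 * (h * a + k * b) * z ^ 2))" for z :: int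
 proof -
  define w where "w = ?P ^ m * z"
  define r where "r = 1 + w"
  \<comment> \<open>Inverse of 1 + w up to third order: (1 + w)(1 - w + w^2) = 1 + w^3, and w^3
    vanishes modulo p^n because 3m >= n. In both h r^3 a and k s^2 b the second-order coefficient is
    3, whence the quadratic coefficient 3(ha + kb).\<close>
  define s where "s = 1 - w + w ^ 2"
  have w3: "int ?q dvd w ^ 3 * y" for y
   using q3 by (simp add: w_def power_mult_distrib power_mult[symmetric] mult.commute[of m 3] dvd_mult2)
  have "r * s - 1 = w ^ 3 * 1"
   by (simp add: r_def s_def algebra_simps power2_eq_square power3_eq_cube)
  then have "[r * s = 1] (mod int ?q)" using w3 cong_iff_dvd_diff by metis
  then have "expsum ?q ?X h k = expsum ?q ?X (h * r ^ 3) (k * s ^ 2)" using expsum_action q0 by metis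
  also have "... = (\<Sum>(a, b)\<in>crit p n m l (h * r ^ 3) (k * s ^ 2). eexp ?q (h * r ^ 3 * a + k * s ^ 2 * b))"
   using expsum_stationary[OF p(1), of m n] n by simp
  also have "crit p n m l (h * r ^ 3) (k * s ^ 2) = ?C"
  proof -
   have "[r = 1] (mod ?P ^ m)" "[s = 1] (mod ?P ^ m)"
    by (simp_all add: r_def s_def w_def cong_iff_dvd_diff power2_eq_square)
   then have "[3 * (h * r ^ 3) * a - 2 * (k * s ^ 2) * b = 3 * (h * 1 ^ 3) * a - 2 * (k * 1 ^ 2) * b] (mod ?P ^ m)" for a b
    by (intro cong_diff cong_mult cong_pow cong_refl)
   then have "?P ^ m dvd 3 * (h * r ^ 3) * a - 2 * (k * s ^ 2) * b \<longleftrightarrow> ?P ^ m dvd 3 * h * a - 2 * k * b" for a b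
    using cong_dvd_iff by fastforce
   then show ?thesis by (simp add: crit_def)
  qed
  also have "(\<Sum>(a, b)\<in>?C. eexp ?q (h * r ^ 3 * a + k * s ^ 2 * b)) = (\<Sum>(a, b)\<in>?C. eexp ?q (h * a + k * b) * eexp p (c a b * z + 3 * (h * a + k * b) * z ^ 2))"
  proof (rule sum.cong[OF refl], clarify)
   fix a b assume ab: "(a, b) \<in> ?C"
   have "h * r ^ 3 * a + k * s ^ 2 * b - (h * a + k * b + ?P ^ (2 * m) * (c a b * z + 3 * (h * a + k * b) * z ^ 2))
     = h * r ^ 3 * a + k * s ^ 2 * b - (h * a + k * b + w * (?P ^ m * c a b) + 3 * (h * a + k * b) * w ^ 2)"
    by (simp add: w_def power_mult_distrib pp algebra_simps power2_eq_square)
   also have "... = w ^ 3 * (h * a + k * b * (w - 2))"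
    unfolding c[OF ab, symmetric] by (simp add: r_def s_def algebra_simps power2_eq_square power3_eq_cube)
   finally have "[h * r ^ 3 * a + k * s ^ 2 * b = h * a + k * b + ?P ^ (2 * m) * (c a b * z + 3 * (h * a + k * b) * z ^ 2)] (mod int ?q)"
    using w3 by (simp only: cong_iff_dvd_diff)
   then have "eexp ?q (h * r ^ 3 * a + k * s ^ 2 * b) = eexp ?q (h * a + k * b + ?P ^ (2 * m) * (c a b * z + 3 * (h * a + k * b) * z ^ 2))"
    using eexp_cong q0 by blast
   then show "eexp ?q (h * r ^ 3 * a + k * s ^ 2 * b) = eexp ?q (h * a + k * b) * eexp p (c a b * z + 3 * (h * a + k * b) * z ^ 2)"
    using eexp_scale[OF p0, of "2 * m" 1] n by (simp add: eexp_add)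
  qed
  finally show ?thesis .
 qed
 have "of_nat p * expsum ?q ?X h k = (\<Sum>z\<in>{0..<?P}. expsum ?q ?X h k)" by simp
 also have "... = (\<Sum>z\<in>{0..<?P}. \<Sum>(a, b)\<in>?C. eexp ?q (h * a + k * b) * eexp p (c a b * z + 3 * (h * a + k * b) * z ^ 2))"
  by (intro sum.cong refl step)
 also have "... = (\<Sum>(a, b)\<in>?C. eexp ?q (h * a + k * b) * G a b)"
  unfolding G_def by (subst sum.swap) (simp add: case_prod_beta sum_distrib_left)
 finally have E: "of_nat p * expsum ?q ?X h k = (\<Sum>(a, b)\<in>?C. eexp ?q (h * a + k * b) * G a b)" .
 have G: "norm (G a b) = sqrt (real p)" if ab: "(a, b) \<in> ?C" for a b
 proof -
  \<comment> \<open>At a stationary point p also divides 3ha - 2kb, and the difference of the two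
    expressions is 5kb. Since p > 5, both k and then h would be divisible by p.\<close>
  have "~ ?P dvd 3 * (h * a + k * b)"
  proof
   assume 1: "?P dvd 3 * (h * a + k * b)"
   have 2: "?P dvd 3 * h * a - 2 * k * b" using c[OF ab] m by simp
   have nd: "~ ?P dvd y" if "0 < y" "y <= 5" for y :: int using p that by (auto dest: zdvd_imp_le)
   have "[a ^ 2 * b ^ 3 = l] (mod int ?q)" using ab by (auto simp: crit_def X_def)
   then have "coprime b (int ?q)" "coprime a (int ?q)" using X_coprime[of a b l "int ?q"] l by auto
   then have cab: "~ ?P dvd b" "~ ?P dvd a" using n pi
    by (auto dest: coprime_common_divisor)
   have "?P dvd 3 * (h * a + k * b) - (3 * h * a - 2 * k * b)" using 1 2 by (rule dvd_diff)
   then have "?P dvd 5 * (k * b)" by (simp add: algebra_simps)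
   then have k: "?P dvd k" using nd[of 5] cab pi by (auto simp: prime_dvd_mult_iff)
   then have "?P dvd 3 * (h * a)" using 1 by (metis distrib_left dvd_add_left_iff dvd_mult dvd_mult2)
   then have "?P dvd h" using nd[of 3] cab pi by (auto simp: prime_dvd_mult_iff)
   then show False using k hk by simp
  qed
  then have "(norm (G a b))\<^sup>2 = real p" unfolding G_def using p by (intro gauss_sum_norm) auto
  then show ?thesis by (metis norm_ge_zero real_sqrt_unique)
 qed
 have "real p * norm (expsum ?q ?X h k) = norm (\<Sum>(a, b)\<in>?C. eexp ?q (h * a + k * b) * G a b)"
  unfolding E[symmetric] by (simp add: norm_mult)
 also have "... <= (\<Sum>x\<in>?C. sqrt (real p))"
  using G by (intro order_trans[OF norm_sum] sum_mono) (auto simp: norm_mult)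
 also have "... = real (card ?C) * sqrt (real p)" by simp
 finally have "(real p * norm (expsum ?q ?X h k)) ^ 2 <= (real (card ?C) * sqrt (real p)) ^ 2"
  by (intro power_mono) auto
 also have "... = real (card ?C) ^ 2 * real p" by (simp add: power_mult_distrib)
 also have "... <= (375 * real p ^ (n - m)) ^ 2 * real p"
 proof (intro mult_right_mono power_mono)
  have "card ?C <= 375 * p ^ (n - m)" using crit_card[OF p(1) m _ l hk, of n] n by simp
  then have "real (card ?C) <= real (375 * p ^ (n - m))" by (simp only: of_nat_le_iff)
  then show "real (card ?C) <= 375 * real p ^ (n - m)" by simp
 qed auto
 also have "... = real p ^ 2 * (140625 * real p ^ n)"
  by (simp add: n power_mult_distrib power_add power_mult[symmetric] power2_eq_square mult.commute[of m 2] mult_2)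
 finally show ?thesis using p0 by (simp add: power_mult_distrib)
qed

text \<open>Outside the Gauss sum case the number of stationary points is already small enough. For
  odd n and p <= 5 it exceeds the target by one factor p, absorbed into 703125 = 5 * 375^2.\<close>

lemma expsum_prime_power:
 assumes p: "prime p" and n: "n >= 2" and l: "coprime l (int p)" and hk: "~ (int p dvd h & int p dvd k)"
 shows "norm (expsum (p ^ n) (X (p ^ n) l) h k) ^ 2 <= 703125 * real p ^ n"
proof (cases "odd n & p > 5")
 case True
 then obtain m where "n = 2 * m + 1" by (auto elim: oddE)
 then have "norm (expsum (p ^ n) (X (p ^ n) l) h k) ^ 2 <= 140625 * real p ^ n"
  using expsum_prime_power_odd[OF p _ _ _ l hk, of n m] True n by auto
 also have "... <= 703125 * real p ^ n" by (intro mult_right_mono) auto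
 finally show ?thesis .
next
 case False
 define m where "m = n div 2"
 have m: "m > 0" "2 * m <= n" using n by (auto simp: m_def)
 have p0: "p > 0" using p prime_gt_0_nat by blast
 have "norm (expsum (p ^ n) (X (p ^ n) l) h k) <= real (card (crit p n m l h k))"
  unfolding expsum_stationary[OF p m(2)] by (rule norm_sum_eexp_le)
 also have "... <= real (375 * p ^ (n - m))"
  using crit_card[OF p m(1) _ l hk, of n] m by (simp only: of_nat_le_iff)
 finally have "norm (expsum (p ^ n) (X (p ^ n) l) h k) ^ 2 <= (375 * real p ^ (n - m)) ^ 2"
  by (intro power_mono) auto
 also have "... = 140625 * real p ^ (2 * (n - m))" by (simp add: power_mult_distrib power_mult[symmetric] mult.commute)
 also have "... <= 703125 * real p ^ n"
 proof (cases "even n")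
  case True
  then have "2 * (n - m) = n" by (auto simp: m_def)
  then show ?thesis by simp
 next
  case odd: False
  then have "2 * (n - m) = Suc n" "real p <= 5" using False by (auto simp: m_def elim!: oddE)
  then show ?thesis using mult_right_mono[of "real p" 5 "real p ^ n"] by simp
 qed
 finally show ?thesis .
qed

section \<open>The energy at prime powers and in general\<close>

text \<open>Split the fourth moment modulo p^(n+1). If p does not divide both frequencies, the
  pointwise bound applies and yields the second summand. If p divides both, the sum is a fourth
  moment with characters modulo p^n over the points modulo p^(n+1); its quadruples reduce to
  quadruples modulo p^n with at most p^4 lifts each. After division by the square of the modulus the
  factor p^2 remains.\<close>

lemma energy_prime_power_step:
 assumes p: "prime p" and n: "n >= 1" and l: "coprime l (int p)"
 shows "real (energy (p ^ Suc n) l) <= real p ^ 2 * real (energy (p ^ n) l) + 703125 ^ 2 * (real p ^ Suc n) ^ 2"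
proof -
 define N where "N = Suc n"
 let ?q = "p ^ N" and ?r = "p ^ n" and ?X = "X (p ^ N) l"
 have p0: "p > 0" using p prime_gt_0_nat by blast
 have qr: "?q = p * ?r" by (simp add: N_def)
 define R where "R = {0..<int ?q}"
 define D where "D = (%h'. int p * h') ` {0..<int ?r}"
 define S where "S = (%(h, k). norm (expsum ?q ?X h k) ^ 4)"
 have D: "D = {h \<in> R. int p dvd h}"
 proof -
  have "h \<in> D" if "h \<in> R" "int p dvd h" for h
  proof -
   obtain h' where h': "h = int p * h'" using \<open>int p dvd h\<close> by blast
   then have "0 <= h'" "h' < int ?r" using that p0 by (auto simp: R_def qr zero_le_mult_iff)
   then show ?thesis using h' by (auto simp: D_def)
  qed
  then show ?thesis using p0 by (auto simp: D_def R_def qr)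
 qed
 have "real ?q ^ 2 * real (energy ?q l) = (\<Sum>h\<in>R. \<Sum>k\<in>R. S (h, k))"
  using fourth_moment[of ?q l] p0 by (simp add: S_def R_def)
 also have "... = (\<Sum>z\<in>R \<times> R. S z)" by (simp add: sum.cartesian_product)
 also have "... = (\<Sum>z\<in>D \<times> D. S z) + (\<Sum>z\<in>R \<times> R - D \<times> D. S z)"
  by (rule sum.subset_diff[THEN trans[OF _ add.commute]]) (auto simp: D R_def)
 finally have split: "real ?q ^ 2 * real (energy ?q l) = (\<Sum>z\<in>D \<times> D. S z) + (\<Sum>z\<in>R \<times> R - D \<times> D. S z)" .
 have "(\<Sum>z\<in>R \<times> R - D \<times> D. S z) <= (\<Sum>z\<in>R \<times> R - D \<times> D. (703125 * real ?q) ^ 2)"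
 proof (rule sum_mono)
  fix z assume "z \<in> R \<times> R - D \<times> D"
  then obtain h k where z: "z = (h, k)" "~ (int p dvd h & int p dvd k)" by (auto simp: D)
  have "(norm (expsum ?q ?X h k) ^ 2) ^ 2 <= (703125 * real p ^ N) ^ 2"
   using expsum_prime_power[OF p _ l z(2), of N] n by (intro power_mono) (auto simp: N_def)
  then show "S z <= (703125 * real ?q) ^ 2" by (simp add: S_def z power_mult[symmetric])
 qed
 also have "... = real (card (R \<times> R - D \<times> D)) * (703125 * real ?q) ^ 2" by simp
 also have "... <= real (?q ^ 2) * (703125 * real ?q) ^ 2"
 proof (intro mult_right_mono)
  have "card (R \<times> R - D \<times> D) <= card (R \<times> R)" by (intro card_mono) (auto simp: R_def)
  also have "... = ?q ^ 2" by (simp add: card_cartesian_product R_def power2_eq_square nat_power_eq)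
  finally show "real (card (R \<times> R - D \<times> D)) <= real (?q ^ 2)" by (simp only: of_nat_le_iff)
 qed auto
 finally have part2: "(\<Sum>z\<in>R \<times> R - D \<times> D. S z) <= real ?q ^ 2 * (703125 ^ 2 * real ?q ^ 2)"
  by (simp add: power_mult_distrib)
 have inj: "inj_on (%(h, k). (int p * h, int p * k)) ({0..<int ?r} \<times> {0..<int ?r})"
  using p0 by (auto simp: inj_on_def)
 have "(\<Sum>z\<in>D \<times> D. S z) = (\<Sum>z\<in>{0..<int ?r} \<times> {0..<int ?r}. S (int p * fst z, int p * snd z))"
 proof -
  have "D \<times> D = (%(h, k). (int p * h, int p * k)) ` ({0..<int ?r} \<times> {0..<int ?r})" by (auto simp: D_def)
  then show ?thesis using sum.reindex[OF inj, of S] by (simp add: case_prod_beta)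
 qed
 also have "... = (\<Sum>h\<in>{0..<int ?r}. \<Sum>k\<in>{0..<int ?r}. norm (expsum ?r ?X h k) ^ 4)"
 proof -
  have "expsum ?q ?X (int p * h) (int p * k) = expsum ?r ?X h k" for h k
   unfolding expsum_def
  proof (rule sum.cong[OF refl], clarify)
   fix a b
   have "eexp ?q (int p * h * a + int p * k * b) = eexp (p ^ (1 + n)) (int p ^ 1 * (h * a + k * b))"
    by (simp add: N_def algebra_simps)
   also have "... = eexp ?r (h * a + k * b)" by (rule eexp_scale[OF p0])
   finally show "eexp ?q (int p * h * a + int p * k * b) = eexp ?r (h * a + k * b)" .
  qed
  then show ?thesis by (simp add: S_def sum.cartesian_product case_prod_beta)
 qed
 also have "... = real ?r ^ 2 * real (card (quads ?r ?X))"
  using p0 by (intro fourth_moment_general) auto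
 also have "... <= real ?r ^ 2 * real (energy ?r l * p ^ 4)"
 proof (intro mult_left_mono)
  \<comment> \<open>The p lifts of a point are told apart by the top base-p digit of t = ab.\<close>
  define \<tau> where "\<tau> = (%P. ((fst P * snd P) mod int ?q) div int ?r)"
  define g where "g = map_prod (map_prod \<tau> \<tau>) (map_prod \<tau> \<tau>)"
  have \<tau>: "\<tau> P \<in> {0..<int p}" for P
  proof -
   have "y div int ?r < int p" if y: "0 <= y" "y < int ?q" for y
   proof (rule ccontr)
    assume "~ ?thesis"
    then have "int ?r * int p <= int ?r * (y div int ?r)" using p0 by (intro mult_left_mono) auto
    also have "... <= y" using p0 y by (simp add: minus_mod_eq_mult_div[symmetric])
    finally show False using y qr by (simp add: mult.commute)
   qed
   then show ?thesis using p0 by (auto simp: \<tau>_def pos_imp_zdiv_nonneg_iff)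
  qed
  have lq: "coprime l (int ?q)" using l by simp
  have inj1: "P = Q" if PQ: "P \<in> ?X" "Q \<in> ?X" and e1: "red (int ?r) P = red (int ?r) Q" and e2: "\<tau> P = \<tau> Q" for P Q
  proof -
   obtain a b c d where P: "P = (a, b)" and Q: "Q = (c, d)" by (cases P, cases Q) auto
   have "[a * b = c * d] (mod int ?r)" using e1 by (intro cong_mult) (auto simp: red_def P Q cong_def)
   then have "(a * b mod int ?q) mod int ?r = (c * d mod int ?q) mod int ?r"
    by (simp add: qr mod_mod_cancel cong_def)
   moreover have "(a * b mod int ?q) div int ?r = (c * d mod int ?q) div int ?r"
    using e2 by (simp add: \<tau>_def P Q)
   ultimately have "a * b mod int ?q = c * d mod int ?q" by (metis div_mult_mod_eq)
   then have "[a = c] (mod int ?q)" "[b = d] (mod int ?q)"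
    using X_inj[OF _ _ lq, of a b c d] PQ P Q by (auto simp: X_def cong_def)
   then show ?thesis using PQ P Q by (auto simp: X_def cong_def)
  qed
  have "card (quads ?r ?X) <= card (quads ?r (X ?r l)) * card (({0..<int p} \<times> {0..<int p}) \<times> ({0..<int p} \<times> {0..<int p}))"
  proof (rule card_prod_bound[where f = "red4 (int ?r)" and g = g])
   show "inj_on (%x. (red4 (int ?r) x, g x)) (quads ?r ?X)"
   proof (rule inj_onI)
    fix z w assume zw: "z \<in> quads ?r ?X" "w \<in> quads ?r ?X" and eq: "(red4 (int ?r) z, g z) = (red4 (int ?r) w, g w)"
    obtain P1 P2 P3 P4 where z: "z = ((P1, P2), (P3, P4))" by (cases z) auto
    obtain Q1 Q2 Q3 Q4 where w: "w = ((Q1, Q2), (Q3, Q4))" by (cases w) auto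
    show "z = w"
     using inj1[of P1 Q1] inj1[of P2 Q2] inj1[of P3 Q3] inj1[of P4 Q4] zw eq
     by (simp add: z w quads_def red4_def g_def)
   qed
   show "g x \<in> ({0..<int p} \<times> {0..<int p}) \<times> ({0..<int p} \<times> {0..<int p})" for x
    using \<tau> by (cases x) (auto simp: g_def map_prod_def case_prod_beta)
   show "red4 (int ?r) x \<in> quads ?r (X ?r l)" if "x \<in> quads ?r ?X" for x
    using that p0 by (intro red4_in_quads) (auto simp: qr)
  qed auto
  also have "... = energy ?r l * p ^ 4" by (simp add: energy_def card_cartesian_product power4_eq_xxxx)
  finally show "real (card (quads ?r ?X)) <= real (energy ?r l * p ^ 4)" by (simp only: of_nat_le_iff)
 qed auto
 also have "... = real ?q ^ 2 * (real p ^ 2 * real (energy ?r l))"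
  by (simp add: qr power_mult_distrib power4_eq_xxxx power2_eq_square mult_ac)
 finally have "real ?q ^ 2 * real (energy ?q l) <= real ?q ^ 2 * (real p ^ 2 * real (energy ?r l) + 703125 ^ 2 * real ?q ^ 2)"
  using split part2 by (simp add: distrib_left)
 then have "real (energy ?q l) <= real p ^ 2 * real (energy ?r l) + 703125 ^ 2 * real ?q ^ 2"
  using p0 by (subst (asm) mult_le_cancel_left_pos) auto
 then show ?thesis by (simp add: N_def)
qed

text \<open>Relative to p^(2n) each step adds a constant. The resulting linear growth in n is
  admissible in \<open>submultiplicative_bound\<close> with \<open>e = 1\<close>.\<close>

lemma energy_prime_power:
 assumes p: "prime p" and n: "n >= 1" and l: "coprime l (int p)"
 shows "real (energy (p ^ n) l) <= 703125 ^ 2 * (real n + 1) * (real p ^ n) ^ 2"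
 using n
proof (induction n rule: dec_induct)
 case base
 have "real (energy p l) <= real (24 * p ^ 2)" using energy_prime[OF p l] by (simp only: of_nat_le_iff)
 also have "... <= 703125 ^ 2 * 2 * real p ^ 2" by simp
 finally show ?case by simp
next
 case (step n)
 have "real (energy (p ^ Suc n) l) <= real p ^ 2 * real (energy (p ^ n) l) + 703125 ^ 2 * (real p ^ Suc n) ^ 2"
  using energy_prime_power_step[OF p _ l] step by simp
 also have "... <= real p ^ 2 * (703125 ^ 2 * (real n + 1) * (real p ^ n) ^ 2) + 703125 ^ 2 * (real p ^ Suc n) ^ 2"
  by (intro add_right_mono mult_left_mono step) auto
 also have "... = 703125 ^ 2 * (real (Suc n) + 1) * (real p ^ Suc n) ^ 2"
  by (simp add: power_mult_distrib algebra_simps)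
 finally show ?case .
qed

lemma energy_bound:
 assumes "\<epsilon> > 0"
 shows "\<exists>K\<ge>1. \<forall>q>0. \<forall>l. coprime l (int q) --> real (energy q l) <= K * real q powr \<epsilon> * real q ^ 2"
proof -
 \<comment> \<open>The value 0 for l not coprime to q makes submultiplicativity hold for every l, so
   that one constant serves all residues.\<close>
 define P where "P = (%q l. if coprime l (int q) then real (energy q l) / real q ^ 2 else 0)"
 have "\<exists>K\<ge>1. \<forall>q>0. \<forall>l. P q l <= K * real q powr \<epsilon>"
 proof (rule submultiplicative_bound[where C = "703125 ^ 2" and e = 1, OF assms])
  fix a b :: nat and l :: int assume ab: "a > 0" "b > 0" "coprime a b"
  have "real (energy (a * b) l) <= real (energy a l) * real (energy b l)"
   using energy_mult[OF ab, of l] by (metis of_nat_le_iff of_nat_mult)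
  then show "P (a * b) l <= P a l * P b l"
   by (auto simp: P_def power_mult_distrib intro!: divide_right_mono)
 next
  fix p n :: nat and l :: int assume pn: "prime p" "n > 0"
  show "P (p ^ n) l <= 703125 ^ 2 * (real n + 1) ^ 1"
  proof (cases "coprime l (int p)")
   case True
   then show ?thesis using energy_prime_power[OF pn(1) _ True, of n] pn prime_gt_0_nat[OF pn(1)]
    by (simp add: P_def divide_le_eq)
  next
   case False
   then show ?thesis using pn by (simp add: P_def)
  qed
 next
  fix l :: int
  have X1: "X 1 l = {(0, 0)}" by (auto simp: X_def)
  then have X1': "X (Suc 0) l = {(0, 0)}" by simp
  have "quads 1 (X 1 l) \<subseteq> {(((0, 0), (0, 0)), ((0, 0), (0, 0)))}" by (auto simp: quads_def X1')
  then have "energy 1 l <= card {(((0::int, 0::int), (0::int, 0::int)), ((0::int, 0::int), (0::int, 0::int)))}"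
   unfolding energy_def by (intro card_mono) auto
  then show "P 1 l <= 1" by (simp add: P_def)
 qed (auto simp: P_def)
 then obtain K where K: "K >= 1" "\<And>q l. q > 0 ==> P q l <= K * real q powr \<epsilon>" by blast
 show ?thesis
 proof (intro exI[of _ K] conjI allI impI K(1))
  fix q :: nat and l assume "q > 0" "coprime l (int q)"
  then show "real (energy q l) <= K * real q powr \<epsilon> * real q ^ 2"
   using K(2)[of q l] by (simp add: P_def divide_le_eq)
 qed
qed

section \<open>Averages of the exponential sums by Hoelder's inequality\<close>

lemma sum_fiber:
 fixes w :: "'z => real"
 assumes "finite I" "finite Z" "\<And>i. i \<in> I ==> m i \<in> Z"
 shows "(\<Sum>i\<in>I. w (m i)) = (\<Sum>z\<in>Z. real (card {i \<in> I. m i = z}) * w z)"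
proof -
 have "(\<Sum>i\<in>I. w (m i)) = (\<Sum>z\<in>Z. \<Sum>i\<in>{i \<in> I. m i = z}. w (m i))"
  using assms by (intro sum.group[symmetric]) auto
 also have "... = (\<Sum>z\<in>Z. \<Sum>i\<in>{i \<in> I. m i = z}. w z)" by (intro sum.cong) auto
 finally show ?thesis by simp
qed

lemma card_collisions:
 assumes "finite I" "finite Z" "\<And>i. i \<in> I ==> m i \<in> Z"
 shows "real (card {(i, j) \<in> I \<times> I. m i = m j}) = (\<Sum>z\<in>Z. real (card {i \<in> I. m i = z}) ^ 2)"
proof -
 have "{(i, j) \<in> I \<times> I. m i = m j} = (SIGMA i:I. {j \<in> I. m j = m i})" by auto
 then have "real (card {(i, j) \<in> I \<times> I. m i = m j}) = (\<Sum>i\<in>I. real (card {j \<in> I. m j = m i}))"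
  using assms(1) by (simp add: card_SigmaI)
 also have "... = (\<Sum>z\<in>Z. real (card {i \<in> I. m i = z}) * real (card {j \<in> I. m j = z}))"
  using sum_fiber[where m = m and w = "%z. real (card {j \<in> I. m j = z})", OF assms] by simp
 finally show ?thesis by (simp add: power2_eq_square)
qed

lemma sum_fst_product: "(\<Sum>z\<in>A \<times> B. F (fst z)) = of_nat (card B) * (\<Sum>x\<in>A. F x :: 'a :: semiring_1)"
proof -
 have "(\<Sum>z\<in>A \<times> B. F (fst z)) = (\<Sum>x\<in>A. \<Sum>y\<in>B. F x)"
  by (simp only: sum.cartesian_product case_prod_unfold)
 then show ?thesis by (simp add: sum_distrib_left)
qed

lemma collision_L2:
 fixes w :: "'z => real"
 assumes "finite I" "finite Z" "\<And>i. i \<in> I ==> m i \<in> Z"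
 shows "(\<Sum>i\<in>I. w (m i)) ^ 2 <= real (card {(i, j) \<in> I \<times> I. m i = m j}) * (\<Sum>z\<in>Z. w z ^ 2)"
proof -
 have "real (card {(i, j) \<in> I \<times> I. m i = m j}) = (\<Sum>z\<in>Z. real (card {i \<in> I. m i = z}) ^ 2)"
  by (rule card_collisions) (use assms in auto)
 moreover have "(\<Sum>i\<in>I. w (m i)) = (\<Sum>z\<in>Z. real (card {i \<in> I. m i = z}) * w z)"
  by (rule sum_fiber) (use assms in auto)
 ultimately show ?thesis by (simp only: Cauchy_Schwarz_ineq_sum)
qed

text \<open>Hoelder's inequality with exponents 2, 4, 4 for the multiplicities of \<open>m\<close>,
  obtained from two applications of Cauchy-Schwarz. The number of collisions is the second moment of
  these multiplicities.\<close>

lemma collision_L4: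
 fixes w :: "'z => real"
 assumes "finite I" "finite Z" "\<And>i. i \<in> I ==> m i \<in> Z"
 shows "(\<Sum>i\<in>I. w (m i)) ^ 4 <= real (card I) ^ 2 * (real (card {(i, j) \<in> I \<times> I. m i = m j}) * (\<Sum>z\<in>Z. w z ^ 4))"
proof -
 have "(\<Sum>i\<in>I. w (m i)) ^ 2 <= real (card I) * (\<Sum>i\<in>I. w (m i) ^ 2)"
  using Cauchy_Schwarz_ineq_sum[of "%_. 1" "%i. w (m i)" I] by simp
 then have "((\<Sum>i\<in>I. w (m i)) ^ 2) ^ 2 <= (real (card I) * (\<Sum>i\<in>I. w (m i) ^ 2)) ^ 2"
  by (intro power_mono) auto
 also have "... = real (card I) ^ 2 * (\<Sum>i\<in>I. w (m i) ^ 2) ^ 2" by (simp add: power_mult_distrib)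
 also have "... <= real (card I) ^ 2 * (real (card {(i, j) \<in> I \<times> I. m i = m j}) * (\<Sum>z\<in>Z. (w z ^ 2) ^ 2))"
  using collision_L2[where m = m and w = "%z. w z ^ 2", OF assms] by (intro mult_left_mono) auto
 finally show ?thesis by (simp add: power_mult[symmetric])
qed

lemma card_cong_interval:
 assumes "q > 0" "N >= 0"
 shows "real (card {n::int. \<bar>n\<bar> <= N & [n = c] (mod int q)}) <= 2 * real_of_int N / real q + 1"
proof (cases "{n::int. \<bar>n\<bar> <= N & [n = c] (mod int q)} = {}")
 case False
 let ?S = "{n::int. \<bar>n\<bar> <= N & [n = c] (mod int q)}"
 have fin: "finite ?S" by (rule finite_subset[of _ "{-N..N}"]) auto
 define n0 where "n0 = Min ?S"
 have n0: "n0 \<in> ?S" "\<And>n. n \<in> ?S ==> n0 <= n" using Min_in[OF fin False] Min_le[OF fin] by (auto simp: n0_def)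
 have dv: "int q dvd n - n0" if "n \<in> ?S" for n
  using that n0(1) by (auto simp: cong_iff_dvd_diff[symmetric] intro: cong_trans cong_sym)
 have "card ?S <= card {0..(2 * N) div int q}"
 proof (rule card_inj_on_le[where f = "%n. (n - n0) div int q"])
  show "inj_on (%n. (n - n0) div int q) ?S"
  proof (rule inj_onI)
   fix x y assume xy: "x \<in> ?S" "y \<in> ?S" and e: "(x - n0) div int q = (y - n0) div int q"
   have "x - n0 = y - n0" using dv[OF xy(1)] dv[OF xy(2)] e by (metis dvd_div_mult_self)
   then show "x = y" by simp
  qed
  show "(%n. (n - n0) div int q) ` ?S \<subseteq> {0..(2 * N) div int q}"
  proof (rule image_subsetI)
   fix n assume n: "n \<in> ?S"
   then have "0 <= n - n0" "n - n0 <= 2 * N" using n0 n0(2)[OF n] by auto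
   then show "(n - n0) div int q \<in> {0..(2 * N) div int q}" using assms
    by (auto simp: pos_imp_zdiv_nonneg_iff intro: zdiv_mono1)
  qed
 qed auto
 also have "real (card {0..(2 * N) div int q}) = real_of_int ((2 * N) div int q) + 1"
  using assms by (simp add: pos_imp_zdiv_nonneg_iff)
 also have "real_of_int ((2 * N) div int q) <= 2 * real_of_int N / real q"
  using real_of_int_div4[of "2 * N" "int q"] by simp
 finally show ?thesis by simp
next
 case True
 then show ?thesis using assms by (simp only: card.empty) simp
qed

definition units :: "nat => int set" where
 "units q = {r. 0 <= r & r < int q & coprime r (int q)}"

lemma finite_units [simp]: "finite (units q)"
 by (rule finite_subset[of _ "{0..<int q}"]) (auto simp: units_def)

lemma card_units:
 assumes "q > 0"
 shows "card (units q) = totient q"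
proof (cases "q = 1")
 case True
 have "units 1 = {0}" by (auto simp: units_def)
 then show ?thesis using True by simp
next
 case False
 then have q: "q > 1" using assms by simp
 have "bij_betw int (totatives q) (units q)"
 proof (rule bij_betwI[where g = nat])
  show "int \<in> totatives q \<rightarrow> units q"
   using q totatives_less[of _ q] by (auto simp: units_def totatives_def)
  show "nat \<in> units q \<rightarrow> totatives q"
  proof
   fix r assume r: "r \<in> units q"
   then have "r \<noteq> 0" using q by (auto simp: units_def)
   then have "r > 0" "int (nat r) = r" using r by (auto simp: units_def)
   then show "nat r \<in> totatives q"
    using r coprime_int_iff[of "nat r" q] by (auto simp: units_def totatives_def nat_le_iff)
  qed
 qed (auto simp: units_def)
 from bij_betw_same_card[OF this] show ?thesis by (simp add: totient_def)
qed

definition uinv :: "nat => int => int" where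
 "uinv q r = (SOME s. [r * s = 1] (mod int q))"

lemma uinv: "r \<in> units q ==> [r * uinv q r = 1] (mod int q)"
 unfolding uinv_def by (rule someI_ex) (auto simp: units_def intro: cong_solve_coprime_int)

lemma power_uinv: "r \<in> units q ==> [x * r ^ e * uinv q r ^ e = x] (mod int q)"
 using cong_mult[OF cong_refl cong_pow[OF uinv[of r q], of e], of x]
 by (simp add: power_mult_distrib mult.assoc)

definition nz :: "nat => int set" where
 "nz H = {h. h \<noteq> 0 & \<bar>h\<bar> <= int H}"

lemma finite_nz [simp]: "finite (nz H)"
 by (rule finite_subset[of _ "{- int H..int H}"]) (auto simp: nz_def)

lemma card_nz: "card (nz H) = 2 * H"
proof -
 have "nz H = {- int H..int H} - {0}" by (auto simp: nz_def)
 then show ?thesis by simp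
qed

text \<open>A single constant \<open>G\<close>, later of size q^\<epsilon>, stands for all
  arithmetic losses, so the estimates below are free of \<epsilon>. Roots are bounded modulo every
  divisor of q because common factors of frequency and modulus are cancelled; divisors are bounded
  up to q^2 because products of two frequencies up to q are factored.\<close>

locale modsys =
 fixes q :: nat and l :: int and G :: real
 assumes q0: "q > 0" and cop: "coprime l (int q)" and G1: "G >= 1"
  and roots: "\<And>e r c. e \<in> {2, 3} ==> r dvd q ==> real (unit_root_count e c r) <= G"
  and divs: "\<And>n. 0 < n ==> n <= q ^ 2 ==> real (card {d. d dvd n}) <= G"
  and tot: "real q <= G * real (totient q)"
  and ener: "real (energy q l) <= G * real q ^ 2"
begin

text \<open>Cancel g = gcd(h, q). Modulo r = q / g every solution s has the same e-th power as one
  fixed solution \<open>s0\<close>, so there are at most G classes modulo r, each with g lifts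
  modulo q.\<close>

lemma root_count_weighted:
 assumes "e \<in> {2, 3}" "h \<noteq> 0"
 shows "real (card {s \<in> units q. [h * s ^ e = h'] (mod int q)}) <= real_of_int (gcd h (int q)) * G"
proof (cases "{s \<in> units q. [h * s ^ e = h'] (mod int q)} = {}")
 case True
 then show ?thesis using G1 by (simp only: card.empty) simp
next
 case False
 then obtain s0 where s0: "s0 \<in> units q" "[h * s0 ^ e = h'] (mod int q)" by auto
 define g where "g = gcd h (int q)"
 have g: "g > 0" using q0 by (simp add: g_def)
 have "g dvd int q" by (simp add: g_def)
 then obtain r' where r': "int q = g * r'" by blast
 define r where "r = nat r'"
 have rp: "r' > 0" using r' q0 g by (metis of_nat_0_less_iff zero_less_mult_pos)
 then have r: "int q = g * int r" "r > 0" using r' by (auto simp: r_def)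
 have rq: "r dvd q" using r by (metis dvd_triv_right int_dvd_int_iff)
 let ?R = "{x. 0 <= x & x < int r & [x ^ e = s0 ^ e] (mod int r) & coprime x (int r)}"
 have "card {s \<in> units q. [h * s ^ e = h'] (mod int q)} <= card ?R * card {0..<g}"
 proof (rule card_prod_bound[where f = "%s. s mod int r" and g = "%s. s div int r"])
  show "inj_on (%x. (x mod int r, x div int r)) {s \<in> units q. [h * s ^ e = h'] (mod int q)}"
   by (rule inj_onI) (metis div_mult_mod_eq prod.inject)
  fix s assume "s \<in> {s \<in> units q. [h * s ^ e = h'] (mod int q)}"
  then have s: "s \<in> units q" "[h * s ^ e = h'] (mod int q)" by auto
  have "[h * s ^ e = h * s0 ^ e] (mod int q)" using s s0 by (meson cong_sym cong_trans)
  then have "int q dvd h * (s ^ e - s0 ^ e)" by (simp add: cong_iff_dvd_diff algebra_simps)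
  moreover obtain h1 where h1: "h = g * h1" unfolding g_def by (meson dvdE gcd_dvd1)
  ultimately have "g * int r dvd g * (h1 * (s ^ e - s0 ^ e))" by (simp add: r(1) mult.assoc)
  then have "int r dvd h1 * (s ^ e - s0 ^ e)" using g by simp
  moreover have "coprime (int r) h1"
  proof -
   have "gcd (g * h1) (g * int r) = g" using g_def h1 r(1) by metis
   then have "g * gcd h1 (int r) = g" using g by (simp add: gcd_mult_left)
   then show ?thesis using g by (simp add: coprime_iff_gcd_eq_1 gcd.commute)
  qed
  ultimately have "int r dvd s ^ e - s0 ^ e" by (simp add: coprime_dvd_mult_right_iff)
  then have "[s ^ e = s0 ^ e] (mod int r)" by (simp add: cong_iff_dvd_diff)
  moreover have "coprime s (int r)" using s r by (auto simp: units_def)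
  ultimately show "s mod int r \<in> ?R" using r by (simp add: cong_def power_mod)
  have "s div int r < g"
  proof (rule ccontr)
   assume "~ ?thesis"
   then have "int r * g <= int r * (s div int r)" using r by (intro mult_left_mono) auto
   also have "... <= s" using r s by (simp add: minus_mod_eq_mult_div[symmetric])
   finally show False using s r by (simp add: units_def mult.commute)
  qed
  then show "s div int r \<in> {0..<g}" using r s by (simp add: units_def pos_imp_zdiv_nonneg_iff)
 qed (auto intro: finite_subset[of _ "{0..<int r}"])
 then have "real (card {s \<in> units q. [h * s ^ e = h'] (mod int q)}) <= real (card ?R) * real (card {0..<g})"
  by (simp only: of_nat_mult[symmetric] of_nat_le_iff)
 also have "... <= G * real_of_int g"
  using roots[OF assms(1) rq, of "s0 ^ e"] g by (intro mult_mono) (auto simp: unit_root_count_def)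
 finally show ?thesis by (simp add: g_def mult.commute)
qed

lemma divs_q: "real (card {d. d dvd q}) <= G"
 using q0 by (intro divs) (auto simp: power2_eq_square)

text \<open>The gcd is at most the sum of the common divisors g of h and q. For each g the multiples
  of g up to H contribute at most g (H / g) <= H.\<close>

lemma gcd_sum: "(\<Sum>h\<in>nz H. real_of_int (gcd h (int q))) <= 2 * real H * G"
proof -
 have sym: "(\<Sum>h\<in>nz H. real_of_int (gcd h (int q))) = 2 * (\<Sum>h\<in>{1..H}. real (gcd h q))"
 proof -
  have "nz H = int ` {1..H} \<union> (%h. - int h) ` {1..H}"
  proof
   show "nz H \<subseteq> int ` {1..H} \<union> (%h. - int h) ` {1..H}"
   proof
    fix h assume h: "h \<in> nz H"
    then have "nat \<bar>h\<bar> \<in> {1..H}" by (auto simp: nz_def)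
    moreover have "h = int (nat \<bar>h\<bar>) \<or> h = - int (nat \<bar>h\<bar>)" by auto
    ultimately show "h \<in> int ` {1..H} \<union> (%h. - int h) ` {1..H}" by blast
   qed
  qed (auto simp: nz_def)
  moreover have "int ` {1..H} \<inter> (%h. - int h) ` {1..H} = {}" by auto
  ultimately have "(\<Sum>h\<in>nz H. real_of_int (gcd h (int q))) = (\<Sum>h\<in>int ` {1..H}. real_of_int (gcd h (int q))) + (\<Sum>h\<in>(%h. - int h) ` {1..H}. real_of_int (gcd h (int q)))"
   by (simp add: sum.union_disjoint)
  also have "... = (\<Sum>h\<in>{1..H}. real (gcd h q)) + (\<Sum>h\<in>{1..H}. real (gcd h q))"
   by (subst (1 2) sum.reindex) (auto simp: inj_on_def)
  finally show ?thesis by simp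
 qed
 have "(\<Sum>h\<in>{1..H}. gcd h q) <= (\<Sum>h\<in>{1..H}. \<Sum>g\<in>{g. g dvd q}. if g dvd h then g else 0)"
 proof (rule sum_mono)
  fix h assume "h \<in> {1..H}"
  have "gcd h q = (\<Sum>g\<in>{gcd h q}. if g dvd h then g else 0)" by simp
  also have "... <= (\<Sum>g\<in>{g. g dvd q}. if g dvd h then g else 0)"
   using q0 by (intro sum_mono2) auto
  finally show "gcd h q <= (\<Sum>g\<in>{g. g dvd q}. if g dvd h then g else 0)" .
 qed
 also have "... = (\<Sum>g\<in>{g. g dvd q}. \<Sum>h\<in>{1..H}. if g dvd h then g else 0)" by (rule sum.swap)
 also have "... <= (\<Sum>g\<in>{g. g dvd q}. H)"
 proof (rule sum_mono)
  fix g assume "g \<in> {g. g dvd q}"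
  then have g: "g > 0" using q0 by (auto intro: Nat.gr0I)
  have "(\<Sum>h\<in>{1..H}. if g dvd h then g else 0) = g * card {h \<in> {1..H}. g dvd h}"
   by (simp add: sum.If_cases Int_def)
  also have "card {h \<in> {1..H}. g dvd h} <= card {1..H div g}"
  proof (rule card_inj_on_le[where f = "%h. h div g"])
   show "inj_on (%h. h div g) {h \<in> {1..H}. g dvd h}" by (rule inj_onI) (metis (mono_tags, lifting) dvd_div_mult_self mem_Collect_eq)
   show "(%h. h div g) ` {h \<in> {1..H}. g dvd h} \<subseteq> {1..H div g}"
    using g by (auto simp: less_eq_div_iff_mult_less_eq mult.commute elim!: dvdE)
  qed auto
  then have "g * card {h \<in> {1..H}. g dvd h} <= g * (H div g)" by simp
  also have "... <= H" by simp
  finally show "(\<Sum>h\<in>{1..H}. if g dvd h then g else 0) <= H" .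
 qed
 also have "... = card {g. g dvd q} * H" by simp
 finally have "real (\<Sum>h\<in>{1..H}. gcd h q) <= real (card {g. g dvd q}) * real H" by (simp only: of_nat_mult[symmetric] of_nat_le_iff)
 also have "... <= G * real H" using divs_q by (intro mult_right_mono) auto
 finally show ?thesis unfolding sym by (simp add: mult.commute)
qed

text \<open>The product xy is one of at most 2H^2 / q + 1 integers n in the residue class with |n|
  <= H^2. It is nonzero because the factors are, and has at most 2G divisors of either sign. The
  condition H <= q keeps n in the range of \<open>divs\<close>.\<close>

lemma product_count:
 assumes "H <= q"
 shows "real (card {(x, y) \<in> nz H \<times> nz H. [x * y = c] (mod int q)}) <= 2 * G * (2 * real H ^ 2 / real q + 1)"
proof -
 define N where "N = {n::int. \<bar>n\<bar> <= int H ^ 2 & [n = c] (mod int q)}"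
 define D where "D = (%n::int. {x::int. x dvd n})"
 have finN: "finite N" by (rule finite_subset[of _ "{- (int H ^ 2)..int H ^ 2}"]) (auto simp: N_def)
 have D: "finite (D n) & real (card (D n)) <= 2 * G" if "n \<in> N" "n \<noteq> 0" for n
 proof -
  have sub: "D n \<subseteq> int ` {d. d dvd nat \<bar>n\<bar>} \<union> (%d. - int d) ` {d. d dvd nat \<bar>n\<bar>}"
  proof
   fix x assume "x \<in> D n"
   then have "nat \<bar>x\<bar> dvd nat \<bar>n\<bar>" by (simp add: D_def nat_abs_dvd_iff)
   moreover have "x = int (nat \<bar>x\<bar>) \<or> x = - int (nat \<bar>x\<bar>)" by auto
   ultimately show "x \<in> int ` {d. d dvd nat \<bar>n\<bar>} \<union> (%d. - int d) ` {d. d dvd nat \<bar>n\<bar>}" by blast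
  qed
  have n0: "nat \<bar>n\<bar> > 0" using that by simp
  have fin: "finite {d. d dvd nat \<bar>n\<bar>}" using finite_divisors_nat[OF n0] .
  have "card (D n) <= card (int ` {d. d dvd nat \<bar>n\<bar>} \<union> (%d. - int d) ` {d. d dvd nat \<bar>n\<bar>})"
   using fin sub by (intro card_mono) auto
  also have "... <= card (int ` {d. d dvd nat \<bar>n\<bar>}) + card ((%d. - int d) ` {d. d dvd nat \<bar>n\<bar>})"
   by (rule card_Un_le)
  also have "... <= card {d. d dvd nat \<bar>n\<bar>} + card {d. d dvd nat \<bar>n\<bar>}"
   using fin by (intro add_mono card_image_le) auto
  finally have "real (card (D n)) <= 2 * real (card {d. d dvd nat \<bar>n\<bar>})" by simp
  also have "real (card {d. d dvd nat \<bar>n\<bar>}) <= G"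
  proof (rule divs[OF n0])
   have sq: "int H ^ 2 <= int q ^ 2" using assms by (intro power_mono) auto
   have "\<bar>n\<bar> <= int q ^ 2" using that order_trans[OF _ sq, of "\<bar>n\<bar>"] by (simp add: N_def)
   then show "nat \<bar>n\<bar> <= q ^ 2" by (simp add: nat_le_iff)
  qed
  finally show ?thesis using finite_subset[OF sub] fin by auto
 qed
 let ?S = "{(x, y) \<in> nz H \<times> nz H. [x * y = c] (mod int q)}"
 have "card ?S <= card (SIGMA n:N - {0}. D n)"
 proof (rule card_inj_on_le[where f = "%(x, y). (x * y, x)"])
  show "inj_on (%(x, y). (x * y, x)) ?S" by (auto simp: inj_on_def nz_def)
  show "(%(x, y). (x * y, x)) ` ?S \<subseteq> (SIGMA n:N - {0}. D n)"
   by (auto simp: N_def D_def nz_def abs_mult power2_eq_square intro!: mult_mono)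
 qed (use finN D in auto)
 also have "... = (\<Sum>n\<in>N - {0}. card (D n))" using finN D by (intro card_SigmaI) auto
 finally have "real (card ?S) <= (\<Sum>n\<in>N - {0}. real (card (D n)))" by (simp only: of_nat_sum[symmetric] of_nat_le_iff)
 also have "... <= (\<Sum>n\<in>N - {0}. 2 * G)" using D by (intro sum_mono) auto
 also have "... = real (card (N - {0})) * (2 * G)" by simp
 also have "... <= (2 * real H ^ 2 / real q + 1) * (2 * G)"
 proof (intro mult_right_mono)
  have "real (card (N - {0})) <= real (card N)" using finN by (simp add: card_mono)
  also have "... <= 2 * real H ^ 2 / real q + 1"
   using card_cong_interval[OF q0, of "int H ^ 2" c] by (simp add: N_def)
  finally show "real (card (N - {0})) <= 2 * real H ^ 2 / real q + 1" .
 qed (use G1 in auto)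
 finally show ?thesis by (simp add: mult.commute)
qed

text \<open>Coincidences between short frequencies on one orbit: s^e carries h to h'. Averaged over
  the units s they measure how evenly the orbits of short frequencies spread modulo q.\<close>

definition twistset :: "nat => nat => int => (int \<times> int) set" where
 "twistset e H s = {(h, h') \<in> nz H \<times> nz H. [h * s ^ e = h'] (mod int q)}"

definition twist :: "nat => nat => int => nat" where
 "twist e H s = card (twistset e H s)"

lemma finite_twistset [simp]: "finite (twistset e H s)"
 by (rule finite_subset[of _ "nz H \<times> nz H"]) (auto simp: twistset_def)

lemma twist_sum:
 assumes e: "e \<in> {2, 3}"
 shows "(\<Sum>s\<in>units q. real (twist e H s)) <= 4 * G ^ 2 * real H ^ 2"
proof -
 have "(\<Sum>s\<in>units q. real (twist e H s)) = real (card (SIGMA s:units q. twistset e H s))"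
  by (subst card_SigmaI) (auto simp: twist_def)
 also have "card (SIGMA s:units q. twistset e H s)
   <= card (SIGMA z:nz H \<times> nz H. {s \<in> units q. [fst z * s ^ e = snd z] (mod int q)})"
  by (rule card_inj_on_le[where f = "%(s, z). (z, s)"]) (auto simp: inj_on_def twistset_def)
 also have "... = (\<Sum>z\<in>nz H \<times> nz H. card {s \<in> units q. [fst z * s ^ e = snd z] (mod int q)})"
  by (subst card_SigmaI) auto
 also have "real ... = (\<Sum>z\<in>nz H \<times> nz H. real (card {s \<in> units q. [fst z * s ^ e = snd z] (mod int q)}))"
  by simp
 also have "... <= (\<Sum>z\<in>nz H \<times> nz H. real_of_int (gcd (fst z) (int q)) * G)"
  using e by (intro sum_mono root_count_weighted) (auto simp: nz_def)
 also have "... = (\<Sum>h\<in>nz H. real_of_int (gcd h (int q))) * (G * (2 * real H))"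
  by (subst sum_fst_product[of "%x. real_of_int (gcd x (int q)) * G"]) (simp add: card_nz sum_distrib_right[symmetric])
 also have "... <= (2 * real H * G) * (G * (2 * real H))"
  using gcd_sum G1 by (intro mult_right_mono) auto
 finally show ?thesis by (simp add: power2_eq_square mult_ac)
qed

text \<open>Two coincidences with the same s, from h1 to h1' and from h2 to h2', give h1 h2' = h1'
  h2 after elimination of s^e. Choose h1 and h2' freely, count (h1', h2) by
  \<open>product_count\<close>, and then s by \<open>root_count_weighted\<close>.\<close>

lemma twist_square_sum:
 assumes e: "e \<in> {2, 3}" and H: "H <= q"
 shows "(\<Sum>s\<in>units q. real (twist e H s) ^ 2) <= 16 * G ^ 3 * real H ^ 2 * (1 + real H ^ 2 / real q)"
proof -
 let ?T = "twistset e H"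
 let ?U = "%h h'. {s \<in> units q. [h * s ^ e = h'] (mod int q)}"
 let ?P = "%c. {(x, y) \<in> nz H \<times> nz H. [x * y = c] (mod int q)}"
 have finP: "finite (?P c)" for c by (rule finite_subset[of _ "nz H \<times> nz H"]) auto
 have "(\<Sum>s\<in>units q. real (twist e H s) ^ 2) = real (card (SIGMA s:units q. ?T s \<times> ?T s))"
  by (subst card_SigmaI) (auto simp: twist_def power2_eq_square card_cartesian_product)
 also have "card (SIGMA s:units q. ?T s \<times> ?T s)
   <= card (SIGMA u:nz H \<times> nz H. SIGMA v:?P (fst u * snd u). ?U (fst u) (fst v))"
 proof (rule card_inj_on_le[where f = "%(s, (h1, h1'), (h2, h2')). ((h1, h2'), ((h1', h2), s))"])
  show "(%(s, (h1, h1'), (h2, h2')). ((h1, h2'), ((h1', h2), s))) ` (SIGMA s:units q. ?T s \<times> ?T s)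
   \<subseteq> (SIGMA u:nz H \<times> nz H. SIGMA v:?P (fst u * snd u). ?U (fst u) (fst v))"
  proof (rule image_subsetI)
   fix z assume "z \<in> (SIGMA s:units q. ?T s \<times> ?T s)"
   then obtain s h1 h1' h2 h2' where z: "z = (s, (h1, h1'), (h2, h2'))" "s \<in> units q"
    "h1 \<in> nz H" "h1' \<in> nz H" "h2 \<in> nz H" "h2' \<in> nz H"
    "[h1 * s ^ e = h1'] (mod int q)" "[h2 * s ^ e = h2'] (mod int q)" by (auto simp: twistset_def)
   have "[h1' * h2 = (h1 * s ^ e) * h2] (mod int q)" using z by (intro cong_mult) (auto intro: cong_sym)
   also have "(h1 * s ^ e) * h2 = h1 * (h2 * s ^ e)" by simp
   also have "[h1 * (h2 * s ^ e) = h1 * h2'] (mod int q)" using z by (intro cong_mult) auto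
   finally show "(%(s, (h1, h1'), (h2, h2')). ((h1, h2'), ((h1', h2), s))) z \<in> (SIGMA u:nz H \<times> nz H. SIGMA v:?P (fst u * snd u). ?U (fst u) (fst v))"
    using z by simp
  qed
 qed (use finP in \<open>auto simp: inj_on_def intro!: finite_SigmaI\<close>)
 also have "... = (\<Sum>u\<in>nz H \<times> nz H. \<Sum>v\<in>?P (fst u * snd u). card (?U (fst u) (fst v)))"
  using finP by (subst card_SigmaI) (auto intro!: sum.cong card_SigmaI finite_SigmaI)
 also have "real ... = (\<Sum>u\<in>nz H \<times> nz H. \<Sum>v\<in>?P (fst u * snd u). real (card (?U (fst u) (fst v))))" by simp
 also have "... <= (\<Sum>u\<in>nz H \<times> nz H. \<Sum>v\<in>?P (fst u * snd u). real_of_int (gcd (fst u) (int q)) * G)"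
  using e by (intro sum_mono root_count_weighted) (auto simp: nz_def)
 also have "... = (\<Sum>u\<in>nz H \<times> nz H. real (card (?P (fst u * snd u))) * (real_of_int (gcd (fst u) (int q)) * G))" by simp
 also have "... <= (\<Sum>u\<in>nz H \<times> nz H. (2 * G * (2 * real H ^ 2 / real q + 1)) * (real_of_int (gcd (fst u) (int q)) * G))"
  using G1 by (intro sum_mono mult_right_mono product_count H) auto
 also have "... = (2 * G * (2 * real H ^ 2 / real q + 1)) * ((\<Sum>h\<in>nz H. real_of_int (gcd h (int q))) * (G * (2 * real H)))"
  by (subst sum_fst_product[of "%x. (2 * G * (2 * real H ^ 2 / real q + 1)) * (real_of_int (gcd x (int q)) * G)"])
   (simp only: card_nz sum_distrib_left[symmetric] sum_distrib_right[symmetric], simp)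
 also have "... <= (2 * G * (2 * real H ^ 2 / real q + 1)) * ((2 * real H * G) * (G * (2 * real H)))"
  using gcd_sum G1 by (intro mult_left_mono mult_right_mono) auto
 also have "... = 8 * G ^ 3 * real H ^ 2 * (2 * real H ^ 2 / real q + 1)"
  by (simp add: power2_eq_square power3_eq_cube algebra_simps)
 also have "... <= 8 * G ^ 3 * real H ^ 2 * (2 * (1 + real H ^ 2 / real q))"
  using G1 by (intro mult_left_mono) auto
 finally show ?thesis by (simp add: algebra_simps)
qed

lemma uinv_mult_units:
 assumes "r \<in> units q" "r' \<in> units q"
 shows "(r * uinv q r') mod int q \<in> units q"
proof -
 have "coprime (r' * uinv q r') (int q)"
  using cong_imp_coprime[OF cong_sym[OF uinv[OF assms(2)]]] by simp
 then have "coprime (uinv q r') (int q)" by simp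
 then show ?thesis using assms q0 by (simp add: units_def coprime_mod_left_iff)
qed

lemma uinv_mult_inj:
 assumes "r \<in> units q" "r1 \<in> units q" "r2 \<in> units q"
  and "(r * uinv q r1) mod int q = (r * uinv q r2) mod int q"
 shows "r1 = r2"
proof -
 have "[r * uinv q r1 = r * uinv q r2] (mod int q)" using assms(4) by (simp add: cong_def)
 then have u: "[uinv q r1 = uinv q r2] (mod int q)"
  using assms(1) by (simp add: units_def cong_mult_lcancel)
 have "[r1 * 1 = r1 * (r2 * uinv q r2)] (mod int q)" using uinv[OF assms(3)] by (intro cong_mult) (auto intro: cong_sym)
 also have "r1 * (r2 * uinv q r2) = (r1 * r2) * uinv q r2" by simp
 also have "[(r1 * r2) * uinv q r2 = (r1 * r2) * uinv q r1] (mod int q)" using u by (intro cong_mult) (auto intro: cong_sym)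
 also have "(r1 * r2) * uinv q r1 = r2 * (r1 * uinv q r1)" by simp
 also have "[r2 * (r1 * uinv q r1) = r2 * 1] (mod int q)" using uinv[OF assms(2)] by (intro cong_mult) auto
 finally show ?thesis using assms by (simp add: units_def cong_def)
qed

text \<open>A collision of orbit points under r and r' depends only on the quotient s = r /
  r'.\<close>

lemma untwist:
 assumes r: "r \<in> units q" "r' \<in> units q" and "[h * r ^ e = h' * r' ^ e] (mod int q)"
 shows "[h * ((r * uinv q r') mod int q) ^ e = h'] (mod int q)"
proof -
 have "[h * ((r * uinv q r') mod int q) ^ e = h * (r * uinv q r') ^ e] (mod int q)"
  by (intro cong_mult cong_pow) (auto simp: cong_def)
 also have "h * (r * uinv q r') ^ e = (h * r ^ e) * uinv q r' ^ e" by (simp add: power_mult_distrib)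
 also have "[(h * r ^ e) * uinv q r' ^ e = (h' * r' ^ e) * uinv q r' ^ e] (mod int q)"
  by (rule cong_scalar_right[OF assms(3)])
 also have "[(h' * r' ^ e) * uinv q r' ^ e = h'] (mod int q)" by (rule power_uinv[OF r(2)])
 finally show ?thesis .
qed

text \<open>For inverse powers the two frequencies exchange roles while s = r / r' stays the same.
  Hence a collision in both coordinates is described by a single unit s.\<close>

lemma untwist_inverse:
 assumes r: "r \<in> units q" "r' \<in> units q" and "[k * uinv q r ^ e = k' * uinv q r' ^ e] (mod int q)"
 shows "[k' * ((r * uinv q r') mod int q) ^ e = k] (mod int q)"
proof -
 have "[k' * ((r * uinv q r') mod int q) ^ e = k' * (r * uinv q r') ^ e] (mod int q)"
  by (intro cong_mult cong_pow) (auto simp: cong_def)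
 also have "k' * (r * uinv q r') ^ e = (k' * uinv q r' ^ e) * r ^ e" by (simp add: power_mult_distrib)
 also have "[(k' * uinv q r' ^ e) * r ^ e = (k * uinv q r ^ e) * r ^ e] (mod int q)"
  by (rule cong_scalar_right[OF cong_sym[OF assms(3)]])
 also have "(k * uinv q r ^ e) * r ^ e = k * r ^ e * uinv q r ^ e" by simp
 also have "[k * r ^ e * uinv q r ^ e = k] (mod int q)" by (rule power_uinv[OF r(1)])
 finally show ?thesis .
qed

abbreviation S :: "int => int => complex" where
 "S \<equiv> expsum q (X q l)"

lemma S_twist:
 assumes "r \<in> units q"
 shows "S ((h * r ^ 3) mod int q) ((k * uinv q r ^ 2) mod int q) = S h k"
 using expsum_cong[of "(h * r ^ 3) mod int q" "h * r ^ 3" q "(k * uinv q r ^ 2) mod int q" "k * uinv q r ^ 2" "X q l"]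
  expsum_action[OF q0 uinv[OF assms], of l h k] q0 by (simp add: cong_def)

text \<open>By invariance the sum, multiplied by the number of units, runs over all translates of
  its frequencies. Hoelder's inequality then brings in the fourth moment, that is the energy, and
  the number of collisions among the translates. At H = K = q^(1/2) the result is of order H K
  q^(1/2) up to powers of G, which is square-root cancellation on average.\<close>

lemma block_sum:
 assumes H: "H <= q" and K: "K <= q"
 shows "(\<Sum>h\<in>nz H. \<Sum>k\<in>nz K. norm (S h k)) ^ 4
   <= 256 * G ^ 5 * (real H * real K) ^ 3 * real q ^ 3 * ((1 + real H / sqrt q) * (1 + real K / sqrt q))"
proof -
 define I where "I = units q \<times> (nz H \<times> nz K)"
 define Z where "Z = {0..<int q} \<times> {0..<int q}"
 define m where "m = (%(r, (h, k)). ((h * r ^ 3) mod int q, (k * uinv q r ^ 2) mod int q))"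
 define w where "w = (%(u, v). norm (S u v))"
 define \<phi> where "\<phi> = real (totient q)"
 define \<Sigma> where "\<Sigma> = (\<Sum>h\<in>nz H. \<Sum>k\<in>nz K. norm (S h k))"
 have \<phi>: "\<phi> > 0" using q0 by (simp add: \<phi>_def)
 have finI: "finite I" by (simp add: I_def)
 have "(\<Sum>i\<in>I. w (m i)) = (\<Sum>r\<in>units q. \<Sum>z\<in>nz H \<times> nz K. w (m (r, z)))"
  by (simp add: I_def sum.cartesian_product)
 also have "... = (\<Sum>r\<in>units q. \<Sigma>)"
 proof (rule sum.cong[OF refl])
  fix r assume r: "r \<in> units q"
  have "(\<Sum>z\<in>nz H \<times> nz K. w (m (r, z))) = (\<Sum>z\<in>nz H \<times> nz K. norm (S (fst z) (snd z)))"
   by (rule sum.cong[OF refl]) (auto simp: w_def m_def S_twist[OF r])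
  then show "(\<Sum>z\<in>nz H \<times> nz K. w (m (r, z))) = \<Sigma>"
   by (simp add: \<Sigma>_def sum.cartesian_product case_prod_unfold)
 qed
 finally have sumI: "(\<Sum>i\<in>I. w (m i)) = \<phi> * \<Sigma>" by (simp add: \<phi>_def card_units[OF q0])
 have cI: "real (card I) = \<phi> * (4 * (real H * real K))"
  by (simp add: I_def card_cartesian_product card_nz card_units[OF q0] \<phi>_def)
 have W: "(\<Sum>z\<in>Z. w z ^ 4) <= G * real q ^ 4"
 proof -
  have "(\<Sum>z\<in>Z. w z ^ 4) = real q ^ 2 * real (energy q l)"
   using fourth_moment[OF q0, of l] by (simp add: Z_def w_def sum.cartesian_product case_prod_unfold)
  also have "... <= real q ^ 2 * (G * real q ^ 2)" by (intro mult_left_mono ener) auto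
  finally show ?thesis by (simp add: power2_eq_square power4_eq_xxxx mult_ac)
 qed
 have C: "real (card {(i, j) \<in> I \<times> I. m i = m j}) <= \<phi> * (\<Sum>s\<in>units q. real (twist 3 H s) * real (twist 2 K s))"
 proof -
  \<comment> \<open>A colliding pair of indices is recorded by r, by s = r / r' and by its
    frequencies. This loses nothing, since r and s determine r', and it separates the two
    coordinates for Cauchy-Schwarz over s.\<close>
  have "card {(i, j) \<in> I \<times> I. m i = m j} <= card (units q \<times> (SIGMA s:units q. twistset 3 H s \<times> twistset 2 K s))"
  proof (rule card_inj_on_le[where f = "%((r, (h, k)), (r', (h', k'))). (r, ((r * uinv q r') mod int q, ((h, h'), (k', k))))"])
   show "inj_on (%((r, (h, k)), (r', (h', k'))). (r, ((r * uinv q r') mod int q, ((h, h'), (k', k))))) {(i, j) \<in> I \<times> I. m i = m j}"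
    by (rule inj_onI) (auto simp: I_def dest: uinv_mult_inj)
   show "(%((r, (h, k)), (r', (h', k'))). (r, ((r * uinv q r') mod int q, ((h, h'), (k', k))))) ` {(i, j) \<in> I \<times> I. m i = m j}
     \<subseteq> units q \<times> (SIGMA s:units q. twistset 3 H s \<times> twistset 2 K s)"
   proof (rule image_subsetI)
    fix z assume "z \<in> {(i, j) \<in> I \<times> I. m i = m j}"
    then obtain r h k r' h' k' where z: "z = ((r, (h, k)), (r', (h', k')))" "r \<in> units q" "r' \<in> units q"
     "h \<in> nz H" "h' \<in> nz H" "k \<in> nz K" "k' \<in> nz K" "m (r, (h, k)) = m (r', (h', k'))" by (auto simp: I_def)
    have "[h * r ^ 3 = h' * r' ^ 3] (mod int q)" "[k * uinv q r ^ 2 = k' * uinv q r' ^ 2] (mod int q)"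
     using z(8) by (auto simp: m_def cong_def)
    from untwist[OF z(2,3) this(1)] untwist_inverse[OF z(2,3) this(2)]
    show "(%((r, (h, k)), (r', (h', k'))). (r, ((r * uinv q r') mod int q, ((h, h'), (k', k))))) z
     \<in> units q \<times> (SIGMA s:units q. twistset 3 H s \<times> twistset 2 K s)"
     using z uinv_mult_units[OF z(2,3)] by (simp add: twistset_def)
   qed
  qed auto
  also have "... = totient q * (\<Sum>s\<in>units q. twist 3 H s * twist 2 K s)"
   by (simp add: card_cartesian_product card_SigmaI card_units[OF q0] twist_def)
  finally have "real (card {(i, j) \<in> I \<times> I. m i = m j}) <= real (totient q * (\<Sum>s\<in>units q. twist 3 H s * twist 2 K s))"
   by (simp only: of_nat_le_iff)
  then show ?thesis by (simp add: \<phi>_def)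
 qed
 define V where "V = (\<Sum>s\<in>units q. real (twist 3 H s) * real (twist 2 K s))"
 have V: "V <= 16 * G ^ 3 * (real H * real K) * ((1 + real H / sqrt q) * (1 + real K / sqrt q))"
 proof (rule power2_le_imp_le)
  have one: "1 + real N ^ 2 / real q <= (1 + real N / sqrt q) ^ 2" for N
   using q0 by (simp add: power2_sum power_divide)
  have "V ^ 2 <= (\<Sum>s\<in>units q. real (twist 3 H s) ^ 2) * (\<Sum>s\<in>units q. real (twist 2 K s) ^ 2)"
   unfolding V_def by (rule Cauchy_Schwarz_ineq_sum)
  also have "... <= (16 * G ^ 3 * real H ^ 2 * (1 + real H ^ 2 / real q)) * (16 * G ^ 3 * real K ^ 2 * (1 + real K ^ 2 / real q))"
   using G1 by (intro mult_mono twist_square_sum H K) (auto intro!: sum_nonneg mult_nonneg_nonneg add_nonneg_nonneg)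
  also have "... <= (16 * G ^ 3 * real H ^ 2 * (1 + real H / sqrt q) ^ 2) * (16 * G ^ 3 * real K ^ 2 * (1 + real K / sqrt q) ^ 2)"
   using G1 by (intro mult_mono one) (auto intro!: mult_nonneg_nonneg add_nonneg_nonneg)
  also have "... = (16 * G ^ 3 * (real H * real K) * ((1 + real H / sqrt q) * (1 + real K / sqrt q))) ^ 2"
   by (simp only: power2_eq_square mult_ac)
  finally show "V ^ 2 <= (16 * G ^ 3 * (real H * real K) * ((1 + real H / sqrt q) * (1 + real K / sqrt q))) ^ 2" .
  show "0 <= 16 * G ^ 3 * (real H * real K) * ((1 + real H / sqrt q) * (1 + real K / sqrt q))"
   using G1 by (intro mult_nonneg_nonneg add_nonneg_nonneg) auto
 qed
 define L where "L = (1 + real H / sqrt q) * (1 + real K / sqrt q)"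
 have L0: "L >= 0" unfolding L_def by (intro mult_nonneg_nonneg add_nonneg_nonneg) auto
 have "(\<phi> * \<Sigma>) ^ 4 <= real (card I) ^ 2 * (real (card {(i, j) \<in> I \<times> I. m i = m j}) * (\<Sum>z\<in>Z. w z ^ 4))"
  unfolding sumI[symmetric] by (rule collision_L4) (use finI q0 in \<open>auto simp: Z_def m_def\<close>)
 also have "... <= (\<phi> * (4 * (real H * real K))) ^ 2 * ((\<phi> * (16 * G ^ 3 * (real H * real K) * L)) * (G * real q ^ 4))"
  unfolding cI
 proof (intro mult_left_mono mult_mono W)
  show "real (card {(i, j) \<in> I \<times> I. m i = m j}) <= \<phi> * (16 * G ^ 3 * (real H * real K) * L)"
   using C mult_left_mono[OF V[folded L_def], of \<phi>] \<phi> unfolding V_def[symmetric] by linarith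
  show "0 <= \<phi> * (16 * G ^ 3 * (real H * real K) * L)" using \<phi> G1 L0 by simp
 qed (auto simp: w_def intro!: sum_nonneg)
 also have "... = \<phi> ^ 3 * (256 * G ^ 4 * (real H * real K) ^ 3 * real q ^ 3 * L) * real q"
  by (simp add: power2_eq_square power3_eq_cube power4_eq_xxxx mult_ac)
 also have "... <= \<phi> ^ 3 * (256 * G ^ 4 * (real H * real K) ^ 3 * real q ^ 3 * L) * (G * \<phi>)"
  using tot \<phi> G1 L0 by (intro mult_left_mono) (auto simp: \<phi>_def)
 also have "... = \<phi> ^ 4 * (256 * G ^ 5 * (real H * real K) ^ 3 * real q ^ 3 * L)"
  by (simp add: eval_nat_numeral mult_ac)
 finally have "\<phi> ^ 4 * \<Sigma> ^ 4 <= \<phi> ^ 4 * (256 * G ^ 5 * (real H * real K) ^ 3 * real q ^ 3 * L)"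
  by (simp add: power_mult_distrib)
 then have "\<Sigma> ^ 4 <= 256 * G ^ 5 * (real H * real K) ^ 3 * real q ^ 3 * L"
  using \<phi> by (subst (asm) mult_le_cancel_left_pos) auto
 then show ?thesis by (simp add: \<Sigma>_def L_def)
qed

text \<open>For given b the variable x = a b^2 satisfies x^2 = (a^2 b^3) b = l b. In the same way x
  = ab satisfies x^3 = l a when a is given.\<close>

lemma column_b: "real (card {P \<in> X q l. [snd P = \<beta>] (mod int q)}) <= G"
proof -
 have "card {P \<in> X q l. [snd P = \<beta>] (mod int q)} <= unit_root_count 2 (l * \<beta>) q"
  unfolding unit_root_count_def
 proof (rule card_inj_on_le[where f = "%P. (fst P * snd P ^ 2) mod int q"])
  show "inj_on (%P. (fst P * snd P ^ 2) mod int q) {P \<in> X q l. [snd P = \<beta>] (mod int q)}"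
  proof (rule inj_onI)
   fix P P' assume P: "P \<in> {P \<in> X q l. [snd P = \<beta>] (mod int q)}" and P': "P' \<in> {P \<in> X q l. [snd P = \<beta>] (mod int q)}"
    and eq: "(fst P * snd P ^ 2) mod int q = (fst P' * snd P' ^ 2) mod int q"
   obtain a b a' b' where ab: "P = (a, b)" "P' = (a', b')" by (cases P, cases P')
   have "[b = b'] (mod int q)" using P P' ab by (auto intro: cong_trans cong_sym)
   then have b: "b = b'" using P P' ab by (auto simp: X_def cong_def)
   have "coprime b (int q)" using P ab X_coprime(2)[of a b l "int q"] cop by (auto simp: X_def)
   moreover have "[a * b ^ 2 = a' * b ^ 2] (mod int q)" using eq ab b by (simp add: cong_def)
   ultimately have "[a = a'] (mod int q)" by (simp add: cong_mult_rcancel)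
   then show "P = P'" using P P' ab b by (auto simp: X_def cong_def)
  qed
  show "(%P. (fst P * snd P ^ 2) mod int q) ` {P \<in> X q l. [snd P = \<beta>] (mod int q)}
   \<subseteq> {x. 0 <= x & x < int q & [x ^ 2 = l * \<beta>] (mod int q) & coprime x (int q)}"
  proof (rule image_subsetI)
   fix P assume P: "P \<in> {P \<in> X q l. [snd P = \<beta>] (mod int q)}"
   obtain a b where ab: "P = (a, b)" by (cases P)
   have X: "[a ^ 2 * b ^ 3 = l] (mod int q)" "[b = \<beta>] (mod int q)" using P ab by (auto simp: X_def)
   have "[(a * b ^ 2) ^ 2 = (a ^ 2 * b ^ 3) * b] (mod int q)" by (simp add: power2_eq_square power3_eq_cube mult_ac)
   also have "[(a ^ 2 * b ^ 3) * b = l * \<beta>] (mod int q)" using X by (intro cong_mult)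
   finally have "[((a * b ^ 2) mod int q) ^ 2 = l * \<beta>] (mod int q)" by (simp add: cong_def power_mod)
   moreover have "coprime (a * b ^ 2) (int q)" using X_coprime[OF X(1) cop] by simp
   ultimately show "(fst P * snd P ^ 2) mod int q \<in> {x. 0 <= x & x < int q & [x ^ 2 = l * \<beta>] (mod int q) & coprime x (int q)}"
    using ab q0 by (simp add: coprime_mod_left_iff)
  qed
 qed (auto intro: finite_subset[of _ "{0..<int q}"])
 then have "real (card {P \<in> X q l. [snd P = \<beta>] (mod int q)}) <= real (unit_root_count 2 (l * \<beta>) q)" by simp
 also have "... <= G" by (rule roots) auto
 finally show ?thesis .
qed

lemma column_a: "real (card {P \<in> X q l. [fst P = \<alpha>] (mod int q)}) <= G"
proof -
 have "card {P \<in> X q l. [fst P = \<alpha>] (mod int q)} <= unit_root_count 3 (l * \<alpha>) q"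
  unfolding unit_root_count_def
 proof (rule card_inj_on_le[where f = "%P. (fst P * snd P) mod int q"])
  show "inj_on (%P. (fst P * snd P) mod int q) {P \<in> X q l. [fst P = \<alpha>] (mod int q)}"
  proof (rule inj_onI)
   fix P P' assume P: "P \<in> {P \<in> X q l. [fst P = \<alpha>] (mod int q)}" and P': "P' \<in> {P \<in> X q l. [fst P = \<alpha>] (mod int q)}"
    and eq: "(fst P * snd P) mod int q = (fst P' * snd P') mod int q"
   obtain a b a' b' where ab: "P = (a, b)" "P' = (a', b')" by (cases P, cases P')
   have "[a = a'] (mod int q)" "[b = b'] (mod int q)"
    using X_inj[of a b l "int q" a' b'] P P' ab eq cop by (auto simp: X_def cong_def)
   then show "P = P'" using P P' ab by (auto simp: X_def cong_def)
  qed
  show "(%P. (fst P * snd P) mod int q) ` {P \<in> X q l. [fst P = \<alpha>] (mod int q)}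
   \<subseteq> {x. 0 <= x & x < int q & [x ^ 3 = l * \<alpha>] (mod int q) & coprime x (int q)}"
  proof (rule image_subsetI)
   fix P assume P: "P \<in> {P \<in> X q l. [fst P = \<alpha>] (mod int q)}"
   obtain a b where ab: "P = (a, b)" by (cases P)
   have X: "[a ^ 2 * b ^ 3 = l] (mod int q)" "[a = \<alpha>] (mod int q)" using P ab by (auto simp: X_def)
   have "[(a * b) ^ 3 = (a ^ 2 * b ^ 3) * a] (mod int q)" by (simp add: power2_eq_square power3_eq_cube mult_ac)
   also have "[(a ^ 2 * b ^ 3) * a = l * \<alpha>] (mod int q)" using X by (intro cong_mult)
   finally have "[((a * b) mod int q) ^ 3 = l * \<alpha>] (mod int q)" by (simp add: cong_def power_mod)
   moreover have "coprime (a * b) (int q)" using X_coprime[OF X(1) cop] by simp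
   ultimately show "(fst P * snd P) mod int q \<in> {x. 0 <= x & x < int q & [x ^ 3 = l * \<alpha>] (mod int q) & coprime x (int q)}"
    using ab q0 by (simp add: coprime_mod_left_iff)
  qed
 qed (auto intro: finite_subset[of _ "{0..<int q}"])
 then have "real (card {P \<in> X q l. [fst P = \<alpha>] (mod int q)}) <= real (unit_root_count 3 (l * \<alpha>) q)" by simp
 also have "... <= G" by (rule roots) auto
 finally show ?thesis .
qed

lemma card_X_totient: "card (X q l) <= totient q"
proof -
 have "card (X q l) <= card (units q)"
 proof (rule card_inj_on_le[where f = "%P. (fst P * snd P) mod int q"])
  show "inj_on (%P. (fst P * snd P) mod int q) (X q l)"
  proof (rule inj_onI)
   fix P P' assume P: "P \<in> X q l" and P': "P' \<in> X q l" and eq: "(fst P * snd P) mod int q = (fst P' * snd P') mod int q"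
   obtain a b a' b' where ab: "P = (a, b)" "P' = (a', b')" by (cases P, cases P')
   have "[a = a'] (mod int q)" "[b = b'] (mod int q)"
    using X_inj[of a b l "int q" a' b'] P P' ab eq cop by (auto simp: X_def cong_def)
   then show "P = P'" using P P' ab by (auto simp: X_def cong_def)
  qed
  show "(%P. (fst P * snd P) mod int q) ` X q l \<subseteq> units q"
   using X_coprime[of _ _ l "int q"] cop q0 by (auto simp: X_def units_def coprime_mod_left_iff)
 qed simp
 then show ?thesis by (simp add: card_units[OF q0])
qed

lemma second_moment_general:
 fixes c :: "int \<times> int => int"
 assumes "\<And>\<alpha>. real (card {P \<in> X q l. [c P = \<alpha>] (mod int q)}) <= G"
 shows "(\<Sum>h\<in>{0..<int q}. norm (\<Sum>P\<in>X q l. eexp q (h * c P)) ^ 2) <= real q * (real (totient q) * G)"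
proof -
 have "{(i, j) \<in> X q l \<times> X q l. [c i = c j] (mod int q)} = (SIGMA i:X q l. {j \<in> X q l. [c j = c i] (mod int q)})"
  by (auto intro: cong_sym)
 then have "real (card {(i, j) \<in> X q l \<times> X q l. [c i = c j] (mod int q)}) = (\<Sum>i\<in>X q l. real (card {j \<in> X q l. [c j = c i] (mod int q)}))"
  by (simp add: card_SigmaI)
 also have "... <= (\<Sum>i\<in>X q l. G)" by (intro sum_mono assms)
 also have "... <= real (totient q) * G" using card_X_totient G1 by (simp add: mult_right_mono)
 finally show ?thesis
  using parseval1[OF q0 finite_X[of q l], where u = c] by (simp add: mult_left_mono)
qed

text \<open>The analogue of \<open>block_sum\<close> when one frequency is zero: the second moment
  takes the place of the fourth, and the first moment of the twists suffices. Here \<open>f\<close>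
  is the norm of \<open>S\<close> on an axis. The disjunction in \<open>coll\<close> covers both
  orientations of a twist and costs a factor 2.\<close>

lemma axis_sum_general:
 fixes f :: "int => real" and m :: "int \<times> int => int"
 assumes m: "\<And>r h. r \<in> units q ==> f (m (r, h)) = f h" "\<And>z. m z \<in> {0..<int q}"
  and coll: "\<And>r h r' h'. r \<in> units q ==> r' \<in> units q ==> m (r, h) = m (r', h') ==> [h * ((r * uinv q r') mod int q) ^ e = h'] (mod int q)
   \<or> [h' * ((r * uinv q r') mod int q) ^ e = h] (mod int q)"
  and e: "e \<in> {2, 3}"
  and L2: "(\<Sum>h\<in>{0..<int q}. f h ^ 2) <= real q * (real (totient q) * G)"
  and f0: "\<And>h. f h >= 0"
 shows "(\<Sum>h\<in>nz H. f h) <= 3 * G ^ 2 * real H * sqrt q"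
proof -
 define I where "I = units q \<times> nz H"
 define \<phi> where "\<phi> = real (totient q)"
 have \<phi>: "\<phi> > 0" using q0 by (simp add: \<phi>_def)
 have finI: "finite I" by (simp add: I_def)
 have "(\<Sum>i\<in>I. f (m i)) = (\<Sum>r\<in>units q. \<Sum>h\<in>nz H. f (m (r, h)))"
  by (simp add: I_def sum.cartesian_product)
 also have "... = \<phi> * (\<Sum>h\<in>nz H. f h)" using m(1) by (simp add: \<phi>_def card_units[OF q0])
 finally have sumI: "(\<Sum>i\<in>I. f (m i)) = \<phi> * (\<Sum>h\<in>nz H. f h)" .
 let ?F = "%((r, h), (r', h')). (r, ((r * uinv q r') mod int q, (h, h')))"
 have "card {(i, j) \<in> I \<times> I. m i = m j} <= card (units q \<times> (SIGMA s:units q. twistset e H s \<union> prod.swap ` twistset e H s))"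
 proof (rule card_inj_on_le[where f = ?F])
  show "inj_on ?F {(i, j) \<in> I \<times> I. m i = m j}"
   by (rule inj_onI) (auto simp: I_def dest: uinv_mult_inj)
  show "?F ` {(i, j) \<in> I \<times> I. m i = m j} \<subseteq> units q \<times> (SIGMA s:units q. twistset e H s \<union> prod.swap ` twistset e H s)"
  proof (rule image_subsetI)
   fix z assume "z \<in> {(i, j) \<in> I \<times> I. m i = m j}"
   then obtain r h r' h' where z: "z = ((r, h), (r', h'))" "r \<in> units q" "r' \<in> units q"
    "h \<in> nz H" "h' \<in> nz H" "m (r, h) = m (r', h')" by (auto simp: I_def)
   from coll[OF z(2,3,6)] have "(h, h') \<in> twistset e H ((r * uinv q r') mod int q) \<union> prod.swap ` twistset e H ((r * uinv q r') mod int q)"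
    using z by (auto simp: twistset_def image_iff)
   then show "?F z \<in> units q \<times> (SIGMA s:units q. twistset e H s \<union> prod.swap ` twistset e H s)"
    using z uinv_mult_units[OF z(2,3)] by simp
  qed
 qed auto
 also have "... = totient q * (\<Sum>s\<in>units q. card (twistset e H s \<union> prod.swap ` twistset e H s))"
  by (simp add: card_cartesian_product card_SigmaI card_units[OF q0])
 also have "... <= totient q * (\<Sum>s\<in>units q. 2 * twist e H s)"
 proof (intro mult_left_mono sum_mono)
  fix s
  have "card (twistset e H s \<union> prod.swap ` twistset e H s) <= card (twistset e H s) + card (prod.swap ` twistset e H s)" by (rule card_Un_le)
  also have "... <= 2 * twist e H s" using card_image_le[of "twistset e H s" prod.swap] by (simp add: twist_def)
  finally show "card (twistset e H s \<union> prod.swap ` twistset e H s) <= 2 * twist e H s" .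
 qed auto
 finally have "real (card {(i, j) \<in> I \<times> I. m i = m j}) <= real (totient q * (\<Sum>s\<in>units q. 2 * twist e H s))"
  by (simp only: of_nat_le_iff)
 also have "... = \<phi> * (2 * (\<Sum>s\<in>units q. real (twist e H s)))" by (simp add: \<phi>_def sum_distrib_left)
 also have "... <= \<phi> * (2 * (4 * G ^ 2 * real H ^ 2))" using \<phi> twist_sum[OF e] by (intro mult_left_mono) auto
 finally have C: "real (card {(i, j) \<in> I \<times> I. m i = m j}) <= \<phi> * (8 * G ^ 2 * real H ^ 2)" by simp
 have "(\<phi> * (\<Sum>h\<in>nz H. f h)) ^ 2 <= real (card {(i, j) \<in> I \<times> I. m i = m j}) * (\<Sum>z\<in>{0..<int q}. f z ^ 2)"
  unfolding sumI[symmetric] by (rule collision_L2) (use finI m in auto)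
 also have "... <= (\<phi> * (8 * G ^ 2 * real H ^ 2)) * (real q * (\<phi> * G))"
  using C L2 \<phi> G1 by (intro mult_mono) (auto simp: \<phi>_def intro!: sum_nonneg)
 also have "... = \<phi> ^ 2 * (8 * G ^ 3 * real H ^ 2 * real q)" by (simp add: eval_nat_numeral mult_ac)
 finally have "\<phi> ^ 2 * (\<Sum>h\<in>nz H. f h) ^ 2 <= \<phi> ^ 2 * (8 * G ^ 3 * real H ^ 2 * real q)" by (simp add: power_mult_distrib)
 then have "(\<Sum>h\<in>nz H. f h) ^ 2 <= 8 * G ^ 3 * real H ^ 2 * real q"
  using \<phi> by (subst (asm) mult_le_cancel_left_pos) auto
 \<comment> \<open>Enlarged to a perfect square before the root is taken.\<close>
 also have "... <= 9 * G ^ 4 * real H ^ 2 * real q"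
  using G1 power_increasing[of 3 4 G] by (intro mult_right_mono mult_mono) auto
 also have "... = (3 * G ^ 2 * real H * sqrt q) ^ 2" by (simp add: power_mult_distrib power_mult[symmetric])
 finally show ?thesis using G1 by (elim power2_le_imp_le) auto
qed

lemma axis_sum_h: "(\<Sum>h\<in>nz H. norm (S h 0)) <= 3 * G ^ 2 * real H * sqrt q"
proof (rule axis_sum_general[where m = "%(r, h). (h * r ^ 3) mod int q" and e = 3])
 show "(\<Sum>h\<in>{0..<int q}. norm (S h 0) ^ 2) <= real q * (real (totient q) * G)"
  using second_moment_general[of fst, OF column_a] by (simp add: expsum_def case_prod_unfold)
 fix r h r' h' assume r: "r \<in> units q" "r' \<in> units q"
 show "norm (S ((%(r, h). (h * r ^ 3) mod int q) (r, h)) 0) = norm (S h 0)"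
  using S_twist[OF r(1), of h 0] by simp
 assume "(%(r, h). (h * r ^ 3) mod int q) (r, h) = (%(r, h). (h * r ^ 3) mod int q) (r', h')"
 then have "[h * r ^ 3 = h' * r' ^ 3] (mod int q)" by (simp add: cong_def)
 from untwist[OF r this] show "[h * ((r * uinv q r') mod int q) ^ 3 = h'] (mod int q) \<or> [h' * ((r * uinv q r') mod int q) ^ 3 = h] (mod int q)" ..
qed (use q0 in auto)

lemma axis_sum_k: "(\<Sum>k\<in>nz K. norm (S 0 k)) <= 3 * G ^ 2 * real K * sqrt q"
proof (rule axis_sum_general[where m = "%(r, k). (k * uinv q r ^ 2) mod int q" and e = 2])
 show "(\<Sum>k\<in>{0..<int q}. norm (S 0 k) ^ 2) <= real q * (real (totient q) * G)"
  using second_moment_general[of snd, OF column_b] by (simp add: expsum_def case_prod_unfold)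
 fix r h r' h' assume r: "r \<in> units q" "r' \<in> units q"
 show "norm (S 0 ((%(r, k). (k * uinv q r ^ 2) mod int q) (r, h))) = norm (S 0 h)"
  using S_twist[OF r(1), of 0 h] by simp
 assume "(%(r, k). (k * uinv q r ^ 2) mod int q) (r, h) = (%(r, k). (k * uinv q r ^ 2) mod int q) (r', h')"
 then have "[h * uinv q r ^ 2 = h' * uinv q r' ^ 2] (mod int q)" by (simp add: cong_def)
 from untwist_inverse[OF r this] show "[h * ((r * uinv q r') mod int q) ^ 2 = h'] (mod int q) \<or> [h' * ((r * uinv q r') mod int q) ^ 2 = h] (mod int q)" ..
qed (use q0 in auto)

end

lemma modsys_exists:
 assumes "\<epsilon> > 0"
 shows "\<exists>K\<ge>1. \<forall>q l. q > 0 --> coprime l (int q) --> modsys q l (K * real q powr \<epsilon>)"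
proof -
 obtain K1 where K1: "K1 >= 1" "\<And>q c. q > 0 ==> real (unit_root_count 2 c q) <= K1 * real q powr \<epsilon>"
  using unit_root_count_bound[OF assms, of 2] by auto
 have "prime (3::nat)" by simp
 then obtain K2 where K2: "K2 >= 1" "\<And>q c. q > 0 ==> real (unit_root_count 3 c q) <= K2 * real q powr \<epsilon>"
  using unit_root_count_bound[OF assms, of 3] by auto
 \<comment> \<open>Half of \<epsilon>, because n ranges up to q^2.\<close>
 obtain K3 where K3: "K3 >= 1" "\<And>n. n > 0 ==> real (card {d::nat. d dvd n}) <= K3 * real n powr (\<epsilon> / 2)"
  using divisor_count_bound[of "\<epsilon> / 2"] assms by auto
 obtain K4 where K4: "K4 >= 1" "\<And>n. n > 0 ==> real n / real (totient n) <= K4 * real n powr \<epsilon>"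
  using totient_lower_bound[OF assms] by auto
 obtain K5 where K5: "K5 >= 1" "\<And>q l. q > 0 ==> coprime l (int q) ==> real (energy q l) <= K5 * real q powr \<epsilon> * real q ^ 2"
  using energy_bound[OF assms] by auto
 define K where "K = K1 + K2 + K3 + K4 + K5"
 have K: "K >= 1" "K1 <= K" "K2 <= K" "K3 <= K" "K4 <= K" "K5 <= K"
  using K1 K2 K3 K4 K5 by (auto simp: K_def)
 have "modsys q l (K * real q powr \<epsilon>)" if q: "q > 0" and l: "coprime l (int q)" for q l
 proof
  have qe: "real q powr \<epsilon> >= 1" using q assms by (simp add: ge_one_powr_ge_zero)
  then show "1 <= K * real q powr \<epsilon>" using K(1) mult_mono[of 1 K 1 "real q powr \<epsilon>"] by simp
  fix e r c assume er: "e \<in> {2, 3::nat}" "r dvd q"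
  then have r: "r > 0" "r <= q" using q by (auto intro: Nat.gr0I dvd_imp_le)
  have rq: "real r powr \<epsilon> <= real q powr \<epsilon>" using r assms by (intro powr_mono2) auto
  have "real (unit_root_count e c r) <= K * real r powr \<epsilon>"
  proof (cases "e = 2")
   case True
   then show ?thesis using K1(2)[OF r(1), of c] mult_right_mono[OF K(2), of "real r powr \<epsilon>"] by simp
  next
   case False
   then show ?thesis using er K2(2)[OF r(1), of c] mult_right_mono[OF K(3), of "real r powr \<epsilon>"] by simp
  qed
  also have "... <= K * real q powr \<epsilon>" using rq K(1) by (intro mult_left_mono) auto
  finally show "real (unit_root_count e c r) <= K * real q powr \<epsilon>" .
 next
  fix n assume n: "0 < n" "n <= q ^ 2"
  have "real n powr (\<epsilon> / 2) <= real (q ^ 2) powr (\<epsilon> / 2)"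
   using n assms by (intro powr_mono2) (auto simp del: of_nat_power)
  also have "real (q ^ 2) powr (\<epsilon> / 2) = real q powr \<epsilon>"
  proof -
   have e: "real (q ^ 2) = real q powr 2" using q by (simp add: powr_numeral)
   show ?thesis by (simp only: e powr_powr) simp
  qed
  finally have "K3 * real n powr (\<epsilon> / 2) <= K * real q powr \<epsilon>" using K K3 by (intro mult_mono) auto
  then show "real (card {d. d dvd n}) <= K * real q powr \<epsilon>" using K3(2)[OF n(1)] by simp
 next
  have "real q / real (totient q) <= K * real q powr \<epsilon>"
   using K4(2)[OF q] mult_right_mono[OF K(5), of "real q powr \<epsilon>"] by simp
  then show "real q <= K * real q powr \<epsilon> * real (totient q)" using q by (simp add: divide_le_eq)
 next
  have "K5 * real q powr \<epsilon> * real q ^ 2 <= K * real q powr \<epsilon> * real q ^ 2" using K by (intro mult_right_mono) auto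
  then show "real (energy q l) <= K * real q powr \<epsilon> * real q ^ 2" using K5(2)[OF q l] by linarith
 qed (use q l in auto)
 then show ?thesis using K(1) by blast
qed

subsection \<open>The Fourier series of the second Bernoulli polynomial\<close>

definition bern2 :: "real => real" where
 "bern2 x = (frac x)\<^sup>2 - frac x + 1 / 6"

lemma bern2_periodic: "bern2 (x + of_int n) = bern2 x"
 by (simp add: bern2_def frac_def)

lemma bern2_on_unit: "0 <= x ==> x < 1 ==> bern2 x = x\<^sup>2 - x + 1 / 6"
 by (simp add: bern2_def frac_eq)

lemma dirichlet_kernel:
 "sin (pi * x) * (1 + 2 * (\<Sum>h<M. cos (2 * pi * real (Suc h) * x))) = sin ((2 * real M + 1) * pi * x)"
proof (induction M)
 case (Suc M)
 have "sin ((2 * real (Suc M) + 1) * pi * x) - sin ((2 * real M + 1) * pi * x)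
   = 2 * sin (pi * x) * cos (2 * pi * real (Suc M) * x)"
 proof -
  have "((2 * real (Suc M) + 1) * pi * x - (2 * real M + 1) * pi * x) / 2 = pi * x"
   "((2 * real (Suc M) + 1) * pi * x + (2 * real M + 1) * pi * x) / 2 = 2 * pi * real (Suc M) * x"
   by (simp_all add: field_simps)
  then show ?thesis
   using sin_diff_sin[of "(2 * real (Suc M) + 1) * pi * x" "(2 * real M + 1) * pi * x"] by (simp only:)
 qed
 then show ?case using Suc by (simp add: algebra_simps)
qed simp

text \<open>The error of the partial sum vanishes at x = 1/2 and has derivative sin(my) /
  sin(\<pi>y) with m = (2M+1)\<pi>. Integration by parts gains a factor 1/M as long as x keeps a
  distance d from the integers.\<close>

lemma sawtooth_partial_sum_bound:
 assumes d: "0 < d" "d < 1 / 2"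
 shows "\<exists>C. \<forall>M>0. \<forall>x\<in>{d..1 - d}. \<bar>(\<Sum>h<M. sin (2 * pi * real (Suc h) * x) / (pi * real (Suc h))) - (1 / 2 - x)\<bar> <= C / real M"
proof -
 define s where "s = sin (pi * d)"
 have s0: "s > 0" using d unfolding s_def by (intro sin_gt_zero) auto
 have sge: "sin (pi * x) >= s" if x: "x \<in> {d..1 - d}" for x
 proof (cases "x <= 1 / 2")
  case True
  have "pi * d <= pi * x" "pi * x <= pi / 2" using x True by auto
  then show ?thesis unfolding s_def using d by (intro sin_monotone_2pi_le) (auto intro: order_trans[of _ 0])
 next
  case False
  have "sin (pi * x) = sin (pi * (1 - x))" by (simp add: algebra_simps sin_diff)
  also have "... >= s" unfolding s_def
  proof (rule sin_monotone_2pi_le)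
   show "- (pi / 2) <= pi * d" using d by (auto intro: order_trans[of _ 0])
   show "pi * d <= pi * (1 - x)" using x by auto
   have "pi * (1 - x) <= pi * (1 / 2)" using False by (intro mult_left_mono) auto
   then show "pi * (1 - x) <= pi / 2" by simp
  qed
  finally show ?thesis .
 qed
 have main: "\<bar>(\<Sum>h<M. sin (2 * pi * real (Suc h) * x) / (pi * real (Suc h))) - (1 / 2 - x)\<bar> <= (1 / s\<^sup>2 + 2 / s) / real M"
  if M: "M > 0" and x: "x \<in> {d..1 - d}" for M x
 proof -
  define a where "a = (%x. (\<Sum>h<M. sin (2 * pi * real (Suc h) * x) / (pi * real (Suc h))) - (1 / 2 - x))"
  define m where "m = (2 * real M + 1) * pi"
  have m: "m > 0" "m >= real M" using mult_mono[of 1 "2 * real M + 1" 1 pi] pi_gt3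
   by (auto simp: m_def intro: add_pos_nonneg order_trans[of _ "(2 * real M + 1) * 1"] mult_left_mono)
  \<comment> \<open>Adding the boundary term of the integration by parts leaves a derivative of
    order 1/m, so that the mean value inequality replaces the integral.\<close>
  define u where "u = (%x. a x + cos (m * x) / m / sin (pi * x))"
  have da: "(a has_field_derivative sin (m * y) / sin (pi * y)) (at y)" if y: "y \<in> {d..1 - d}" for y
  proof -
   have "(a has_field_derivative (\<Sum>h<M. cos (2 * pi * real (Suc h) * y) * (2 * pi * real (Suc h)) / (pi * real (Suc h))) - (0 - 1)) (at y)"
    unfolding a_def by (rule derivative_eq_intros sum.cong refl | simp)+
   also have "(\<Sum>h<M. cos (2 * pi * real (Suc h) * y) * (2 * pi * real (Suc h)) / (pi * real (Suc h))) = 2 * (\<Sum>h<M. cos (2 * pi * real (Suc h) * y))"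
    unfolding sum_distrib_left by (intro sum.cong) (auto simp: field_simps simp del: of_nat_Suc)
   also have "... - (0 - 1) = sin (m * y) / sin (pi * y)"
    using dirichlet_kernel[of y M] sge[OF y] s0 by (simp add: m_def field_simps)
   finally show ?thesis .
  qed
  have du: "(u has_field_derivative - (cos (m * y) * (pi * cos (pi * y)) / (m * (sin (pi * y))\<^sup>2))) (at y)" if y: "y \<in> {d..1 - d}" for y
  proof -
   have sn: "sin (pi * y) \<noteq> 0" using sge[OF y] s0 by simp
   have "(u has_field_derivative sin (m * y) / sin (pi * y) + ((- sin (m * y) * m / m) * sin (pi * y) - cos (m * y) / m * (cos (pi * y) * pi)) / (sin (pi * y) * sin (pi * y))) (at y)"
   proof -
    have d1: "((%y. cos (m * y) / m) has_field_derivative - sin (m * y) * m / m) (at y)"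
     using m by (auto intro!: derivative_eq_intros)
    have d2: "((%y. sin (pi * y)) has_field_derivative cos (pi * y) * pi) (at y)"
     by (auto intro!: derivative_eq_intros)
    show ?thesis unfolding u_def using DERIV_add[OF da[OF y] DERIV_divide[OF d1 d2 sn]] by simp
   qed
   also have "sin (m * y) / sin (pi * y) + ((- sin (m * y) * m / m) * sin (pi * y) - cos (m * y) / m * (cos (pi * y) * pi)) / (sin (pi * y) * sin (pi * y))
     = - (cos (m * y) * (pi * cos (pi * y)) / (m * (sin (pi * y))\<^sup>2))"
    using sn m by (simp add: field_simps power2_eq_square)
   finally show ?thesis .
  qed
  have "norm (u x - u (1 / 2)) <= 1 / (real M * s\<^sup>2) * norm (x - 1 / 2)"
  proof (rule field_differentiable_bound[where S = "{d..1 - d}"])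
   fix y assume y: "y \<in> {d..1 - d}"
   show "(u has_field_derivative - (cos (m * y) * (pi * cos (pi * y)) / (m * (sin (pi * y))\<^sup>2))) (at y within {d..1 - d})"
    by (rule has_field_derivative_at_within[OF du[OF y]])
   have "norm (- (cos (m * y) * (pi * cos (pi * y)) / (m * (sin (pi * y))\<^sup>2))) = \<bar>cos (m * y)\<bar> * (pi * \<bar>cos (pi * y)\<bar>) / (m * (sin (pi * y))\<^sup>2)"
    using m by (simp add: abs_mult)
   also have "... <= 1 * (pi * 1) / (pi * real M * s\<^sup>2)"
   proof (intro frac_le mult_mono power_mono)
    show "pi * real M <= m" by (simp add: m_def algebra_simps)
   qed (use sge[OF y] s0 M m(1) in auto)
   finally show "norm (- (cos (m * y) * (pi * cos (pi * y)) / (m * (sin (pi * y))\<^sup>2))) <= 1 / (real M * s\<^sup>2)" by simp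
  qed (use x d in auto)
  also have "... <= 1 / (real M * s\<^sup>2) * 1" using x d M s0 by (intro mult_left_mono) auto
  finally have ub: "\<bar>u x - u (1 / 2)\<bar> <= 1 / (real M * s\<^sup>2)" by simp
  have cb: "\<bar>cos (m * y) / m / sin (pi * y)\<bar> <= 1 / (real M * s)" if y: "y \<in> {d..1 - d}" for y
  proof -
   have "\<bar>cos (m * y) / m / sin (pi * y)\<bar> = \<bar>cos (m * y)\<bar> / (m * sin (pi * y))" using m sge[OF y] s0 by simp
   also have "... <= 1 / (real M * s)" using m sge[OF y] s0 M by (intro frac_le mult_mono) auto
   finally show ?thesis .
  qed
  have a12: "a (1 / 2) = 0"
  proof -
   have "sin (2 * pi * real (Suc h) * (1 / 2)) = 0" for h
    using sin_npi[of "Suc h"] by (simp add: mult.commute)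
   then show ?thesis by (simp add: a_def del: of_nat_Suc)
  qed
  have "\<bar>a x\<bar> <= \<bar>u x - u (1 / 2)\<bar> + \<bar>cos (m * x) / m / sin (pi * x)\<bar> + \<bar>cos (m * (1 / 2)) / m / sin (pi * (1 / 2))\<bar>"
   unfolding u_def using a12 by linarith
  also have "... <= 1 / (real M * s\<^sup>2) + 1 / (real M * s) + 1 / (real M * s)"
   using d by (intro add_mono ub cb x) auto
  also have "... = (1 / s\<^sup>2 + 2 / s) / real M" using M s0 by (simp add: field_simps)
  finally show ?thesis by (simp add: a_def)
 qed
 then show ?thesis by blast
qed

lemma bern2_series_summable: "summable (%h. 1 / (pi\<^sup>2 * (real (Suc h))\<^sup>2))"
 using summable_mult[OF sums_summable[OF inverse_squares_sums], of "1 / pi\<^sup>2"] by (simp add: add.commute)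

text \<open>The series converges uniformly, but its termwise derivative, the sawtooth series, only
  on compact subintervals of (0, 1). Hence the limit differs from the polynomial by a constant on
  the open interval. Continuity at 0 and the value of the series there, given by the sum of the
  inverse squares, show that the constant is zero.\<close>

lemma bern2_sums: "(%h. cos (2 * pi * real (Suc h) * x) / (pi\<^sup>2 * (real (Suc h))\<^sup>2)) sums bern2 x"
proof -
 define g where "g = (%x. \<Sum>h. cos (2 * pi * real (Suc h) * x) / (pi\<^sup>2 * (real (Suc h))\<^sup>2))"
 have bound: "norm (cos (2 * pi * real (Suc h) * x) / (pi\<^sup>2 * (real (Suc h))\<^sup>2)) <= 1 / (pi\<^sup>2 * (real (Suc h))\<^sup>2)" for h x
  by (simp add: divide_right_mono del: of_nat_Suc)
 have summ: "summable (%h. cos (2 * pi * real (Suc h) * x) / (pi\<^sup>2 * (real (Suc h))\<^sup>2))" for x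
  by (rule summable_comparison_test'[OF bern2_series_summable bound])
 have unif: "uniform_limit UNIV (%M x. \<Sum>h<M. cos (2 * pi * real (Suc h) * x) / (pi\<^sup>2 * (real (Suc h))\<^sup>2)) g sequentially"
  unfolding g_def by (rule Weierstrass_m_test[OF bound bern2_series_summable])
 have cont: "continuous_on UNIV g"
  by (rule uniform_limit_theorem[OF _ unif]) (auto intro!: always_eventually continuous_intros simp del: of_nat_Suc)
 define p where "p = (%x::real. x\<^sup>2 - x + 1 / 6)"
 have const: "g x - p x = g (1 / 2) - p (1 / 2)" if x: "0 < x" "x < 1" for x
 proof -
  define d where "d = min (x / 2) (min ((1 - x) / 2) (1 / 4))"
  have d12: "d <= x / 2" "d <= (1 - x) / 2"
   unfolding d_def by (rule min.cobounded1, rule min.coboundedI2, rule min.cobounded1)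
  have "0 < d" "d < 1 / 2" using x by (auto simp: d_def)
  moreover have "x \<in> {d..1 - d}" using x d12 by auto
  ultimately have d: "0 < d" "d < 1 / 2" "x \<in> {d..1 - d}" by auto
  obtain C where C: "\<And>M y. M > 0 ==> y \<in> {d..1 - d} ==> \<bar>(\<Sum>h<M. sin (2 * pi * real (Suc h) * y) / (pi * real (Suc h))) - (1 / 2 - y)\<bar> <= C / real M"
   using sawtooth_partial_sum_bound[OF d(1,2)] by blast
  define c where "c = (%M y. (\<Sum>h<M. cos (2 * pi * real (Suc h) * y) / (pi\<^sup>2 * (real (Suc h))\<^sup>2)) - p y)"
  have lim: "(%M. c M y) \<longlonglongrightarrow> g y - p y" for y
   unfolding c_def g_def by (intro tendsto_diff tendsto_const summable_LIMSEQ summ)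
  have le: "norm (c M x - c M (1 / 2)) <= 2 * (C / real M) * norm (x - 1 / 2)" if M: "M > 0" for M
  proof (rule field_differentiable_bound[where S = "{d..1 - d}"])
   fix y assume y: "y \<in> {d..1 - d}"
   have "(c M has_field_derivative (\<Sum>h<M. - sin (2 * pi * real (Suc h) * y) * (2 * pi * real (Suc h)) / (pi\<^sup>2 * (real (Suc h))\<^sup>2)) - (2 * y - 1)) (at y)"
    unfolding c_def p_def by (rule derivative_eq_intros sum.cong refl | simp)+
   also have "(\<Sum>h<M. - sin (2 * pi * real (Suc h) * y) * (2 * pi * real (Suc h)) / (pi\<^sup>2 * (real (Suc h))\<^sup>2)) = - 2 * (\<Sum>h<M. sin (2 * pi * real (Suc h) * y) / (pi * real (Suc h)))"
    unfolding sum_distrib_left by (intro sum.cong) (auto simp: field_simps power2_eq_square simp del: of_nat_Suc)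
   finally show "(c M has_field_derivative - 2 * (\<Sum>h<M. sin (2 * pi * real (Suc h) * y) / (pi * real (Suc h))) - (2 * y - 1)) (at y within {d..1 - d})"
    by (rule has_field_derivative_at_within)
   show "norm (- 2 * (\<Sum>h<M. sin (2 * pi * real (Suc h) * y) / (pi * real (Suc h))) - (2 * y - 1)) <= 2 * (C / real M)"
    using C[OF M y] by (simp add: abs_le_iff)
  qed (use d in auto)
  have "(%M. c M x - c M (1 / 2)) \<longlonglongrightarrow> 0"
  proof (rule Lim_null_comparison)
   show "\<forall>\<^sub>F M in sequentially. norm (c M x - c M (1 / 2)) <= 2 * (C / real M) * norm (x - 1 / 2)"
    using eventually_gt_at_top[of 0] by eventually_elim (rule le)
   show "(%M. 2 * (C / real M) * norm (x - 1 / 2)) \<longlonglongrightarrow> 0" by real_asymp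
  qed
  moreover have "(%M. c M x - c M (1 / 2)) \<longlonglongrightarrow> (g x - p x) - (g (1 / 2) - p (1 / 2))" by (intro tendsto_diff lim)
  ultimately show ?thesis using LIMSEQ_unique by fastforce
 qed
 have g0: "g 0 = 1 / 6"
 proof -
  have inv: "(%h. 1 / (real (Suc h))\<^sup>2) sums (pi\<^sup>2 / 6)"
   using inverse_squares_sums by (simp add: add.commute)
  have "(%h. cos (2 * pi * real (Suc h) * 0) / (pi\<^sup>2 * (real (Suc h))\<^sup>2)) sums (1 / 6)"
   using sums_mult[OF inv, of "1 / pi\<^sup>2"] by (simp del: of_nat_Suc)
  then show ?thesis unfolding g_def by (rule sums_unique[symmetric])
 qed
 have "((%x. g x - p x) \<longlongrightarrow> g 0 - p 0) (at_right 0)"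
 proof -
  have "isCont (%x. g x - p x) 0"
   using cont by (auto simp: p_def continuous_on_eq_continuous_at intro!: continuous_intros)
  then show ?thesis unfolding isCont_def by (rule filterlim_mono[OF _ order_refl at_le]) simp
 qed
 moreover have "((%x. g x - p x) \<longlongrightarrow> g (1 / 2) - p (1 / 2)) (at_right 0)"
 proof (rule tendsto_eventually)
  show "\<forall>\<^sub>F x in at_right 0. g x - p x = g (1 / 2) - p (1 / 2)"
   by (rule eventually_mono[OF eventually_at_right_real[OF zero_less_one]]) (rule const, auto)
 qed
 ultimately have "g 0 - p 0 = g (1 / 2) - p (1 / 2)"
  by (rule tendsto_unique[OF trivial_limit_at_right_real])
 then have eq0: "g (1 / 2) - p (1 / 2) = 0" by (simp add: g0 p_def)
 have per: "g (x - of_int n) = g x" for x n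
 proof -
  have "cos (2 * pi * real (Suc h) * (x - of_int n)) = cos (2 * pi * real (Suc h) * x)" for h
  proof -
   have "2 * pi * real (Suc h) * (x - of_int n) = 2 * pi * real (Suc h) * x - 2 * pi * of_int (int (Suc h) * n)"
    by (simp add: algebra_simps)
   then show ?thesis by (simp only: cos_diff cos_int_2pin sin_int_2pin)
  qed
  then show ?thesis by (simp only: g_def)
 qed
 have "g x = bern2 x"
 proof -
  have f: "0 <= frac x" "frac x < 1" using frac_lt_1 by auto
  have "g x = g (frac x)" using per[of x "\<lfloor>x\<rfloor>"] by (simp add: frac_def)
  also have "... = p (frac x)"
  proof -
   define z where "z = frac x"
   have "0 <= z" "z < 1" using f by (auto simp: z_def)
   then show ?thesis unfolding z_def[symmetric] using const[of z] eq0 g0 by (cases "z = 0") (auto simp: p_def)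
  qed
  finally show ?thesis by (simp add: p_def bern2_def)
 qed
 moreover have "(%h. cos (2 * pi * real (Suc h) * x) / (pi\<^sup>2 * (real (Suc h))\<^sup>2)) sums g x"
  using summ summable_sums by (auto simp: g_def)
 ultimately show ?thesis by simp
qed

lemma bern2_approx:
 assumes M: "M > 0"
 shows "\<bar>bern2 x - (\<Sum>h<M. cos (2 * pi * real (Suc h) * x) / (pi\<^sup>2 * (real (Suc h))\<^sup>2))\<bar> <= 1 / (pi\<^sup>2 * real M)"
proof -
 define f where "f = (%h. cos (2 * pi * real (Suc h) * x) / (pi\<^sup>2 * (real (Suc h))\<^sup>2))"
 define t where "t = (%h. 1 / pi\<^sup>2 * (1 / real (h + M) - 1 / real (Suc h + M)))"
 have "(%h. 1 / real (h + M)) \<longlonglongrightarrow> 0" by real_asymp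
 from telescope_sums'[OF this] have "(%h. 1 / real (h + M) - 1 / real (Suc h + M)) sums (1 / real M)" by simp
 then have t: "t sums (1 / pi\<^sup>2 * (1 / real M))" unfolding t_def by (rule sums_mult)
 have le: "norm (f (h + M)) <= t h" for h
 proof -
  have hM: "real (h + M) > 0" using M by simp
  have "norm (f (h + M)) <= 1 / (pi\<^sup>2 * (real (Suc (h + M)))\<^sup>2)"
   by (simp add: f_def divide_right_mono del: of_nat_Suc)
  also have "... = 1 / pi\<^sup>2 * (1 / (real (Suc (h + M)))\<^sup>2)" by simp
  also have "... <= 1 / pi\<^sup>2 * (1 / (real (h + M) * real (Suc (h + M))))"
   using hM by (intro mult_left_mono divide_left_mono) (auto simp: power2_eq_square intro!: mult_right_mono mult_pos_pos)
  also have "1 / (real (h + M) * real (Suc (h + M))) = 1 / real (h + M) - 1 / real (Suc h + M)"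
   using hM by (simp add: divide_simps)
  finally show ?thesis by (simp add: t_def)
 qed
 have sf: "f sums bern2 x" unfolding f_def by (rule bern2_sums)
 have "(%h. f (h + M)) sums (bern2 x - (\<Sum>h<M. f h))" using sums_split_initial_segment[OF sf, of M] by simp
 then have "bern2 x - (\<Sum>h<M. f h) = (\<Sum>h. f (h + M))" by (rule sums_unique)
 also have "norm ... <= (\<Sum>h. t h)"
  by (rule norm_suminf_le[OF le]) (use t sums_summable in blast)
 also have "... = 1 / (pi\<^sup>2 * real M)" using sums_unique[OF t] by simp
 finally show ?thesis by (simp add: f_def)
qed

subsection \<open>Sums of the sawtooth function\<close>

definition saw :: "real => real" where
 "saw x = of_int \<lfloor>x\<rfloor> - x + 1 / 2"

text \<open>The sawtooth is at most its mean over \<open>[x, x + \<eta>]\<close> plus \<open>\<eta>/2\<close>, because \<open>\<lfloor>x\<rfloor>\<close> is monotone;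
 the mean is a difference of values of \<open>bern2\<close>.\<close>

lemma saw_upper:
 assumes "0 < \<eta>" "\<eta> <= 1"
 shows "2 * \<eta> * saw x <= bern2 x - bern2 (x + \<eta>) + \<eta>\<^sup>2"
proof -
 define t where "t = frac x"
 have t: "0 <= t" "t < 1" by (auto simp: t_def frac_lt_1)
 have s: "saw x = 1 / 2 - t" by (simp add: saw_def t_def frac_def)
 have bx: "bern2 x = t\<^sup>2 - t + 1 / 6" by (simp add: bern2_def t_def)
 have "x + \<eta> = (t + \<eta>) + of_int \<lfloor>x\<rfloor>" by (simp add: t_def frac_def)
 then have b1: "bern2 (x + \<eta>) = bern2 (t + \<eta>)" by (simp only: bern2_periodic)
 show ?thesis
 proof (cases "t + \<eta> < 1")
  case True
  then have "bern2 (t + \<eta>) = (t + \<eta>)\<^sup>2 - (t + \<eta>) + 1 / 6" using t assms by (intro bern2_on_unit) auto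
  then show ?thesis unfolding s bx b1 by (simp add: power2_eq_square algebra_simps)
 next
  case False
  have "bern2 (t + \<eta>) = bern2 ((t + \<eta> - 1) + of_int 1)" by simp
  also have "... = bern2 (t + \<eta> - 1)" by (rule bern2_periodic)
  also have "... = (t + \<eta> - 1)\<^sup>2 - (t + \<eta> - 1) + 1 / 6" using t assms False by (intro bern2_on_unit) auto
  finally show ?thesis using False unfolding s bx b1 by (simp add: power2_eq_square algebra_simps)
 qed
qed

lemma saw_lower:
 assumes "0 < \<eta>" "\<eta> <= 1"
 shows "2 * \<eta> * saw x >= bern2 (x - \<eta>) - bern2 x - \<eta>\<^sup>2"
proof -
 define t where "t = frac x"
 have t: "0 <= t" "t < 1" by (auto simp: t_def frac_lt_1)
 have s: "saw x = 1 / 2 - t" by (simp add: saw_def t_def frac_def)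
 have bx: "bern2 x = t\<^sup>2 - t + 1 / 6" by (simp add: bern2_def t_def)
 have "x - \<eta> = (t - \<eta>) + of_int \<lfloor>x\<rfloor>" by (simp add: t_def frac_def)
 then have b1: "bern2 (x - \<eta>) = bern2 (t - \<eta>)" by (simp only: bern2_periodic)
 show ?thesis
 proof (cases "t - \<eta> >= 0")
  case True
  then have "bern2 (t - \<eta>) = (t - \<eta>)\<^sup>2 - (t - \<eta>) + 1 / 6" using t assms by (intro bern2_on_unit) auto
  then show ?thesis unfolding s bx b1 by (simp add: power2_eq_square algebra_simps)
 next
  case False
  have "bern2 (t - \<eta>) = bern2 ((t - \<eta> + 1) + of_int (-1))" by simp
  also have "... = bern2 (t - \<eta> + 1)" by (rule bern2_periodic)
  also have "... = (t - \<eta> + 1)\<^sup>2 - (t - \<eta> + 1) + 1 / 6" using t assms False by (intro bern2_on_unit) auto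
  finally show ?thesis using False unfolding s bx b1 by (simp add: power2_eq_square algebra_simps)
 qed
qed

lemma norm_one_minus_ee: "norm (1 - ee t) <= 2 * pi * \<bar>t\<bar>"
proof (rule power2_le_imp_le)
 have "(norm (1 - ee t))\<^sup>2 = (1 - cos (2 * pi * t))\<^sup>2 + (sin (2 * pi * t))\<^sup>2"
  by (simp add: ee_def cmod_power2)
 also have "... = 2 - 2 * cos (2 * (pi * t))"
  using sin_cos_squared_add[of "2 * pi * t"] by (simp add: power2_diff algebra_simps)
 also have "... = 4 * (sin (pi * t))\<^sup>2" by (simp add: cos_double_sin)
 also have "... <= 4 * (\<bar>pi * t\<bar>)\<^sup>2"
  using power_mono[OF abs_sin_x_le_abs_x[of "pi * t"], of 2] by simp
 finally show "(norm (1 - ee t))\<^sup>2 <= (2 * pi * \<bar>t\<bar>)\<^sup>2" by (simp add: power_mult_distrib)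
qed auto

text \<open>The sawtooth is squeezed between difference quotients of \<open>bern2\<close> of width
  \<eta> = 1/H. In these the factor |e(k\<sigma>) - e(k\<tau>)| <= 2\<pi>k\<eta> turns the
  coefficients 1/k^2 into 1/k. The truncation error of order 1/M is divided by \<eta> and must
  remain of order 1/H, hence the condition M >= H^2.\<close>

lemma saw_sum_bound:
 fixes x :: "'i => real"
 assumes I: "finite I" and H: "H >= 1" and M: "real M >= H\<^sup>2"
 shows "\<bar>\<Sum>i\<in>I. saw (x i)\<bar> <= real (card I) / H + (\<Sum>h=1..M. norm (\<Sum>i\<in>I. ee (real h * x i)) / real h)"
proof -
 define \<eta> where "\<eta> = 1 / H"
 have \<eta>: "0 < \<eta>" "\<eta> <= 1" using H by (auto simp: \<eta>_def)
 have M0: "M > 0" using M one_le_power[OF H, of 2] by (cases M) auto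
 define U where "U = (%h. norm (\<Sum>i\<in>I. ee (real h * x i)))"
 define W where "W = (\<Sum>h=1..M. U h / real h)"
 have W0: "W >= 0" unfolding W_def U_def by (intro sum_nonneg) auto
 have key: "\<bar>\<Sum>i\<in>I. bern2 (x i + \<sigma>) - bern2 (x i + \<tau>)\<bar> <= 2 * \<eta> * W + real (card I) * (2 / (pi\<^sup>2 * real M))"
  if st: "\<bar>\<sigma> - \<tau>\<bar> = \<eta>" for \<sigma> \<tau>
 proof -
  define T where "T = (%y. \<Sum>h<M. cos (2 * pi * real (Suc h) * y) / (pi\<^sup>2 * (real (Suc h))\<^sup>2))"
  have "\<bar>\<Sum>i\<in>I. (bern2 (x i + \<sigma>) - bern2 (x i + \<tau>)) - (T (x i + \<sigma>) - T (x i + \<tau>))\<bar> <= (\<Sum>i\<in>I. 2 / (pi\<^sup>2 * real M))"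
  proof (rule order_trans[OF sum_abs sum_mono])
   fix i
   have tb: "\<bar>bern2 y - T y\<bar> <= 1 / (pi\<^sup>2 * real M)" for y unfolding T_def by (rule bern2_approx[OF M0])
   have e: "2 / (pi\<^sup>2 * real M) = 2 * (1 / (pi\<^sup>2 * real M))" by simp
   show "\<bar>(bern2 (x i + \<sigma>) - bern2 (x i + \<tau>)) - (T (x i + \<sigma>) - T (x i + \<tau>))\<bar> <= 2 / (pi\<^sup>2 * real M)"
    using tb[of "x i + \<sigma>"] tb[of "x i + \<tau>"] unfolding e by linarith
  qed
  then have 1: "\<bar>(\<Sum>i\<in>I. bern2 (x i + \<sigma>) - bern2 (x i + \<tau>)) - (\<Sum>i\<in>I. T (x i + \<sigma>) - T (x i + \<tau>))\<bar> <= real (card I) * (2 / (pi\<^sup>2 * real M))"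
   by (simp add: sum_subtractf)
  have "(\<Sum>i\<in>I. T (x i + \<sigma>) - T (x i + \<tau>)) = (\<Sum>h<M. (\<Sum>i\<in>I. cos (2 * pi * real (Suc h) * (x i + \<sigma>)) - cos (2 * pi * real (Suc h) * (x i + \<tau>))) / (pi\<^sup>2 * (real (Suc h))\<^sup>2))"
   unfolding T_def sum_subtractf[symmetric] sum_divide_distrib by (subst sum.swap) (simp add: diff_divide_distrib del: of_nat_Suc)
  also have "\<bar>...\<bar> <= (\<Sum>h<M. 2 * \<eta> * (U (Suc h) / real (Suc h)))"
  proof (rule order_trans[OF sum_abs sum_mono])
   fix h
   define k where "k = real (Suc h)"
   have k: "k > 0" by (simp add: k_def)
   have "(\<Sum>i\<in>I. cos (2 * pi * k * (x i + \<sigma>)) - cos (2 * pi * k * (x i + \<tau>))) = Re ((ee (k * \<sigma>) - ee (k * \<tau>)) * (\<Sum>i\<in>I. ee (k * x i)))"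
   proof -
    have "cos (2 * pi * k * (x i + \<sigma>)) - cos (2 * pi * k * (x i + \<tau>)) = Re ((ee (k * \<sigma>) - ee (k * \<tau>)) * ee (k * x i))" for i
     unfolding left_diff_distrib ee_add[symmetric] by (simp add: ee_def algebra_simps)
    then show ?thesis by (simp add: sum_distrib_left)
   qed
   also have "\<bar>...\<bar> <= norm ((ee (k * \<sigma>) - ee (k * \<tau>)) * (\<Sum>i\<in>I. ee (k * x i)))" by (rule abs_Re_le_cmod)
   also have "... <= (2 * pi * k * \<eta>) * U (Suc h)"
   proof -
    have "ee (k * \<sigma>) - ee (k * \<tau>) = ee (k * \<sigma>) * (1 - ee (k * (\<tau> - \<sigma>)))"
     by (simp add: algebra_simps ee_add[symmetric])
    then have "norm (ee (k * \<sigma>) - ee (k * \<tau>)) = norm (1 - ee (k * (\<tau> - \<sigma>)))" by (simp add: norm_mult)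
    also have "... <= 2 * pi * \<bar>k * (\<tau> - \<sigma>)\<bar>" by (rule norm_one_minus_ee)
    also have "... = 2 * pi * k * \<eta>" using k st by (simp add: abs_mult abs_minus_commute)
    finally show ?thesis by (simp add: norm_mult U_def k_def mult_right_mono del: of_nat_Suc)
   qed
   finally have "\<bar>(\<Sum>i\<in>I. cos (2 * pi * k * (x i + \<sigma>)) - cos (2 * pi * k * (x i + \<tau>))) / (pi\<^sup>2 * k\<^sup>2)\<bar> <= (2 * pi * k * \<eta>) * U (Suc h) / (pi\<^sup>2 * k\<^sup>2)"
    by (simp add: divide_right_mono)
   also have "... = 2 * \<eta> * (U (Suc h) / k) / pi" using k by (simp add: power2_eq_square mult_ac)
   also have "... <= 2 * \<eta> * (U (Suc h) / k) / 1"
    using \<eta> k pi_gt3 by (intro divide_left_mono mult_nonneg_nonneg divide_nonneg_nonneg) (auto simp: U_def)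
   finally show "\<bar>(\<Sum>i\<in>I. cos (2 * pi * real (Suc h) * (x i + \<sigma>)) - cos (2 * pi * real (Suc h) * (x i + \<tau>))) / (pi\<^sup>2 * (real (Suc h))\<^sup>2)\<bar> <= 2 * \<eta> * (U (Suc h) / real (Suc h))"
    by (simp add: k_def)
  qed
  also have "... = 2 * \<eta> * W"
   unfolding W_def sum_distrib_left by (rule sum.reindex_bij_witness[of _ "%h. h - 1" Suc]) auto
  finally have "\<bar>\<Sum>i\<in>I. T (x i + \<sigma>) - T (x i + \<tau>)\<bar> <= 2 * \<eta> * W" .
  then show ?thesis using 1 by linarith
 qed
 have fin: "2 * \<eta> * W + real (card I) * (2 / (pi\<^sup>2 * real M)) + real (card I) * \<eta>\<^sup>2 <= 2 * \<eta> * (W + real (card I) / H)"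
 proof -
  have pi2: "pi\<^sup>2 >= 2" using pi_gt3 power_mono[of 3 pi 2] by simp
  have "2 / (pi\<^sup>2 * real M) <= 2 / (2 * H\<^sup>2)" using M H pi2 M0 by (intro divide_left_mono mult_mono mult_pos_pos) auto
  also have "... = \<eta>\<^sup>2" by (simp add: \<eta>_def power_divide)
  finally have "real (card I) * (2 / (pi\<^sup>2 * real M)) <= real (card I) * \<eta>\<^sup>2" by (intro mult_left_mono) auto
  moreover have "2 * \<eta> * (W + real (card I) / H) = 2 * \<eta> * W + 2 * (real (card I) * \<eta>\<^sup>2)"
   by (simp add: \<eta>_def power2_eq_square distrib_left)
  ultimately show ?thesis by linarith
 qed
 have up1: "2 * \<eta> * saw (x i) <= bern2 (x i + 0) - bern2 (x i + \<eta>) + \<eta>\<^sup>2" for i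
  using saw_upper[OF \<eta>, of "x i"] by simp
 have lo1: "bern2 (x i + (- \<eta>)) - bern2 (x i + 0) - \<eta>\<^sup>2 <= 2 * \<eta> * saw (x i)" for i
  using saw_lower[OF \<eta>, of "x i"] by simp
 have "2 * \<eta> * (\<Sum>i\<in>I. saw (x i)) <= (\<Sum>i\<in>I. bern2 (x i + 0) - bern2 (x i + \<eta>) + \<eta>\<^sup>2)"
  unfolding sum_distrib_left by (intro sum_mono up1)
 also have "... = (\<Sum>i\<in>I. bern2 (x i + 0) - bern2 (x i + \<eta>)) + real (card I) * \<eta>\<^sup>2" by (simp add: sum.distrib)
 also have "... <= 2 * \<eta> * (W + real (card I) / H)" using key[of 0 \<eta>] \<eta> fin by (simp add: abs_le_iff)
 finally have up: "(\<Sum>i\<in>I. saw (x i)) <= W + real (card I) / H" using \<eta> by simp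
 have "2 * \<eta> * (W + real (card I) / H) >= - ((\<Sum>i\<in>I. bern2 (x i + (- \<eta>)) - bern2 (x i + 0)) - real (card I) * \<eta>\<^sup>2)"
  using key[of "- \<eta>" 0] \<eta> fin by (simp add: abs_le_iff)
 also have "(\<Sum>i\<in>I. bern2 (x i + (- \<eta>)) - bern2 (x i + 0)) - real (card I) * \<eta>\<^sup>2 = (\<Sum>i\<in>I. bern2 (x i + (- \<eta>)) - bern2 (x i + 0) - \<eta>\<^sup>2)"
  by (simp add: sum_subtractf)
 also have "- (\<Sum>i\<in>I. bern2 (x i + (- \<eta>)) - bern2 (x i + 0) - \<eta>\<^sup>2) >= - (2 * \<eta> * (\<Sum>i\<in>I. saw (x i)))"
  unfolding sum_distrib_left by (intro le_imp_neg_le sum_mono lo1)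
 finally have "2 * \<eta> * (W + real (card I) / H) >= 2 * \<eta> * (- (\<Sum>i\<in>I. saw (x i)))" by simp
 then have "W + real (card I) / H >= - (\<Sum>i\<in>I. saw (x i))" using \<eta> by (subst (asm) mult_le_cancel_left_pos) auto
 then show ?thesis using up by (simp add: W_def U_def abs_le_iff)
qed

subsection \<open>The Kuzmin--Landau inequality and the second derivative test\<close>

lemma sin_pi_ge:
 assumes "\<theta> <= x" "x <= 1 - \<theta>" "0 <= \<theta>"
 shows "sin (pi * x) >= \<theta>"
proof -
 have half: "sin (pi * y) >= y" if y: "0 <= y" "y <= 1 / 2" for y
 proof -
  define z where "z = pi * y"
  have z: "0 <= z" "z <= 2" using y mult_mono[OF less_imp_le[OF pi_less_4], of y "1 / 2"] by (auto simp: z_def)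
  have "\<bar>sin z - (\<Sum>m<3. sin_coeff m * z ^ m)\<bar> <= inverse (fact 3) * \<bar>z\<bar> ^ 3" by (rule Maclaurin_sin_bound)
  moreover have "(\<Sum>m<3. sin_coeff m * z ^ m) = z" by (simp add: sin_coeff_def numeral_3_eq_3)
  moreover have "fact 3 = (6::real)" by (simp add: fact_numeral)
  ultimately have "\<bar>sin z - z\<bar> <= z ^ 3 / 6" using z by simp
  then have "sin z >= z - z ^ 3 / 6" by linarith
  moreover have "z ^ 3 <= 4 * z" using z mult_mono[of z 2 z 2] mult_right_mono[of "z * z" 4 z] by (simp add: power3_eq_cube)
  ultimately have "sin z >= z / 3" by simp
  moreover have "z / 3 >= y" using y pi_gt3 mult_right_mono[of 3 pi y] by (simp add: z_def)
  ultimately show ?thesis by (simp add: z_def)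
 qed
 show ?thesis
 proof (cases "x <= 1 / 2")
  case True
  then show ?thesis using half[of x] assms by simp
 next
  case False
  have "sin (pi * x) = sin (pi * (1 - x))" by (simp add: algebra_simps sin_diff)
  then show ?thesis using half[of "1 - x"] assms False by simp
 qed
qed

text \<open>Each term equals c_n (E_n - E_(n+1)) with c_n = 1 / (1 - e(\<delta>_n)) = 1/2 + (i/2)
  cot(\<pi> \<delta>_n). Since \<delta> is increasing inside (0, 1), the cotangents decrease and the
  sum left by partial summation telescopes.\<close>

lemma kuzmin_landau_nat:
 fixes F :: "nat => real"
 assumes mono: "\<And>n m. n <= m ==> m < N ==> F (Suc n) - F n <= F (Suc m) - F m"
  and range: "\<And>n. n < N ==> \<theta> <= F (Suc n) - F n & F (Suc n) - F n <= 1 - \<theta>"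
  and \<theta>: "0 < \<theta>"
 shows "norm (\<Sum>n<N. ee (F n)) <= 2 / \<theta>"
proof (cases "N = 0")
 case False
 define \<delta> where "\<delta> = (%n. F (Suc n) - F n)"
 define ct where "ct = (%n. cos (pi * \<delta> n) / sin (pi * \<delta> n))"
 define c where "c = (%n. Complex (1 / 2) (ct n / 2))"
 define E where "E = (%n. ee (F n))"
 have sn: "sin (pi * \<delta> n) >= \<theta>" if "n < N" for n
  using range[OF that] \<theta> by (intro sin_pi_ge) (auto simp: \<delta>_def)
 have cE: "E n = c n * (E n - E (Suc n))" if n: "n < N" for n
 proof -
  have s0: "sin (pi * \<delta> n) > 0" using sn[OF n] \<theta> by linarith
  have "c n * (1 - ee (\<delta> n)) = 1"
  proof -
   define \<alpha> where "\<alpha> = pi * \<delta> n"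
   have ee: "ee (\<delta> n) = Complex (1 - 2 * (sin \<alpha>)\<^sup>2) (2 * sin \<alpha> * cos \<alpha>)"
    using cos_double_sin[of \<alpha>] sin_double[of \<alpha>] by (simp add: ee_def \<alpha>_def complex_eq_iff mult.assoc)
   have "sin \<alpha> * sin \<alpha> + cos \<alpha> * cos \<alpha> = 1" using sin_cos_squared_add[of \<alpha>] by (simp add: power2_eq_square)
   then show ?thesis unfolding ee c_def ct_def \<alpha>_def[symmetric] using s0[folded \<alpha>_def]
    by (simp add: complex_eq_iff power2_eq_square)
  qed
  moreover have "E (Suc n) = E n * ee (\<delta> n)" by (simp add: E_def ee_add[symmetric] \<delta>_def)
  ultimately have e: "c n * (1 - ee (\<delta> n)) = 1" "E (Suc n) = E n * ee (\<delta> n)" by simp_all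
  have "c n * (E n - E (Suc n)) = E n * (c n * (1 - ee (\<delta> n)))"
   unfolding e(2) by (simp add: algebra_simps)
  then show ?thesis using e(1) by simp
 qed
 have parts: "(\<Sum>n<Suc K. c n * (E n - E (Suc n))) = c 0 * E 0 - c K * E (Suc K) + (\<Sum>n<K. E (Suc n) * (c (Suc n) - c n))" for K
  by (induction K) (simp_all add: algebra_simps)
 obtain K where K: "N = Suc K" using False by (cases N) auto
 have ctb: "\<bar>ct n\<bar> <= 1 / \<theta>" if "n < N" for n
 proof -
  have "\<bar>ct n\<bar> = \<bar>cos (pi * \<delta> n)\<bar> / sin (pi * \<delta> n)" using sn[OF that] \<theta> by (simp add: ct_def)
  also have "... <= 1 / \<theta>" using sn[OF that] \<theta> by (intro frac_le) auto
  finally show ?thesis .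
 qed
 have cb: "norm (c n) <= 1 / (2 * \<theta>)" if n: "n < N" for n
 proof -
  have s0: "sin (pi * \<delta> n) > 0" using sn[OF n] \<theta> by linarith
  have "norm (c n) = sqrt (1 / 4 + (ct n)\<^sup>2 / 4)" by (simp add: c_def complex_norm power_divide)
  also have "1 / 4 + (ct n)\<^sup>2 / 4 = (1 / (2 * sin (pi * \<delta> n)))\<^sup>2"
  proof -
   have "1 + (ct n)\<^sup>2 = ((sin (pi * \<delta> n))\<^sup>2 + (cos (pi * \<delta> n))\<^sup>2) / (sin (pi * \<delta> n))\<^sup>2"
    using s0 by (simp only: ct_def power_divide add_divide_distrib) simp
   then show ?thesis by (simp add: power_divide power_mult_distrib field_simps)
  qed
  also have "sqrt ... = 1 / (2 * sin (pi * \<delta> n))" using s0 by simp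
  also have "... <= 1 / (2 * \<theta>)" using sn[OF n] \<theta> by (intro frac_le) auto
  finally show ?thesis .
 qed
 have dec: "ct (Suc n) <= ct n" if n: "n < K" for n
 proof -
  have s: "sin (pi * \<delta> n) > 0" "sin (pi * \<delta> (Suc n)) > 0" using sn[of n] sn[of "Suc n"] \<theta> n K by auto
  have d: "\<delta> n <= \<delta> (Suc n)" using mono[of n "Suc n"] n K by (simp add: \<delta>_def)
  have "\<delta> (Suc n) - \<delta> n <= 1" using range[of n] range[of "Suc n"] \<theta> n K by (simp add: \<delta>_def)
  then have "sin (pi * \<delta> (Suc n) - pi * \<delta> n) >= 0"
   using d mult_left_mono[of "\<delta> (Suc n) - \<delta> n" 1 pi] by (intro sin_ge_zero) (auto simp: algebra_simps)
  then have "cos (pi * \<delta> n) * sin (pi * \<delta> (Suc n)) - cos (pi * \<delta> (Suc n)) * sin (pi * \<delta> n) >= 0"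
   by (simp add: sin_diff algebra_simps)
  then show ?thesis using s by (simp add: ct_def divide_simps mult.commute)
 qed
 have "(\<Sum>n<N. ee (F n)) = (\<Sum>n<Suc K. c n * (E n - E (Suc n)))"
  unfolding K by (intro sum.cong refl) (use cE K in \<open>auto simp: E_def\<close>)
 also have "... = c 0 * E 0 - c K * E (Suc K) + (\<Sum>n<K. E (Suc n) * (c (Suc n) - c n))" by (rule parts)
 also have "norm ... <= norm (c 0) + norm (c K) + (\<Sum>n<K. norm (E (Suc n) * (c (Suc n) - c n)))"
 proof -
  have "norm (c 0 * E 0 - c K * E (Suc K)) <= norm (c 0) + norm (c K)"
   by (rule order_trans[OF norm_triangle_ineq4]) (simp add: E_def norm_mult)
  then show ?thesis by (intro norm_triangle_le add_mono norm_sum)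
 qed
 also have "(\<Sum>n<K. norm (E (Suc n) * (c (Suc n) - c n))) = (\<Sum>n<K. (ct n - ct (Suc n)) / 2)"
 proof (rule sum.cong[OF refl])
  fix n assume "n \<in> {..<K}"
  then have "ct (Suc n) <= ct n" using dec by simp
  then show "norm (E (Suc n) * (c (Suc n) - c n)) = (ct n - ct (Suc n)) / 2"
  proof -
   assume le: "ct (Suc n) <= ct n"
   have "c (Suc n) - c n = Complex 0 ((ct (Suc n) - ct n) / 2)"
    by (simp add: c_def complex_eq_iff diff_divide_distrib)
   then show ?thesis using le by (simp add: norm_mult E_def complex_norm)
  qed
 qed
 also have "... = (ct 0 - ct K) / 2"
  by (simp add: sum_divide_distrib[symmetric] sum_lessThan_telescope')
 also have "... <= 1 / \<theta>" using ctb[of 0] ctb[of K] K by (simp add: abs_le_iff)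
 finally show ?thesis using cb[of 0] cb[of K] K \<theta> by (simp add: field_simps)
qed (use \<theta> in simp)

lemma kuzmin_landau:
 fixes F :: "int => real"
 assumes mono: "\<And>n m. u <= n ==> n <= m ==> m < v ==> F (n + 1) - F n <= F (m + 1) - F m"
  and range: "\<And>n. u <= n ==> n < v ==> of_int j + \<theta> <= F (n + 1) - F n & F (n + 1) - F n <= of_int j + 1 - \<theta>"
  and \<theta>: "0 < \<theta>"
 shows "norm (\<Sum>n\<in>{u..<v}. ee (F n)) <= 2 / \<theta>"
proof -
 define N where "N = nat (v - u)"
 have "(\<Sum>n\<in>{u..<v}. ee (F n)) = (\<Sum>n<N. ee (F (u + int n)))"
  by (rule sum.reindex_bij_witness[of _ "%n. u + int n" "%n. nat (n - u)"]) (auto simp: N_def)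
 also have "... = (\<Sum>n<N. ee (F (u + int n) - of_int (j * int n)))"
 proof (rule sum.cong[OF refl])
  fix n
  have "ee (F (u + int n)) = ee ((F (u + int n) - of_int (j * int n)) + of_int (j * int n))" by simp
  also have "... = ee (F (u + int n) - of_int (j * int n))" by (simp only: ee_add ee_of_int) simp
  finally show "ee (F (u + int n)) = ee (F (u + int n) - of_int (j * int n))" .
 qed
 also have "norm ... <= 2 / \<theta>"
 proof (rule kuzmin_landau_nat[OF _ _ \<theta>])
  fix n m assume "n <= m" "m < N"
  then show "F (u + int (Suc n)) - of_int (j * int (Suc n)) - (F (u + int n) - of_int (j * int n))
    <= F (u + int (Suc m)) - of_int (j * int (Suc m)) - (F (u + int m) - of_int (j * int m))"
   using mono[of "u + int n" "u + int m"] by (simp add: N_def algebra_simps)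
 next
  fix n assume "n < N"
  then show "\<theta> <= F (u + int (Suc n)) - of_int (j * int (Suc n)) - (F (u + int n) - of_int (j * int n)) \<and>
     F (u + int (Suc n)) - of_int (j * int (Suc n)) - (F (u + int n) - of_int (j * int n)) <= 1 - \<theta>"
   using range[of "u + int n"] by (simp add: N_def algebra_simps)
 qed
 finally show ?thesis .
qed

lemma convex_int_set:
 fixes S :: "int set"
 assumes "finite S" "\<And>x y z. x \<in> S ==> y \<in> S ==> x <= z ==> z <= y ==> z \<in> S"
 obtains u v where "S = {u..<v}"
proof (cases "S = {}")
 case True
 then show ?thesis using that[of 0 0] by simp
next
 case False
 have "S = {Min S..<Max S + 1}"
 proof
  show "S \<subseteq> {Min S..<Max S + 1}" using assms(1) by (auto simp: less_add_one)
  show "{Min S..<Max S + 1} \<subseteq> S" using assms(2)[OF Min_in[OF assms(1) False] Max_in[OF assms(1) False]] by auto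
 qed
 then show ?thesis using that by blast
qed

lemma card_separated:
 fixes \<delta> :: "int => real"
 assumes fin: "finite S" and sep: "\<And>n m. n \<in> S ==> m \<in> S ==> n <= m ==> \<mu> * of_int (m - n) <= w" and "\<mu> > 0" "w >= 0"
 shows "real (card S) <= w / \<mu> + 1"
proof (cases "S = {}")
 case False
 define a where "a = Min S"
 define b where "b = Max S"
 have ab: "a \<in> S" "b \<in> S" "a <= b" using fin False by (auto simp: a_def b_def)
 have "S \<subseteq> {a..b}" using fin by (auto simp: a_def b_def)
 then have "card S <= card {a..b}" by (intro card_mono) auto
 then have "real (card S) <= of_int (b - a) + 1" using ab by simp
 also have "of_int (b - a) <= w / \<mu>" using sep[OF ab] assms by (simp add: field_simps)
 finally show ?thesis by simp
qed (use assms in simp)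

text \<open>The differences \<delta> grow by at least \<mu> at each step and by at most 1 in all, so
  their integer parts take at most two values. For each value, the n with \<delta> within \<theta>
  of an integer are few and are estimated trivially, and Kuzmin-Landau bounds the rest by 2 /
  \<theta>. The choice of \<theta> as half the root of \<mu> balances both.\<close>

lemma second_derivative_test:
 fixes F :: "int => real"
 defines "\<delta> \<equiv> %n. F (n + 1) - F n"
 assumes incr: "\<And>n. u <= n ==> n + 1 < v ==> \<delta> n + \<mu> <= \<delta> (n + 1)"
  and range: "\<And>n m. u <= n ==> n < v ==> u <= m ==> m < v ==> \<delta> m - \<delta> n <= 1"
  and \<mu>: "0 < \<mu>" "\<mu> <= 1"
 shows "norm (\<Sum>n\<in>{u..<v}. ee (F n)) <= 14 / sqrt \<mu>"
proof (cases "u < v")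
 case True
 define \<theta> where "\<theta> = sqrt \<mu> / 2"
 have \<theta>: "\<theta> > 0" using \<mu> by (simp add: \<theta>_def)
 have lin: "\<delta> n + \<mu> * of_int (m - n) <= \<delta> m" if "u <= n" "n <= m" "m < v" for n m
  using that(2,3)
 proof (induction m rule: int_ge_induct)
  case (step m)
  then have "\<delta> n + \<mu> * of_int (m - n) <= \<delta> m" by simp
  moreover have "\<delta> m + \<mu> <= \<delta> (m + 1)" using incr[of m] step that(1) by simp
  ultimately show ?case by (simp add: algebra_simps)
 qed simp
 have mono: "\<delta> n <= \<delta> m" if "u <= n" "n <= m" "m < v" for n m
 proof -
  have "0 <= \<mu> * of_int (m - n)" using \<mu> that by (intro mult_nonneg_nonneg) auto
  then show ?thesis using lin[OF that] by linarith
 qed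
 define j0 where "j0 = \<lfloor>\<delta> u\<rfloor>"
 define S where "S = (%j. {n \<in> {u..<v}. \<lfloor>\<delta> n\<rfloor> = j})"
 have finS: "finite (S j)" for j by (rule finite_subset[of _ "{u..<v}"]) (auto simp: S_def)
 have bnd: "norm (\<Sum>n\<in>S j. ee (F n)) <= 7 / sqrt \<mu>" for j
 proof -
  define A where "A = {n \<in> S j. \<delta> n < of_int j + \<theta>}"
  define B where "B = {n \<in> S j. of_int j + \<theta> <= \<delta> n & \<delta> n <= of_int j + 1 - \<theta>}"
  define C where "C = {n \<in> S j. ~ \<delta> n < of_int j + \<theta> & ~ (of_int j + \<theta> <= \<delta> n & \<delta> n <= of_int j + 1 - \<theta>)}"
  have fin: "finite A" "finite B" "finite C" using finS[of j] by (auto simp: A_def B_def C_def)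
  have inS: "n \<in> S j ==> of_int j <= \<delta> n & \<delta> n < of_int j + 1" for n by (simp add: S_def floor_eq_iff)
  have S: "S j = A \<union> B \<union> C" by (auto simp: A_def B_def C_def)
  have cA: "real (card A) <= \<theta> / \<mu> + 1"
  proof (rule card_separated[OF fin(1) _ \<mu>(1)])
   fix n m assume nm: "n \<in> A" "m \<in> A" "n <= m"
   then have "\<delta> n + \<mu> * of_int (m - n) <= \<delta> m" by (intro lin) (auto simp: A_def S_def)
   then show "\<mu> * of_int (m - n) <= \<theta>" using nm inS[of n] by (auto simp: A_def)
  qed (use \<theta> in simp)
  have cC: "real (card C) <= \<theta> / \<mu> + 1"
  proof (rule card_separated[OF fin(3) _ \<mu>(1)])
   fix n m assume nm: "n \<in> C" "m \<in> C" "n <= m"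
   then have "\<delta> n + \<mu> * of_int (m - n) <= \<delta> m" by (intro lin) (auto simp: C_def S_def)
   then show "\<mu> * of_int (m - n) <= \<theta>" using nm inS[of m] by (auto simp: C_def)
  qed (use \<theta> in simp)
  obtain u' v' where B: "B = {u'..<v'}"
  proof (rule convex_int_set[OF fin(2)])
   fix x y z assume xyz: "x \<in> B" "y \<in> B" "x <= z" "z <= y"
   then have m: "\<delta> x <= \<delta> z" "\<delta> z <= \<delta> y" by (auto intro!: mono simp: B_def S_def)
   then have "\<lfloor>\<delta> x\<rfloor> <= \<lfloor>\<delta> z\<rfloor>" "\<lfloor>\<delta> z\<rfloor> <= \<lfloor>\<delta> y\<rfloor>" by (auto intro: floor_mono)
   then show "z \<in> B" using xyz m by (auto simp: B_def S_def)
  qed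
  have KL: "norm (\<Sum>n\<in>B. ee (F n)) <= 2 / \<theta>"
   unfolding B
  proof (rule kuzmin_landau[OF _ _ \<theta>])
   have Bs: "n \<in> B" if "u' <= n" "n < v'" for n using that B by auto
   show "F (n + 1) - F n <= F (m + 1) - F m" if "u' <= n" "n <= m" "m < v'" for n m
    using mono[of n m] Bs[of n] Bs[of m] that by (auto simp: \<delta>_def B_def S_def)
   show "of_int j + \<theta> <= F (n + 1) - F n & F (n + 1) - F n <= of_int j + 1 - \<theta>" if "u' <= n" "n < v'" for n
    using Bs[OF that] by (auto simp: \<delta>_def B_def)
  qed
  have tr: "norm (\<Sum>n\<in>Z. ee (F n)) <= real (card Z)" for Z
   using sum_norm_le[of Z "%n. ee (F n)" "%_. 1"] by simp
  have "(\<Sum>n\<in>S j. ee (F n)) = (\<Sum>n\<in>A \<union> B. ee (F n)) + (\<Sum>n\<in>C. ee (F n))"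
   unfolding S using fin by (intro sum.union_disjoint) (auto simp: A_def B_def C_def)
  also have "(\<Sum>n\<in>A \<union> B. ee (F n)) = (\<Sum>n\<in>A. ee (F n)) + (\<Sum>n\<in>B. ee (F n))"
   using fin by (intro sum.union_disjoint) (auto simp: A_def B_def)
  finally have "norm (\<Sum>n\<in>S j. ee (F n)) <= norm (\<Sum>n\<in>A. ee (F n)) + norm (\<Sum>n\<in>B. ee (F n)) + norm (\<Sum>n\<in>C. ee (F n))"
   by (simp add: norm_triangle_le norm_triangle_ineq add_mono order_trans[OF norm_triangle_ineq])
  also have "... <= (\<theta> / \<mu> + 1) + 2 / \<theta> + (\<theta> / \<mu> + 1)"
   using tr[of A] tr[of C] cA cC KL by linarith
  also have "\<theta> / \<mu> = 1 / 2 / sqrt \<mu>" using \<mu> by (simp add: \<theta>_def field_simps)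
  also have "2 / \<theta> = 4 / sqrt \<mu>" by (simp add: \<theta>_def)
  also have "1 / 2 / sqrt \<mu> + 1 + 4 / sqrt \<mu> + (1 / 2 / sqrt \<mu> + 1) = 5 / sqrt \<mu> + 2" by (simp add: field_simps)
  also have "2 <= 2 / sqrt \<mu>" using \<mu> by (simp add: field_simps)
  finally show ?thesis by (simp add: field_simps)
 qed
 have fl: "\<lfloor>\<delta> n\<rfloor> = j0 \<or> \<lfloor>\<delta> n\<rfloor> = j0 + 1" if "n \<in> {u..<v}" for n
 proof -
  have 1: "\<delta> u <= \<delta> n" "\<delta> n <= \<delta> u + 1" using that mono[of u n] range[of u n] True by auto
  then have "j0 <= \<lfloor>\<delta> n\<rfloor>" unfolding j0_def by (intro floor_mono)
  moreover have "\<lfloor>\<delta> n\<rfloor> <= \<lfloor>\<delta> u + 1\<rfloor>" using 1 by (intro floor_mono)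
  then have "\<lfloor>\<delta> n\<rfloor> <= j0 + 1" by (simp add: j0_def)
  ultimately show ?thesis by linarith
 qed
 have "(\<Sum>n\<in>{u..<v}. ee (F n)) = (\<Sum>n\<in>S j0 \<union> S (j0 + 1). ee (F n))"
 proof -
  have "{u..<v} = S j0 \<union> S (j0 + 1)" using fl unfolding S_def by blast
  then show ?thesis by simp
 qed
 also have "... = (\<Sum>n\<in>S j0. ee (F n)) + (\<Sum>n\<in>S (j0 + 1). ee (F n))"
 proof (intro sum.union_disjoint finS)
  show "S j0 \<inter> S (j0 + 1) = {}" by (auto simp: S_def)
 qed
 finally have "norm (\<Sum>n\<in>{u..<v}. ee (F n)) <= 7 / sqrt \<mu> + 7 / sqrt \<mu>"
  using bnd[of j0] bnd[of "j0 + 1"] by (simp only: norm_triangle_le add_mono)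
 then show ?thesis by simp
qed (use \<mu> in simp)

section \<open>Point sets in the residue plane and dyadic decomposition of frequencies\<close>

text \<open>Representatives of least absolute value, because linear phases are estimated by q /
  |k|.\<close>

definition resid :: "nat => int set" where
 "resid q = {- int (q div 2)..<int q - int (q div 2)}"

lemma sum_resid:
 fixes F :: "int => 'a::comm_monoid_add"
 assumes "q > 0" "\<And>x y. [x = y] (mod int q) ==> F x = F y"
 shows "(\<Sum>k\<in>resid q. F k) = (\<Sum>k\<in>{0..<int q}. F k)"
proof -
 have "(\<Sum>k\<in>resid q. F k) = (\<Sum>k\<in>{0..<int q}. F (k + - int (q div 2)))"
  unfolding resid_def by (rule sum.reindex_bij_witness[of _ "%k. k + - int (q div 2)" "%k. k + int (q div 2)"]) auto
 also have "... = (\<Sum>k\<in>{0..<int q}. F k)" by (rule sum_shift_periodic[OF assms])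
 finally show ?thesis .
qed

lemma resid_abs: "k \<in> resid q ==> 2 * \<bar>k\<bar> <= int q"
 by (auto simp: resid_def)

lemma finite_resid [simp]: "finite (resid q)"
 by (simp add: resid_def)

lemma zero_in_resid: "q > 0 ==> 0 \<in> resid q"
 by (auto simp: resid_def)

text \<open>A finite set of residue pairs whose exponential sums satisfy the bounds of a
 one-parameter curve on average. Both the set of solutions of \<open>a\<^sup>2b\<^sup>3 = l\<close> and its transpose are
 of this kind.\<close>

locale pointset =
 fixes q :: nat and A :: "(int \<times> int) set" and \<Gamma> :: real
 assumes q0: "q > 0" and finA [simp]: "finite A" and G1: "\<Gamma> >= 1"
  and box: "\<And>a b. (a, b) \<in> A ==> 0 <= a & a < int q & 0 <= b & b < int q"
  and block: "\<And>H K. H <= q ==> K <= q ==> (\<Sum>h\<in>nz H. \<Sum>k\<in>nz K. norm (expsum q A h k)) ^ 4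
    <= \<Gamma> ^ 4 * (real H * real K) ^ 3 * real q ^ 3 * ((1 + real H / sqrt q) * (1 + real K / sqrt q))"
  and axis_h: "\<And>H. (\<Sum>h\<in>nz H. norm (expsum q A h 0)) <= \<Gamma> * real H * sqrt q"
  and axis_k: "\<And>K. (\<Sum>k\<in>nz K. norm (expsum q A 0 k)) <= \<Gamma> * real K * sqrt q"
  and col_b: "\<And>\<beta>. real (card {P \<in> A. [snd P = \<beta>] (mod int q)}) <= \<Gamma>"
  and col_a: "\<And>\<alpha>. real (card {P \<in> A. [fst P = \<alpha>] (mod int q)}) <= \<Gamma>"
  and cardA: "card A <= q"

lemma expsum_swap: "expsum q (prod.swap ` A) h k = expsum q A k h"
proof -
 have "expsum q (prod.swap ` A) h k = (\<Sum>P\<in>A. eexp q (h * snd P + k * fst P))"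
  unfolding expsum_def by (subst sum.reindex) (auto simp: case_prod_unfold)
 then show ?thesis by (simp add: expsum_def case_prod_unfold add.commute)
qed

lemma (in pointset) transpose: "pointset q (prod.swap ` A) \<Gamma>"
proof
 show "q > 0" "finite (prod.swap ` A)" "\<Gamma> >= 1" using q0 G1 by auto
 show "0 <= a & a < int q & 0 <= b & b < int q" if "(a, b) \<in> prod.swap ` A" for a b
  using that box by auto
 show "(\<Sum>h\<in>nz H. \<Sum>k\<in>nz K. norm (expsum q (prod.swap ` A) h k)) ^ 4
    <= \<Gamma> ^ 4 * (real H * real K) ^ 3 * real q ^ 3 * ((1 + real H / sqrt q) * (1 + real K / sqrt q))"
  if "H <= q" "K <= q" for H K
  unfolding expsum_swap using block[OF that(2,1)] by (subst sum.swap) (simp add: mult.commute mult.left_commute)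
 show "(\<Sum>h\<in>nz H. norm (expsum q (prod.swap ` A) h 0)) <= \<Gamma> * real H * sqrt q" for H
  unfolding expsum_swap by (rule axis_k)
 show "(\<Sum>k\<in>nz K. norm (expsum q (prod.swap ` A) 0 k)) <= \<Gamma> * real K * sqrt q" for K
  unfolding expsum_swap by (rule axis_h)
 have "card {P \<in> prod.swap ` A. R (fst P) (snd P)} = card {P \<in> A. R (snd P) (fst P)}" for R :: "int => int => bool"
 proof -
  have "{P \<in> prod.swap ` A. R (fst P) (snd P)} = prod.swap ` {P \<in> A. R (snd P) (fst P)}" by auto
  then show ?thesis by (simp add: card_image)
 qed
 from this[of "%_ b. [b = \<beta>] (mod int q)" for \<beta>] this[of "%a _. [a = \<beta>] (mod int q)" for \<beta>]
 show "real (card {P \<in> prod.swap ` A. [snd P = \<beta>] (mod int q)}) <= \<Gamma>"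
  "real (card {P \<in> prod.swap ` A. [fst P = \<beta>] (mod int q)}) <= \<Gamma>" for \<beta>
  using col_a col_b by auto
 show "card (prod.swap ` A) <= q" using cardA by (simp add: card_image)
qed

text \<open>The constant 4 G^2 is chosen for \<open>block\<close>, where 256 G^5 has to be at most
  its fourth power 256 G^8. It also exceeds the constants 3 G^2 and G of the remaining
  axioms.\<close>

lemma (in modsys) X_pointset: "pointset q (X q l) (4 * G ^ 2)"
proof
 have G2: "G <= G ^ 2" using G1 by (simp add: self_le_power)
 show "4 * G ^ 2 >= 1" using one_le_power[OF G1, of 2] by linarith
 show "q > 0" "finite (X q l)" using q0 by auto
 show "0 <= a & a < int q & 0 <= b & b < int q" if "(a, b) \<in> X q l" for a b using that by (auto simp: X_def)
 show "(\<Sum>h\<in>nz H. \<Sum>k\<in>nz K. norm (S h k)) ^ 4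
    <= (4 * G ^ 2) ^ 4 * (real H * real K) ^ 3 * real q ^ 3 * ((1 + real H / sqrt q) * (1 + real K / sqrt q))"
  if "H <= q" "K <= q" for H K
 proof -
  have "256 * G ^ 5 <= 256 * G ^ 8" using G1 by (simp add: power_increasing)
  also have "... = (4 * G ^ 2) ^ 4" by (simp add: power_mult_distrib power_mult[symmetric])
  finally show ?thesis
   by (intro order_trans[OF block_sum[OF that]] mult_right_mono) (auto intro!: mult_nonneg_nonneg add_nonneg_nonneg)
 qed
 show "(\<Sum>h\<in>nz H. norm (S h 0)) <= 4 * G ^ 2 * real H * sqrt q" for H
  by (rule order_trans[OF axis_sum_h]) (intro mult_right_mono; simp)
 show "(\<Sum>k\<in>nz K. norm (S 0 k)) <= 4 * G ^ 2 * real K * sqrt q" for K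
  by (rule order_trans[OF axis_sum_k]) (intro mult_right_mono; simp)
 show "real (card {P \<in> X q l. [snd P = \<beta>] (mod int q)}) <= 4 * G ^ 2" for \<beta>
  using column_b[of \<beta>] G2 by linarith
 show "real (card {P \<in> X q l. [fst P = \<beta>] (mod int q)}) <= 4 * G ^ 2" for \<beta>
  using column_a[of \<beta>] G2 by linarith
 show "card (X q l) <= q" by (rule X_card_le[OF q0 cop])
qed

lemma dyadic_sum_le:
 fixes f :: "'z => real"
 assumes "finite Z" "\<And>z. z \<in> Z ==> g z \<in> T" "finite T"
  and "\<And>t. t \<in> T ==> (\<Sum>z\<in>{z \<in> Z. g z = t}. f z) <= c"
 shows "(\<Sum>z\<in>Z. f z) <= real (card T) * c"
proof -
 have "(\<Sum>z\<in>Z. f z) = (\<Sum>t\<in>T. \<Sum>z\<in>{z \<in> Z. g z = t}. f z)"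
  using assms by (intro sum.group[symmetric]) auto
 also have "... <= (\<Sum>t\<in>T. c)" by (intro sum_mono assms(4))
 finally show ?thesis by simp
qed

definition ilog :: "int => nat" where
 "ilog k = floor_log (nat \<bar>k\<bar>)"

lemma ilog_bounds:
 assumes "k \<noteq> 0"
 shows "2 ^ ilog k <= \<bar>k\<bar>" "\<bar>k\<bar> < 2 * 2 ^ ilog k"
proof -
 have k: "nat \<bar>k\<bar> > 0" using assms by simp
 from floor_log_exp2_le[OF k] have "2 ^ ilog k <= nat \<bar>k\<bar>" by (simp add: ilog_def)
 then have "int (2 ^ ilog k) <= int (nat \<bar>k\<bar>)" by (simp only: of_nat_le_iff)
 then show "2 ^ ilog k <= \<bar>k\<bar>" by simp
 from floor_log_exp2_gt[of "nat \<bar>k\<bar>"] have "nat \<bar>k\<bar> < 2 * 2 ^ ilog k" by (simp add: ilog_def)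
 then have "int (nat \<bar>k\<bar>) < int (2 * 2 ^ ilog k)" by (simp only: of_nat_less_iff)
 then show "\<bar>k\<bar> < 2 * 2 ^ ilog k" by simp
qed

lemma ilog_mono: "\<bar>k\<bar> <= int q ==> ilog k <= floor_log q"
 unfolding ilog_def by (rule monoD[OF floor_log_mono]) simp

context pointset
begin

text \<open>The number of dyadic ranges for a frequency of absolute value at most q.\<close>

definition L :: real where "L = real (floor_log q) + 1"

lemma L1: "L >= 1" by (simp add: L_def)

lemma block_powr:
 assumes "H <= q" "K <= q"
 shows "(\<Sum>h\<in>nz H. \<Sum>k\<in>nz K. norm (expsum q A h k))
  <= \<Gamma> * (real H * real K) powr (3/4) * real q powr (3/4) * ((1 + real H / sqrt q) powr (1/4) * (1 + real K / sqrt q) powr (1/4))"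
  (is "?S <= ?R")
proof (cases "H = 0 \<or> K = 0")
 case True
 then have "nz H = {} \<or> nz K = {}" by (auto simp: nz_def)
 then have "?S = 0" by auto
 moreover have "?R >= 0" using G1 by (auto intro!: mult_nonneg_nonneg)
 ultimately show ?thesis by linarith
next
 case False
 have p: "1 + real H / sqrt q > 0" "1 + real K / sqrt q > 0" by (auto intro!: add_pos_nonneg)
 have pw: "(x powr (3/4)) ^ 4 = x ^ 3" "(x powr (1/4)) ^ 4 = x" if "x > 0" for x :: real
  using that by (simp_all add: powr_power powr_numeral)
 have HK: "real H * real K > 0" "real q > 0" using False q0 by auto
 have "?R ^ 4 = \<Gamma> ^ 4 * (real H * real K) ^ 3 * real q ^ 3 * ((1 + real H / sqrt q) * (1 + real K / sqrt q))"
  by (simp only: power_mult_distrib[of _ _ 4] pw[OF HK(1)] pw[OF HK(2)] pw[OF p(1)] pw[OF p(2)])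
 then have le: "?S ^ 4 <= ?R ^ 4" using block[OF assms] by simp
 have "?R >= 0" using G1 by (intro mult_nonneg_nonneg) auto
 then show ?thesis using le power_strict_mono[of ?R ?S 4] by (meson linorder_not_less zero_less_numeral)
qed

lemma cell_bound:
 assumes "2 * 2 ^ i <= q" "2 * 2 ^ j <= q" and Z: "Z \<subseteq> {(h, k). h \<noteq> 0 & k \<noteq> 0 & ilog h = i & ilog k = j}"
 shows "(\<Sum>(h, k)\<in>Z. norm (expsum q A h k))
  <= 4 * \<Gamma> * (2 ^ i * 2 ^ j) powr (3/4) * real q powr (3/4) * ((1 + 2 * 2 ^ i / sqrt q) powr (1/4) * (1 + 2 * 2 ^ j / sqrt q) powr (1/4))"
proof -
 define H :: nat where "H = 2 * 2 ^ i"
 define K :: nat where "K = 2 * 2 ^ j"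
 have "Z \<subseteq> nz H \<times> nz K"
 proof
  fix z assume "z \<in> Z"
  then obtain h k where z: "z = (h, k)" "h \<noteq> 0" "k \<noteq> 0" "ilog h = i" "ilog k = j" using Z by auto
  then show "z \<in> nz H \<times> nz K" using ilog_bounds[of h] ilog_bounds[of k] by (auto simp: nz_def H_def K_def)
 qed
 then have "(\<Sum>(h, k)\<in>Z. norm (expsum q A h k)) <= (\<Sum>(h, k)\<in>nz H \<times> nz K. norm (expsum q A h k))"
  by (intro sum_mono2) auto
 also have "... = (\<Sum>h\<in>nz H. \<Sum>k\<in>nz K. norm (expsum q A h k))" by (simp add: sum.cartesian_product)
 also have "... <= \<Gamma> * (real H * real K) powr (3/4) * real q powr (3/4) * ((1 + real H / sqrt q) powr (1/4) * (1 + real K / sqrt q) powr (1/4))"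
  using assms by (intro block_powr) (auto simp: H_def K_def)
 also have "real H * real K = 4 * (2 ^ i * 2 ^ j)" by (simp add: H_def K_def)
 also have "(4 * (2 ^ i * 2 ^ j :: real)) powr (3/4) = 4 powr (3/4) * (2 ^ i * 2 ^ j) powr (3/4)" by (simp add: powr_mult)
 also have "\<Gamma> * (4 powr (3/4) * (2 ^ i * 2 ^ j) powr (3/4)) * real q powr (3/4) * ((1 + real H / sqrt q) powr (1/4) * (1 + real K / sqrt q) powr (1/4))
   <= \<Gamma> * (4 * (2 ^ i * 2 ^ j) powr (3/4)) * real q powr (3/4) * ((1 + real H / sqrt q) powr (1/4) * (1 + real K / sqrt q) powr (1/4))"
 proof -
  have "(4::real) powr (3/4) <= 4 powr 1" by (intro powr_mono) auto
  then show ?thesis using G1 by (intro mult_right_mono mult_left_mono) auto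
 qed
 finally show ?thesis by (simp add: H_def K_def mult_ac)
qed

lemma expsum_neg: "norm (expsum q A (- h) (- k)) = norm (expsum q A h k)"
proof -
 have "expsum q A (- h) (- k) = cnj (expsum q A h k)"
  unfolding expsum_def cnj_sum
 proof (rule sum.cong[OF refl], clarify)
  fix a b
  have "- h * a + - k * b = - (h * a + k * b)" by simp
  then show "eexp q (- h * a + - k * b) = cnj (eexp q (h * a + k * b))" by (simp only: eexp_minus)
 qed
 then show ?thesis by simp
qed

lemma fiber_fourier:
 "of_nat q * (\<Sum>P\<in>{P \<in> A. [snd P = n] (mod int q)}. eexp q (c * fst P)) = (\<Sum>k\<in>resid q. eexp q (k * n) * expsum q A c (- k))"
proof -
 have "(\<Sum>k\<in>resid q. eexp q (k * n) * expsum q A c (- k)) = (\<Sum>k\<in>resid q. \<Sum>P\<in>A. eexp q (c * fst P) * eexp q (k * (n - snd P)))"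
  unfolding expsum_def sum_distrib_left
  by (intro sum.cong refl) (simp add: case_prod_unfold eexp_add[symmetric] algebra_simps)
 also have "... = (\<Sum>P\<in>A. \<Sum>k\<in>resid q. eexp q (c * fst P) * eexp q (k * (n - snd P)))" by (rule sum.swap)
 also have "... = (\<Sum>P\<in>A. eexp q (c * fst P) * (\<Sum>k\<in>resid q. eexp q (k * (n - snd P))))" by (simp add: sum_distrib_left)
 also have "... = (\<Sum>P\<in>A. eexp q (c * fst P) * (if [snd P = n] (mod int q) then of_nat q else 0))"
 proof (intro sum.cong refl arg_cong2[where f = "(*)"])
  fix P
  have "(\<Sum>k\<in>resid q. eexp q (k * (n - snd P))) = (\<Sum>k\<in>{0..<int q}. eexp q (k * (n - snd P)))"
   by (rule sum_resid[OF q0]) (auto intro!: eexp_cong cong_mult q0)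
  also have "... = (if [snd P = n] (mod int q) then of_nat q else 0)"
   by (simp add: sum_eexp[OF q0] cong_iff_dvd_diff dvd_diff_commute)
  finally show "(\<Sum>k\<in>resid q. eexp q (k * (n - snd P))) = (if [snd P = n] (mod int q) then of_nat q else 0)" .
 qed
 also have "... = (\<Sum>P\<in>A. if [snd P = n] (mod int q) then eexp q (c * fst P) * of_nat q else 0)"
  by (intro sum.cong) auto
 also have "... = (\<Sum>P\<in>{P \<in> A. [snd P = n] (mod int q)}. eexp q (c * fst P) * of_nat q)"
  by (rule sum.inter_filter[symmetric]) simp
 finally show ?thesis by (simp add: sum_distrib_left mult.commute)
qed

text \<open>With \<theta> = |k| / (2q) the linear part contributes 2\<theta> or -2\<theta> to each
  phase increment, while h F contributes at most \<theta> in absolute value. As 4\<theta> <= 1, the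
  increments keep distance \<theta> from the integers and Kuzmin-Landau applies.\<close>

lemma phase_sum_nonresonant:
 fixes F :: "int => real"
 assumes mono: "\<And>n m. u <= n ==> n <= m ==> m < v ==> F (n + 1) - F n <= F (m + 1) - F m"
  and D: "\<And>n. u <= n ==> n < v ==> \<bar>F (n + 1) - F n\<bar> <= D"
  and k: "k \<noteq> 0" "2 * \<bar>k\<bar> <= int q" and h: "h >= 0" "2 * of_int h * D <= of_int \<bar>k\<bar>"
 shows "norm (\<Sum>n\<in>{u..<v}. ee ((of_int h * F n + of_int (k * n)) / real q)) <= 4 * real q / of_int \<bar>k\<bar>"
proof -
 define \<theta> where "\<theta> = of_int \<bar>k\<bar> / (2 * real q)"
 have \<theta>: "\<theta> > 0" using k q0 by (simp add: \<theta>_def)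
 have "of_int (2 * \<bar>k\<bar>) <= (of_int (int q) :: real)" using k(2) by (simp only: of_int_le_iff)
 then have \<theta>4: "4 * \<theta> <= 1" using q0 by (simp add: \<theta>_def field_simps)
 have eq: "(of_int h * F (n + 1) + of_int (k * (n + 1))) / real q - (of_int h * F n + of_int (k * n)) / real q
   = (of_int h * (F (n + 1) - F n)) / real q + of_int k / real q" for n
  using q0 by (simp add: field_simps)
 have hd: "\<bar>of_int h * (F (n + 1) - F n) / real q\<bar> <= \<theta>" if "u <= n" "n < v" for n
 proof -
  have "\<bar>of_int h * (F (n + 1) - F n)\<bar> = of_int h * \<bar>F (n + 1) - F n\<bar>" using h by (simp add: abs_mult)
  also have "... <= of_int h * D" using D[OF that] h by (intro mult_left_mono) auto
  also have "... <= of_int \<bar>k\<bar> / 2" using h by simp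
  finally show ?thesis using q0 by (simp add: \<theta>_def field_simps)
 qed
 have "norm (\<Sum>n\<in>{u..<v}. ee ((of_int h * F n + of_int (k * n)) / real q)) <= 2 / \<theta>"
 proof (rule kuzmin_landau[OF _ _ \<theta>, where j = "if k > 0 then 0 else - 1"])
  fix n m assume nm: "u <= n" "n <= m" "m < v"
  have "of_int h * (F (n + 1) - F n) / real q <= of_int h * (F (m + 1) - F m) / real q"
   using mono[OF nm] h by (intro divide_right_mono mult_left_mono) auto
  then show "(of_int h * F (n + 1) + of_int (k * (n + 1))) / real q - (of_int h * F n + of_int (k * n)) / real q
   <= (of_int h * F (m + 1) + of_int (k * (m + 1))) / real q - (of_int h * F m + of_int (k * m)) / real q"
   unfolding eq by simp
 next
  fix n assume n: "u <= n" "n < v"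
  define x where "x = of_int h * (F (n + 1) - F n) / real q"
  have x: "- \<theta> <= x" "x <= \<theta>" using hd[OF n, folded x_def] by (auto simp only: abs_le_iff)
  have y: "of_int k / real q = (if k > 0 then 2 * \<theta> else - (2 * \<theta>))" by (auto simp: \<theta>_def abs_if)
  have "of_int (if k > 0 then 0 else - 1) + \<theta> <= x + (if k > 0 then 2 * \<theta> else - (2 * \<theta>)) \<and>
   x + (if k > 0 then 2 * \<theta> else - (2 * \<theta>)) <= of_int (if k > 0 then 0 else - 1) + 1 - \<theta>"
   using x \<theta>4 \<theta> by auto
  then show "of_int (if k > 0 then 0 else - 1) + \<theta> <= (of_int h * F (n + 1) + of_int (k * (n + 1))) / real q - (of_int h * F n + of_int (k * n)) / real q \<and>
   (of_int h * F (n + 1) + of_int (k * (n + 1))) / real q - (of_int h * F n + of_int (k * n)) / real q <= of_int (if k > 0 then 0 else - 1) + 1 - \<theta>"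
   unfolding eq x_def[symmetric] y .
 qed
 also have "2 / \<theta> = 4 * real q / of_int \<bar>k\<bar>" using k q0 by (simp add: \<theta>_def)
 finally show ?thesis .
qed

lemma phase_sum_resonant:
 fixes F :: "int => real"
 assumes incr: "\<And>n. u <= n ==> n + 1 < v ==> F (n + 1) - F n + \<mu> <= F (n + 1 + 1) - F (n + 1)"
  and D: "\<And>n. u <= n ==> n < v ==> \<bar>F (n + 1) - F n\<bar> <= D"
  and h: "h > 0" and \<mu>: "0 < \<mu>" "of_int h * \<mu> <= real q" "2 * of_int h * D <= real q"
 shows "norm (\<Sum>n\<in>{u..<v}. ee ((of_int h * F n + of_int (k * n)) / real q)) <= 14 / sqrt (of_int h * \<mu> / real q)"
proof (rule second_derivative_test)
 have eq: "(of_int h * F (n + 1) + of_int (k * (n + 1))) / real q - (of_int h * F n + of_int (k * n)) / real q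
   = (of_int h * (F (n + 1) - F n)) / real q + of_int k / real q" for n
  using q0 by (simp add: field_simps)
 fix n assume n: "u <= n" "n + 1 < v"
 have "of_int h * (F (n + 1) - F n + \<mu>) <= of_int h * (F (n + 1 + 1) - F (n + 1))"
  using incr[OF n] h by (intro mult_left_mono) auto
 then have "(of_int h * (F (n + 1) - F n) + of_int h * \<mu>) / real q <= of_int h * (F (n + 1 + 1) - F (n + 1)) / real q"
  by (intro divide_right_mono) (auto simp: algebra_simps)
 then show "(of_int h * F (n + 1) + of_int (k * (n + 1))) / real q - (of_int h * F n + of_int (k * n)) / real q + of_int h * \<mu> / real q
   <= (of_int h * F (n + 1 + 1) + of_int (k * (n + 1 + 1))) / real q - (of_int h * F (n + 1) + of_int (k * (n + 1))) / real q"
  unfolding eq by (simp add: add_divide_distrib)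
next
 have eq: "(of_int h * F (n + 1) + of_int (k * (n + 1))) / real q - (of_int h * F n + of_int (k * n)) / real q
   = (of_int h * (F (n + 1) - F n)) / real q + of_int k / real q" for n
  using q0 by (simp add: field_simps)
 fix n m assume nm: "u <= n" "n < v" "u <= m" "m < v"
 have "F (m + 1) - F m - (F (n + 1) - F n) <= 2 * D" using D[of n] D[of m] nm by (simp add: abs_le_iff)
 then have "of_int h * (F (m + 1) - F m - (F (n + 1) - F n)) <= of_int h * (2 * D)" using h by (intro mult_left_mono) auto
 also have "... <= real q" using \<mu> by simp
 finally have "of_int h * (F (m + 1) - F m - (F (n + 1) - F n)) / real q <= 1" using q0 by (simp add: divide_le_eq)
 then show "(of_int h * F (m + 1) + of_int (k * (m + 1))) / real q - (of_int h * F m + of_int (k * m)) / real q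
   - ((of_int h * F (n + 1) + of_int (k * (n + 1))) / real q - (of_int h * F n + of_int (k * n)) / real q) <= 1"
  unfolding eq by (simp add: right_diff_distrib diff_divide_distrib)
qed (use assms q0 in \<open>auto simp: divide_le_eq\<close>)

text \<open>For a <= q^(1/2) the minimum is interpolated as the power 1/4 of N times the power 3/4
  of 4q/a, and the latter cancels a^(3/4). For larger a the last factor supplies another a^(1/4), so
  that the choice 4q/a cancels the full power of a and leaves q^(7/8).\<close>

lemma weight_bound:
 assumes a: "a >= 1" and N: "N >= 0"
 shows "min N (4 * real q / a) * (a powr (3/4) * (1 + 2 * a / sqrt q) powr (1/4)) <= 12 * (N powr (1/4) * real q powr (3/4) + real q powr (7/8))"
proof -
 have q: "real q > 0" using q0 by simp
 have three: "(3::real) powr (1/4) <= 3" using powr_mono[of "1/4" 1 "3::real"] by simp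
 have m0: "min N (4 * real q / a) >= 0" using N a q by simp
 show ?thesis
 proof (cases "a <= sqrt q")
  case True
  have "2 * a / sqrt q <= 2" using True q by (simp add: field_simps)
  then have "(1 + 2 * a / sqrt q) powr (1/4) <= 3 powr (1/4)" using a q by (intro powr_mono2) auto
  then have 1: "(1 + 2 * a / sqrt q) powr (1/4) <= 3" using three by linarith
  have "min N (4 * real q / a) = min N (4 * real q / a) powr (1/4 + 3/4)" using m0 by simp
  also have "... = min N (4 * real q / a) powr (1/4) * min N (4 * real q / a) powr (3/4)" by (rule powr_add)
  also have "... <= N powr (1/4) * (4 * real q / a) powr (3/4)"
   using m0 by (intro mult_mono powr_mono2) auto
  finally have "min N (4 * real q / a) * a powr (3/4) <= N powr (1/4) * (4 * real q / a) powr (3/4) * a powr (3/4)"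
   by (intro mult_right_mono) auto
  then have "min N (4 * real q / a) * a powr (3/4) <= N powr (1/4) * ((4 * real q / a) powr (3/4) * a powr (3/4))"
   by (simp only: mult.assoc)
  also have "(4 * real q / a) powr (3/4) * a powr (3/4) = 4 powr (3/4) * real q powr (3/4)"
   using a q by (simp add: powr_mult[symmetric])
  also have "N powr (1/4) * (4 powr (3/4) * real q powr (3/4)) <= N powr (1/4) * (4 * real q powr (3/4))"
   using powr_mono[of "3/4" 1 "4::real"] by (intro mult_left_mono mult_right_mono) auto
  finally have 2: "min N (4 * real q / a) * a powr (3/4) <= 4 * (N powr (1/4) * real q powr (3/4))" by simp
  have "(min N (4 * real q / a) * a powr (3/4)) * (1 + 2 * a / sqrt q) powr (1/4) <= (4 * (N powr (1/4) * real q powr (3/4))) * 3"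
   by (intro mult_mono 1 2) auto
  also have "... <= 12 * (N powr (1/4) * real q powr (3/4) + real q powr (7/8))" by simp
  finally show ?thesis by (simp add: mult.assoc)
 next
  case False
  then have r: "1 <= a / sqrt q" using q by (simp add: field_simps)
  have "1 + 2 * a / sqrt q <= 3 * (a / sqrt q)" using r by simp
  then have "(1 + 2 * a / sqrt q) powr (1/4) <= (3 * (a / sqrt q)) powr (1/4)" using a q by (intro powr_mono2) auto
  also have "... = 3 powr (1/4) * (a powr (1/4) / real q powr (1/8))"
   using a q by (simp add: powr_mult powr_divide powr_half_sqrt[symmetric] powr_powr)
  also have "... <= 3 * (a powr (1/4) / real q powr (1/8))" by (intro mult_right_mono three) auto
  finally have 1: "(1 + 2 * a / sqrt q) powr (1/4) <= 3 * (a powr (1/4) / real q powr (1/8))" .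
  have "min N (4 * real q / a) * (a powr (3/4) * (1 + 2 * a / sqrt q) powr (1/4)) <= (4 * real q / a) * (a powr (3/4) * (3 * (a powr (1/4) / real q powr (1/8))))"
   using a q by (intro mult_mono 1) auto
  also have "a powr (3/4) * (3 * (a powr (1/4) / real q powr (1/8))) = 3 * (a powr (3/4 + 1/4)) / real q powr (1/8)"
   by (simp only: powr_add) simp
  also have "(4 * real q / a) * (3 * (a powr (3/4 + 1/4)) / real q powr (1/8)) = 12 * (real q / real q powr (1/8))" using a by simp
  also have "real q / real q powr (1/8) = real q powr (7/8)"
   using q powr_diff[of "real q" 1 "1/8"] by simp
  also have "12 * real q powr (7/8) <= 12 * (N powr (1/4) * real q powr (3/4) + real q powr (7/8))" by simp
  finally show ?thesis .
 qed
qed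

end

section \<open>Sawtooth sums over short blocks\<close>

context pointset
begin

definition fib :: "int => (int \<times> int) set" where
 "fib n = {P \<in> A. [snd P = n] (mod int q)}"

lemma finite_fib [simp]: "finite (fib n)"
 by (rule finite_subset[OF _ finA]) (auto simp: fib_def)

lemma card_fib: "real (card (fib n)) <= \<Gamma>"
 using col_b[of n] by (simp add: fib_def)

abbreviation cell :: "real => real => real" where
 "cell a b \<equiv> 4 * \<Gamma> * (a * b) powr (3/4) * real q powr (3/4) * ((1 + 2 * a / sqrt q) powr (1/4) * (1 + 2 * b / sqrt q) powr (1/4))"

lemma double_dyadic:
 assumes Z: "finite Z" "\<And>h k. (h, k) \<in> Z ==> h \<noteq> 0 & k \<noteq> 0 & 2 * \<bar>h\<bar> <= int q & 2 * \<bar>k\<bar> <= int q"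
  and w: "\<And>h k. (h, k) \<in> Z ==> w h k <= W (ilog h) (ilog k)"
  and W: "\<And>h k. (h, k) \<in> Z ==> W (ilog h) (ilog k) >= 0 & W (ilog h) (ilog k) * cell (2 ^ ilog h) (2 ^ ilog k) <= c"
  and c: "c >= 0"
 shows "(\<Sum>(h, k)\<in>Z. w h k * norm (expsum q A h k)) <= L ^ 2 * c"
proof -
 define T where "T = {..floor_log q} \<times> {..floor_log q}"
 have "(\<Sum>(h, k)\<in>Z. w h k * norm (expsum q A h k)) <= real (card T) * c"
 proof (rule dyadic_sum_le[OF Z(1), where g = "%(h, k). (ilog h, ilog k)"])
  show "finite T" by (simp add: T_def)
  show "(%(h, k). (ilog h, ilog k)) z \<in> T" if "z \<in> Z" for z
  proof -
   obtain h k where z: "z = (h, k)" by (cases z)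
   then have "2 * \<bar>h\<bar> <= int q" "2 * \<bar>k\<bar> <= int q" using Z(2) that by auto
   then have "\<bar>h\<bar> <= int q" "\<bar>k\<bar> <= int q" by linarith+
   then show ?thesis by (simp add: z T_def ilog_mono)
  qed
  fix t assume "t \<in> T"
  obtain i j where t: "t = (i, j)" by (cases t)
  define Y where "Y = {z \<in> Z. (%(h, k). (ilog h, ilog k)) z = t}"
  show "(\<Sum>(h, k)\<in>Y. w h k * norm (expsum q A h k)) <= c"
  proof (cases "Y = {}")
   case True
   then show ?thesis using c by simp
  next
   case False
   then obtain h0 k0 where hk: "(h0, k0) \<in> Z" "ilog h0 = i" "ilog k0 = j" by (auto simp: Y_def t)
   have sz: "2 * 2 ^ i <= q" "2 * 2 ^ j <= q"
   proof -
    have z: "h0 \<noteq> 0" "k0 \<noteq> 0" "2 * \<bar>h0\<bar> <= int q" "2 * \<bar>k0\<bar> <= int q" using Z(2)[OF hk(1)] by auto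
    then have "int (2 * 2 ^ i) <= int q" "int (2 * 2 ^ j) <= int q"
     using ilog_bounds(1)[OF z(1)] ilog_bounds(1)[OF z(2)] hk by auto
    then show "2 * 2 ^ i <= q" "2 * 2 ^ j <= q" by (simp_all only: of_nat_le_iff)
   qed
   have "(\<Sum>(h, k)\<in>Y. w h k * norm (expsum q A h k)) <= (\<Sum>(h, k)\<in>Y. W i j * norm (expsum q A h k))"
    by (rule sum_mono) (auto simp: Y_def t intro!: mult_right_mono dest: w)
   also have "... = W i j * (\<Sum>(h, k)\<in>Y. norm (expsum q A h k))"
    by (simp add: sum_distrib_left case_prod_unfold)
   also have "... <= W i j * cell (2 ^ i) (2 ^ j)"
   proof (rule mult_left_mono)
    show "(\<Sum>(h, k)\<in>Y. norm (expsum q A h k)) <= cell (2 ^ i) (2 ^ j)"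
     by (rule cell_bound[OF sz]) (use Z(2) in \<open>auto simp: Y_def t\<close>)
    show "0 <= W i j" using W[OF hk(1)] hk by simp
   qed
   also have "... <= c" using W[OF hk(1)] hk by simp
   finally show ?thesis .
  qed
 qed
 also have "real (card T) = L ^ 2" by (simp add: T_def card_cartesian_product L_def power2_eq_square algebra_simps)
 finally show ?thesis .
qed

text \<open>The weight 1/|h| offsets the linear growth of the partial sums over \<open>nz H\<close>,
  so every dyadic range contributes the same amount and their number gives the factor
  \<open>L\<close>.\<close>

lemma axis_dyadic:
 fixes f :: "int => real"
 assumes Z: "finite Z" "\<And>h. h \<in> Z ==> h \<noteq> 0 & \<bar>h\<bar> <= int q"
  and f: "\<And>h. f h >= 0" "\<And>H. (\<Sum>h\<in>nz H. f h) <= \<Gamma> * real H * sqrt q"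
  and w: "\<And>h. h \<in> Z ==> w h <= c / of_int \<bar>h\<bar>" and c: "c >= 0"
 shows "(\<Sum>h\<in>Z. w h * f h) <= L * (2 * c * \<Gamma> * sqrt q)"
proof -
 have "(\<Sum>h\<in>Z. w h * f h) <= real (card {..floor_log q}) * (2 * c * \<Gamma> * sqrt q)"
 proof (rule dyadic_sum_le[OF Z(1), where g = ilog])
  show "ilog h \<in> {..floor_log q}" if "h \<in> Z" for h using Z(2)[OF that] by (simp add: ilog_mono)
  fix i
  have "(\<Sum>h\<in>{h \<in> Z. ilog h = i}. w h * f h) <= (\<Sum>h\<in>{h \<in> Z. ilog h = i}. c / 2 ^ i * f h)"
  proof (rule sum_mono)
   fix h assume h: "h \<in> {h \<in> Z. ilog h = i}"
   then have h0: "h \<noteq> 0" using Z(2) by auto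
   have "2 ^ i <= \<bar>h\<bar>" using ilog_bounds(1)[OF h0] h by simp
   then have "(of_int (2 ^ i) :: real) <= of_int \<bar>h\<bar>" by (simp only: of_int_le_iff)
   then have "c / of_int \<bar>h\<bar> <= c / 2 ^ i" using c h0 by (intro divide_left_mono) auto
   then show "w h * f h <= c / 2 ^ i * f h" using w[of h] h f by (intro mult_right_mono) auto
  qed
  also have "... <= (\<Sum>h\<in>nz (2 * 2 ^ i). c / 2 ^ i * f h)"
  proof (rule sum_mono2)
   show "{h \<in> Z. ilog h = i} \<subseteq> nz (2 * 2 ^ i)"
    using Z(2) ilog_bounds(2) by (fastforce simp: nz_def)
  qed (use c f in auto)
  also have "... = c / 2 ^ i * (\<Sum>h\<in>nz (2 * 2 ^ i). f h)" by (simp add: sum_distrib_left)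
  also have "... <= c / 2 ^ i * (\<Gamma> * real (2 * 2 ^ i) * sqrt q)" using c by (intro mult_left_mono f) auto
  also have "... = 2 * c * \<Gamma> * sqrt q" by simp
  finally show "(\<Sum>h\<in>{h \<in> Z. ilog h = i}. w h * f h) <= 2 * c * \<Gamma> * sqrt q" .
 qed simp
 then show ?thesis by (simp add: L_def add.commute)
qed

lemma small_factor:
 assumes "0 <= a" "a <= c * sqrt q" "2 * c + 1 <= 81" "c >= 0"
 shows "(1 + 2 * a / sqrt q) powr (1/4) <= 3"
proof -
 have "a / sqrt q <= c" using assms q0 by (simp add: divide_le_eq)
 then have "1 + 2 * a / sqrt q <= 81" using assms by simp
 then have "(1 + 2 * a / sqrt q) powr (1/4) <= 81 powr (1/4)"
  using assms by (intro powr_mono2) (auto intro!: add_nonneg_nonneg)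
 also have "(81::real) powr (1/4) = (3 powr 4) powr (1/4)" by simp
 also have "... = 3" by (simp only: powr_powr) simp
 finally show ?thesis .
qed

lemma cell_nonresonant:
 assumes a: "1 <= a" "a <= sqrt q" and b: "1 <= b" and N: "N >= 0"
 shows "min N (4 * real q / b) / a * cell a b <= 144 * \<Gamma> * (real q * (sqrt q * N powr (1/4) + real q powr (5/8)))"
proof -
 have q: "real q > 0" using q0 by simp
 have 1: "(1 + 2 * a / sqrt q) powr (1/4) <= 3" using a by (intro small_factor[of a 1]) auto
 have 2: "a powr (3/4) / a <= 1" using a powr_mono[of "3/4" 1 a] by simp
 have "min N (4 * real q / b) / a * cell a b = 4 * \<Gamma> * real q powr (3/4) * ((a powr (3/4) / a) * (1 + 2 * a / sqrt q) powr (1/4))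
   * (min N (4 * real q / b) * (b powr (3/4) * (1 + 2 * b / sqrt q) powr (1/4)))"
  using a b by (simp add: powr_mult)
 also have "... <= 4 * \<Gamma> * real q powr (3/4) * (1 * 3) * (12 * (N powr (1/4) * real q powr (3/4) + real q powr (7/8)))"
  using a b N G1 by (intro mult_mono mult_left_mono 1 2 weight_bound) (auto intro!: mult_nonneg_nonneg)
 also have "... = 144 * \<Gamma> * (real q powr (3/4) * real q powr (3/4) * N powr (1/4) + real q powr (3/4) * real q powr (7/8))"
  by (simp add: algebra_simps)
 also have "real q powr (3/4) * real q powr (3/4) = real q * sqrt q"
 proof -
  have "real q powr (3/4) * real q powr (3/4) = real q powr (1 + 1/2)" by (simp add: powr_add[symmetric])
  also have "... = real q * sqrt q" using q by (simp only: powr_add powr_half_sqrt) simp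
  finally show ?thesis .
 qed
 also have "real q powr (3/4) * real q powr (7/8) = real q * real q powr (5/8)"
 proof -
  have "real q powr (3/4) * real q powr (7/8) = real q powr (1 + 5/8)" by (simp add: powr_add[symmetric])
  also have "... = real q * real q powr (5/8)" using q by (simp only: powr_add) simp
  finally show ?thesis .
 qed
 finally show ?thesis by (simp add: algebra_simps)
qed

text \<open>Resonance restricts b to at most 4aD, so (ab)^(3/4) is of order a^(3/2) D^(3/4). The
  power of a is exactly that of the weight 1 / (a sqrt a), which makes the bound independent of the
  cell.\<close>

lemma cell_resonant:
 assumes a: "1 <= a" "a <= sqrt q" "a * D <= sqrt q" and b: "1 <= b" "b <= 4 * a * D" and \<mu>: "\<mu> > 0"
 shows "14 * sqrt (real q / \<mu>) / (a * sqrt a) * cell a b <= 2016 * \<Gamma> * (real q * (real q powr (1/4) * D powr (3/4) / sqrt \<mu>))"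
proof -
 have q: "real q > 0" using q0 by simp
 have D: "D > 0" using a b by (meson less_le_trans mult_nonneg_nonpos not_le order_trans zero_less_one linear mult_pos_pos zero_le_numeral mult_nonneg_nonneg less_imp_le)
 have 1: "(1 + 2 * a / sqrt q) powr (1/4) <= 3" using a by (intro small_factor[of a 1]) auto
 have 2: "(1 + 2 * b / sqrt q) powr (1/4) <= 3" using a b by (intro small_factor[of b 4]) auto
 have "(a * b) powr (3/4) <= (4 * (a * a) * D) powr (3/4)"
  using a b D mult_left_mono[OF b(2), of a] by (intro powr_mono2) (auto simp: mult_ac)
 also have "... = 4 powr (3/4) * (a * a) powr (3/4) * D powr (3/4)" using a D by (simp add: powr_mult)
 also have "(a * a) powr (3/4) = a * sqrt a"
 proof -
  have "(a * a) powr (3/4) = a powr (3/4 + 3/4)" using a by (simp only: powr_mult powr_add)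
  also have "... = a powr (1 + 1/2)" by simp
  also have "... = a * sqrt a" using a by (simp only: powr_add powr_half_sqrt) simp
  finally show ?thesis .
 qed
 also have "4 powr (3/4) * (a * sqrt a) * D powr (3/4) <= 4 * (a * sqrt a) * D powr (3/4)"
  using powr_mono[of "3/4" 1 "4::real"] a by (intro mult_right_mono) auto
 finally have 3: "(a * b) powr (3/4) <= 4 * (a * sqrt a) * D powr (3/4)" .
 have as: "a * sqrt a > 0" using a by simp
 have "14 * sqrt (real q / \<mu>) / (a * sqrt a) * cell a b
   <= 14 * sqrt (real q / \<mu>) / (a * sqrt a) * (4 * \<Gamma> * (4 * (a * sqrt a) * D powr (3/4)) * real q powr (3/4) * (3 * 3))"
  using G1 as a b \<mu> by (intro mult_left_mono mult_mono 1 2 3) (auto intro!: mult_nonneg_nonneg)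
 also have "... = 2016 * \<Gamma> * (sqrt (real q) * real q powr (3/4) * D powr (3/4) / sqrt \<mu>)"
  using as a by (simp add: real_sqrt_divide)
 also have "sqrt (real q) * real q powr (3/4) = real q * real q powr (1/4)"
 proof -
  have "sqrt (real q) * real q powr (3/4) = real q powr (1/2 + 3/4)" using q by (simp only: powr_add powr_half_sqrt)
  also have "... = real q powr (1 + 1/4)" by simp
  also have "... = real q * real q powr (1/4)" using q by (simp only: powr_add) simp
  finally show ?thesis .
 qed
 finally show ?thesis by (simp add: mult.assoc)
qed

lemma saw_block:
 fixes F :: "int => real" and u v :: int
 defines "N \<equiv> of_int (v - u) :: real"
 assumes uv: "u <= v" and q4: "q >= 4"
  and mono: "\<And>n m. u <= n ==> n <= m ==> m < v ==> F (n + 1) - F n <= F (m + 1) - F m"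
  and D: "\<And>n. u <= n ==> n < v ==> \<bar>F (n + 1) - F n\<bar> <= D" "D >= 0"
  and res: "D > 0 ==> 0 < \<mu> & \<mu> <= D"
   "\<And>n. D > 0 ==> u <= n ==> n + 1 < v ==> F (n + 1) - F n + \<mu> <= F (n + 1 + 1) - F (n + 1)"
  and H: "H >= 1" and M: "H\<^sup>2 <= real M" "real M <= sqrt q" "real M * D <= sqrt q"
 shows "\<bar>\<Sum>n\<in>{u..<v}. \<Sum>P\<in>fib n. saw ((F n - of_int (fst P)) / real q)\<bar>
  <= \<Gamma> * N / H + 2 * \<Gamma> * L * N / sqrt q
   + 2016 * \<Gamma> * L\<^sup>2 * (sqrt q * N powr (1/4) + real q powr (5/8) + (if D = 0 then 0 else real q powr (1/4) * D powr (3/4) / sqrt \<mu>))"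
proof -
 have q: "real q > 0" using q0 by simp
 have N0: "N >= 0" using uv by (simp add: N_def)
 \<comment> \<open>This is what q >= 4 provides: every h <= M <= sqrt q then satisfies 2h <= q, as
   required by the dyadic decomposition.\<close>
 have sq: "2 * sqrt q <= real q"
 proof -
  have "2 <= sqrt q" using q4 by (intro real_le_rsqrt) auto
  then have "2 * sqrt q <= sqrt q * sqrt q" by (intro mult_right_mono) auto
  then show ?thesis by simp
 qed
 have M1: "M >= 1" using M(1) one_le_power[OF H, of 2] by (cases M) auto
 define I where "I = (SIGMA n:{u..<v}. fib n)"
 define x where "x = (%(n, P :: int \<times> int). (F n - of_int (fst P)) / real q)"
 define E where "E = (if D = 0 then 0 else real q powr (1/4) * D powr (3/4) / sqrt \<mu>)"
 define J where "J = (%h k. \<Sum>n\<in>{u..<v}. ee ((of_int h * F n + of_int (k * n)) / real q))"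
 have finI: "finite I" by (simp add: I_def)
 have cI: "real (card I) <= \<Gamma> * N"
 proof -
  have "real (card I) = (\<Sum>n\<in>{u..<v}. real (card (fib n)))" by (simp add: I_def)
  also have "... <= (\<Sum>n\<in>{u..<v}. \<Gamma>)" by (intro sum_mono card_fib)
  also have "... = \<Gamma> * N" using uv by (simp add: N_def mult.commute)
  finally show ?thesis .
 qed
 \<comment> \<open>The Fourier expansion of the fibres produces the frequencies (-h, -k). They may
   be replaced by (h, k), because conjugation does not change the norm.\<close>
 have U: "norm (\<Sum>i\<in>I. ee (real h * x i)) <= (\<Sum>k\<in>resid q. norm (expsum q A (int h) k) * norm (J (int h) k)) / real q" for h :: nat
 proof -
  have "(\<Sum>i\<in>I. ee (real h * x i)) = (\<Sum>n\<in>{u..<v}. \<Sum>P\<in>fib n. ee (real h * x (n, P)))"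
   unfolding I_def by (subst sum.Sigma) (auto simp: case_prod_unfold)
  also have "... = (\<Sum>n\<in>{u..<v}. ee (real h * F n / real q) * (\<Sum>P\<in>fib n. eexp q (- int h * fst P)))"
  proof (rule sum.cong[OF refl])
   fix n
   have "ee (real h * x (n, P)) = ee (real h * F n / real q) * eexp q (- int h * fst P)" for P
   proof -
    have "real h * x (n, P) = real h * F n / real q + of_int (- int h * fst P) / real q"
     by (simp add: x_def diff_divide_distrib right_diff_distrib)
    then show ?thesis by (simp only: ee_add eexp_def)
   qed
   then show "(\<Sum>P\<in>fib n. ee (real h * x (n, P))) = ee (real h * F n / real q) * (\<Sum>P\<in>fib n. eexp q (- int h * fst P))"
    by (simp add: sum_distrib_left)
  qed
  finally have "of_nat q * (\<Sum>i\<in>I. ee (real h * x i)) = (\<Sum>n\<in>{u..<v}. ee (real h * F n / real q) * (of_nat q * (\<Sum>P\<in>fib n. eexp q (- int h * fst P))))"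
   by (simp add: sum_distrib_left mult.left_commute)
  also have "... = (\<Sum>n\<in>{u..<v}. \<Sum>k\<in>resid q. ee (real h * F n / real q) * (eexp q (k * n) * expsum q A (- int h) (- k)))"
   by (simp only: fib_def fiber_fourier) (simp only: sum_distrib_left)
  also have "... = (\<Sum>k\<in>resid q. \<Sum>n\<in>{u..<v}. ee (real h * F n / real q) * (eexp q (k * n) * expsum q A (- int h) (- k)))" by (rule sum.swap)
  also have "... = (\<Sum>k\<in>resid q. expsum q A (- int h) (- k) * J (int h) k)"
  proof (rule sum.cong[OF refl])
   fix k
   have "ee (real h * F n / real q) * (eexp q (k * n) * expsum q A (- int h) (- k)) = expsum q A (- int h) (- k) * ee ((of_int (int h) * F n + of_int (k * n)) / real q)" for n
    by (simp add: eexp_def add_divide_distrib ee_add)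
   then show "(\<Sum>n\<in>{u..<v}. ee (real h * F n / real q) * (eexp q (k * n) * expsum q A (- int h) (- k))) = expsum q A (- int h) (- k) * J (int h) k"
    by (simp only: J_def sum_distrib_left)
  qed
  finally have e: "of_nat q * (\<Sum>i\<in>I. ee (real h * x i)) = (\<Sum>k\<in>resid q. expsum q A (- int h) (- k) * J (int h) k)" .
  have "real q * norm (\<Sum>i\<in>I. ee (real h * x i)) = norm (\<Sum>k\<in>resid q. expsum q A (- int h) (- k) * J (int h) k)"
   unfolding e[symmetric] by (simp add: norm_mult)
  also have "... <= (\<Sum>k\<in>resid q. norm (expsum q A (int h) k) * norm (J (int h) k))"
   by (rule order_trans[OF norm_sum]) (simp add: norm_mult expsum_neg)
  finally show ?thesis using q by (simp add: le_divide_eq mult.commute)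
 qed
 have Jtriv: "norm (J h k) <= N" for h k
  using sum_norm_le[of "{u..<v}" "%n. ee ((of_int h * F n + of_int (k * n)) / real q)" "%_. 1"] uv
  by (simp add: J_def N_def)
 define f where "f = (%h k. norm (expsum q A h k) * norm (J h k) / of_int h)"
 have "(\<Sum>h=1..M. norm (\<Sum>i\<in>I. ee (real h * x i)) / real h) <= (\<Sum>h=1..M. (\<Sum>k\<in>resid q. f (int h) k) / real q)"
 proof (rule sum_mono)
  fix h assume "h \<in> {1..M}"
  then have "norm (\<Sum>i\<in>I. ee (real h * x i)) / real h <= ((\<Sum>k\<in>resid q. norm (expsum q A (int h) k) * norm (J (int h) k)) / real q) / real h"
   by (intro divide_right_mono U) auto
  also have "... = (\<Sum>k\<in>resid q. f (int h) k) / real q"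
   by (simp add: f_def sum_divide_distrib[symmetric] mult.commute)
  finally show "norm (\<Sum>i\<in>I. ee (real h * x i)) / real h <= (\<Sum>k\<in>resid q. f (int h) k) / real q" .
 qed
 also have "... = (\<Sum>h\<in>{1..int M}. \<Sum>k\<in>resid q. f h k) / real q"
  unfolding sum_divide_distrib[symmetric]
  by (rule arg_cong[where f = "%x. x / real q"], rule sum.reindex_bij_witness[of _ nat int]) auto
 also have "(\<Sum>h\<in>{1..int M}. \<Sum>k\<in>resid q. f h k) = (\<Sum>h\<in>{1..int M}. f h 0) + (\<Sum>h\<in>{1..int M}. \<Sum>k\<in>resid q - {0}. f h k)"
  unfolding sum.distrib[symmetric] using zero_in_resid[OF q0] by (intro sum.cong refl) (simp add: sum.remove)
 also have "(\<Sum>h\<in>{1..int M}. \<Sum>k\<in>resid q - {0}. f h k) = (\<Sum>(h, k)\<in>{1..int M} \<times> (resid q - {0}). (norm (J h k) / of_int h) * norm (expsum q A h k))"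
  by (simp add: sum.cartesian_product f_def mult.commute)
 finally have W: "(\<Sum>h=1..M. norm (\<Sum>i\<in>I. ee (real h * x i)) / real h) <= ((\<Sum>h\<in>{1..int M}. f h 0) + (\<Sum>(h, k)\<in>{1..int M} \<times> (resid q - {0}). (norm (J h k) / of_int h) * norm (expsum q A h k))) / real q" .
 have hM: "real_of_int h <= real M" if "h \<in> {1..int M}" for h
 proof -
  have "real_of_int h <= real_of_int (int M)" using that by (simp only: of_int_le_iff) simp
  then show ?thesis by simp
 qed
 have W0: "(\<Sum>h\<in>{1..int M}. f h 0) <= L * (2 * N * \<Gamma> * sqrt q)"
 proof -
  have "(\<Sum>h\<in>{1..int M}. f h 0) = (\<Sum>h\<in>{1..int M}. (norm (J h 0) / of_int h) * norm (expsum q A h 0))"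
   by (simp add: f_def mult.commute)
  also have "... <= L * (2 * N * \<Gamma> * sqrt q)"
  proof (rule axis_dyadic[OF _ _ _ axis_h])
   fix h assume h: "h \<in> {1..int M}"
   show "norm (J h 0) / of_int h <= N / of_int \<bar>h\<bar>" using h Jtriv[of h 0] by (auto intro!: divide_right_mono)
   have "real_of_int h <= real q" using hM[OF h] M(2) sq q by (smt (verit) real_sqrt_ge_zero of_nat_0_le_iff)
   then show "h \<noteq> 0 & \<bar>h\<bar> <= int q" using h by auto
  qed (use N0 in auto)
  finally show ?thesis .
 qed
 define c where "c = 144 * \<Gamma> * (real q * (sqrt q * N powr (1/4) + real q powr (5/8))) + 2016 * \<Gamma> * (real q * E)"
 \<comment> \<open>The first summand majorizes the nonresonant weight, the second the resonant one.
   Its condition follows from |k| < 2hD together with 2^j <= |k| and h <= 2 * 2^i.\<close>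
 define w where "w = (%i j::nat. min N (4 * real q / 2 ^ j) / 2 ^ i + (if D > 0 & 2 ^ j <= 4 * 2 ^ i * D then 14 * sqrt (real q / \<mu>) / (2 ^ i * sqrt (2 ^ i)) else 0))"
 have E0: "E >= 0" using res(1) D(2) by (auto simp: E_def)
 have W1: "(\<Sum>(h, k)\<in>{1..int M} \<times> (resid q - {0}). (norm (J h k) / of_int h) * norm (expsum q A h k)) <= L ^ 2 * c"
 proof (rule double_dyadic[where W = w])
  show "finite ({1..int M} \<times> (resid q - {0}))" by simp
  show "c >= 0" using G1 E0 N0 by (auto simp: c_def intro!: add_nonneg_nonneg mult_nonneg_nonneg)
  fix h k assume hk: "(h, k) \<in> {1..int M} \<times> (resid q - {0})"
  then have h: "h \<in> {1..int M}" and k: "k \<noteq> 0" "2 * \<bar>k\<bar> <= int q" using resid_abs by auto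
  have h0: "h \<noteq> 0" "h > 0" using h by auto
  have hr: "real_of_int h <= sqrt q" using hM[OF h] M(2) by linarith
  have hD: "real_of_int h * D <= sqrt q" using mult_right_mono[OF hM[OF h] D(2)] M(3) by linarith
  have "2 * real_of_int h <= real q" using hr sq by linarith
  then have "real_of_int (2 * h) <= real_of_int (int q)" by simp
  then have "2 * \<bar>h\<bar> <= int q" using h by (simp only: of_int_le_iff) auto
  then show "h \<noteq> 0 & k \<noteq> 0 & 2 * \<bar>h\<bar> <= int q & 2 * \<bar>k\<bar> <= int q" using h k by auto
  define i where "i = ilog h"
  define j where "j = ilog k"
  have "2 ^ i <= \<bar>h\<bar>" "\<bar>h\<bar> < 2 * 2 ^ i" "2 ^ j <= \<bar>k\<bar>" "\<bar>k\<bar> < 2 * 2 ^ j" using ilog_bounds[OF h0(1)] ilog_bounds[OF k(1)] by (auto simp: i_def j_def)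
  then have "real_of_int (2 ^ i) <= real_of_int h" "real_of_int h < real_of_int (2 * 2 ^ i)" "real_of_int (2 ^ j) <= real_of_int \<bar>k\<bar>"
   using h0 by (auto simp only: of_int_le_iff of_int_less_iff abs_of_pos)
  then have a: "2 ^ i <= real_of_int h" "real_of_int h <= 2 * 2 ^ i" and b: "2 ^ j <= real_of_int \<bar>k\<bar>" by auto
  have w1: "min N (4 * real q / 2 ^ j) / 2 ^ i >= 0" using N0 by simp
  have w2: "(if D > 0 & 2 ^ j <= 4 * 2 ^ i * D then 14 * sqrt (real q / \<mu>) / (2 ^ i * sqrt (2 ^ i)) else 0) >= 0"
   using res(1) by auto
  show "norm (J h k) / of_int h <= w (ilog h) (ilog k)"
  proof (cases "2 * of_int h * D <= of_int \<bar>k\<bar>")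
   case True
   have "norm (J h k) <= 4 * real q / of_int \<bar>k\<bar>"
    unfolding J_def using True k h0 mono D(1) by (intro phase_sum_nonresonant[where D = D]) auto
   also have "... <= 4 * real q / 2 ^ j" using b k by (intro divide_left_mono) auto
   finally have "norm (J h k) <= min N (4 * real q / 2 ^ j)" using Jtriv[of h k] by simp
   then have "norm (J h k) / of_int h <= min N (4 * real q / 2 ^ j) / 2 ^ i"
    using a h0 N0 by (intro frac_le) auto
   then show ?thesis unfolding w_def i_def[symmetric] j_def[symmetric] using w2 by linarith
  next
   case False
   then have kD: "of_int \<bar>k\<bar> < 2 * of_int h * D" by simp
   have Dp: "D > 0"
   proof (rule ccontr)
    assume "~ D > 0"
    then have "D = 0" using D(2) by simp
    then show False using kD k by simp
   qed
   have \<mu>: "\<mu> > 0" "\<mu> <= D" using res(1)[OF Dp] by auto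
   have "of_int h * \<mu> <= of_int h * D" using \<mu> h0 by (intro mult_left_mono) auto
   then have hm: "of_int h * \<mu> <= real q" using hD sq q by (smt (verit) real_sqrt_ge_zero of_nat_0_le_iff)
   have "norm (J h k) <= 14 / sqrt (of_int h * \<mu> / real q)"
    unfolding J_def using h0 \<mu> hm hD sq res(2)[OF Dp] D(1) by (intro phase_sum_resonant[where D = D]) auto
   also have "14 / sqrt (of_int h * \<mu> / real q) = 14 * sqrt (real q / \<mu>) / sqrt (of_int h)"
    using h0 \<mu> q by (simp add: real_sqrt_divide real_sqrt_mult)
   finally have "norm (J h k) / of_int h <= 14 * sqrt (real q / \<mu>) / sqrt (of_int h) / of_int h"
    using h0 by (intro divide_right_mono) auto
   also have "... = 14 * sqrt (real q / \<mu>) / (of_int h * sqrt (of_int h))" by (simp add: mult.commute)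
   also have "... <= 14 * sqrt (real q / \<mu>) / (2 ^ i * sqrt (2 ^ i))"
    using a \<mu> h0 by (intro divide_left_mono mult_mono mult_pos_pos) auto
   also have "... = (if D > 0 & 2 ^ j <= 4 * 2 ^ i * D then 14 * sqrt (real q / \<mu>) / (2 ^ i * sqrt (2 ^ i)) else 0)"
   proof -
    have "2 ^ j <= 4 * 2 ^ i * D" using b kD mult_right_mono[OF a(2) D(2)] by simp
    then show ?thesis using Dp by simp
   qed
   finally show ?thesis unfolding w_def i_def[symmetric] j_def[symmetric] using w1 by linarith
  qed
  have ai: "1 <= (2::real) ^ i" "(2::real) ^ i <= sqrt q" "1 <= (2::real) ^ j" using order_trans[OF a(1) hr] by auto
  have aD: "2 ^ i * D <= sqrt q" using mult_right_mono[OF a(1) D(2)] hD by linarith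
  have p1: "min N (4 * real q / 2 ^ j) / 2 ^ i * cell (2 ^ i) (2 ^ j) <= 144 * \<Gamma> * (real q * (sqrt q * N powr (1/4) + real q powr (5/8)))"
   using ai N0 by (intro cell_nonresonant) auto
  have p2: "(if D > 0 & 2 ^ j <= 4 * 2 ^ i * D then 14 * sqrt (real q / \<mu>) / (2 ^ i * sqrt (2 ^ i)) else 0) * cell (2 ^ i) (2 ^ j) <= 2016 * \<Gamma> * (real q * E)"
  proof (cases "D > 0 & 2 ^ j <= 4 * 2 ^ i * D")
   case True
   then have "14 * sqrt (real q / \<mu>) / (2 ^ i * sqrt (2 ^ i)) * cell (2 ^ i) (2 ^ j) <= 2016 * \<Gamma> * (real q * (real q powr (1/4) * D powr (3/4) / sqrt \<mu>))"
    using ai aD res(1) by (intro cell_resonant) auto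
   then show ?thesis using True by (simp add: E_def)
  next
   case False
   then have z: "(if D > 0 & 2 ^ j <= 4 * 2 ^ i * D then 14 * sqrt (real q / \<mu>) / (2 ^ i * sqrt (2 ^ i)) else 0) = 0" by auto
   show ?thesis unfolding z using G1 E0 by (auto intro!: mult_nonneg_nonneg)
  qed
  show "0 <= w (ilog h) (ilog k) & w (ilog h) (ilog k) * cell (2 ^ ilog h) (2 ^ ilog k) <= c"
   unfolding w_def i_def[symmetric] j_def[symmetric] c_def distrib_right using w1 w2 p1 p2
   by (intro conjI add_mono add_nonneg_nonneg)
 qed
 have "\<bar>\<Sum>i\<in>I. saw (x i)\<bar> <= real (card I) / H + (\<Sum>h=1..M. norm (\<Sum>i\<in>I. ee (real h * x i)) / real h)"
  by (rule saw_sum_bound[OF finI H M(1)])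
 also have "... <= \<Gamma> * N / H + (L * (2 * N * \<Gamma> * sqrt q) + L\<^sup>2 * c) / real q"
  using cI H W W0 W1 q by (intro add_mono divide_right_mono order_trans[OF W]) auto
 also have "(L * (2 * N * \<Gamma> * sqrt q) + L\<^sup>2 * c) / real q = 2 * \<Gamma> * L * N / sqrt q + L\<^sup>2 * (144 * \<Gamma> * (sqrt q * N powr (1/4) + real q powr (5/8)) + 2016 * \<Gamma> * E)"
 proof -
  have "sqrt q / real q = 1 / sqrt q" using q by (simp add: field_simps)
  moreover have "L * (2 * N * \<Gamma> * sqrt q) / real q = (2 * \<Gamma> * L * N) * (sqrt q / real q)" by simp
  ultimately have "L * (2 * N * \<Gamma> * sqrt q) / real q = 2 * \<Gamma> * L * N / sqrt q" by simp
  moreover have "L\<^sup>2 * c / real q = L\<^sup>2 * (144 * \<Gamma> * (sqrt q * N powr (1/4) + real q powr (5/8)) + 2016 * \<Gamma> * E)"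
   using q by (simp add: c_def field_simps)
  ultimately show ?thesis by (simp only: add_divide_distrib)
 qed
 also have "L\<^sup>2 * (144 * \<Gamma> * (sqrt q * N powr (1/4) + real q powr (5/8)) + 2016 * \<Gamma> * E) <= 2016 * \<Gamma> * L\<^sup>2 * (sqrt q * N powr (1/4) + real q powr (5/8) + E)"
 proof -
  have "144 * \<Gamma> * (sqrt q * N powr (1/4) + real q powr (5/8)) <= 2016 * \<Gamma> * (sqrt q * N powr (1/4) + real q powr (5/8))"
   using G1 by (intro mult_right_mono) auto
  then have "L\<^sup>2 * (144 * \<Gamma> * (sqrt q * N powr (1/4) + real q powr (5/8)) + 2016 * \<Gamma> * E) <= L\<^sup>2 * (2016 * \<Gamma> * (sqrt q * N powr (1/4) + real q powr (5/8)) + 2016 * \<Gamma> * E)"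
   by (intro mult_left_mono) auto
  then show ?thesis by (simp add: algebra_simps)
 qed
 also have "(\<Sum>i\<in>I. saw (x i)) = (\<Sum>n\<in>{u..<v}. \<Sum>P\<in>fib n. saw ((F n - of_int (fst P)) / real q))"
  unfolding I_def by (subst sum.Sigma) (auto simp: case_prod_unfold x_def)
 finally show ?thesis by (simp add: E_def add.assoc)
qed

end

section \<open>Points in boxes and the discrepancy of columns\<close>

context pointset
begin

lemma linear_phase_sum:
 assumes "k \<noteq> 0" "2 * \<bar>k\<bar> <= int q"
 shows "norm (\<Sum>n\<in>{u..<v}. eexp q (k * n)) <= 4 * real q / of_int \<bar>k\<bar>"
 using phase_sum_nonresonant[of u v "%_. 0" 0 k 0] assms by (simp add: eexp_def)

lemma linear_phase_trivial: "u <= v ==> norm (\<Sum>n\<in>{u..<v}. eexp q (k * n)) <= of_int (v - u)"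
 using sum_norm_le[of "{u..<v}" "%n. eexp q (k * n)" "%_. 1"] by simp

definition hits :: "int => int => int => nat" where
 "hits u v \<alpha> = card {m \<in> {u..<v}. [m = \<alpha>] (mod int q)}"

lemma hits_fourier:
 "of_nat q * of_nat (hits u v \<alpha>) = (\<Sum>h\<in>resid q. (\<Sum>m\<in>{u..<v}. eexp q (h * m)) * eexp q (- h * \<alpha>))"
proof -
 have "(\<Sum>h\<in>resid q. (\<Sum>m\<in>{u..<v}. eexp q (h * m)) * eexp q (- h * \<alpha>)) = (\<Sum>h\<in>resid q. \<Sum>m\<in>{u..<v}. eexp q (h * (m - \<alpha>)))"
  unfolding sum_distrib_right eexp_add[symmetric] by (simp add: right_diff_distrib)
 also have "... = (\<Sum>m\<in>{u..<v}. \<Sum>h\<in>resid q. eexp q (h * (m - \<alpha>)))" by (rule sum.swap)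
 also have "... = (\<Sum>m\<in>{u..<v}. if [m = \<alpha>] (mod int q) then of_nat q else 0)"
 proof (rule sum.cong[OF refl])
  fix m
  have "(\<Sum>h\<in>resid q. eexp q (h * (m - \<alpha>))) = (\<Sum>h\<in>{0..<int q}. eexp q (h * (m - \<alpha>)))"
   by (rule sum_resid[OF q0]) (auto intro!: eexp_cong cong_mult q0)
  then show "(\<Sum>h\<in>resid q. eexp q (h * (m - \<alpha>))) = (if [m = \<alpha>] (mod int q) then of_nat q else 0)"
   by (simp add: sum_eexp[OF q0] cong_iff_dvd_diff)
 qed
 also have "... = (\<Sum>m\<in>{m \<in> {u..<v}. [m = \<alpha>] (mod int q)}. of_nat q)"
  by (rule sum.inter_filter[symmetric]) simp
 finally show ?thesis by (simp add: hits_def mult.commute)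
qed

lemma split_axes:
 fixes f :: "int => int => real"
 assumes "finite R" "0 \<in> R"
 shows "(\<Sum>h\<in>R. \<Sum>k\<in>R. f h k) = f 0 0 + (\<Sum>h\<in>R - {0}. f h 0) + (\<Sum>k\<in>R - {0}. f 0 k) + (\<Sum>(h, k)\<in>(R - {0}) \<times> (R - {0}). f h k)"
proof -
 have "(\<Sum>h\<in>R. \<Sum>k\<in>R. f h k) = (\<Sum>h\<in>R. f h 0) + (\<Sum>h\<in>R. \<Sum>k\<in>R - {0}. f h k)"
  unfolding sum.distrib[symmetric] by (intro sum.cong refl sum.remove assms)
 also have "(\<Sum>h\<in>R. f h 0) = f 0 0 + (\<Sum>h\<in>R - {0}. f h 0)" by (intro sum.remove assms)
 also have "(\<Sum>h\<in>R. \<Sum>k\<in>R - {0}. f h k) = (\<Sum>k\<in>R - {0}. f 0 k) + (\<Sum>h\<in>R - {0}. \<Sum>k\<in>R - {0}. f h k)" by (intro sum.remove assms)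
 finally show ?thesis by (simp add: sum.cartesian_product)
qed

text \<open>Points of the periodic extension of \<open>A\<close> in a box: frequency (0, 0) gives
  the expected number, the two axes give the second term, and all other frequencies the
  third.\<close>

lemma box_count:
 assumes uv: "u1 <= v1" "u2 <= v2" "of_int (v1 - u1) <= Na" "of_int (v2 - u2) <= Nb" and N: "sqrt q <= Na" "sqrt q <= Nb"
 shows "(\<Sum>n\<in>{u2..<v2}. \<Sum>P\<in>fib n. real (hits u1 v1 (fst P)))
  <= Na * Nb / real q + 8 * \<Gamma> * L * (Na + Nb) / sqrt q + 2304 * \<Gamma> * L\<^sup>2 * (real q powr (1/4) * (Na * Nb) powr (1/4))"
proof -
 have q: "real q > 0" using q0 by simp
 have N0: "Na > 0" "Nb > 0" using N q by (auto intro: less_le_trans[of _ "sqrt q"])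
 define I where "I = (%h. \<Sum>m\<in>{u1..<v1}. eexp q (h * m))"
 define J where "J = (%k. \<Sum>n\<in>{u2..<v2}. eexp q (k * n))"
 define C where "C = (\<Sum>n\<in>{u2..<v2}. \<Sum>P\<in>fib n. real (hits u1 v1 (fst P)))"
 let ?R = "resid q"
 have "of_nat q * (of_nat q * complex_of_real C) = (\<Sum>n\<in>{u2..<v2}. of_nat q * (\<Sum>P\<in>fib n. of_nat q * of_nat (hits u1 v1 (fst P))))"
  by (simp add: C_def sum_distrib_left)
 also have "... = (\<Sum>n\<in>{u2..<v2}. of_nat q * (\<Sum>P\<in>fib n. \<Sum>h\<in>?R. I h * eexp q (- h * fst P)))"
  by (simp only: hits_fourier I_def)
 also have "... = (\<Sum>n\<in>{u2..<v2}. of_nat q * (\<Sum>h\<in>?R. \<Sum>P\<in>fib n. I h * eexp q (- h * fst P)))"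
  by (intro sum.cong refl arg_cong2[where f = "(*)"] sum.swap)
 also have "... = (\<Sum>n\<in>{u2..<v2}. \<Sum>h\<in>?R. I h * (of_nat q * (\<Sum>P\<in>fib n. eexp q (- h * fst P))))"
  by (simp add: sum_distrib_left mult_ac)
 also have "... = (\<Sum>n\<in>{u2..<v2}. \<Sum>h\<in>?R. I h * (\<Sum>k\<in>?R. eexp q (k * n) * expsum q A (- h) (- k)))"
  by (simp only: fib_def fiber_fourier)
 also have "... = (\<Sum>h\<in>?R. I h * (\<Sum>n\<in>{u2..<v2}. \<Sum>k\<in>?R. eexp q (k * n) * expsum q A (- h) (- k)))"
  by (subst sum.swap) (simp add: sum_distrib_left)
 also have "... = (\<Sum>h\<in>?R. I h * (\<Sum>k\<in>?R. \<Sum>n\<in>{u2..<v2}. eexp q (k * n) * expsum q A (- h) (- k)))"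
  by (intro sum.cong refl arg_cong2[where f = "(*)"] sum.swap)
 also have "... = (\<Sum>h\<in>?R. \<Sum>k\<in>?R. I h * (J k * expsum q A (- h) (- k)))"
  by (simp add: J_def sum_distrib_left sum_distrib_right)
 finally have e: "of_nat q * (of_nat q * complex_of_real C) = (\<Sum>h\<in>?R. \<Sum>k\<in>?R. I h * (J k * expsum q A (- h) (- k)))" .
 have C0: "C >= 0" unfolding C_def by (intro sum_nonneg) auto
 define f where "f = (%h k. (norm (I h) * norm (J k)) * norm (expsum q A h k))"
 have "real q * (real q * C) = norm (of_nat q * (of_nat q * complex_of_real C))" using C0 by (simp add: norm_mult)
 also have "... <= (\<Sum>h\<in>?R. \<Sum>k\<in>?R. f h k)"
  unfolding e by (intro order_trans[OF norm_sum] sum_mono) (simp add: norm_mult expsum_neg f_def mult.assoc)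
 also have "... = f 0 0 + (\<Sum>h\<in>?R - {0}. f h 0) + (\<Sum>k\<in>?R - {0}. f 0 k) + (\<Sum>(h, k)\<in>(?R - {0}) \<times> (?R - {0}). f h k)"
  using zero_in_resid[OF q0] by (intro split_axes) auto
 also have "... <= Na * Nb * real q + Nb * (L * (2 * (4 * real q) * \<Gamma> * sqrt q)) + Na * (L * (2 * (4 * real q) * \<Gamma> * sqrt q))
   + L\<^sup>2 * (2304 * \<Gamma> * (real q * (real q * (real q powr (1/4) * (Na * Nb) powr (1/4)))))"
 proof (intro add_mono)
  have I1: "norm (I h) <= Na" for h using linear_phase_trivial[OF uv(1), of h] uv(3) by (simp add: I_def)
  have J1: "norm (J k) <= Nb" for k using linear_phase_trivial[OF uv(2), of k] uv(4) by (simp add: J_def)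
  have I2: "norm (I h) <= 4 * real q / of_int \<bar>h\<bar>" if "h \<in> ?R - {0}" for h
   using linear_phase_sum[of h u1 v1] resid_abs[of h q] that by (simp add: I_def)
  have J2: "norm (J k) <= 4 * real q / of_int \<bar>k\<bar>" if "k \<in> ?R - {0}" for k
   using linear_phase_sum[of k u2 v2] resid_abs[of k q] that by (simp add: J_def)
  have "expsum q A 0 0 = of_nat (card A)" by (simp add: expsum_def case_prod_unfold)
  then show "f 0 0 <= Na * Nb * real q"
   unfolding f_def using I1 J1 cardA N0 by (intro mult_mono) auto
  have ra: "h \<noteq> 0 & \<bar>h\<bar> <= int q" if "h \<in> ?R - {0}" for h using resid_abs[of h q] that by auto
  have "(\<Sum>h\<in>?R - {0}. f h 0) <= (\<Sum>h\<in>?R - {0}. Nb * (norm (I h) * norm (expsum q A h 0)))"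
   unfolding f_def using mult_right_mono[OF J1[of 0], of "norm (I h) * norm (expsum q A h 0)" for h] by (intro sum_mono) (simp add: mult_ac)
  also have "... = Nb * (\<Sum>h\<in>?R - {0}. norm (I h) * norm (expsum q A h 0))" by (simp add: sum_distrib_left)
  also have "... <= Nb * (L * (2 * (4 * real q) * \<Gamma> * sqrt q))"
   using N0 by (intro mult_left_mono axis_dyadic axis_h I2 ra) auto
  finally show "(\<Sum>h\<in>?R - {0}. f h 0) <= Nb * (L * (2 * (4 * real q) * \<Gamma> * sqrt q))" .
  have "(\<Sum>k\<in>?R - {0}. f 0 k) <= (\<Sum>k\<in>?R - {0}. Na * (norm (J k) * norm (expsum q A 0 k)))"
   unfolding f_def using I1[of 0] by (intro sum_mono) (simp add: mult.assoc mult_right_mono)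
  also have "... = Na * (\<Sum>k\<in>?R - {0}. norm (J k) * norm (expsum q A 0 k))" by (simp add: sum_distrib_left)
  also have "... <= Na * (L * (2 * (4 * real q) * \<Gamma> * sqrt q))"
   using N0 by (intro mult_left_mono axis_dyadic axis_k J2 ra) auto
  finally show "(\<Sum>k\<in>?R - {0}. f 0 k) <= Na * (L * (2 * (4 * real q) * \<Gamma> * sqrt q))" .
  define W where "W = (%i j::nat. min Na (4 * real q / 2 ^ i) * min Nb (4 * real q / 2 ^ j))"
  have W0: "W i j >= 0" for i j using N0 by (simp add: W_def)
  have wi: "norm (I h) <= min Na (4 * real q / 2 ^ ilog h)" if "h \<in> ?R - {0}" for h
  proof -
   have "h \<noteq> 0" using that by simp
   from ilog_bounds(1)[OF this] have "real_of_int (2 ^ ilog h) <= real_of_int \<bar>h\<bar>" by (simp only: of_int_le_iff)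
   then have "4 * real q / of_int \<bar>h\<bar> <= 4 * real q / 2 ^ ilog h" using \<open>h \<noteq> 0\<close> by (intro divide_left_mono) auto
   then show ?thesis using I1[of h] I2[OF that] by simp
  qed
  have wj: "norm (J h) <= min Nb (4 * real q / 2 ^ ilog h)" if "h \<in> ?R - {0}" for h
  proof -
   have "h \<noteq> 0" using that by simp
   from ilog_bounds(1)[OF this] have "real_of_int (2 ^ ilog h) <= real_of_int \<bar>h\<bar>" by (simp only: of_int_le_iff)
   then have "4 * real q / of_int \<bar>h\<bar> <= 4 * real q / 2 ^ ilog h" using \<open>h \<noteq> 0\<close> by (intro divide_left_mono) auto
   then show ?thesis using J1[of h] J2[OF that] by simp
  qed
  \<comment> \<open>Since N >= sqrt q, the term q^(7/8) = q^(3/4) (sqrt q)^(1/4) of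
    \<open>weight_bound\<close> is absorbed by the other one.\<close>
  have wb: "min N (4 * real q / a) * (a powr (3/4) * (1 + 2 * a / sqrt q) powr (1/4)) <= 24 * (N powr (1/4) * real q powr (3/4))"
   if "a >= 1" "sqrt q <= N" for a N
  proof -
   have "0 <= sqrt q" by simp
   then have N0: "N >= 0" using that(2) by linarith
   have "real q powr (7/8) = real q powr (1/8 + 3/4)" by simp
   also have "... = real q powr (1/8) * real q powr (3/4)" by (rule powr_add)
   also have "real q powr (1/8) = (sqrt q) powr (1/4)" using q by (simp add: powr_half_sqrt[symmetric] powr_powr)
   also have "(sqrt q) powr (1/4) * real q powr (3/4) <= N powr (1/4) * real q powr (3/4)"
    using that by (intro mult_right_mono powr_mono2) auto
   finally have c: "real q powr (7/8) <= N powr (1/4) * real q powr (3/4)" .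
   have "12 * (x + y) <= 24 * x" if "y <= x" for x y :: real using that by simp
   from this[OF c] have "12 * (N powr (1/4) * real q powr (3/4) + real q powr (7/8)) <= 24 * (N powr (1/4) * real q powr (3/4))" .
   with weight_bound[OF that(1) N0] show ?thesis by (rule order_trans)
  qed
  show "(\<Sum>(h, k)\<in>(?R - {0}) \<times> (?R - {0}). f h k) <= L\<^sup>2 * (2304 * \<Gamma> * (real q * (real q * (real q powr (1/4) * (Na * Nb) powr (1/4)))))"
   unfolding f_def
  proof (rule double_dyadic[where W = W])
   fix h k assume hk: "(h, k) \<in> (?R - {0}) \<times> (?R - {0})"
   then show "h \<noteq> 0 & k \<noteq> 0 & 2 * \<bar>h\<bar> <= int q & 2 * \<bar>k\<bar> <= int q" using resid_abs by auto
   show "norm (I h) * norm (J k) <= W (ilog h) (ilog k)"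
    unfolding W_def using hk wi wj N0 by (intro mult_mono) auto
   define a where "a = (2::real) ^ ilog h"
   define b where "b = (2::real) ^ ilog k"
   have ab: "a >= 1" "b >= 1" by (auto simp: a_def b_def)
   have "W (ilog h) (ilog k) * cell a b = 4 * \<Gamma> * real q powr (3/4) * ((min Na (4 * real q / a) * (a powr (3/4) * (1 + 2 * a / sqrt q) powr (1/4)))
     * (min Nb (4 * real q / b) * (b powr (3/4) * (1 + 2 * b / sqrt q) powr (1/4))))"
    using ab by (simp add: W_def a_def b_def powr_mult)
   also have "... <= 4 * \<Gamma> * real q powr (3/4) * ((24 * (Na powr (1/4) * real q powr (3/4))) * (24 * (Nb powr (1/4) * real q powr (3/4))))"
    using ab N N0 G1 by (intro mult_left_mono mult_mono wb) (auto intro!: mult_nonneg_nonneg)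
   also have "... = 2304 * \<Gamma> * ((real q powr (3/4) * real q powr (3/4) * real q powr (3/4)) * (Na powr (1/4) * Nb powr (1/4)))"
    by simp
   also have "real q powr (3/4) * real q powr (3/4) * real q powr (3/4) = real q * (real q * real q powr (1/4))"
   proof -
    have "real q powr (3/4) * real q powr (3/4) * real q powr (3/4) = real q powr (1 + (1 + 1/4))" by (simp add: powr_add[symmetric])
    also have "... = real q * (real q * real q powr (1/4))" using q by (simp only: powr_add) simp
    finally show ?thesis .
   qed
   also have "Na powr (1/4) * Nb powr (1/4) = (Na * Nb) powr (1/4)" using N0 by (simp add: powr_mult)
   finally show "0 <= W (ilog h) (ilog k) & W (ilog h) (ilog k) * cell (2 ^ ilog h) (2 ^ ilog k) <= 2304 * \<Gamma> * (real q * (real q * (real q powr (1/4) * (Na * Nb) powr (1/4))))"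
    using W0 by (simp add: a_def b_def mult.assoc)
  qed (use G1 in auto)
 qed
 also have "... = real q * (real q * (Na * Nb / real q + 8 * \<Gamma> * L * (Na + Nb) / sqrt q + 2304 * \<Gamma> * L\<^sup>2 * (real q powr (1/4) * (Na * Nb) powr (1/4))))"
 proof -
  have "real q / sqrt q = sqrt q" by (simp add: real_div_sqrt)
  then have "real q * (8 * \<Gamma> * L * (Na + Nb) / sqrt q) = 8 * \<Gamma> * L * (Na + Nb) * sqrt q" by (metis times_divide_eq_left times_divide_eq_right mult.commute)
  then show ?thesis using q by (simp add: distrib_left algebra_simps)
 qed
 finally show ?thesis using q by (simp add: C_def)
qed

text \<open>Frequency zero gives the main term; at k different from 0 the linear phase is at most 4q
  / |k|, and \<open>axis_dyadic\<close> applies. For the curve this supplies the mean values of N2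
  and N3 that make C and D accessible to partial summation.\<close>

lemma discrepancy:
 assumes uv: "u <= v"
 shows "\<bar>(\<Sum>n\<in>{u..<v}. real (card (fib n))) - real (card A) / real q * of_int (v - u)\<bar> <= 8 * \<Gamma> * L * sqrt q"
proof -
 have q: "real q > 0" using q0 by simp
 let ?R = "resid q"
 define J where "J = (%k. \<Sum>n\<in>{u..<v}. eexp q (k * n))"
 define C where "C = (\<Sum>n\<in>{u..<v}. real (card (fib n)))"
 have "of_nat q * complex_of_real C = (\<Sum>n\<in>{u..<v}. of_nat q * (\<Sum>P\<in>fib n. eexp q (0 * fst P)))"
  by (simp add: C_def sum_distrib_left)
 also have "... = (\<Sum>n\<in>{u..<v}. \<Sum>k\<in>?R. eexp q (k * n) * expsum q A 0 (- k))"
  by (simp only: fib_def fiber_fourier)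
 also have "... = (\<Sum>k\<in>?R. \<Sum>n\<in>{u..<v}. eexp q (k * n) * expsum q A 0 (- k))" by (rule sum.swap)
 also have "... = (\<Sum>k\<in>?R. J k * expsum q A 0 (- k))" by (simp add: J_def sum_distrib_right)
 also have "... = J 0 * expsum q A 0 0 + (\<Sum>k\<in>?R - {0}. J k * expsum q A 0 (- k))"
  using zero_in_resid[OF q0] by (simp add: sum.remove)
 also have "J 0 * expsum q A 0 0 = complex_of_real (of_int (v - u) * real (card A))"
  using uv by (simp add: J_def expsum_def case_prod_unfold)
 finally have "of_nat q * complex_of_real C - complex_of_real (of_int (v - u) * real (card A)) = (\<Sum>k\<in>?R - {0}. J k * expsum q A 0 (- k))" by simp
 then have "complex_of_real (real q * C - of_int (v - u) * real (card A)) = (\<Sum>k\<in>?R - {0}. J k * expsum q A 0 (- k))" by simp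
 then have "\<bar>real q * C - of_int (v - u) * real (card A)\<bar> = norm (\<Sum>k\<in>?R - {0}. J k * expsum q A 0 (- k))" by (metis norm_of_real)
 also have "... <= (\<Sum>k\<in>?R - {0}. norm (J k) * norm (expsum q A 0 k))"
  using expsum_neg[of 0] by (intro order_trans[OF norm_sum] sum_mono) (simp add: norm_mult)
 also have "... <= L * (2 * (4 * real q) * \<Gamma> * sqrt q)"
 proof (rule axis_dyadic[OF _ _ _ axis_k])
  fix k assume k: "k \<in> ?R - {0}"
  then show "k \<noteq> 0 & \<bar>k\<bar> <= int q" using resid_abs[of k q] by auto
  show "norm (J k) <= 4 * real q / of_int \<bar>k\<bar>" using linear_phase_sum[of k u v] resid_abs[of k q] k by (simp add: J_def)
 qed auto
 finally have "\<bar>real q * C - of_int (v - u) * real (card A)\<bar> / real q <= L * (2 * (4 * real q) * \<Gamma> * sqrt q) / real q"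
  by (rule divide_right_mono) simp
 also have "\<bar>real q * C - of_int (v - u) * real (card A)\<bar> / real q = \<bar>C - real (card A) / real q * of_int (v - u)\<bar>"
 proof -
  have "real q * C - of_int (v - u) * real (card A) = real q * (C - real (card A) / real q * of_int (v - u))" using q by (simp add: right_diff_distrib del: of_int_diff)
  then show ?thesis using q by (simp add: abs_mult)
 qed
 finally show ?thesis using q by (simp add: C_def mult_ac)
qed

lemma hits_floor:
 assumes "0 <= w" "w <= x"
 shows "real (hits (\<lfloor>w\<rfloor> + 1) (\<lfloor>x\<rfloor> + 1) \<alpha>) = of_int \<lfloor>(x - of_int \<alpha>) / real q\<rfloor> - of_int \<lfloor>(w - of_int \<alpha>) / real q\<rfloor>"
proof -
 have q: "real q > 0" using q0 by simp
 define s where "s = \<lfloor>(w - of_int \<alpha>) / real q\<rfloor>"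
 define t where "t = \<lfloor>(x - of_int \<alpha>) / real q\<rfloor>"
 have st: "s <= t" unfolding s_def t_def using assms q by (intro floor_mono divide_right_mono) auto
 have lift: "\<alpha> + int q * j <= \<lfloor>z\<rfloor> \<longleftrightarrow> j <= \<lfloor>(z - of_int \<alpha>) / real q\<rfloor>" for z :: real and j
  using q by (simp add: le_floor_iff le_divide_eq) (auto simp: algebra_simps)
 have "bij_betw (%j. \<alpha> + int q * j) {s + 1..t} {m \<in> {\<lfloor>w\<rfloor> + 1..<\<lfloor>x\<rfloor> + 1}. [m = \<alpha>] (mod int q)}"
 proof (rule bij_betw_imageI)
  show "inj_on (%j. \<alpha> + int q * j) {s + 1..t}" using q0 by (auto simp: inj_on_def)
  show "(%j. \<alpha> + int q * j) ` {s + 1..t} = {m \<in> {\<lfloor>w\<rfloor> + 1..<\<lfloor>x\<rfloor> + 1}. [m = \<alpha>] (mod int q)}"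
  proof
   show "(%j. \<alpha> + int q * j) ` {s + 1..t} \<subseteq> {m \<in> {\<lfloor>w\<rfloor> + 1..<\<lfloor>x\<rfloor> + 1}. [m = \<alpha>] (mod int q)}"
   proof (rule image_subsetI)
    fix j assume j: "j \<in> {s + 1..t}"
    then have "\<alpha> + int q * j <= \<lfloor>x\<rfloor>" "~ \<alpha> + int q * j <= \<lfloor>w\<rfloor>" unfolding lift by (auto simp: s_def t_def)
    then show "\<alpha> + int q * j \<in> {m \<in> {\<lfloor>w\<rfloor> + 1..<\<lfloor>x\<rfloor> + 1}. [m = \<alpha>] (mod int q)}" by (auto simp: cong_def)
   qed
   show "{m \<in> {\<lfloor>w\<rfloor> + 1..<\<lfloor>x\<rfloor> + 1}. [m = \<alpha>] (mod int q)} \<subseteq> (%j. \<alpha> + int q * j) ` {s + 1..t}"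
   proof
    fix m assume m: "m \<in> {m \<in> {\<lfloor>w\<rfloor> + 1..<\<lfloor>x\<rfloor> + 1}. [m = \<alpha>] (mod int q)}"
    then obtain j where j: "m = \<alpha> + int q * j" by (metis (mono_tags, lifting) cong_iff_lin cong_sym mem_Collect_eq)
    have "j <= t" using lift[of j x] m j by (simp add: t_def)
    moreover have "~ j <= s" using lift[of j w] m j by (simp add: s_def)
    ultimately show "m \<in> (%j. \<alpha> + int q * j) ` {s + 1..t}" using j by auto
   qed
  qed
 qed
 then have "hits (\<lfloor>w\<rfloor> + 1) (\<lfloor>x\<rfloor> + 1) \<alpha> = card {s + 1..t}" unfolding hits_def by (rule bij_betw_same_card[symmetric])
 then show ?thesis using st by (simp add: s_def t_def)
qed

text \<open>Column n of the hyperbola problem: points with first coordinate in the half-open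
  interval from w (excluded) to x, minus their expected number. In the two halves of the hyperbola w
  is 0 and Y.\<close>

definition err :: "real => real => int => real" where
 "err w x n = (\<Sum>P\<in>fib n. real (hits (\<lfloor>w\<rfloor> + 1) (\<lfloor>x\<rfloor> + 1) (fst P))) - real (card (fib n)) * (x - w) / real q"

lemma err_saw:
 assumes "0 <= w" "w <= x"
 shows "err w x n = (\<Sum>P\<in>fib n. saw ((x - of_int (fst P)) / real q)) - (\<Sum>P\<in>fib n. saw ((w - of_int (fst P)) / real q))"
proof -
 have "real (hits (\<lfloor>w\<rfloor> + 1) (\<lfloor>x\<rfloor> + 1) \<alpha>) - (x - w) / real q = saw ((x - of_int \<alpha>) / real q) - saw ((w - of_int \<alpha>) / real q)" for \<alpha>
  unfolding hits_floor[OF assms] saw_def by (simp add: diff_divide_distrib)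
 then have "(\<Sum>P\<in>fib n. saw ((x - of_int (fst P)) / real q)) - (\<Sum>P\<in>fib n. saw ((w - of_int (fst P)) / real q)) = (\<Sum>P\<in>fib n. real (hits (\<lfloor>w\<rfloor> + 1) (\<lfloor>x\<rfloor> + 1) (fst P)) - (x - w) / real q)"
  by (simp add: sum_subtractf[symmetric])
 also have "... = err w x n" by (simp add: err_def sum_subtractf)
 finally show ?thesis by simp
qed

lemma err_trivial:
 assumes "0 <= w" "w <= x"
 shows "\<bar>err w x n\<bar> <= \<Gamma>"
proof -
 have s: "\<bar>saw z\<bar> <= 1 / 2" for z unfolding saw_def by linarith
 have "\<bar>saw z - saw z'\<bar> <= 1" for z z' using s[of z] s[of z'] by linarith
 then have "\<bar>err w x n\<bar> <= (\<Sum>P\<in>fib n. 1)"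
  unfolding err_saw[OF assms] sum_subtractf[symmetric] by (intro order_trans[OF sum_abs] sum_mono)
 also have "... <= \<Gamma>" using card_fib[of n] by simp
 finally show ?thesis .
qed

end

section \<open>The error on a dyadic block under the hyperbola\<close>

lemma powr_difference_bounds:
 fixes c \<kappa> :: real
 defines "F \<equiv> %z. c * z powr (- \<kappa>)"
 assumes c: "c > 0" and k: "1 / 2 <= \<kappa>" "\<kappa> <= 2" and z: "z > 0"
 shows "\<bar>F (z + 1) - F z\<bar> <= 2 * c * z powr (- \<kappa> - 1)"
  and "c * (z + 2) powr (- \<kappa> - 2) * (3 / 4) <= (F (z + 1 + 1) - F (z + 1)) - (F (z + 1) - F z)"
proof -
 define F1 where "F1 = (%z. - \<kappa> * c * z powr (- \<kappa> - 1))"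
 define F2 where "F2 = (%z. \<kappa> * (\<kappa> + 1) * c * z powr (- \<kappa> - 2))"
 have d1: "DERIV F x :> F1 x" if "x > 0" for x
  unfolding F_def F1_def using that by (auto intro!: derivative_eq_intros simp: algebra_simps)
 have d2: "DERIV F1 x :> F2 x" if "x > 0" for x
  unfolding F1_def F2_def using that by (auto intro!: derivative_eq_intros simp: algebra_simps)
 have "\<exists>x. z < x & x < z + 1 & F (z + 1) - F z = (z + 1 - z) * F1 x"
  using z d1 by (intro MVT2) auto
 then obtain x where x: "z < x" "x < z + 1" "F (z + 1) - F z = F1 x" by auto
 have "\<bar>F1 x\<bar> = \<kappa> * c * x powr (- \<kappa> - 1)" using c k by (simp add: F1_def abs_mult)
 also have "... <= 2 * c * z powr (- \<kappa> - 1)"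
  using c k x z by (intro mult_mono powr_mono2') auto
 finally show "\<bar>F (z + 1) - F z\<bar> <= 2 * c * z powr (- \<kappa> - 1)" using x by simp
 define G where "G = (%z. F (z + 1) - F z)"
 have dG: "DERIV G x :> F1 (x + 1) - F1 x" if "x > 0" for x
 proof -
  have "DERIV (%x. F (x + 1)) x :> F1 (x + 1)"
   using DERIV_shift[of F "F1 (x + 1)" x 1] d1[of "x + 1"] that by simp
  then show ?thesis unfolding G_def by (intro DERIV_diff d1 that)
 qed
 have "\<exists>x. z < x & x < z + 1 & G (z + 1) - G z = (z + 1 - z) * (F1 (x + 1) - F1 x)"
  using z dG by (intro MVT2) auto
 then obtain x where x: "z < x" "x < z + 1" "G (z + 1) - G z = F1 (x + 1) - F1 x" by auto
 have "\<exists>y. x < y & y < x + 1 & F1 (x + 1) - F1 x = (x + 1 - x) * F2 y"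
  using x z d2 by (intro MVT2) auto
 then obtain y where y: "x < y" "y < x + 1" "F1 (x + 1) - F1 x = F2 y" by auto
 have "1 / 2 * (1 / 2 + 1) <= \<kappa> * (\<kappa> + 1)" using k by (intro mult_mono) auto
 then have "3 / 4 * c * (z + 2) powr (- \<kappa> - 2) <= F2 y"
  unfolding F2_def using x y z k c by (intro mult_mono powr_mono2') auto
 then show "c * (z + 2) powr (- \<kappa> - 2) * (3 / 4) <= (F (z + 1 + 1) - F (z + 1)) - (F (z + 1) - F z)"
  using x y by (simp add: G_def mult_ac)
qed

context pointset
begin

lemma hits_mono: "u <= u' ==> v' <= v ==> hits u' v' \<alpha> <= hits u v \<alpha>"
 unfolding hits_def by (rule card_mono, rule finite_subset[of _ "{u..<v}"]) auto

text \<open>If the box around the block is expected to hold only about T points, oscillation is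
  irrelevant: both the number of points and its expected value are of order T up to the factors
  \<Gamma> and \<open>L\<close>, the former by \<open>box_count\<close>.\<close>

lemma block_error_small:
 assumes BT: "B > 0" "T > 0" and small: "A0 * B <= real q * T" and A0: "sqrt q <= A0" and B: "sqrt q <= B"
  and len: "u <= v" "of_int (v - u) <= 2 * B"
  and h1: "(A0 * B) powr (1/4) * real q powr (1/4) <= T" and h2: "B <= T * sqrt q"
  and w: "0 <= w" "\<And>n. n \<in> {u..<v} ==> w <= F n" "\<And>n. n \<in> {u..<v} ==> F n <= A0"
 shows "\<bar>\<Sum>n\<in>{u..<v}. err w (F n) n\<bar> <= 10000 * \<Gamma> * L\<^sup>2 * T"
proof -
 have q: "real q > 0" "sqrt q > 0" using q0 by auto
 have A00: "A0 > 0" using A0 q by linarith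
 have LL: "1 <= L\<^sup>2" "L <= L\<^sup>2" using L1 one_le_power[of L 2] by (auto simp: power2_eq_square)
 have GT: "\<Gamma> * T > 0" using G1 BT by simp
 have "(\<Sum>n\<in>{u..<v}. \<Sum>P\<in>fib n. real (hits 1 (\<lfloor>A0\<rfloor> + 1) (fst P)))
  <= A0 * (2 * B) / real q + 8 * \<Gamma> * L * (A0 + 2 * B) / sqrt q + 2304 * \<Gamma> * L\<^sup>2 * (real q powr (1/4) * (A0 * (2 * B)) powr (1/4))"
  using len A00 A0 B BT by (intro box_count) auto
 also have "... <= 2 * T + 8 * \<Gamma> * L * (3 * T) + 2304 * \<Gamma> * L\<^sup>2 * (2 * T)"
 proof (intro add_mono)
  show "A0 * (2 * B) / real q <= 2 * T" using small q by (simp add: field_simps)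
  have "A0 * sqrt q <= A0 * B" using B A00 by (intro mult_left_mono) auto
  also have "... <= (T * sqrt q) * sqrt q" using small unfolding mult.assoc by (simp add: mult.commute)
  finally have "A0 <= T * sqrt q" using q by simp
  then have "(A0 + 2 * B) / sqrt q <= 3 * T" using h2 q by (simp add: field_simps)
  then have "8 * \<Gamma> * L * ((A0 + 2 * B) / sqrt q) <= 8 * \<Gamma> * L * (3 * T)"
   using G1 L1 by (intro mult_left_mono) auto
  then show "8 * \<Gamma> * L * (A0 + 2 * B) / sqrt q <= 8 * \<Gamma> * L * (3 * T)" by simp
  have "(A0 * (2 * B)) powr (1/4) = 2 powr (1/4) * (A0 * B) powr (1/4)"
   using A00 BT by (simp add: powr_mult)
  also have "... <= 2 powr 1 * (A0 * B) powr (1/4)" by (intro mult_right_mono powr_mono) auto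
  finally have "real q powr (1/4) * (A0 * (2 * B)) powr (1/4) <= real q powr (1/4) * (2 * (A0 * B) powr (1/4))"
   by (intro mult_left_mono) auto
  also have "... <= 2 * T" using h1 by (simp add: mult_ac)
  finally show "2304 * \<Gamma> * L\<^sup>2 * (real q powr (1/4) * (A0 * (2 * B)) powr (1/4)) <= 2304 * \<Gamma> * L\<^sup>2 * (2 * T)"
   using G1 by (intro mult_left_mono) auto
 qed
 finally have a: "(\<Sum>n\<in>{u..<v}. \<Sum>P\<in>fib n. real (hits 1 (\<lfloor>A0\<rfloor> + 1) (fst P))) <= 2 * T + 8 * \<Gamma> * L * (3 * T) + 2304 * \<Gamma> * L\<^sup>2 * (2 * T)" .
 have "\<bar>err w (F n) n\<bar> <= (\<Sum>P\<in>fib n. real (hits 1 (\<lfloor>A0\<rfloor> + 1) (fst P))) + \<Gamma> * A0 / real q" if n: "n \<in> {u..<v}" for n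
 proof -
  have "\<bar>err w (F n) n\<bar> <= (\<Sum>P\<in>fib n. real (hits (\<lfloor>w\<rfloor> + 1) (\<lfloor>F n\<rfloor> + 1) (fst P))) + real (card (fib n)) * (F n - w) / real q"
  proof -
   have "0 <= (\<Sum>P\<in>fib n. real (hits (\<lfloor>w\<rfloor> + 1) (\<lfloor>F n\<rfloor> + 1) (fst P)))" by (intro sum_nonneg) auto
   moreover have "0 <= real (card (fib n)) * (F n - w) / real q" using w(2)[OF n] by simp
   moreover have "\<bar>a - b\<bar> <= a + b" if "0 <= a" "0 <= b" for a b :: real using that by linarith
   ultimately show ?thesis unfolding err_def by blast
  qed
  also have "... <= (\<Sum>P\<in>fib n. real (hits 1 (\<lfloor>A0\<rfloor> + 1) (fst P))) + \<Gamma> * A0 / real q"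
  proof (intro add_mono sum_mono divide_right_mono mult_mono)
   show "real (hits (\<lfloor>w\<rfloor> + 1) (\<lfloor>F n\<rfloor> + 1) (fst P)) <= real (hits 1 (\<lfloor>A0\<rfloor> + 1) (fst P))" for P
    using w(1) w(3)[OF n] by (intro of_nat_mono hits_mono) (auto intro: floor_mono)
  qed (use card_fib w(1) w(2)[OF n] w(3)[OF n] G1 q in auto)
  finally show ?thesis .
 qed
 then have "\<bar>\<Sum>n\<in>{u..<v}. err w (F n) n\<bar> <= (\<Sum>n\<in>{u..<v}. (\<Sum>P\<in>fib n. real (hits 1 (\<lfloor>A0\<rfloor> + 1) (fst P))) + \<Gamma> * A0 / real q)"
  by (intro order_trans[OF sum_abs] sum_mono)
 also have "... = (\<Sum>n\<in>{u..<v}. \<Sum>P\<in>fib n. real (hits 1 (\<lfloor>A0\<rfloor> + 1) (fst P))) + of_int (v - u) * (\<Gamma> * A0 / real q)"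
  using len by (simp add: sum.distrib)
 also have "... <= (2 * T + 8 * \<Gamma> * L * (3 * T) + 2304 * \<Gamma> * L\<^sup>2 * (2 * T)) + (2 * B) * (\<Gamma> * A0 / real q)"
  using a len G1 A00 by (intro add_mono mult_right_mono) auto
 also have "(2 * B) * (\<Gamma> * A0 / real q) = 2 * \<Gamma> * (A0 * B / real q)" by simp
 also have "... <= 2 * \<Gamma> * T" using small q G1 by (intro mult_left_mono) (auto simp: field_simps)
 finally have b: "\<bar>\<Sum>n\<in>{u..<v}. err w (F n) n\<bar> <= (2 * T + 8 * \<Gamma> * L * (3 * T) + 2304 * \<Gamma> * L\<^sup>2 * (2 * T)) + 2 * \<Gamma> * T" by simp
 have "T <= \<Gamma> * L\<^sup>2 * T" using mult_mono[of 1 \<Gamma> 1 "L\<^sup>2"] LL G1 BT by simp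
 moreover have "\<Gamma> * L * T <= \<Gamma> * L\<^sup>2 * T" using LL G1 BT by (intro mult_right_mono mult_left_mono) auto
 moreover have "\<Gamma> * 1 * T <= \<Gamma> * L\<^sup>2 * T" using LL G1 BT by (intro mult_right_mono mult_left_mono) auto
 moreover have "\<Gamma> * L\<^sup>2 * T > 0" using G1 L1 BT by simp
 ultimately show ?thesis using b by (simp add: mult_ac)
qed

text \<open>Apply \<open>saw_block\<close> to the curve and to the constant lower end w, with H = B
  / (2T) so that the term N/H is of order T. The hypotheses correspond to its remaining terms and
  side conditions: \<open>h1\<close> bounds the resonant term, \<open>h2\<close> the axis k = 0,
  \<open>h4\<close> the nonresonant terms, while \<open>h3\<close> and \<open>h5\<close> keep M D
  and M below sqrt q.\<close>

lemma block_error_large: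
 fixes c \<kappa> B T w :: real and u v :: int
 defines "F \<equiv> %z. c * z powr (- \<kappa>)" and "A0 \<equiv> c * B powr (- \<kappa>)"
 assumes c: "c > 0" and k: "1 / 2 <= \<kappa>" "\<kappa> <= 2" and q4: "q >= 4"
  and T: "sqrt q <= T" and B: "2 * T <= B"
  and J: "u <= v" "B < of_int u" "of_int v <= 2 * B + 1"
  and h1: "(A0 * B) powr (1/4) * real q powr (1/4) <= T" and h2: "B <= T * sqrt q"
  and h3: "(B / T)\<^sup>2 * (A0 / B) <= sqrt q" and h4: "sqrt q * B powr (1/4) <= T" and h5: "(B / T)\<^sup>2 <= sqrt q"
  and w: "0 <= w" "\<And>n. n \<in> {u..<v} ==> w <= F (of_int n)"
 shows "\<bar>\<Sum>n\<in>{u..<v}. err w (F (of_int n)) n\<bar> <= 100000 * \<Gamma> * L\<^sup>2 * T"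
proof -
 have q: "real q > 0" "sqrt q > 0" using q0 by auto
 have T0: "T > 0" using T q by linarith
 have s2: "sqrt q >= 2" using q4 real_le_rsqrt[of 2 q] by simp
 have B1: "B >= 4" using s2 T B by linarith
 have LL: "1 <= L\<^sup>2" "L <= L\<^sup>2" using L1 one_le_power[of L 2] by (auto simp: power2_eq_square)
 have A00: "A0 > 0" using c B1 by (simp add: A0_def)
 define s where "s = A0 / B"
 have s0: "s > 0" using A00 B1 by (simp add: s_def)
 have s_eq: "s = c * B powr (- \<kappa> - 1)"
  using B1 by (simp add: s_def A0_def powr_diff)
 \<comment> \<open>The true lower bound for the second difference is s / (108 B), where 108 = 81 *
   4/3: the factor 81 = 3^4 comes from n + 2 <= 3B and \<kappa> <= 2, and 3/4 from
   \<open>powr_difference_bounds\<close>. It is rounded to 128.\<close>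
 define \<mu> where "\<mu> = s / (128 * B)"
 define H where "H = B / (2 * T)"
 define M where "M = nat \<lceil>H\<^sup>2\<rceil>"
 have H1: "H >= 1" using B T0 by (simp add: H_def)
 then have H2: "H\<^sup>2 >= 1" by (simp add: one_le_power)
 have M: "H\<^sup>2 <= real M" "real M <= 2 * H\<^sup>2"
  unfolding M_def using H2 by linarith+
 have HB: "2 * H\<^sup>2 = (B / T)\<^sup>2 / 2" by (simp add: H_def power2_eq_square)
 have Mq: "real M <= sqrt q" using M HB h5 q by linarith
 have MD: "real M * (2 * s) <= sqrt q"
 proof -
  have "real M * (2 * s) <= ((B / T)\<^sup>2 / 2) * (2 * s)" using M HB s0 by (intro mult_right_mono) auto
  then show ?thesis using h3 by (simp add: s_def)
 qed
 define N where "N = (of_int (v - u) :: real)"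
 have N: "0 <= N" "N <= 2 * B" unfolding N_def using J B1 by auto
 have Npow: "N powr (1/4) <= 2 * B powr (1/4)"
 proof -
  have "N powr (1/4) <= (2 * B) powr (1/4)" using N by (intro powr_mono2) auto
  also have "... = 2 powr (1/4) * B powr (1/4)" using B1 by (simp add: powr_mult)
  also have "... <= 2 powr 1 * B powr (1/4)" by (intro mult_right_mono powr_mono) auto
  finally show ?thesis by simp
 qed
 have x1: "sqrt q * N powr (1/4) <= 2 * T"
 proof -
  have "sqrt q * N powr (1/4) <= sqrt q * (2 * B powr (1/4))" using Npow by (intro mult_left_mono) auto
  then show ?thesis using h4 by simp
 qed
 have x2: "real q powr (5/8) <= T"
 proof -
  have "real q powr (5/8) = real q powr (1/2 + 1/8)" by simp
  also have "... = real q powr (1/2) * real q powr (1/8)" by (rule powr_add)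
  also have "real q powr (1/2) = sqrt q" using q by (simp add: powr_half_sqrt)
  also have "real q powr (1/8) = (sqrt q) powr (1/4)" using q by (simp add: powr_half_sqrt[symmetric] powr_powr)
  also have "sqrt q * (sqrt q) powr (1/4) <= sqrt q * B powr (1/4)"
   using T B q T0 by (intro mult_left_mono powr_mono2) auto
  finally show ?thesis using h4 by linarith
 qed
 have gen: "X <= 50000 * \<Gamma> * L\<^sup>2 * T"
  if X: "X <= \<Gamma> * N / H + 2 * \<Gamma> * L * N / sqrt q + 2016 * \<Gamma> * L\<^sup>2 * (sqrt q * N powr (1/4) + real q powr (5/8) + E)" and E: "E <= 20 * T" for X E
 proof -
  have "\<Gamma> * (N / H) <= \<Gamma> * (4 * T)"
  proof (intro mult_left_mono)
   have "N / H <= 2 * B / H" using N H1 by (intro divide_right_mono) auto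
   also have "... = 4 * T" using B1 T0 by (simp add: H_def)
   finally show "N / H <= 4 * T" .
  qed (use G1 in auto)
  moreover have "(\<Gamma> * L) * (N / sqrt q) <= (\<Gamma> * L) * (2 * T)"
  proof (intro mult_left_mono)
   have "N / sqrt q <= 2 * B / sqrt q" using N q by (intro divide_right_mono) auto
   also have "... <= 2 * T" using h2 q by (simp add: field_simps)
   finally show "N / sqrt q <= 2 * T" .
  qed (use G1 L1 in auto)
  moreover have "(\<Gamma> * L\<^sup>2) * (sqrt q * N powr (1/4) + real q powr (5/8) + E) <= (\<Gamma> * L\<^sup>2) * (23 * T)"
   using x1 x2 E G1 by (intro mult_left_mono) auto
  moreover have "\<Gamma> * L * T <= \<Gamma> * L\<^sup>2 * T" using LL G1 T0 by (intro mult_right_mono mult_left_mono) auto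
  moreover have "\<Gamma> * 1 * T <= \<Gamma> * L\<^sup>2 * T" using LL G1 T0 by (intro mult_right_mono mult_left_mono) auto
  moreover have "\<Gamma> * L\<^sup>2 * T > 0" using G1 L1 T0 by simp
  moreover have "\<Gamma> * N / H = \<Gamma> * (N / H)" "2 * \<Gamma> * L * N / sqrt q = 2 * ((\<Gamma> * L) * (N / sqrt q))"
   "2016 * \<Gamma> * L\<^sup>2 * Q = 2016 * ((\<Gamma> * L\<^sup>2) * Q)" for Q by simp_all
  moreover have "\<Gamma> * (4 * T) = 4 * (\<Gamma> * 1 * T)" "(\<Gamma> * L) * (2 * T) = 2 * (\<Gamma> * L * T)"
   "(\<Gamma> * L\<^sup>2) * (23 * T) = 23 * (\<Gamma> * L\<^sup>2 * T)" "50000 * \<Gamma> * L\<^sup>2 * T = 50000 * (\<Gamma> * L\<^sup>2 * T)" by simp_all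
  ultimately show ?thesis using X by linarith
 qed
 \<comment> \<open>The lower end w does not depend on n and is treated as a phase with D = 0; the
   value 1 given to \<mu> is immaterial.\<close>
 have "\<bar>\<Sum>n\<in>{u..<v}. \<Sum>P\<in>fib n. saw ((w - of_int (fst P)) / real q)\<bar>
   <= \<Gamma> * of_int (v - u) / H + 2 * \<Gamma> * L * of_int (v - u) / sqrt q + 2016 * \<Gamma> * L\<^sup>2 * (sqrt q * of_int (v - u) powr (1/4) + real q powr (5/8) + (if (0::real) = 0 then 0 else real q powr (1/4) * 0 powr (3/4) / sqrt 1))"
  using J q4 H1 M Mq by (intro saw_block) auto
 then have "\<bar>\<Sum>n\<in>{u..<v}. \<Sum>P\<in>fib n. saw ((w - of_int (fst P)) / real q)\<bar>
   <= \<Gamma> * N / H + 2 * \<Gamma> * L * N / sqrt q + 2016 * \<Gamma> * L\<^sup>2 * (sqrt q * N powr (1/4) + real q powr (5/8) + 0)"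
  by (simp add: N_def)
 then have e2: "\<bar>\<Sum>n\<in>{u..<v}. \<Sum>P\<in>fib n. saw ((w - of_int (fst P)) / real q)\<bar> <= 50000 * \<Gamma> * L\<^sup>2 * T"
  by (rule gen) (use T0 in simp)
 define F' where "F' = (%n::int. F (of_int n))"
 have step: "F' (n + 1) - F' n + \<mu> <= F' (n + 1 + 1) - F' (n + 1)" if n: "u <= n" "n + 1 < v" for n
 proof -
  have n0: "of_int n > (0::real)" "of_int n + 2 <= 3 * B"
  proof -
   have "real_of_int u <= of_int n" using n(1) by simp
   then show "of_int n > (0::real)" using J B1 by linarith
   have "n + 2 <= v" using n by simp
   then have "real_of_int (n + 2) <= of_int v" by (simp only: of_int_le_iff)
   then show "of_int n + 2 <= 3 * B" using J B1 by simp
  qed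
  have "\<mu> <= s / (108 * B)" unfolding \<mu>_def using s0 B1 by (intro divide_left_mono) auto
  also have "... = c * ((1 / 81) * (B powr (- \<kappa> - 1) / B)) * (3 / 4)" by (simp add: s_eq)
  also have "B powr (- \<kappa> - 1) / B = B powr (- \<kappa> - 2)"
  proof -
   have "B powr (- \<kappa> - 2) = B powr ((- \<kappa> - 1) - 1)" by (rule arg_cong[where f = "%x. B powr x"]) simp
   also have "... = B powr (- \<kappa> - 1) / B" using B1 by (subst powr_diff) auto
   finally show ?thesis by simp
  qed
  also have "c * ((1 / 81) * B powr (- \<kappa> - 2)) * (3 / 4) <= c * (3 * B) powr (- \<kappa> - 2) * (3 / 4)"
  proof -
   have "(3::real) powr (-4) <= 3 powr (- \<kappa> - 2)" using k by (intro powr_mono) auto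
   moreover have "(3::real) powr (-4) = 1 / 81" by (simp add: powr_minus powr_numeral divide_simps)
   ultimately have "(1 / 81) * B powr (- \<kappa> - 2) <= 3 powr (- \<kappa> - 2) * B powr (- \<kappa> - 2)"
    by (intro mult_right_mono) auto
   also have "... = (3 * B) powr (- \<kappa> - 2)" using B1 by (simp add: powr_mult)
   finally show ?thesis using c by (intro mult_right_mono mult_left_mono) auto
  qed
  also have "... <= c * (of_int n + 2) powr (- \<kappa> - 2) * (3 / 4)"
   using n0 k c by (intro mult_right_mono mult_left_mono powr_mono2') auto
  also have "... <= (F' (n + 1 + 1) - F' (n + 1)) - (F' (n + 1) - F' n)"
   using powr_difference_bounds(2)[OF c k n0(1)] by (simp add: F'_def F_def)
  finally show ?thesis by linarith
 qed
 have mu0: "\<mu> > 0" using s0 B1 by (simp add: \<mu>_def)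
 have mono: "F' (n + 1) - F' n <= F' (m + 1) - F' m" if "u <= n" "n <= m" "m < v" for n m
 proof -
  have "m < v --> F' (n + 1) - F' n <= F' (m + 1) - F' m" using that(2)
  proof (induction m rule: int_ge_induct)
   case (step i)
   then show ?case using step.IH \<open>\<And>n. u <= n ==> n + 1 < v ==> _ n\<close>[of i] that(1) mu0 by force
  qed simp
  then show ?thesis using that by simp
 qed
 have D: "\<bar>F' (n + 1) - F' n\<bar> <= 2 * s" if "u <= n" "n < v" for n
 proof -
  have n0: "B <= of_int n" using that J by (meson le_less_trans less_le_trans less_imp_le of_int_le_iff)
  have "\<bar>F' (n + 1) - F' n\<bar> <= 2 * c * of_int n powr (- \<kappa> - 1)"
   using powr_difference_bounds(1)[OF c k, of "of_int n"] n0 B1 by (simp add: F'_def F_def)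
  also have "... <= 2 * c * B powr (- \<kappa> - 1)"
   using n0 B1 k c by (intro mult_left_mono powr_mono2') auto
  finally show ?thesis by (simp add: s_eq)
 qed
 have "\<bar>\<Sum>n\<in>{u..<v}. \<Sum>P\<in>fib n. saw ((F' n - of_int (fst P)) / real q)\<bar>
   <= \<Gamma> * of_int (v - u) / H + 2 * \<Gamma> * L * of_int (v - u) / sqrt q + 2016 * \<Gamma> * L\<^sup>2 * (sqrt q * of_int (v - u) powr (1/4) + real q powr (5/8) + (if 2 * s = 0 then 0 else real q powr (1/4) * (2 * s) powr (3/4) / sqrt \<mu>))"
 proof (rule saw_block)
  have "\<mu> <= s / 1" unfolding \<mu>_def using s0 B1 by (intro divide_left_mono) auto
  then show "0 < \<mu> & \<mu> <= 2 * s" using mu0 s0 by linarith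
 qed (use J q4 mono D s0 step H1 M Mq MD in auto)
 then have "\<bar>\<Sum>n\<in>{u..<v}. \<Sum>P\<in>fib n. saw ((F' n - of_int (fst P)) / real q)\<bar>
   <= \<Gamma> * N / H + 2 * \<Gamma> * L * N / sqrt q + 2016 * \<Gamma> * L\<^sup>2 * (sqrt q * N powr (1/4) + real q powr (5/8) + real q powr (1/4) * (2 * s) powr (3/4) / sqrt \<mu>)"
  using s0 by (simp add: N_def)
 then have e1: "\<bar>\<Sum>n\<in>{u..<v}. \<Sum>P\<in>fib n. saw ((F' n - of_int (fst P)) / real q)\<bar> <= 50000 * \<Gamma> * L\<^sup>2 * T"
 proof (rule gen)
  have "(2 * s) powr (3/4) / sqrt \<mu> = (2 powr (3/4) * sqrt 128) * (s powr (1/4) * B powr (1/2))"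
  proof -
   have "(2 * s) powr (3/4) = 2 powr (3/4) * s powr (1/4 + 1/2)" using s0 by (simp add: powr_mult)
   also have "s powr (1/4 + 1/2) = s powr (1/4) * sqrt s" using s0 by (simp only: powr_add powr_half_sqrt)
   finally have "(2 * s) powr (3/4) = 2 powr (3/4) * s powr (1/4) * sqrt s" by simp
   moreover have "sqrt \<mu> = sqrt s / (sqrt 128 * sqrt B)" by (simp add: \<mu>_def real_sqrt_divide real_sqrt_mult)
   ultimately show ?thesis using s0 B1 by (simp add: powr_half_sqrt)
  qed
  also have "s powr (1/4) * B powr (1/2) = (A0 * B) powr (1/4)"
  proof -
   have "A0 * B = s * B\<^sup>2" using B1 by (simp add: s_def power2_eq_square)
   moreover have "(B\<^sup>2) powr (1/4) = B powr (1/2)" using B1 by (simp add: powr_numeral[symmetric] powr_powr del: powr_numeral)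
   ultimately show ?thesis using s0 by (simp add: powr_mult)
  qed
  also have "2 powr (3/4) * sqrt 128 * (A0 * B) powr (1/4) <= 20 * (A0 * B) powr (1/4)"
  proof (rule mult_right_mono)
   have "(2::real) powr (3/4) = sqrt (sqrt 8)"
   proof -
    have "sqrt (sqrt 8) = ((2::real) powr 3) powr (1/4)" by (simp add: powr_half_sqrt[symmetric] powr_powr)
    then show ?thesis by (simp only: powr_powr) simp
   qed
   also have "sqrt (sqrt 8) <= sqrt 3" by (simp add: real_le_lsqrt)
   finally have "2 powr (3/4) * sqrt 128 <= sqrt 3 * sqrt 128" by (intro mult_right_mono) auto
   also have "... = sqrt 384" by (simp add: real_sqrt_mult[symmetric])
   also have "... <= 20" by (intro real_le_lsqrt) auto
   finally show "2 powr (3/4) * sqrt 128 <= 20" .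
  qed auto
  finally have "real q powr (1/4) * ((2 * s) powr (3/4) / sqrt \<mu>) <= real q powr (1/4) * (20 * (A0 * B) powr (1/4))"
   by (rule mult_left_mono) auto
  then show "real q powr (1/4) * (2 * s) powr (3/4) / sqrt \<mu> <= 20 * T" using h1 by (simp add: mult_ac)
 qed
 have "(\<Sum>n\<in>{u..<v}. err w (F (of_int n)) n) = (\<Sum>n\<in>{u..<v}. \<Sum>P\<in>fib n. saw ((F' n - of_int (fst P)) / real q)) - (\<Sum>n\<in>{u..<v}. \<Sum>P\<in>fib n. saw ((w - of_int (fst P)) / real q))"
  unfolding sum_subtractf[symmetric] by (intro sum.cong refl) (simp add: err_saw[OF w(1) w(2)] F'_def sum_subtractf)
 then show ?thesis using e1 e2 by linarith
qed

text \<open>Blocks with few expected points go to \<open>block_error_small\<close>, the others to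
  \<open>block_error_large\<close>; accordingly \<open>h4\<close> is demanded only of the latter.
  For q < 4 the inequality B <= T sqrt q bounds the number of columns by 4T, and the trivial
  estimate suffices.\<close>

lemma block_error:
 fixes c \<kappa> B T w :: real and u v :: int
 defines "F \<equiv> %z. c * z powr (- \<kappa>)" and "A0 \<equiv> c * B powr (- \<kappa>)"
 assumes c: "c > 0" and k: "1 / 2 <= \<kappa>" "\<kappa> <= 2"
  and T: "sqrt q <= T" and B: "2 * T <= B" and A0: "sqrt q <= A0"
  and J: "u <= v" "B < of_int u" "of_int v <= 2 * B + 1"
  and h1: "(A0 * B) powr (1/4) * real q powr (1/4) <= T" and h2: "B <= T * sqrt q"
  and h3: "(B / T)\<^sup>2 * (A0 / B) <= sqrt q" and h4: "real q * T < A0 * B ==> sqrt q * B powr (1/4) <= T"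
  and h5: "(B / T)\<^sup>2 <= sqrt q"
  and w: "0 <= w" "\<And>n. n \<in> {u..<v} ==> w <= F (of_int n)"
 shows "\<bar>\<Sum>n\<in>{u..<v}. err w (F (of_int n)) n\<bar> <= 100000 * \<Gamma> * L\<^sup>2 * T"
proof -
 have q: "real q > 0" "sqrt q > 0" "real q >= 1" "sqrt q >= 1" using q0 by auto
 have T0: "T > 0" using T q by linarith
 have B1: "B >= 2" using q T B by linarith
 have LL: "1 <= L\<^sup>2" using L1 one_le_power[of L 2] by (auto simp: power2_eq_square)
 have len: "of_int (v - u) <= 2 * B" using J B1 by simp
 consider "q < 4" | "q >= 4" "A0 * B <= real q * T" | "q >= 4" "real q * T < A0 * B" by linarith
 then show ?thesis
 proof cases
  case 1
  have "sqrt q <= 2" using 1 by (intro real_le_lsqrt) auto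
  then have "T * sqrt q <= T * 2" using T0 by (intro mult_left_mono) auto
  then have "of_int (v - u) <= 4 * T" using len h2 by linarith
  have "\<bar>\<Sum>n\<in>{u..<v}. err w (F (of_int n)) n\<bar> <= (\<Sum>n\<in>{u..<v}. \<Gamma>)"
   using w by (intro order_trans[OF sum_abs] sum_mono err_trivial) auto
  also have "... = of_int (v - u) * \<Gamma>" using J by simp
  also have "... <= (4 * T) * \<Gamma>" using \<open>of_int (v - u) <= 4 * T\<close> G1 by (intro mult_right_mono) auto
  also have "... = 4 * (\<Gamma> * 1 * T)" by simp
  also have "... <= 100000 * (\<Gamma> * L\<^sup>2 * T)" using LL G1 T0 by (intro mult_mono) auto
  finally show ?thesis by simp
 next
  case 2
  have "\<bar>\<Sum>n\<in>{u..<v}. err w (F (of_int n)) n\<bar> <= 10000 * \<Gamma> * L\<^sup>2 * T"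
  proof (rule block_error_small[of B T A0])
   fix n assume n: "n \<in> {u..<v}"
   then have "real_of_int u <= of_int n" by simp
   then show "F (of_int n) <= A0" unfolding F_def A0_def using J c B1 k by (intro mult_left_mono powr_mono2') auto
  qed (use 2 A0 T B T0 B1 J len h1 h2 w in auto)
  also have "... <= 100000 * \<Gamma> * L\<^sup>2 * T" using G1 T0 by (intro mult_right_mono) auto
  finally show ?thesis .
 next
  case 3
  then show ?thesis unfolding F_def using c k T B J h1 h2 h3 h4 h5 w unfolding F_def A0_def
   by (intro block_error_large) auto
 qed
qed

end

context pointset
begin

text \<open>Columns up to 4T are estimated trivially, and the rest of the range up to Y is halved
  repeatedly. Since Y <= qT this takes about log q steps, independently of Y. The second entry of T
  comes from \<open>h3\<close> with \<kappa> = 3/2: on blocks B close to T it demands that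
  (Y/T)^(5/2) be at most of order sqrt q.\<close>

lemma hyperbola_error:
 fixes \<kappa> Y w :: real
 defines "F \<equiv> %z. Y powr (1 + \<kappa>) * z powr (- \<kappa>)"
  and "T \<equiv> max (Y powr (5/6) * real q powr (1/12)) (Y * real q powr (-1/5))"
 assumes k: "\<kappa> = 3/2 \<or> \<kappa> = 2/3" and Y: "sqrt q <= Y" and w: "0 <= w" "w <= Y"
 shows "\<bar>\<Sum>n\<in>{1..<\<lfloor>Y\<rfloor> + 1}. err w (F (of_int n)) n\<bar> <= 200000 * \<Gamma> * L ^ 3 * T"
proof -
 have q: "real q > 0" "sqrt q > 0" "real q >= 1" "sqrt q >= 1" using q0 by auto
 have Y1: "Y >= 1" using Y q by linarith
 have T0: "T > 0" unfolding T_def using Y1 q by (simp add: less_max_iff_disj)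
 \<comment> \<open>In logarithms every condition of \<open>block_error\<close> is a linear
   inequality between y, p, t and the logarithm b of the block length.\<close>
 define y where "y = ln Y"
 define p where "p = ln (real q)"
 define t where "t = ln T"
 have Yx: "Y = exp y" and qx: "real q = exp p" and Tx: "T = exp t"
  using Y1 q T0 by (simp_all add: y_def p_def t_def)
 have sqx: "sqrt q = exp (p / 2)" using q by (simp add: p_def powr_half_sqrt[symmetric] powr_def)
 have y: "p / 2 <= y" "p >= 0" "y >= 0" using Y q Y1 unfolding sqx Yx by (auto simp: p_def y_def)
 have t: "5 / 6 * y + p / 12 <= t" "y - p / 5 <= t"
 proof -
  have "Y powr (5/6) * real q powr (1/12) = exp (5 / 6 * y + p / 12)" unfolding Yx qx by (simp add: powr_def exp_add)
  moreover have "Y * real q powr (-1/5) = exp (y - p / 5)" unfolding Yx qx by (simp add: powr_def exp_add[symmetric])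
  ultimately have "exp (5 / 6 * y + p / 12) <= exp t" "exp (y - p / 5) <= exp t" unfolding Tx[symmetric] T_def by auto
  then show "5 / 6 * y + p / 12 <= t" "y - p / 5 <= t" by simp_all
 qed
 have Tq: "sqrt q <= T" unfolding sqx Tx using t y by simp
 have F_ge: "w <= F z" if "0 < z" "z <= Y" for z
 proof -
  have "Y = Y powr (1 + \<kappa>) * Y powr (- \<kappa>)" using Y1 by (simp add: powr_add[symmetric])
  also have "... <= F z" unfolding F_def using that Y1 k by (intro mult_left_mono powr_mono2') auto
  finally show ?thesis using w by simp
 qed
 have block: "\<bar>\<Sum>n\<in>{u..<v}. err w (F (of_int n)) n\<bar> <= 100000 * \<Gamma> * L\<^sup>2 * T"
  if B: "2 * T <= B" "B <= Y" and uv: "u <= v" "B < of_int u" "of_int v <= 2 * B + 1" "of_int v <= Y + 1" for B u v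
 proof -
  have B0: "B > 0" using B T0 by linarith
  define b where "b = ln B"
  have Bx: "B = exp b" using B0 by (simp add: b_def)
  define a where "a = y + \<kappa> * (y - b)"
  have Ax: "Y powr (1 + \<kappa>) * B powr (- \<kappa>) = exp a"
   unfolding Yx Bx a_def by (simp add: powr_def exp_add[symmetric] algebra_simps)
  have b: "t <= b" "b <= y"
  proof -
   have "exp t <= exp b" "exp b <= exp y" unfolding Tx[symmetric] Bx[symmetric] Yx[symmetric] using B T0 by auto
   then show "t <= b" "b <= y" by simp_all
  qed
  have a: "a = y + 3/2 * (y - b) \<or> a = y + 2/3 * (y - b)" using k unfolding a_def by metis
  note arith = b t y
  have sq: "exp u ^ 2 = exp (2 * u)" for u :: real by (simp add: exp_double)
  show ?thesis unfolding F_def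
  proof (rule block_error)
   show "0 < Y powr (1 + \<kappa>)" using Y1 by simp
   show "1/2 <= \<kappa>" "\<kappa> <= 2" using k by auto
   show "sqrt q <= Y powr (1 + \<kappa>) * B powr (- \<kappa>)" unfolding Ax sqx exp_le_cancel_iff
   proof -
    have "0 <= \<kappa> * (y - b)" using k b by auto
    then show "p / 2 <= a" using y unfolding a_def by linarith
   qed
   have "(exp a * exp b) powr (1/4) * exp p powr (1/4) = exp ((a + b + p) / 4)"
    by (simp add: powr_def exp_add[symmetric] ln_mult add_divide_distrib)
   moreover have "(a + b + p) / 4 <= t" using a b t y by argo
   ultimately show "(Y powr (1 + \<kappa>) * B powr (- \<kappa>) * B) powr (1/4) * real q powr (1/4) <= T"
    unfolding Ax unfolding Bx qx Tx by simp
   show "B <= T * sqrt q" unfolding sqx Bx Tx exp_add[symmetric] exp_le_cancel_iff using a b t y by argo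
   have "2 * (b - t) + (a - b) <= p / 2" using a b t y by argo
   then show "(B / T)\<^sup>2 * (Y powr (1 + \<kappa>) * B powr (- \<kappa>) / B) <= sqrt q"
    unfolding Ax sqx unfolding Bx Tx exp_diff[symmetric] sq exp_add[symmetric] exp_le_cancel_iff .
   have "2 * (b - t) <= p / 2" using a b t y by argo
   then show "(B / T)\<^sup>2 <= sqrt q"
    unfolding sqx Bx Tx exp_diff[symmetric] sq exp_le_cancel_iff .
   show "sqrt q * B powr (1/4) <= T" if h: "real q * T < Y powr (1 + \<kappa>) * B powr (- \<kappa>) * B"
   proof -
    have "p + t < a + b" using h unfolding Ax unfolding Bx qx Tx exp_add[symmetric] exp_less_cancel_iff .
    then have "p / 2 + b / 4 <= t" using a b t y by argo
    moreover have "exp (p / 2) * exp b powr (1/4) = exp (p / 2 + b / 4)" by (simp add: powr_def exp_add)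
    ultimately show ?thesis unfolding sqx Bx Tx by simp
   qed
   show "w <= Y powr (1 + \<kappa>) * real_of_int n powr (- \<kappa>)" if n: "n \<in> {u..<v}" for n
   proof -
    have "n + 1 <= v" "u <= n" using n by auto
    then have "real_of_int (n + 1) <= of_int v" "real_of_int u <= of_int n" by (simp_all only: of_int_le_iff)
    then show ?thesis using F_ge[of "of_int n"] uv B0 by (simp add: F_def)
   qed
  qed (use Tq B uv w in auto)
 qed
 have LL: "1 <= L ^ 3" "L\<^sup>2 >= 0" using L1 one_le_power[of L 3] by auto
 define S where "S = (%x::real. \<Sum>n\<in>{1..<\<lfloor>x\<rfloor> + 1}. err w (F (of_int n)) n)"
 have trivial: "\<bar>S x\<bar> <= 4 * \<Gamma> * T" if x: "0 <= x" "x <= 4 * T" "x <= Y" for x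
 proof -
  have "\<bar>S x\<bar> <= (\<Sum>n\<in>{1..<\<lfloor>x\<rfloor> + 1}. \<Gamma>)" unfolding S_def
  proof (intro order_trans[OF sum_abs] sum_mono)
   fix n assume n: "n \<in> {1..<\<lfloor>x\<rfloor> + 1}"
   then have "real_of_int n <= x" "n >= 1" by (auto simp: le_floor_iff)
   then show "\<bar>err w (F (of_int n)) n\<bar> <= \<Gamma>" using w(1) x by (intro err_trivial F_ge) auto
  qed
  also have "... = of_int \<lfloor>x\<rfloor> * \<Gamma>" using x by simp
  also have "... <= (4 * T) * \<Gamma>" using x G1 by (intro mult_right_mono) (auto intro: order_trans[OF of_int_floor_le])
  also have "(4 * T) * \<Gamma> = 4 * \<Gamma> * T" by (simp only: mult_ac)
  finally show ?thesis .
 qed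
 have main: "\<bar>S x\<bar> <= 4 * \<Gamma> * T + real k * (100000 * \<Gamma> * L\<^sup>2 * T)" if "0 <= x" "x <= Y" "x <= 2 ^ k * (4 * T)" for x k
  using that
 proof (induction k arbitrary: x)
  case 0
  then show ?case using trivial[of x] by simp
 next
  case (Suc k)
  have C0: "0 <= 100000 * \<Gamma> * L\<^sup>2 * T" using G1 T0 by simp
  show ?case
  proof (cases "x <= 4 * T")
   case True
   then have "\<bar>S x\<bar> <= 4 * \<Gamma> * T" using trivial[of x] Suc.prems by simp
   moreover have "0 <= real (Suc k) * (100000 * \<Gamma> * L\<^sup>2 * T)" by (rule mult_nonneg_nonneg[OF of_nat_0_le_iff C0])
   ultimately show ?thesis by linarith
  next
   case False
   have fl: "0 <= \<lfloor>x / 2\<rfloor>" "\<lfloor>x / 2\<rfloor> <= \<lfloor>x\<rfloor>" using Suc.prems by (auto intro: floor_mono)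
   have "S x = S (x / 2) + (\<Sum>n\<in>{\<lfloor>x / 2\<rfloor> + 1..<\<lfloor>x\<rfloor> + 1}. err w (F (of_int n)) n)"
   proof -
    have "{1..<\<lfloor>x\<rfloor> + 1} = {1..<\<lfloor>x / 2\<rfloor> + 1} \<union> {\<lfloor>x / 2\<rfloor> + 1..<\<lfloor>x\<rfloor> + 1}" using fl by (intro ivl_disj_un_two(3)[symmetric]) auto
    then show ?thesis unfolding S_def by (simp only:) (rule sum.union_disjoint, auto)
   qed
   moreover have "\<bar>S (x / 2)\<bar> <= 4 * \<Gamma> * T + real k * (100000 * \<Gamma> * L\<^sup>2 * T)"
    using Suc.prems by (intro Suc.IH) auto
   moreover have "\<bar>\<Sum>n\<in>{\<lfloor>x / 2\<rfloor> + 1..<\<lfloor>x\<rfloor> + 1}. err w (F (of_int n)) n\<bar> <= 100000 * \<Gamma> * L\<^sup>2 * T"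
   proof (rule block[of "x / 2"])
    show "x / 2 < of_int (\<lfloor>x / 2\<rfloor> + 1)" by linarith
    show "of_int (\<lfloor>x\<rfloor> + 1) <= 2 * (x / 2) + 1" by simp
    show "of_int (\<lfloor>x\<rfloor> + 1) <= Y + 1" using order_trans[OF of_int_floor_le Suc.prems(2)] by simp
   qed (use Suc.prems False fl in auto)
   moreover have "real (Suc k) * (100000 * \<Gamma> * L\<^sup>2 * T) = real k * (100000 * \<Gamma> * L\<^sup>2 * T) + 100000 * \<Gamma> * L\<^sup>2 * T"
    by (simp add: algebra_simps)
   ultimately show ?thesis by linarith
  qed
 qed
 define k where "k = floor_log q + 1"
 have "Y <= 2 ^ k * (4 * T)"
 proof -
  have "q < 2 ^ k" unfolding k_def using floor_log_exp2_gt[of q] by simp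
  then have "real q < 2 ^ k" using of_nat_less_iff[of q "2 ^ k", where 'a = real] by simp
  have "Y <= real q * T" unfolding Yx qx Tx exp_add[symmetric] exp_le_cancel_iff using t y by argo
  also have "... <= 2 ^ k * T" using \<open>real q < 2 ^ k\<close> T0 by (intro mult_right_mono) auto
  also have "... <= 2 ^ k * (4 * T)" using T0 by simp
  finally show ?thesis .
 qed
 then have "\<bar>S Y\<bar> <= 4 * \<Gamma> * T + real k * (100000 * \<Gamma> * L\<^sup>2 * T)" using Y1 by (intro main) auto
 also have "real k * (100000 * \<Gamma> * L\<^sup>2 * T) = 100000 * \<Gamma> * L ^ 3 * T" by (simp add: k_def L_def power2_eq_square power3_eq_cube)
 also have "4 * \<Gamma> * T <= 100000 * \<Gamma> * L ^ 3 * T"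
 proof -
  have "\<Gamma> * 1 * T <= \<Gamma> * L ^ 3 * T" using LL G1 T0 by (intro mult_right_mono mult_left_mono) auto
  moreover have "0 < \<Gamma> * 1 * T" using G1 T0 by simp
  ultimately have "4 * (\<Gamma> * 1 * T) <= 100000 * (\<Gamma> * L ^ 3 * T)" by argo
  then show ?thesis by (simp add: mult.assoc)
 qed
 also have "100000 * \<Gamma> * L ^ 3 * T + 100000 * \<Gamma> * L ^ 3 * T = 200000 * \<Gamma> * L ^ 3 * T" by simp
 finally show ?thesis unfolding S_def by simp
qed

end

section \<open>Partial summation and the coefficients C and D\<close>

lemma abel_bound:
 fixes d g :: "nat => real"
 assumes e: "\<And>m. \<bar>\<Sum>k=1..m. d k\<bar> <= R"
  and g: "\<And>k. k >= N ==> g (Suc k) <= g k" "\<And>k. k >= N ==> 0 <= g k" and NM: "N <= M"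
 shows "\<bar>\<Sum>k=N+1..M. d k * g k\<bar> <= 2 * R * g N"
proof -
 define E where "E = (%m. \<Sum>k=1..m. d k)"
 \<comment> \<open>The bound contains the unspent part of the decrease of g, which lets the
   induction close without absolute values of the increments.\<close>
 have "\<bar>(\<Sum>k=N+1..M. d k * g k) - E M * g M\<bar> <= R * (2 * g N - g M)" using NM
 proof (induction M rule: dec_induct)
  case base
  have "\<bar>E N\<bar> * g N <= R * g N" using e g(2)[of N] by (intro mult_right_mono) (auto simp: E_def)
  then show ?case using g(2)[of N] by (simp add: abs_mult)
 next
  case (step M)
  have "(\<Sum>k=N+1..Suc M. d k * g k) - E (Suc M) * g (Suc M) = ((\<Sum>k=N+1..M. d k * g k) - E M * g M) + E M * (g M - g (Suc M))"
   using step by (simp add: E_def algebra_simps)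
  moreover have "\<bar>E M * (g M - g (Suc M))\<bar> <= R * (g M - g (Suc M))"
   unfolding abs_mult using g(1)[of M] step e by (intro mult_mono) (auto simp: E_def intro: order_trans[OF abs_ge_zero])
  moreover have "R * (2 * g N - g (Suc M)) = R * (2 * g N - g M) + R * (g M - g (Suc M))" by (simp add: algebra_simps)
  ultimately show ?case using step.IH by linarith
 qed
 moreover have "\<bar>E M * g M\<bar> <= R * g M"
  unfolding abs_mult using e g(2)[OF NM] by (intro mult_mono) (auto simp: E_def intro: order_trans[OF abs_ge_zero])
 moreover have "R * (2 * g N - g M) + R * g M = 2 * R * g N" by (simp add: algebra_simps)
 ultimately show ?thesis by linarith
qed

lemma sum_antideriv_bound:
 fixes g H :: "real => real"
 assumes H: "\<And>x. x >= real N ==> DERIV H x :> g x"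
  and g: "\<And>x y. real N <= x ==> x <= y ==> g y <= g x" "\<And>x. x >= real N ==> 0 <= g x" and NM: "N <= M"
 shows "\<bar>(\<Sum>k=N+1..M. g (real k)) - (H M - H N)\<bar> <= g N"
proof -
 have s: "g (real (Suc k)) <= H (Suc k) - H k & H (Suc k) - H k <= g (real k)" if "k >= N" for k
 proof -
  have "\<exists>x. real k < x & x < real (Suc k) & H (Suc k) - H k = (real (Suc k) - real k) * g x"
   using that by (intro MVT2 H) auto
  then obtain x where "real k < x" "x < real (Suc k)" "H (Suc k) - H k = g x" by auto
  then show ?thesis using g(1)[of "real k" x] g(1)[of x "real (Suc k)"] that by auto
 qed
 have "(\<Sum>k=N+1..M. g (real k)) - (H M - H N) <= 0 & g (real M) - g (real N) <= (\<Sum>k=N+1..M. g (real k)) - (H M - H N)"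
  using NM
 proof (induction M rule: dec_induct)
  case (step M)
  then show ?case using s[of M] by simp
 qed simp
 then show ?thesis using g(2)[of M] NM by linarith
qed

lemma mean_value_sum:
 fixes g H :: "real => real" and c :: "nat => real"
 assumes c: "\<And>m. \<bar>(\<Sum>k=1..m. c k) - \<rho> * real m\<bar> <= R" and \<rho>: "0 <= \<rho>" "\<rho> <= 1"
  and H: "\<And>x. x >= real N ==> DERIV H x :> g x"
  and g: "\<And>x y. real N <= x ==> x <= y ==> g y <= g x" "\<And>x. x >= real N ==> 0 <= g x" and NM: "N <= M"
 shows "\<bar>(\<Sum>k=N+1..M. c k * g (real k)) - \<rho> * (H M - H N)\<bar> <= (2 * R + 1) * g N"
proof -
 have "\<bar>\<Sum>k=N+1..M. (c k - \<rho>) * g (real k)\<bar> <= 2 * R * g (real N)"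
 proof (rule abel_bound[OF _ _ _ NM])
  fix m
  have "(\<Sum>k=1..m. c k - \<rho>) = (\<Sum>k=1..m. c k) - \<rho> * real m" by (simp add: sum_subtractf)
  then show "\<bar>\<Sum>k=1..m. c k - \<rho>\<bar> <= R" using c by simp
 qed (use g in auto)
 moreover have "(\<Sum>k=N+1..M. (c k - \<rho>) * g (real k)) = (\<Sum>k=N+1..M. c k * g (real k)) - \<rho> * (\<Sum>k=N+1..M. g (real k))"
  by (simp add: left_diff_distrib sum_subtractf sum_distrib_left)
 moreover have "\<bar>\<rho> * ((\<Sum>k=N+1..M. g (real k)) - (H M - H N))\<bar> <= 1 * g (real N)"
  unfolding abs_mult using \<rho> g(2)[of N] by (intro mult_mono sum_antideriv_bound[OF H g NM]) auto
 ultimately show ?thesis by (simp add: algebra_simps)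
qed

text \<open>Approximation of C by a partial sum: for coefficients of mean value \<rho> the tail
  beyond N is 2 \<rho> N^(-1/2), up to the discrepancy R.\<close>

lemma mean_value_series:
 fixes c :: "nat => real"
 assumes c: "\<And>m. \<bar>(\<Sum>k=1..m. c k) - \<rho> * real m\<bar> <= R" and \<rho>: "0 <= \<rho>" "\<rho> <= 1" and c0: "\<And>k. 0 <= c k" and N: "N >= 1"
 shows "summable (%k. c (Suc k) / real (Suc k) powr (3/2))"
  and "\<bar>(\<Sum>k. c (Suc k) / real (Suc k) powr (3/2)) - (\<Sum>k=1..N. c k / real k powr (3/2)) - 2 * \<rho> * real N powr (-1/2)\<bar> <= (2 * R + 1) * real N powr (-3/2)"
proof -
 define g where "g = (%x::real. x powr (-3/2))"
 define H where "H = (%x::real. - 2 * x powr (-1/2))"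
 have H: "DERIV H x :> g x" if "x > 0" for x
  unfolding H_def g_def using that by (auto intro!: derivative_eq_intros)
 have g: "g y <= g x" if "0 < x" "x <= y" for x y
  unfolding g_def using that by (intro powr_mono2') auto
 have g0: "g x >= 0" for x by (simp add: g_def)
 have R0: "R >= 0" using c[of 0] by simp
 have cg: "c k / real k powr (3/2) = c k * g (real k)" for k
  by (simp add: g_def powr_minus_divide)
 have part: "\<bar>(\<Sum>k=N+1..M. c k * g (real k)) - \<rho> * (H M - H N)\<bar> <= (2 * R + 1) * g N" if "1 <= N" "N <= M" for N M :: nat
  by (rule mean_value_sum[OF c \<rho>]) (use that H g g0 in auto)
 have shift: "(\<Sum>k<M. c (Suc k) / real (Suc k) powr (3/2)) = (\<Sum>k=1..M. c k * g (real k))" for M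
  unfolding cg One_nat_def sum.atLeast1_atMost_eq ..
 have H_le: "H (real M) <= 0" for M by (simp add: H_def)
 show summ: "summable (%k. c (Suc k) / real (Suc k) powr (3/2))"
 proof (rule summableI_nonneg_bounded)
  fix M
  show "(\<Sum>k<M. c (Suc k) / real (Suc k) powr (3/2)) <= c 1 * g 1 + 2 * \<rho> + (2 * R + 1) * g 1"
  proof (cases "M >= 1")
   case True
   have "(\<Sum>k=1..M. c k * g (real k)) = c 1 * g 1 + (\<Sum>k=1+1..M. c k * g (real k))"
    using True by (simp add: sum.atLeast_Suc_atMost)
   moreover have "\<rho> * (H M - H 1) <= \<rho> * 2" using \<rho> H_le[of M] by (intro mult_left_mono) (auto simp: H_def)
   ultimately show ?thesis unfolding shift using part[of 1 M] True by simp
  next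
   case False
   then have "M = 0" by simp
   then show ?thesis using \<rho> R0 c0[of 1] by (simp add: g_def)
  qed
 qed (use c0 in auto)
 have lim1: "(%M. (\<Sum>k=1..M. c k * g (real k))) \<longlonglongrightarrow> (\<Sum>k. c (Suc k) / real (Suc k) powr (3/2))"
  using summable_LIMSEQ[OF summ] unfolding shift .
 have lim2: "(%M. H (real M)) \<longlonglongrightarrow> 0" unfolding H_def by real_asymp
 have split: "(\<Sum>k=1..M. c k * g (real k)) = (\<Sum>k=1..N. c k * g (real k)) + (\<Sum>k=N+1..M. c k * g (real k))" if "M >= N" for M
  using sum.ub_add_nat[of 1 N "%k. c k * g (real k)" "M - N"] that by simp
 have "(%M. \<bar>(\<Sum>k=1..M. c k * g (real k)) - (\<Sum>k=1..N. c k * g (real k)) - \<rho> * (H M - H N)\<bar>)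
   \<longlonglongrightarrow> \<bar>(\<Sum>k. c (Suc k) / real (Suc k) powr (3/2)) - (\<Sum>k=1..N. c k * g (real k)) - \<rho> * (0 - H N)\<bar>"
  by (intro tendsto_intros lim1 lim2)
 moreover have "\<forall>\<^sub>F M in sequentially. \<bar>(\<Sum>k=1..M. c k * g (real k)) - (\<Sum>k=1..N. c k * g (real k)) - \<rho> * (H M - H N)\<bar> <= (2 * R + 1) * g N"
  using eventually_ge_at_top[of N]
 proof eventually_elim
  case (elim M)
  then show ?case using part[of N M] N split[of M] by simp
 qed
 ultimately have "\<bar>(\<Sum>k. c (Suc k) / real (Suc k) powr (3/2)) - (\<Sum>k=1..N. c k * g (real k)) - \<rho> * (0 - H N)\<bar> <= (2 * R + 1) * g N"
  by (intro tendsto_upperbound) auto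
 then show "\<bar>(\<Sum>k. c (Suc k) / real (Suc k) powr (3/2)) - (\<Sum>k=1..N. c k / real k powr (3/2)) - 2 * \<rho> * real N powr (-1/2)\<bar> <= (2 * R + 1) * real N powr (-3/2)"
  unfolding cg by (simp add: g_def H_def)
qed

lemma unit_interval_integral:
 fixes s \<rho> :: real and n :: nat
 assumes "n >= 1"
 shows "((%u. (s - \<rho> * u) / u powr (5/3)) has_integral
  (- 3 / 2 * s * (real (Suc n) powr (-2/3) - real n powr (-2/3)) - 3 * \<rho> * (real (Suc n) powr (1/3) - real n powr (1/3)))) {real n..real (Suc n)}"
proof -
 have "((%u. (s - \<rho> * u) / u powr (5/3)) has_integral
   ((- 3 / 2 * s * real (Suc n) powr (-2/3) - 3 * \<rho> * real (Suc n) powr (1/3)) - (- 3 / 2 * s * real n powr (-2/3) - 3 * \<rho> * real n powr (1/3)))) {real n..real (Suc n)}"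
 proof (rule fundamental_theorem_of_calculus)
  fix u assume u: "u \<in> {real n..real (Suc n)}"
  then have u0: "u > 0" using assms by auto
  have e1: "u powr (- (5/3)) = 1 / u powr (5/3)" by (simp add: powr_minus_divide)
  have e2: "u powr (- (2/3)) = u / u powr (5/3)"
  proof -
   have "u powr (- (2/3)) = u powr (1 - 5/3)" by simp
   also have "... = u / u powr (5/3)" using u0 by (subst powr_diff) simp
   finally show ?thesis .
  qed
  have "((%u. - 3 / 2 * s * u powr (-2/3) - 3 * \<rho> * u powr (1/3)) has_real_derivative (s * u powr (- (5/3)) - \<rho> * u powr (- (2/3)))) (at u within {real n..real (Suc n)})"
   using u0 by (auto intro!: derivative_eq_intros)
  moreover have "s * u powr (- (5/3)) - \<rho> * u powr (- (2/3)) = (s - \<rho> * u) / u powr (5/3)"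
   unfolding e1 e2 by (simp add: diff_divide_distrib)
  ultimately show "((%u. - 3 / 2 * s * u powr (-2/3) - 3 * \<rho> * u powr (1/3)) has_vector_derivative (s - \<rho> * u) / u powr (5/3)) (at u within {real n..real (Suc n)})"
   by (simp add: has_real_derivative_iff_has_vector_derivative)
 qed simp
 then show ?thesis by (simp add: algebra_simps)
qed

lemma step_integral:
 fixes c :: "nat => real" and \<rho> :: real
 defines "f \<equiv> %u. ((\<Sum>a\<in>{1..nat \<lfloor>u\<rfloor>}. c a) - \<rho> * u) / u powr (5/3)"
 assumes "N >= 1"
 shows "(f has_integral (3 / 2 * ((\<Sum>k=1..N. c k / real k powr (2/3)) - (\<Sum>k=1..N. c k) * real N powr (-2/3)) - 3 * \<rho> * (real N powr (1/3) - 1))) {1..real N}"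
 using assms(2)
proof (induction N rule: nat_induct_at_least)
 case base
 then show ?case by (simp add: has_integral_refl)
next
 case (Suc n)
 define S where "S = (\<Sum>k=1..n. c k)"
 define i where "i = - 3 / 2 * S * (real (Suc n) powr (-2/3) - real n powr (-2/3)) - 3 * \<rho> * (real (Suc n) powr (1/3) - real n powr (1/3))"
 have "(f has_integral i) {real n..real (Suc n)}"
 proof (rule has_integral_spike_finite[OF _ _ unit_interval_integral[OF Suc.hyps, of S \<rho>, folded i_def]])
  show "finite {real (Suc n)}" by simp
  fix u assume u: "u \<in> {real n..real (Suc n)} - {real (Suc n)}"
  then have "\<lfloor>u\<rfloor> = int n" by (auto simp: floor_eq_iff)
  then show "f u = (S - \<rho> * u) / u powr (5/3)" by (simp add: f_def S_def)
 qed
 then have "(f has_integral ((3 / 2 * ((\<Sum>k=1..n. c k / real k powr (2/3)) - (\<Sum>k=1..n. c k) * real n powr (-2/3)) - 3 * \<rho> * (real n powr (1/3) - 1)) + i)) {1..real (Suc n)}"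
  using Suc by (intro has_integral_combine[OF _ _ Suc.IH]) auto
 moreover have "c (Suc n) / real (Suc n) powr (2/3) = c (Suc n) * real (Suc n) powr (-2/3)" by (simp add: powr_minus_divide)
 ultimately show ?case by (simp add: i_def S_def algebra_simps)
qed

text \<open>Integrating over the steps turns the integral up to N into the sum of c_k k^(-2/3) minus
  3 \<rho> N^(1/3), up to a term that tends to zero; the summand -2 \<rho> of D cancels the
  contribution of the lower limit u = 1. Thus D is the constant term in the asymptotics of the
  divergent sum.\<close>

lemma mean_value_integral:
 fixes c :: "nat => real" and \<rho> R :: real
 defines "f \<equiv> %u. ((\<Sum>a\<in>{1..nat \<lfloor>u\<rfloor>}. c a) - \<rho> * u) / u powr (5/3)"
 assumes c: "\<And>m. \<bar>(\<Sum>k=1..m. c k) - \<rho> * real m\<bar> <= R" and \<rho>: "0 <= \<rho>" "\<rho> <= 1" and N: "N >= 1"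
 shows "\<bar>(- 2 * \<rho> + 2 / 3 * (LBINT u:{1..}. f u)) - (\<Sum>k=1..N. c k / real k powr (2/3)) + 3 * \<rho> * real N powr (1/3)\<bar> <= (2 * R + 1) * real N powr (-2/3)"
proof -
 have R0: "R >= 0" using c[of 0] by simp
 have meas: "f \<in> borel_measurable borel"
 proof -
  have "(%u::real. \<Sum>a\<in>{1..nat \<lfloor>u\<rfloor>}. c a) \<in> borel_measurable borel"
   by (rule measurable_compose[where f = "%u::real. nat \<lfloor>u\<rfloor>" and N = "count_space UNIV"]) measurable
  then show ?thesis unfolding f_def by measurable
 qed
 have fb: "\<bar>f u\<bar> <= (R + 1) * u powr (-5/3)" if "u >= 1" for u
 proof -
  define m where "m = nat \<lfloor>u\<rfloor>"
  have m: "real m <= u" "u <= real m + 1" unfolding m_def using that by linarith+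
  have "\<bar>\<rho> * (u - real m)\<bar> <= 1 * 1" unfolding abs_mult using \<rho> m by (intro mult_mono) auto
  then have "\<bar>(\<Sum>a\<in>{1..m}. c a) - \<rho> * u\<bar> <= R + 1" using c[of m] by (simp add: algebra_simps)
  then have "\<bar>(\<Sum>a\<in>{1..m}. c a) - \<rho> * u\<bar> / u powr (5/3) <= (R + 1) / u powr (5/3)" by (intro divide_right_mono) auto
  then show ?thesis by (simp add: f_def m_def powr_minus_divide abs_mult)
 qed
 have int: "set_integrable lborel {1..} f"
 proof (rule set_integrable_bound)
  have "(%x::real. x powr (-5/3)) absolutely_integrable_on {1..}"
   using has_integral_powr_to_inf[of "-5/3" 1] by (intro nonnegative_absolutely_integrable_1) (auto simp: integrable_on_def)
  then have "set_integrable lborel {1..} (%x::real. x powr (-5/3))"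
   unfolding set_integrable_def by (subst (asm) integrable_completion) auto
  then show "set_integrable lborel {1..} (%x::real. (R + 1) * x powr (-5/3))"
   by (rule set_integrable_mult_right)
  show "set_borel_measurable lborel {1..} f"
   unfolding set_borel_measurable_def using meas by measurable
  show "AE x in lborel. x \<in> {1..} --> norm (f x) <= norm ((R + 1) * x powr (-5/3))"
   using fb R0 by (auto simp: abs_mult)
 qed
 define e where "e = (%M. (\<Sum>k=1..M. c k) - \<rho> * real M)"
 define S where "S = (%M. (\<Sum>k=1..M. c k / real k powr (2/3)))"
 have lim: "(%M. LBINT u:{1..real M}. f u) \<longlonglongrightarrow> (LBINT u:{1..}. f u)"
  using filterlim_compose[OF tendsto_set_lebesgue_integral_at_top[OF _ int] filterlim_real_sequentially] by simp
 have val: "- 2 * \<rho> + 2 / 3 * (LBINT u:{1..real M}. f u) = S M - 3 * \<rho> * real M powr (1/3) - e M * real M powr (-2/3)" if M: "M >= 1" for M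
 proof -
  have "set_integrable lborel {1..real M} f" by (rule set_integrable_subset[OF int]) auto
  then have "(LBINT u:{1..real M}. f u) = integral {1..real M} f" by (rule set_borel_integral_eq_integral)
  also have "... = 3 / 2 * (S M - (\<Sum>k=1..M. c k) * real M powr (-2/3)) - 3 * \<rho> * (real M powr (1/3) - 1)"
   using step_integral[OF M, of c \<rho>] unfolding f_def[symmetric] S_def by (rule integral_unique)
  finally have 1: "(LBINT u:{1..real M}. f u) = 3 / 2 * (S M - (\<Sum>k=1..M. c k) * real M powr (-2/3)) - 3 * \<rho> * (real M powr (1/3) - 1)" .
  have "real M powr (1/3) = real M powr (1 + (-2/3))" by simp
  also have "... = real M * real M powr (-2/3)" using M by (subst powr_add) simp
  finally show ?thesis unfolding 1 e_def by (simp add: algebra_simps)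
 qed
 have e0: "(%M. e M * real M powr (-2/3)) \<longlonglongrightarrow> 0"
 proof (rule Lim_null_comparison)
  show "\<forall>\<^sub>F M in sequentially. norm (e M * real M powr (-2/3)) <= R * real M powr (-2/3)"
   using c by (intro always_eventually allI) (auto simp: e_def abs_mult intro: mult_right_mono)
  show "(%M. R * real M powr (-2/3)) \<longlonglongrightarrow> 0" by real_asymp
 qed
 have "(%M. (- 2 * \<rho> + 2 / 3 * (LBINT u:{1..real M}. f u)) + e M * real M powr (-2/3)) \<longlonglongrightarrow> (- 2 * \<rho> + 2 / 3 * (LBINT u:{1..}. f u)) + 0"
  by (intro tendsto_intros lim e0)
 moreover have "\<forall>\<^sub>F M in sequentially. (- 2 * \<rho> + 2 / 3 * (LBINT u:{1..real M}. f u)) + e M * real M powr (-2/3) = S M - 3 * \<rho> * real M powr (1/3)"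
  using eventually_ge_at_top[of 1]
 proof eventually_elim
  case (elim M)
  then show ?case unfolding val[OF elim] by simp
 qed
 ultimately have lim3: "(%M. S M - 3 * \<rho> * real M powr (1/3)) \<longlonglongrightarrow> - 2 * \<rho> + 2 / 3 * (LBINT u:{1..}. f u)"
  by (simp add: tendsto_cong)
 define g where "g = (%x::real. x powr (-2/3))"
 define H where "H = (%x::real. 3 * x powr (1/3))"
 have H: "DERIV H x :> g x" if "x > 0" for x
  unfolding H_def g_def using that by (auto intro!: derivative_eq_intros)
 have g: "g y <= g x" if "0 < x" "x <= y" for x y
  unfolding g_def using that by (intro powr_mono2') auto
 have cg: "c k / real k powr (2/3) = c k * g (real k)" for k
  by (simp add: g_def powr_minus_divide)
 have part: "\<bar>(\<Sum>k=N+1..M. c k * g (real k)) - \<rho> * (H M - H N)\<bar> <= (2 * R + 1) * g N" if "N <= M" for M :: nat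
  by (rule mean_value_sum[OF c \<rho>]) (use that N H g in \<open>auto simp: g_def\<close>)
 have split: "S M = S N + (\<Sum>k=N+1..M. c k * g (real k))" if "M >= N" for M
  unfolding S_def cg using sum.ub_add_nat[of 1 N "%k. c k * g (real k)" "M - N"] that by simp
 have "(%M. \<bar>(S M - 3 * \<rho> * real M powr (1/3)) - S N + 3 * \<rho> * real N powr (1/3)\<bar>)
   \<longlonglongrightarrow> \<bar>(- 2 * \<rho> + 2 / 3 * (LBINT u:{1..}. f u)) - S N + 3 * \<rho> * real N powr (1/3)\<bar>"
  by (intro tendsto_intros lim3)
 moreover have "\<forall>\<^sub>F M in sequentially. \<bar>(S M - 3 * \<rho> * real M powr (1/3)) - S N + 3 * \<rho> * real N powr (1/3)\<bar> <= (2 * R + 1) * g N"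
  using eventually_ge_at_top[of N]
 proof eventually_elim
  case (elim M)
  then show ?case using part[of M] split[of M] by (simp add: H_def algebra_simps)
 qed
 ultimately have "\<bar>(- 2 * \<rho> + 2 / 3 * (LBINT u:{1..}. f u)) - S N + 3 * \<rho> * real N powr (1/3)\<bar> <= (2 * R + 1) * g N"
  by (intro tendsto_upperbound) auto
 then show ?thesis by (simp add: S_def g_def)
qed

section \<open>Fibres of the curve and the counts N2 and N3\<close>

text \<open>Multiplication by u maps solutions of x^k c = l to k-th roots of l d, because u^k = c d.
  It links the fibres of the curve with N2 and N3 and later compares these counts for different
  l.\<close>

lemma unit_root_count_fiber:
 fixes u c d l :: int
 assumes q: "q > 0" and cop: "coprime u (int q)" "coprime d (int q)" "coprime l (int q)" and k: "k > 0"
  and eq: "[u ^ k = c * d] (mod int q)"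
 shows "unit_root_count k (l * d) q = card {x. 0 <= x & x < int q & [x ^ k * c = l] (mod int q)}"
proof -
 obtain v where v: "[u * v = 1] (mod int q)" using cong_solve_coprime_int[OF cop(1)] by auto
 have iff: "[x ^ k * c = l] (mod int q) \<longleftrightarrow> [(x * u) ^ k = l * d] (mod int q)" for x
 proof -
  have "[(x * u) ^ k = (x ^ k * c) * d] (mod int q)"
   unfolding power_mult_distrib mult.assoc by (rule cong_mult[OF cong_refl eq])
  then have "[(x * u) ^ k = l * d] (mod int q) \<longleftrightarrow> [(x ^ k * c) * d = l * d] (mod int q)"
   by (meson cong_sym cong_trans)
  also have "... \<longleftrightarrow> [x ^ k * c = l] (mod int q)" using cop(2) by (simp add: cong_mult_rcancel)
  finally show ?thesis by simp
 qed
 have red: "[(x mod int q) = x] (mod int q)" for x by (simp add: cong_def)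
 have can: "[(x * u) * v = x] (mod int q)" "[(x * v) * u = x] (mod int q)" for x
  using cong_mult[OF cong_refl v, of x] by (simp_all add: mult_ac)
 have "bij_betw (%x. (x * u) mod int q) {x. 0 <= x & x < int q & [x ^ k * c = l] (mod int q)}
   {x. 0 <= x & x < int q & [x ^ k = l * d] (mod int q) & coprime x (int q)}"
 proof (rule bij_betwI[where g = "%x. (x * v) mod int q"])
  have "0 <= (x * u) mod int q & (x * u) mod int q < int q & [((x * u) mod int q) ^ k = l * d] (mod int q) & coprime ((x * u) mod int q) (int q)"
   if x: "[x ^ k * c = l] (mod int q)" for x
  proof -
   have e: "[((x * u) mod int q) ^ k = l * d] (mod int q)"
    using x unfolding iff by (rule cong_trans[OF cong_pow[OF red]])
   then have "coprime (((x * u) mod int q) ^ k) (int q)"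
    using cop by (intro cong_imp_coprime[OF cong_sym[OF e]]) simp
   then show ?thesis using e q k by (simp add: coprime_power_left_iff)
  qed
  then show "(%x. (x * u) mod int q) \<in> {x. 0 <= x & x < int q & [x ^ k * c = l] (mod int q)} \<rightarrow>
    {x. 0 <= x & x < int q & [x ^ k = l * d] (mod int q) & coprime x (int q)}" by auto
  have "[((x * v) mod int q) ^ k * c = l] (mod int q)" if x: "[x ^ k = l * d] (mod int q)" for x
  proof -
   have "[((x * v) mod int q) * u = x] (mod int q)"
    using cong_trans[OF cong_scalar_right[OF red] can(2)] .
   then have "[(((x * v) mod int q) * u) ^ k = l * d] (mod int q)" using x by (meson cong_pow cong_trans)
   then show ?thesis unfolding iff .
  qed
  then show "(%x. (x * v) mod int q) \<in> {x. 0 <= x & x < int q & [x ^ k = l * d] (mod int q) & coprime x (int q)} \<rightarrow>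
    {x. 0 <= x & x < int q & [x ^ k * c = l] (mod int q)}" using q by auto
  fix x assume "x \<in> {x. 0 <= x & x < int q & [x ^ k * c = l] (mod int q)}"
  then show "(((x * u) mod int q) * v) mod int q = x"
   using cong_trans[OF cong_scalar_right[OF red] can(1), of x] by (simp add: cong_def)
 next
  fix x assume "x \<in> {x. 0 <= x & x < int q & [x ^ k = l * d] (mod int q) & coprime x (int q)}"
  then show "(((x * v) mod int q) * u) mod int q = x"
   using cong_trans[OF cong_scalar_right[OF red] can(2), of x] by (simp add: cong_def)
 qed
 then show ?thesis unfolding unit_root_count_def by (rule bij_betw_same_card[symmetric])
qed

lemma unit_root_count_eq_0:
 assumes "~ coprime d (int q)"
 shows "unit_root_count k (l * d) q = 0"
proof -
 have "coprime d (int q)" if "[x ^ k = l * d] (mod int q)" "coprime x (int q)" for x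
 proof -
  have "coprime (l * d) (int q)" using that by (intro cong_imp_coprime[OF that(1)]) simp
  then show ?thesis by simp
 qed
 then have "{x. 0 <= x & x < int q & [x ^ k = l * d] (mod int q) & coprime x (int q)} = {}" using assms by blast
 then show ?thesis unfolding unit_root_count_def by (simp only: card.empty)
qed

lemma card_X_fiber:
 assumes q: "q > 0" and l: "coprime l (int q)"
 shows "card {P \<in> X q l. [snd P = b] (mod int q)} = N2 (l * b) q"
proof (cases "coprime b (int q)")
 case True
 have b: "[b mod int q = b] (mod int q)" by (simp add: cong_def)
 have bb: "[a ^ 2 * (b mod int q) ^ 3 = a ^ 2 * b ^ 3] (mod int q)" for a
  by (rule cong_mult[OF cong_refl cong_pow[OF b]])
 have "N2 (l * b) q = card {x. 0 <= x & x < int q & [x ^ 2 * b ^ 3 = l] (mod int q)}"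
  using True by (intro unit_root_count_fiber[OF q _ True l, where u = "b ^ 2"]) (auto simp: power_add[symmetric] power2_eq_square power3_eq_cube mult.assoc)
 also have "... = card {P \<in> X q l. [snd P = b] (mod int q)}"
 proof (rule bij_betw_same_card[where f = "%x. (x, b mod int q)"], rule bij_betwI[where g = fst])
  show "(%x. (x, b mod int q)) \<in> {x. 0 <= x & x < int q & [x ^ 2 * b ^ 3 = l] (mod int q)} \<rightarrow> {P \<in> X q l. [snd P = b] (mod int q)}"
   using q b bb by (auto simp: X_def intro: cong_trans)
  have "fst P \<in> {x. 0 <= x & x < int q & [x ^ 2 * b ^ 3 = l] (mod int q)} & snd P = b mod int q"
   if "P \<in> X q l" "[snd P = b] (mod int q)" for P
  proof -
   obtain x y where P: "P = (x, y)" by (cases P)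
   have y: "y = b mod int q" using that P by (auto simp: X_def cong_def)
   then show ?thesis using that P bb[of x] by (auto simp: X_def intro: cong_trans cong_sym)
  qed
  then show "fst \<in> {P \<in> X q l. [snd P = b] (mod int q)} \<rightarrow> {x. 0 <= x & x < int q & [x ^ 2 * b ^ 3 = l] (mod int q)}"
   "\<And>P. P \<in> {P \<in> X q l. [snd P = b] (mod int q)} ==> (fst P, b mod int q) = P" by (auto simp: prod_eq_iff)
 qed auto
 finally show ?thesis by simp
next
 case False
 have "coprime b (int q)" if "P \<in> X q l" "[snd P = b] (mod int q)" for P
  using that X_coprime(2)[OF _ l, of "fst P" "snd P"] cong_imp_coprime[OF that(2)] by (auto simp: X_def)
 then have "{P \<in> X q l. [snd P = b] (mod int q)} = {}" using False by blast
 then show ?thesis using unit_root_count_eq_0[OF False] by simp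
qed

lemma card_X_fiber_swap:
 assumes q: "q > 0" and l: "coprime l (int q)"
 shows "card {P \<in> prod.swap ` X q l. [snd P = a] (mod int q)} = N3 (l * a) q"
proof (cases "coprime a (int q)")
 case True
 have b: "[a mod int q = a] (mod int q)" by (simp add: cong_def)
 have bb: "[(a mod int q) ^ 2 * x ^ 3 = x ^ 3 * a ^ 2] (mod int q)" for x
  unfolding mult.commute[of "x ^ 3"] by (rule cong_mult[OF cong_pow[OF b] cong_refl])
 have "N3 (l * a) q = card {x. 0 <= x & x < int q & [x ^ 3 * a ^ 2 = l] (mod int q)}"
  using True by (intro unit_root_count_fiber[OF q _ True l, where u = a]) (auto simp: power2_eq_square power3_eq_cube mult.assoc)
 also have "... = card {P \<in> prod.swap ` X q l. [snd P = a] (mod int q)}"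
 proof (rule bij_betw_same_card[where f = "%x. (x, a mod int q)"], rule bij_betwI[where g = fst])
  have "(a mod int q, x) \<in> X q l" if "0 <= x" "x < int q" "[x ^ 3 * a ^ 2 = l] (mod int q)" for x
   using that q cong_trans[OF bb that(3)] by (auto simp: X_def)
  then show "(%x. (x, a mod int q)) \<in> {x. 0 <= x & x < int q & [x ^ 3 * a ^ 2 = l] (mod int q)} \<rightarrow> {P \<in> prod.swap ` X q l. [snd P = a] (mod int q)}"
   using b by (force simp: image_iff)
  have "y = a mod int q & x \<in> {x. 0 <= x & x < int q & [x ^ 3 * a ^ 2 = l] (mod int q)}"
   if "(y, x) \<in> X q l" "[y = a] (mod int q)" for x y
  proof -
   have y: "y = a mod int q" using that by (auto simp: X_def cong_def)
   then show ?thesis using that cong_trans[OF cong_sym[OF bb]] by (auto simp: X_def)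
  qed
  then show "fst \<in> {P \<in> prod.swap ` X q l. [snd P = a] (mod int q)} \<rightarrow> {x. 0 <= x & x < int q & [x ^ 3 * a ^ 2 = l] (mod int q)}"
   "\<And>P. P \<in> {P \<in> prod.swap ` X q l. [snd P = a] (mod int q)} ==> (fst P, a mod int q) = P" by auto
 qed auto
 finally show ?thesis by simp
next
 case False
 have "coprime a (int q)" if "(x, y) \<in> X q l" "[x = a] (mod int q)" for x y
  using that X_coprime(1)[OF _ l, of x y] cong_imp_coprime[OF that(2)] by (auto simp: X_def)
 then have "{P \<in> prod.swap ` X q l. [snd P = a] (mod int q)} = {}" using False by auto
 then show ?thesis using unit_root_count_eq_0[OF False] by simp
qed

text \<open>Every unit t occurs as ab, namely for a = t^3 / l and b = l / t^2. The mean value of the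
  fibre sizes is therefore exactly \<open>totient q / q\<close>.\<close>

lemma (in modsys) card_X: "card (X q l) = totient q"
proof (rule antisym[OF card_X_totient])
 obtain l' where l': "[l * l' = 1] (mod int q)" using cong_solve_coprime_int[OF cop] by auto
 let ?f = "%t. ((t ^ 3 * l') mod int q, (l * uinv q t ^ 2) mod int q)"
 have red: "[(x mod int q) = x] (mod int q)" for x by (simp add: cong_def)
 have "card (units q) <= card (X q l)"
 proof (rule card_inj_on_le[where f = ?f])
  have ab: "[((t ^ 3 * l') mod int q) * ((l * uinv q t ^ 2) mod int q) = t] (mod int q)" if "t \<in> units q" for t
  proof -
   have 1: "[((t ^ 3 * l') mod int q) * ((l * uinv q t ^ 2) mod int q) = (t ^ 3 * l') * (l * uinv q t ^ 2)] (mod int q)"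
    by (rule cong_mult[OF red red])
   have 2: "(t ^ 3 * l') * (l * uinv q t ^ 2) = (l * l') * (t * uinv q t) ^ 2 * t"
    by (simp add: power_mult_distrib power2_eq_square power3_eq_cube)
   have 3: "[(l * l') * (t * uinv q t) ^ 2 * t = 1 * 1 ^ 2 * t] (mod int q)"
    by (intro cong_mult cong_pow l' uinv that cong_refl)
   show ?thesis using cong_trans[OF 1[unfolded 2] 3] by (simp only: mult_1 power_one)
  qed
  show "inj_on ?f (units q)"
  proof (rule inj_onI)
   fix t t' assume t: "t \<in> units q" "t' \<in> units q" and "?f t = ?f t'"
   then have eq: "(t ^ 3 * l') mod int q = (t' ^ 3 * l') mod int q" "(l * uinv q t ^ 2) mod int q = (l * uinv q t' ^ 2) mod int q" by simp_all
   have "[t = t'] (mod int q)" using cong_trans[OF cong_sym[OF ab[OF t(1), unfolded eq]] ab[OF t(2)]] .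
   then show "t = t'" using t by (simp add: units_def cong_def)
  qed
  show "?f ` units q \<subseteq> X q l"
  proof (rule image_subsetI)
   fix t assume t: "t \<in> units q"
   have 1: "[((t ^ 3 * l') mod int q) ^ 2 * ((l * uinv q t ^ 2) mod int q) ^ 3 = (t ^ 3 * l') ^ 2 * (l * uinv q t ^ 2) ^ 3] (mod int q)"
    by (intro cong_mult cong_pow red)
   have 2: "(t ^ 3 * l') ^ 2 * (l * uinv q t ^ 2) ^ 3 = (l * l') ^ 2 * ((t * uinv q t) ^ 2) ^ 3 * l"
    by (simp add: power_mult_distrib power_mult[symmetric] power2_eq_square power3_eq_cube)
   have 3: "[(l * l') ^ 2 * ((t * uinv q t) ^ 2) ^ 3 * l = 1 ^ 2 * (1 ^ 2) ^ 3 * l] (mod int q)"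
    by (intro cong_mult cong_pow l' uinv t cong_refl)
   have "[((t ^ 3 * l') mod int q) ^ 2 * ((l * uinv q t ^ 2) mod int q) ^ 3 = l] (mod int q)"
    using cong_trans[OF 1[unfolded 2] 3] by (simp only: mult_1 power_one)
   then show "?f t \<in> X q l" using q0 by (simp add: X_def)
  qed
 qed simp
 then show "totient q <= card (X q l)" by (simp add: card_units[OF q0])
qed

lemma (in pointset) slice_card:
 assumes inv: "\<And>m n. (m mod int q, n mod int q) \<in> A \<longleftrightarrow> Q m n"
 shows "card {m \<in> {u..<v}. Q m n} = (\<Sum>P\<in>fib n. hits u v (fst P))"
proof -
 have fibD: "snd P = n mod int q" "fst P mod int q = fst P" "P \<in> A" if "P \<in> fib n" for P
  using that box[of "fst P" "snd P"] by (auto simp: fib_def cong_def)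
 have "{m \<in> {u..<v}. Q m n} = (\<Union>P\<in>fib n. {m \<in> {u..<v}. [m = fst P] (mod int q)})"
 proof (intro equalityI subsetI)
  fix m assume m: "m \<in> {m \<in> {u..<v}. Q m n}"
  then have "(m mod int q, n mod int q) \<in> fib n" using inv[of m n] by (auto simp: fib_def)
  then show "m \<in> (\<Union>P\<in>fib n. {m \<in> {u..<v}. [m = fst P] (mod int q)})" using m by (force simp: cong_def)
 next
  fix m assume "m \<in> (\<Union>P\<in>fib n. {m \<in> {u..<v}. [m = fst P] (mod int q)})"
  then obtain P where P: "P \<in> fib n" "m \<in> {u..<v}" "[m = fst P] (mod int q)" by auto
  have "P = (m mod int q, n mod int q)" using fibD[OF P(1)] P(3) by (auto simp: prod_eq_iff cong_def)
  then show "m \<in> {m \<in> {u..<v}. Q m n}" using P fibD(3)[OF P(1)] inv[of m n] by auto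
 qed
 also have "card ... = (\<Sum>P\<in>fib n. card {m \<in> {u..<v}. [m = fst P] (mod int q)})"
 proof (rule card_UN_disjoint)
  show "\<forall>P\<in>fib n. \<forall>P'\<in>fib n. P \<noteq> P' --> {m \<in> {u..<v}. [m = fst P] (mod int q)} \<inter> {m \<in> {u..<v}. [m = fst P'] (mod int q)} = {}"
  proof (intro ballI impI)
   fix P P' assume P: "P \<in> fib n" "P' \<in> fib n" "P \<noteq> P'"
   then have "fst P \<noteq> fst P'" using fibD[OF P(1)] fibD[OF P(2)] by (auto simp: prod_eq_iff)
   then have "~ [fst P = fst P'] (mod int q)" using fibD[OF P(1)] fibD[OF P(2)] by (simp add: cong_def)
   then show "{m \<in> {u..<v}. [m = fst P] (mod int q)} \<inter> {m \<in> {u..<v}. [m = fst P'] (mod int q)} = {}"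
    by (auto dest: cong_sym intro: cong_trans)
  qed
  have "finite {m \<in> {u..<v}. [m = fst P] (mod int q)}" for P :: "int \<times> int" by (rule finite_subset[of _ "{u..<v}"]) auto
  then show "\<forall>P\<in>fib n. finite {m \<in> {u..<v}. [m = fst P] (mod int q)}" by blast
 qed simp
 finally show ?thesis by (simp only: hits_def)
qed

section \<open>The hyperbola method for pairs\<close>

text \<open>With z = N/Y the terms in \<rho> combine to \<rho> Y^2 (-2 z^(-1/2) + 3 z^(1/3) - z).
  The bracket vanishes at z = 1 since -2 + 3 - 1 = 0, and 1 - z <= 1/Y reduces the order from Y^2 to
  Y. Everything else is discrepancy.\<close>

lemma main_terms:
 fixes Y \<rho> R C D A2 A3 S :: real and N :: nat
 assumes Y: "Y >= 1" "real N <= Y" "Y < real N + 1" and \<rho>: "0 <= \<rho>" "\<rho> <= 1"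
  and C: "\<bar>C - A2 - 2 * \<rho> * real N powr (-1/2)\<bar> <= (2 * R + 1) * real N powr (-3/2)"
  and D: "\<bar>D - A3 + 3 * \<rho> * real N powr (1/3)\<bar> <= (2 * R + 1) * real N powr (-2/3)"
  and S: "\<bar>S - \<rho> * real N\<bar> <= R"
 shows "\<bar>Y powr (5/2) * A2 + Y powr (5/3) * A3 - Y * S - (C * Y powr (5/2) + D * Y powr (5/3))\<bar> <= 15 * (R + 1) * Y"
proof -
 have N1: "N >= 1" using Y by linarith
 have R0: "R >= 0" using S by linarith
 define z where "z = real N / Y"
 have z: "0 < z" "z <= 1" "1 / 2 <= z" using Y N1 by (auto simp: z_def field_simps)
 have Nz: "real N = Y * z" using Y by (simp add: z_def)
 have zY: "1 - z <= 1 / Y"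
 proof -
  have "1 - z = (Y - real N) / Y" using Y by (simp add: z_def diff_divide_distrib)
  also have "... <= 1 / Y" using Y by (intro divide_right_mono) auto
  finally show ?thesis .
 qed
 have Npow: "real N powr a = Y powr a * z powr a" for a unfolding Nz using Y z by (simp add: powr_mult)
 have pw: "Y powr (5/2) * Y powr (-1/2) = Y\<^sup>2" "Y powr (5/2) * Y powr (-3/2) = Y" "Y powr (5/3) * Y powr (1/3) = Y\<^sup>2" "Y powr (5/3) * Y powr (-2/3) = Y"
  using Y by (simp_all add: powr_add[symmetric])
 have zi: "z powr a <= 4" if "-2 <= a" for a
 proof (cases "a >= 0")
  case True
  then have "z powr a <= 1 powr a" using z by (intro powr_mono2) auto
  then show ?thesis by simp
 next
  case False
  then have "z powr a <= (1/2) powr a" using z by (intro powr_mono2') auto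
  also have "... <= (1/2) powr (-2)" using that by (intro powr_mono') auto
  also have "... = 4" by (simp add: powr_minus powr_numeral power2_eq_square)
  finally show ?thesis .
 qed
 have e1: "\<bar>Y powr (5/2) * (C - A2 - 2 * \<rho> * real N powr (-1/2))\<bar> <= 4 * (2 * R + 1) * Y"
 proof -
  have "\<bar>Y powr (5/2) * (C - A2 - 2 * \<rho> * real N powr (-1/2))\<bar> <= Y powr (5/2) * ((2 * R + 1) * real N powr (-3/2))"
   unfolding abs_mult using C by (intro mult_mono) auto
  also have "... = (2 * R + 1) * (Y powr (5/2) * Y powr (-3/2)) * z powr (-3/2)" unfolding Npow by (simp only: mult_ac)
  also have "... <= (2 * R + 1) * Y * 4" unfolding pw using R0 Y by (intro mult_left_mono zi) auto
  also have "(2 * R + 1) * Y * 4 = 4 * (2 * R + 1) * Y" by (simp only: mult_ac)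
  finally show ?thesis .
 qed
 have e2: "\<bar>Y powr (5/3) * (D - A3 + 3 * \<rho> * real N powr (1/3))\<bar> <= 2 * (2 * R + 1) * Y"
 proof -
  have "\<bar>Y powr (5/3) * (D - A3 + 3 * \<rho> * real N powr (1/3))\<bar> <= Y powr (5/3) * ((2 * R + 1) * real N powr (-2/3))"
   unfolding abs_mult using D by (intro mult_mono) auto
  also have "... = (2 * R + 1) * (Y powr (5/3) * Y powr (-2/3)) * z powr (-2/3)" unfolding Npow by (simp only: mult_ac)
  also have "... <= (2 * R + 1) * Y * 2"
  proof -
   have "z powr (-2/3) <= (1/2) powr (-2/3)" using z by (intro powr_mono2') auto
   also have "... <= (1/2) powr (-1)" by (intro powr_mono') auto
   finally show ?thesis unfolding pw using R0 Y by (intro mult_left_mono) (auto simp: powr_minus)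
  qed
  also have "(2 * R + 1) * Y * 2 = 2 * (2 * R + 1) * Y" by (simp only: mult_ac)
  finally show ?thesis .
 qed
 have e3: "\<bar>Y * (S - \<rho> * real N)\<bar> <= R * Y"
  unfolding abs_mult using S Y by (simp add: mult.commute)
 have e4: "\<bar>\<rho> * (Y\<^sup>2 * (- 2 * z powr (-1/2) + 3 * z powr (1/3) - z))\<bar> <= 8 * Y"
 proof -
  have "1 <= z powr (-1/2)" using z powr_mono2'[of "-1/2" z 1] by simp
  moreover have "z powr (-1/2) <= 1 + 2 * (1 - z)"
  proof -
   have "z powr (-1/2) <= z powr (-1)" using z by (intro powr_mono') auto
   also have "... = 1 + (1 - z) / z" using z by (simp add: powr_minus field_simps)
   also have "(1 - z) / z <= (1 - z) / (1 / 2)" using z by (intro divide_left_mono) auto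
   finally show ?thesis by simp
  qed
  moreover have "z powr (1/3) <= 1" using z powr_mono2[of "1/3" z 1] by simp
  moreover have "z <= z powr (1/3)" using z powr_mono'[of "1/3" 1 z] by simp
  moreover have "\<bar>- 2 * a + 3 * b - z\<bar> <= 8 * (1 - z)" if "1 <= a" "a <= 1 + 2 * (1 - z)" "b <= 1" "z <= b" for a b
   unfolding abs_le_iff using that z by argo
  ultimately have "\<bar>- 2 * z powr (-1/2) + 3 * z powr (1/3) - z\<bar> <= 8 * (1 - z)" by blast
  also have "8 * (1 - z) <= 8 * (1 / Y)" using zY by (rule mult_left_mono) simp
  finally have h: "\<bar>- 2 * z powr (-1/2) + 3 * z powr (1/3) - z\<bar> <= 8 * (1 / Y)" .
  have "\<bar>\<rho> * (Y\<^sup>2 * (- 2 * z powr (-1/2) + 3 * z powr (1/3) - z))\<bar> <= 1 * (Y\<^sup>2 * (8 * (1 / Y)))"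
   unfolding abs_mult using \<rho> h by (intro mult_mono) auto
  also have "... = 8 * Y" using Y by (simp add: power2_eq_square)
  finally show ?thesis .
 qed
 have four: "\<bar>a - b - c - d\<bar> <= a' + b' + c' + d'" if "\<bar>a\<bar> <= a'" "\<bar>b\<bar> <= b'" "\<bar>c\<bar> <= c'" "\<bar>d\<bar> <= d'" for a b c d a' b' c' d' :: real
  using that unfolding abs_le_iff by argo
 have "Y powr (5/2) * A2 + Y powr (5/3) * A3 - Y * S - (C * Y powr (5/2) + D * Y powr (5/3))
   = \<rho> * (- 2 * (Y powr (5/2) * Y powr (-1/2)) * z powr (-1/2) + 3 * (Y powr (5/3) * Y powr (1/3)) * z powr (1/3) - Y * real N)
    - Y powr (5/2) * (C - A2 - 2 * \<rho> * real N powr (-1/2)) - Y powr (5/3) * (D - A3 + 3 * \<rho> * real N powr (1/3)) - Y * (S - \<rho> * real N)"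
  unfolding Npow by (simp only: algebra_simps)
 also have "- 2 * (Y powr (5/2) * Y powr (-1/2)) * z powr (-1/2) + 3 * (Y powr (5/3) * Y powr (1/3)) * z powr (1/3) - Y * real N
   = Y\<^sup>2 * (- 2 * z powr (-1/2) + 3 * z powr (1/3) - z)"
  unfolding pw Nz by (simp only: algebra_simps power2_eq_square)
 finally have "\<bar>Y powr (5/2) * A2 + Y powr (5/3) * A3 - Y * S - (C * Y powr (5/2) + D * Y powr (5/3))\<bar>
   <= 8 * Y + 4 * (2 * R + 1) * Y + 2 * (2 * R + 1) * Y + R * Y"
  using four[OF e4 e1 e2 e3] by (simp only:)
 also have "... <= 15 * (R + 1) * Y" using R0 Y by (simp add: algebra_simps)
 finally show ?thesis .
qed

definition pairs :: "nat => int => real => (int \<times> int) set" where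
 "pairs q l y = {(a, b). a >= 1 & b >= 1 & of_int (a ^ 2 * b ^ 3) <= y & [a ^ 2 * b ^ 3 = l] (mod int q)}"

definition pair_error :: "nat => int => real => real" where
 "pair_error q l y = real (card (pairs q l y)) - (C_coeff q l * y powr (1/2) + D_coeff q l * y powr (1/3)) / real q"

lemma le_curve_iff:
 fixes a b Y :: real
 assumes "a > 0" "b > 0" "Y > 0"
 shows "a <= Y powr (1 + 3/2) * b powr (- (3/2)) \<longleftrightarrow> a ^ 2 * b ^ 3 <= Y ^ 5"
  and "b <= Y powr (1 + 2/3) * a powr (- (2/3)) \<longleftrightarrow> a ^ 2 * b ^ 3 <= Y ^ 5"
proof -
 have "a <= Y powr (1 + 3/2) * b powr (- (3/2)) \<longleftrightarrow> a ^ 2 <= (Y powr (1 + 3/2) * b powr (- (3/2))) ^ 2"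
  using assms by (intro power_mono_iff[symmetric]) auto
 also have "(Y powr (1 + 3/2) * b powr (- (3/2))) ^ 2 = Y ^ 5 / b ^ 3"
  using assms by (simp add: power_mult_distrib power_divide powr_power powr_minus_divide powr_numeral)
 finally show "a <= Y powr (1 + 3/2) * b powr (- (3/2)) \<longleftrightarrow> a ^ 2 * b ^ 3 <= Y ^ 5"
  using assms by (simp add: pos_le_divide_eq)
 have "b <= Y powr (1 + 2/3) * a powr (- (2/3)) \<longleftrightarrow> b ^ 3 <= (Y powr (1 + 2/3) * a powr (- (2/3))) ^ 3"
  using assms by (intro power_mono_iff[symmetric]) auto
 also have "(Y powr (1 + 2/3) * a powr (- (2/3))) ^ 3 = Y ^ 5 / a ^ 2"
  using assms by (simp add: power_mult_distrib power_divide powr_power powr_minus_divide powr_numeral)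
 finally show "b <= Y powr (1 + 2/3) * a powr (- (2/3)) \<longleftrightarrow> a ^ 2 * b ^ 3 <= Y ^ 5"
  using assms by (simp add: pos_le_divide_eq mult.commute)
qed

lemma sum_int_interval:
 fixes f :: "int => real"
 shows "(\<Sum>n\<in>{1..<int m + 1}. f n) = (\<Sum>k=1..m. f (int k))"
proof -
 have "{1..<int m + 1} = int ` {1..m}"
 proof (intro equalityI subsetI)
  fix n assume "n \<in> {1..<int m + 1}"
  then have "n = int (nat n)" "nat n \<in> {1..m}" by auto
  then show "n \<in> int ` {1..m}" by blast
 qed auto
 then show ?thesis by (simp add: sum.reindex)
qed

text \<open>The cut is made at Y because a = b = Y lies on the boundary curve, so that b > Y forces
  a <= Y. The second part starts just above Y, which makes the two parts disjoint.\<close>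

lemma card_pairs:
 fixes Y :: real
 assumes Y: "Y >= 1"
 defines "U \<equiv> {1..<\<lfloor>Y\<rfloor> + 1}"
 shows "card (pairs q l (Y ^ 5)) =
  (\<Sum>b\<in>U. card {a \<in> {1..<\<lfloor>Y powr (1 + 3/2) * of_int b powr (- (3/2))\<rfloor> + 1}. [a ^ 2 * b ^ 3 = l] (mod int q)})
  + (\<Sum>a\<in>U. card {b \<in> {\<lfloor>Y\<rfloor> + 1..<\<lfloor>Y powr (1 + 2/3) * of_int a powr (- (2/3))\<rfloor> + 1}. [a ^ 2 * b ^ 3 = l] (mod int q)})"
proof -
 define P1 where "P1 = (%b. {a \<in> {1..<\<lfloor>Y powr (1 + 3/2) * of_int b powr (- (3/2))\<rfloor> + 1}. [a ^ 2 * b ^ 3 = l] (mod int q)})"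
 define P2 where "P2 = (%a. {b \<in> {\<lfloor>Y\<rfloor> + 1..<\<lfloor>Y powr (1 + 2/3) * of_int a powr (- (2/3))\<rfloor> + 1}. [a ^ 2 * b ^ 3 = l] (mod int q)})"
 have fin: "finite (P1 b)" "finite (P2 b)" for b
  unfolding P1_def P2_def by (rule finite_subset[OF Collect_restrict], simp)+
 have c1: "a < \<lfloor>Y powr (1 + 3/2) * of_int b powr (- (3/2))\<rfloor> + 1 \<longleftrightarrow> of_int (a ^ 2 * b ^ 3) <= Y ^ 5" if "a >= 1" "b >= 1" for a b :: int
  using le_curve_iff(1)[of "of_int a" "of_int b" Y] that Y by (simp add: le_floor_iff)
 have c2: "b < \<lfloor>Y powr (1 + 2/3) * of_int a powr (- (2/3))\<rfloor> + 1 \<longleftrightarrow> of_int (a ^ 2 * b ^ 3) <= Y ^ 5" if "a >= 1" "b >= 1" for a b :: int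
  using le_curve_iff(2)[of "of_int a" "of_int b" Y] that Y by (simp add: le_floor_iff)
 have small: "a < \<lfloor>Y\<rfloor> + 1" if "a >= 1" "b >= \<lfloor>Y\<rfloor> + 1" "of_int (a ^ 2 * b ^ 3) <= Y ^ 5" for a b :: int
 proof -
  have b: "Y <= of_int b" using that(2) by linarith
  have "of_int a ^ 2 * Y ^ 3 <= of_int a ^ 2 * of_int b ^ 3" using b Y by (intro mult_left_mono power_mono) auto
  also have "... <= Y ^ 2 * Y ^ 3" using that(3) by (simp add: power_add[symmetric])
  finally have m: "of_int a ^ 2 * Y ^ 3 <= Y ^ 2 * Y ^ 3" .
  have "Y ^ 3 > 0" "0 <= Y" using Y by auto
  then have "of_int a <= Y" using power2_le_imp_le[OF mult_right_le_imp_le[OF m]] by blast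
  then show ?thesis by (simp add: le_floor_iff)
 qed
 have Y1: "\<lfloor>Y\<rfloor> >= 1" using Y by (simp add: le_floor_iff)
 have "pairs q l (Y ^ 5) = prod.swap ` (SIGMA b:U. P1 b) \<union> (SIGMA a:U. P2 a)"
 proof (intro equalityI subsetI)
  fix p assume "p \<in> pairs q l (Y ^ 5)"
  then obtain a b where p: "p = (a, b)" "a >= 1" "b >= 1" "of_int (a ^ 2 * b ^ 3) <= Y ^ 5" "[a ^ 2 * b ^ 3 = l] (mod int q)" by (auto simp: pairs_def)
  show "p \<in> prod.swap ` (SIGMA b:U. P1 b) \<union> (SIGMA a:U. P2 a)"
  proof (cases "b < \<lfloor>Y\<rfloor> + 1")
   case True
   then have "(b, a) \<in> (SIGMA b:U. P1 b)" using p c1[of a b] by (simp add: U_def P1_def)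
   then have "prod.swap (b, a) \<in> prod.swap ` (SIGMA b:U. P1 b)" by (rule imageI)
   then show ?thesis using p by simp
  next
   case False
   then show ?thesis using p c2[of a b] small[of a b] by (simp add: U_def P2_def)
  qed
 next
  fix p assume "p \<in> prod.swap ` (SIGMA b:U. P1 b) \<union> (SIGMA a:U. P2 a)"
  then consider a b where "p = (a, b)" "b \<in> U" "a \<in> P1 b" | a b where "p = (a, b)" "a \<in> U" "b \<in> P2 a" by auto
  then show "p \<in> pairs q l (Y ^ 5)"
  proof cases
   case 1
   then show ?thesis using c1[of a b] by (simp add: U_def P1_def pairs_def)
  next
   case 2
   then show ?thesis using c2[of a b] Y1 by (simp add: U_def P2_def pairs_def)
  qed
 qed
 moreover have "prod.swap ` (SIGMA b:U. P1 b) \<inter> (SIGMA a:U. P2 a) = {}" by (auto simp: U_def P2_def)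
 moreover have "finite U" by (simp add: U_def)
 ultimately have "card (pairs q l (Y ^ 5)) = card (prod.swap ` (SIGMA b:U. P1 b)) + card (SIGMA a:U. P2 a)"
  using fin by (simp add: card_Un_disjoint)
 also have "card (prod.swap ` (SIGMA b:U. P1 b)) = card (SIGMA b:U. P1 b)" by (rule card_image) simp
 also have "... = (\<Sum>b\<in>U. card (P1 b))" using fin \<open>finite U\<close> by (simp add: card_SigmaI)
 also have "card (SIGMA a:U. P2 a) = (\<Sum>a\<in>U. card (P2 a))" using fin \<open>finite U\<close> by (simp add: card_SigmaI)
 finally show ?thesis unfolding P1_def P2_def .
qed

lemma powr_fifth:
 fixes y :: real
 assumes "y > 0"
 defines "Y \<equiv> y powr (1/5)"
 shows "y = Y ^ 5" "y powr (1/2) = Y powr (5/2)" "y powr (1/3) = Y powr (5/3)"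
 using assms by (simp_all add: powr_power powr_powr)

text \<open>The columns b <= Y and the columns a <= Y are two instances of \<open>pointset\<close>,
  the curve and its transpose, with \<kappa> = 3/2 and \<kappa> = 2/3. For Y < sqrt q the trivial
  bound for the columns is used. It is kept as Y, rather than weakened to the maximum, because it
  decays fast enough in Y for the later sum over m.\<close>

lemma (in modsys) pair_error_bound:
 fixes y :: real
 defines "Y \<equiv> y powr (1/5)"
 assumes y: "y > 0"
 shows "\<bar>pair_error q l y\<bar> <= 2000000 * G\<^sup>2 * real (floor_log q + 1) ^ 3 *
  (if Y < sqrt q then Y else max (Y powr (5/6) * real q powr (1/12)) (Y * real q powr (-1/5)))"
proof -
 interpret P2: pointset q "X q l" "4 * G\<^sup>2" by (rule X_pointset)
 interpret P3: pointset q "prod.swap ` X q l" "4 * G\<^sup>2" by (rule P2.transpose)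
 define \<Gamma> where "\<Gamma> = 4 * G\<^sup>2"
 define L where "L = real (floor_log q + 1)"
 have Leq: "P2.L = L" "P3.L = L" by (simp_all add: P2.L_def P3.L_def L_def)
 have L1: "L >= 1" by (simp add: L_def)
 have Gam: "\<Gamma> >= 1" using P2.G1 by (simp add: \<Gamma>_def)
 have q: "real q > 0" "sqrt q >= 1" "sqrt q > 0" using q0 by auto
 have Y0: "Y > 0" using y by (simp add: Y_def)
 note y5 = powr_fifth[OF y, folded Y_def]
 define \<rho> where "\<rho> = real (totient q) / real q"
 have \<rho>: "0 <= \<rho>" "\<rho> <= 1" using q totient_le[of q] by (simp_all add: \<rho>_def)
 define R where "R = 8 * \<Gamma> * L * sqrt q"
 define c2 where "c2 = (%k. real (N2 (l * int k) q))"
 define c3 where "c3 = (%k. real (N3 (l * int k) q))"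
 have f2: "card (P2.fib b) = N2 (l * b) q" for b unfolding P2.fib_def by (rule card_X_fiber[OF q0 cop])
 have f3: "card (P3.fib b) = N3 (l * b) q" for b unfolding P3.fib_def by (rule card_X_fiber_swap[OF q0 cop])
 have cX: "card (prod.swap ` X q l) = totient q" using card_X by (simp add: card_image)
 have d2: "\<bar>(\<Sum>k=1..m. c2 k) - \<rho> * real m\<bar> <= R" for m
  using P2.discrepancy[of 1 "int m + 1"] unfolding f2 card_X sum_int_interval Leq by (simp add: c2_def \<rho>_def R_def \<Gamma>_def)
 have d3: "\<bar>(\<Sum>k=1..m. c3 k) - \<rho> * real m\<bar> <= R" for m
  using P3.discrepancy[of 1 "int m + 1"] unfolding f3 cX sum_int_interval Leq by (simp add: c3_def \<rho>_def R_def \<Gamma>_def)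
 have Ceq: "C_coeff q l = (\<Sum>k. c2 (Suc k) / real (Suc k) powr (3/2))" by (simp add: C_coeff_def c2_def)
 have Deq: "D_coeff q l = - 2 * \<rho> + 2 / 3 * (LBINT u:{1..}. ((\<Sum>a\<in>{1..nat \<lfloor>u\<rfloor>}. c3 a) - \<rho> * u) / u powr (5/3))"
  by (simp add: D_coeff_def c3_def \<rho>_def)
 have CN: "\<bar>C_coeff q l - (\<Sum>k=1..N. c2 k / real k powr (3/2)) - 2 * \<rho> * real N powr (-1/2)\<bar> <= (2 * R + 1) * real N powr (-3/2)" if "N >= 1" for N
  unfolding Ceq by (rule mean_value_series(2)[OF d2 \<rho> _ that]) (simp add: c2_def)
 have DN: "\<bar>D_coeff q l - (\<Sum>k=1..N. c3 k / real k powr (2/3)) + 3 * \<rho> * real N powr (1/3)\<bar> <= (2 * R + 1) * real N powr (-2/3)" if "N >= 1" for N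
  unfolding Deq by (rule mean_value_integral[OF d3 \<rho> that])
 have GL: "1 <= \<Gamma> * L" using mult_mono[of 1 \<Gamma> 1 L] Gam L1 by simp
 have GLq: "\<Gamma> * L <= \<Gamma> * L * sqrt q" using mult_left_mono[of 1 "sqrt q" "\<Gamma> * L"] q GL by simp
 have Rq: "R = 8 * (\<Gamma> * L * sqrt q)" by (simp add: R_def)
 have R0: "R >= 0" "R + 1 <= 9 * (\<Gamma> * L * sqrt q)" unfolding Rq using GL GLq by argo+
 have LL: "L <= L ^ 3" "1 <= L ^ 3" using L1 power_increasing[of 1 3 L] one_le_power[of L 3] by auto
 have GL3: "\<Gamma> * L <= \<Gamma> * L ^ 3" using LL Gam by (intro mult_left_mono) auto
 define T where "T = max (Y powr (5/6) * real q powr (1/12)) (Y * real q powr (-1/5))"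
 \<comment> \<open>Common to both ranges of Y >= 1: \<open>E2\<close> and \<open>E3\<close> are any
   available bounds for the column errors, and the last term is the cost of the main terms.\<close>
 have large: "\<bar>pair_error q l y\<bar> <= (E2 + E3) + 135 * (\<Gamma> * L) * (Y / sqrt q)"
  if Y1: "Y >= 1"
   and E2: "\<bar>\<Sum>n\<in>{1..<\<lfloor>Y\<rfloor> + 1}. P2.err 0 (Y powr (1 + 3/2) * of_int n powr (- (3/2))) n\<bar> <= E2"
   and E3: "\<bar>\<Sum>n\<in>{1..<\<lfloor>Y\<rfloor> + 1}. P3.err Y (Y powr (1 + 2/3) * of_int n powr (- (2/3))) n\<bar> <= E3" for E2 E3
 proof -
  define N where "N = nat \<lfloor>Y\<rfloor>"
  have N: "N >= 1" "real N <= Y" "Y < real N + 1" "\<lfloor>Y\<rfloor> = int N" using Y1 unfolding N_def by linarith+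
  define F2 where "F2 = (%n::int. Y powr (1 + 3/2) * of_int n powr (- (3/2)))"
  define F3 where "F3 = (%n::int. Y powr (1 + 2/3) * of_int n powr (- (2/3)))"
  define U where "U = {1..<\<lfloor>Y\<rfloor> + 1}"
  have s2: "card {a \<in> {u..<v}. [a ^ 2 * b ^ 3 = l] (mod int q)} = (\<Sum>P\<in>P2.fib b. P2.hits u v (fst P))" for u v b
  proof (rule P2.slice_card)
   fix m n :: int
   have "[(m mod int q) ^ 2 * (n mod int q) ^ 3 = m ^ 2 * n ^ 3] (mod int q)" by (intro cong_mult cong_pow) (auto simp: cong_def)
   then show "(m mod int q, n mod int q) \<in> X q l \<longleftrightarrow> [m ^ 2 * n ^ 3 = l] (mod int q)"
    unfolding X_def using q0 by (simp only: mem_Collect_eq case_prod_conv pos_mod_sign pos_mod_bound of_nat_0_less_iff simp_thms) (meson cong_trans cong_sym)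
  qed
  have s3: "card {b \<in> {u..<v}. [a ^ 2 * b ^ 3 = l] (mod int q)} = (\<Sum>P\<in>P3.fib a. P3.hits u v (fst P))" for u v a
  proof (rule P3.slice_card)
   fix m n :: int
   have "[(n mod int q) ^ 2 * (m mod int q) ^ 3 = n ^ 2 * m ^ 3] (mod int q)" by (intro cong_mult cong_pow) (auto simp: cong_def)
   moreover have "(m mod int q, n mod int q) \<in> prod.swap ` X q l \<longleftrightarrow> (n mod int q, m mod int q) \<in> X q l" by (force simp: image_iff)
   ultimately show "(m mod int q, n mod int q) \<in> prod.swap ` X q l \<longleftrightarrow> [n ^ 2 * m ^ 3 = l] (mod int q)"
    unfolding X_def using q0 by (simp only: mem_Collect_eq case_prod_conv pos_mod_sign pos_mod_bound of_nat_0_less_iff simp_thms) (meson cong_trans cong_sym)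
  qed
  have "real (card (pairs q l y)) = (\<Sum>b\<in>U. \<Sum>P\<in>P2.fib b. real (P2.hits 1 (\<lfloor>F2 b\<rfloor> + 1) (fst P)))
    + (\<Sum>a\<in>U. \<Sum>P\<in>P3.fib a. real (P3.hits (\<lfloor>Y\<rfloor> + 1) (\<lfloor>F3 a\<rfloor> + 1) (fst P)))"
   unfolding y5(1) card_pairs[OF Y1] s2 s3 F2_def F3_def U_def by simp
  also have "... = (\<Sum>b\<in>U. P2.err 0 (F2 b) b + real (N2 (l * b) q) * F2 b / real q) + (\<Sum>a\<in>U. P3.err Y (F3 a) a + real (N3 (l * a) q) * (F3 a - Y) / real q)"
   by (simp add: P2.err_def P3.err_def f2 f3)
  also have "... = (\<Sum>b\<in>U. P2.err 0 (F2 b) b) + (\<Sum>a\<in>U. P3.err Y (F3 a) a)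
    + ((\<Sum>b\<in>U. real (N2 (l * b) q) * F2 b) + (\<Sum>a\<in>U. real (N3 (l * a) q) * (F3 a - Y))) / real q"
   by (simp add: sum.distrib sum_divide_distrib add_divide_distrib)
  also have "(\<Sum>b\<in>U. real (N2 (l * b) q) * F2 b) = Y powr (5/2) * (\<Sum>k=1..N. c2 k / real k powr (3/2))"
   unfolding U_def N(4) sum_int_interval by (simp add: c2_def F2_def sum_distrib_left powr_minus_divide mult_ac)
  also have "(\<Sum>a\<in>U. real (N3 (l * a) q) * (F3 a - Y)) = Y powr (5/3) * (\<Sum>k=1..N. c3 k / real k powr (2/3)) - Y * (\<Sum>k=1..N. c3 k)"
   unfolding U_def N(4) sum_int_interval by (simp add: c3_def F3_def sum_distrib_left powr_minus_divide right_diff_distrib sum_subtractf mult_ac)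
  finally have "pair_error q l y = (\<Sum>b\<in>U. P2.err 0 (F2 b) b) + (\<Sum>a\<in>U. P3.err Y (F3 a) a)
    + (Y powr (5/2) * (\<Sum>k=1..N. c2 k / real k powr (3/2)) + Y powr (5/3) * (\<Sum>k=1..N. c3 k / real k powr (2/3)) - Y * (\<Sum>k=1..N. c3 k)
     - (C_coeff q l * Y powr (5/2) + D_coeff q l * Y powr (5/3))) / real q"
   unfolding pair_error_def y5(2,3) by (simp add: diff_divide_distrib add_divide_distrib)
  moreover have "\<bar>(Y powr (5/2) * (\<Sum>k=1..N. c2 k / real k powr (3/2)) + Y powr (5/3) * (\<Sum>k=1..N. c3 k / real k powr (2/3)) - Y * (\<Sum>k=1..N. c3 k)
     - (C_coeff q l * Y powr (5/2) + D_coeff q l * Y powr (5/3))) / real q\<bar> <= 135 * (\<Gamma> * L) * (Y / sqrt q)"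
  proof -
   have "\<bar>Y powr (5/2) * (\<Sum>k=1..N. c2 k / real k powr (3/2)) + Y powr (5/3) * (\<Sum>k=1..N. c3 k / real k powr (2/3)) - Y * (\<Sum>k=1..N. c3 k)
     - (C_coeff q l * Y powr (5/2) + D_coeff q l * Y powr (5/3))\<bar> <= 15 * (R + 1) * Y"
    by (rule main_terms[OF Y1 N(2,3) \<rho> CN[OF N(1)] DN[OF N(1)] d3])
   also have "... <= 15 * (9 * (\<Gamma> * L * sqrt q)) * Y" using R0 Y0 by (intro mult_right_mono mult_left_mono) auto
   also have "... / real q = 135 * (\<Gamma> * L) * (Y * (sqrt q / real q))" by simp
   also have "sqrt q / real q = 1 / sqrt q" using q by (simp add: field_simps)
   finally show ?thesis using q by (simp add: abs_divide divide_right_mono)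
  qed
  moreover have "\<bar>a + b + c\<bar> <= (a' + b') + c'" if "\<bar>a\<bar> <= a'" "\<bar>b\<bar> <= b'" "\<bar>c\<bar> <= c'" for a b c a' b' c' :: real
   using that unfolding abs_le_iff by argo
  ultimately show ?thesis using E2 E3 unfolding F2_def F3_def U_def by simp
 qed
 have small: "\<bar>pair_error q l y\<bar> <= 200 * (\<Gamma> * L) * Y" if Ysm: "Y < sqrt q"
 proof (cases "Y >= 1")
  case True
  have fl: "0 < real_of_int n & real_of_int n <= Y" if "n \<in> {1..<\<lfloor>Y\<rfloor> + 1}" for n
   using that by (auto simp: le_floor_iff)
  have cardU: "(\<Sum>n\<in>{1..<\<lfloor>Y\<rfloor> + 1}. \<Gamma>) <= \<Gamma> * Y" using Gam True by (simp add: mult.commute)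
  have w3: "Y <= Y powr (1 + 2/3) * z powr (- (2/3))" if "0 < z" "z <= Y" for z
  proof -
   have "Y = Y powr (1 + 2/3) * Y powr (- (2/3))" using Y0 by (simp add: powr_add[symmetric])
   also have "... <= Y powr (1 + 2/3) * z powr (- (2/3))" using that by (intro mult_left_mono powr_mono2') auto
   finally show ?thesis .
  qed
  have 1: "\<bar>pair_error q l y\<bar> <= (\<Gamma> * Y + \<Gamma> * Y) + 135 * (\<Gamma> * L) * (Y / sqrt q)"
  proof (rule large[OF True])
   show "\<bar>\<Sum>n\<in>{1..<\<lfloor>Y\<rfloor> + 1}. P2.err 0 (Y powr (1 + 3/2) * of_int n powr (- (3/2))) n\<bar> <= \<Gamma> * Y"
    unfolding \<Gamma>_def by (intro order_trans[OF order_trans[OF sum_abs sum_mono] cardU[unfolded \<Gamma>_def]] P2.err_trivial) auto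
   show "\<bar>\<Sum>n\<in>{1..<\<lfloor>Y\<rfloor> + 1}. P3.err Y (Y powr (1 + 2/3) * of_int n powr (- (2/3))) n\<bar> <= \<Gamma> * Y"
    unfolding \<Gamma>_def using Y0 fl by (intro order_trans[OF order_trans[OF sum_abs sum_mono] cardU[unfolded \<Gamma>_def]] P3.err_trivial w3) auto
  qed
  have "135 * (\<Gamma> * L) * (Y / sqrt q) <= 135 * (\<Gamma> * L) * Y"
   using q Y0 GL divide_left_mono[of 1 "sqrt q" Y] by (intro mult_left_mono) auto
  then have 2: "135 * (\<Gamma> * L) * (Y / sqrt q) <= 135 * ((\<Gamma> * L) * Y)" by (simp only: mult.assoc)
  have 3: "\<Gamma> * Y <= (\<Gamma> * L) * Y" using Gam L1 Y0 by (intro mult_right_mono) auto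
  have 4: "0 < (\<Gamma> * L) * Y" using GL Y0 by simp
  have "p <= 200 * z" if "p <= (g + g) + w" "w <= 135 * z" "g <= z" "0 < z" for p g w z :: real
   using that by linarith
  from this[OF 1 2 3 4] show ?thesis by (simp only: mult.assoc)
 next
  case False
  \<comment> \<open>There are no pairs now, so the main terms themselves have to be of order Y. The
    coefficients are at most of order \<Gamma> L sqrt q, and the powers 5/2 and 5/3 of Y < 1 are
    below Y.\<close>
  have "y < 1"
  proof -
   have "Y ^ 5 < 1 ^ 5" using False Y0 by (intro power_strict_mono) auto
   then show ?thesis using y5(1) by simp
  qed
  have "a ^ 2 * b ^ 3 >= 1" if "a >= 1" "b >= 1" for a b :: int
   using mult_mono[of 1 "a ^ 2" 1 "b ^ 3"] one_le_power[of a 2] one_le_power[of b 3] that by simp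
  then have ge1: "real_of_int (a ^ 2 * b ^ 3) >= 1" if "a >= 1" "b >= 1" for a b :: int
   using that by (simp only: of_int_1_le_iff)
  have "pairs q l y = {}" unfolding pairs_def using ge1 \<open>y < 1\<close> by force
  then have "\<bar>pair_error q l y\<bar> = \<bar>C_coeff q l * Y powr (5/2) + D_coeff q l * Y powr (5/3)\<bar> / real q"
   by (simp add: pair_error_def y5(2,3))
  also have "... <= (42 * (\<Gamma> * L * sqrt q) * Y) / real q"
  proof (rule divide_right_mono)
   have c1: "0 <= c2 1" "c2 1 <= \<Gamma>" "0 <= c3 1" "c3 1 <= \<Gamma>"
    using P2.card_fib[of 1] P3.card_fib[of 1] unfolding f2 f3 by (simp_all add: c2_def c3_def \<Gamma>_def)
   have G': "\<Gamma> <= \<Gamma> * L * sqrt q"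
   proof -
    have "\<Gamma> <= \<Gamma> * L" using Gam L1 by simp
    then show ?thesis using GLq by linarith
   qed
   have "\<bar>C_coeff q l - c2 1 - 2 * \<rho>\<bar> <= 2 * R + 1" using CN[of 1] by simp
   then have "\<bar>C_coeff q l\<bar> <= 21 * (\<Gamma> * L * sqrt q)" using c1 \<rho> Rq G' GL GLq unfolding abs_le_iff by argo
   moreover have "\<bar>D_coeff q l - c3 1 + 3 * \<rho>\<bar> <= 2 * R + 1" using DN[of 1] by simp
   then have "\<bar>D_coeff q l\<bar> <= 21 * (\<Gamma> * L * sqrt q)" using c1 \<rho> Rq G' GL GLq unfolding abs_le_iff by argo
   moreover have "Y powr (5/2) <= Y" "Y powr (5/3) <= Y" using False Y0 powr_mono'[of 1 "5/2" Y] powr_mono'[of 1 "5/3" Y] by auto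
   ultimately have "\<bar>C_coeff q l * Y powr (5/2)\<bar> <= 21 * (\<Gamma> * L * sqrt q) * Y" "\<bar>D_coeff q l * Y powr (5/3)\<bar> <= 21 * (\<Gamma> * L * sqrt q) * Y"
    unfolding abs_mult using Y0 GL q by (auto intro!: mult_mono)
   then show "\<bar>C_coeff q l * Y powr (5/2) + D_coeff q l * Y powr (5/3)\<bar> <= 42 * (\<Gamma> * L * sqrt q) * Y" by argo
  qed simp
  also have "... = (42 * (\<Gamma> * L) * Y) * (sqrt q / real q)" by simp
  also have "... <= (42 * (\<Gamma> * L) * Y) * 1"
  proof (rule mult_left_mono)
   have "sqrt q / real q = 1 / sqrt q" using q by (simp add: field_simps)
   then show "sqrt q / real q <= 1" using q by simp
  qed (use GL Y0 in auto)
  also have "... <= 200 * (\<Gamma> * L) * Y" using GL Y0 by (simp add: mult_right_mono)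
  finally show ?thesis .
 qed
 show ?thesis
 proof (cases "Y < sqrt q")
  case True
  have "200 * (\<Gamma> * L) * Y <= 500000 * (\<Gamma> * L ^ 3) * Y"
  proof (rule mult_right_mono)
   have "200 * a <= 500000 * b" if "a <= b" "1 <= a" for a b :: real using that by linarith
   from this[OF GL3 GL] show "200 * (\<Gamma> * L) <= 500000 * (\<Gamma> * L ^ 3)" .
  qed (use Y0 in simp)
  then have "\<bar>pair_error q l y\<bar> <= 500000 * (\<Gamma> * L ^ 3) * Y" using small[OF True] by (rule order_trans[rotated])
  then show ?thesis using True by (simp add: \<Gamma>_def L_def)
 next
  case False
  then have Y1: "Y >= 1" "sqrt q <= Y" using q(2) by linarith+
  have 1: "\<bar>pair_error q l y\<bar> <= (200000 * \<Gamma> * L ^ 3 * T + 200000 * \<Gamma> * L ^ 3 * T) + 135 * (\<Gamma> * L) * (Y / sqrt q)"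
  proof (rule large[OF Y1(1)])
   show "\<bar>\<Sum>n\<in>{1..<\<lfloor>Y\<rfloor> + 1}. P2.err 0 (Y powr (1 + 3/2) * of_int n powr (- (3/2))) n\<bar> <= 200000 * \<Gamma> * L ^ 3 * T"
    using P2.hyperbola_error[of "3/2" Y 0] Y1 unfolding Leq T_def \<Gamma>_def by simp
   show "\<bar>\<Sum>n\<in>{1..<\<lfloor>Y\<rfloor> + 1}. P3.err Y (Y powr (1 + 2/3) * of_int n powr (- (2/3))) n\<bar> <= 200000 * \<Gamma> * L ^ 3 * T"
    using P3.hyperbola_error[of "2/3" Y Y] Y1 unfolding Leq T_def \<Gamma>_def by simp
  qed
  have 2: "135 * (\<Gamma> * L) * (Y / sqrt q) <= 135 * (\<Gamma> * L ^ 3) * T"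
  proof (rule mult_mono)
   show "135 * (\<Gamma> * L) <= 135 * (\<Gamma> * L ^ 3)" using GL3 by (rule mult_left_mono) simp
   show "0 <= 135 * (\<Gamma> * L ^ 3)" using order_trans[OF GL GL3] by simp
   show "0 <= Y / sqrt q" using Y0 by simp
   have "Y / sqrt q = Y * real q powr (-1/2)" using q by (simp add: powr_minus_divide powr_half_sqrt)
   also have "... <= Y * real q powr (-1/5)" using Y0 q0 by (intro mult_left_mono powr_mono) auto
   also have "... <= T" by (simp add: T_def)
   finally show "Y / sqrt q <= T" .
  qed
  have 3: "0 <= \<Gamma> * L ^ 3 * T"
  proof (rule mult_nonneg_nonneg)
   show "0 <= \<Gamma> * L ^ 3" using order_trans[OF GL GL3] by (rule order_trans[OF zero_le_one])
   show "0 <= T" using Y0 by (simp add: T_def le_max_iff_disj)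
  qed
  have "p <= 500000 * z" if "p <= (200000 * z + 200000 * z) + w" "w <= 135 * z" "0 <= z" for p z w :: real
   using that by linarith
  from this[OF 1[unfolded mult.assoc] 2[unfolded mult.assoc] 3[unfolded mult.assoc]]
  have "\<bar>pair_error q l y\<bar> <= 500000 * (\<Gamma> * L ^ 3) * T" by (simp only: mult.assoc)
  then show ?thesis using False by (simp add: \<Gamma>_def L_def T_def)
 qed
qed

section \<open>Squarefull numbers and Moebius inversion\<close>

definition mob :: "nat => real" where
 "mob n = (if squarefree n then (-1) ^ card (prime_factors n) else 0)"

lemma abs_mob: "\<bar>mob n\<bar> <= 1" by (simp add: mob_def power_abs)

lemma mob_1: "mob 1 = 1" by (simp add: mob_def)

lemma mob_prime_mult:
 assumes p: "prime p" "~ p dvd d"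
 shows "mob (p * d) = - mob d"
proof -
 have cop: "coprime p d" using p by (simp add: prime_imp_coprime)
 have d0: "d \<noteq> 0" using p by (intro notI) simp
 have "squarefree (p * d) \<longleftrightarrow> squarefree d"
  using squarefree_mult_coprime[OF cop squarefree_prime[OF p(1)]] squarefree_multD(2)[of p d] by blast
 moreover have "prime_factors (p * d) = insert p (prime_factors d)"
  using p d0 by (subst prime_factors_product) (auto simp: prime_prime_factors)
 moreover have "p \<notin> prime_factors d" using p by (auto simp: prime_factors_dvd)
 ultimately show ?thesis by (simp add: mob_def)
qed

lemma sum_mob_divisors:
 assumes "n > 0"
 shows "(\<Sum>d | d dvd n. mob d) = (if n = 1 then 1 else 0)"
proof (cases "n = 1")
 case True
 then show ?thesis using mob_1 by simp
next
 case False
 then obtain p where p: "prime p" "p dvd n" using prime_factor_nat by blast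
 have fin: "finite {d. d dvd n}" using assms by simp
 define T0 where "T0 = {d. d dvd n & squarefree d & ~ p dvd d}"
 define T1 where "T1 = {d. d dvd n & squarefree d & p dvd d}"
 have finT: "finite T0" "finite T1" by (auto intro: finite_subset[OF _ fin] simp: T0_def T1_def)
 have T1: "T1 = (%d. p * d) ` T0"
 proof (intro equalityI subsetI)
  fix d assume d: "d \<in> T1"
  then obtain e where e: "d = p * e" by (auto simp: T1_def elim: dvdE)
  have "~ p dvd e"
  proof
   assume "p dvd e"
   then have "p ^ 2 dvd d" unfolding e power2_eq_square by (rule mult_dvd_mono[OF dvd_refl])
   then show False using d squarefreeD[of d p] p by (auto simp: T1_def)
  qed
  then have "e \<in> T0" using d squarefree_multD(2)[of p e] dvd_mult_right[of p e n] by (auto simp: T0_def T1_def e)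
  then show "d \<in> (%d. p * d) ` T0" using e by blast
 next
  fix d assume "d \<in> (%d. p * d) ` T0"
  then obtain e where e: "d = p * e" "e dvd n" "squarefree e" "~ p dvd e" by (auto simp: T0_def)
  have "coprime p e" using p e by (simp add: prime_imp_coprime)
  then show "d \<in> T1" using e p squarefree_mult_coprime[of p e] squarefree_prime[OF p(1)] divides_mult[of p n e] by (simp add: T1_def)
 qed
 have "(\<Sum>d | d dvd n. mob d) = (\<Sum>d\<in>T0 \<union> T1. mob d)"
  by (rule sum.mono_neutral_right[OF fin]) (auto simp: T0_def T1_def mob_def)
 also have "... = (\<Sum>d\<in>T0. mob d) + (\<Sum>d\<in>T1. mob d)"
  using finT by (intro sum.union_disjoint) (auto simp: T0_def T1_def)
 also have "(\<Sum>d\<in>T1. mob d) = (\<Sum>d\<in>T0. mob (p * d))"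
  unfolding T1 using p by (subst sum.reindex) (auto simp: inj_on_def)
 also have "... = - (\<Sum>d\<in>T0. mob d)"
  unfolding sum_negf[symmetric] by (intro sum.cong refl mob_prime_mult p(1)) (auto simp: T0_def)
 finally show ?thesis using False by simp
qed

lemma squarefree_iff_square_part:
 fixes b :: nat
 assumes "b > 0"
 shows "squarefree b \<longleftrightarrow> square_part b = 1"
proof
 assume "squarefree b"
 then have "square_part b dvd 1" using squarefreeD square_part_square_dvd by blast
 then show "square_part b = 1" by simp
next
 assume "square_part b = 1"
 then have "b = squarefree_part b" using squarefree_decompose[of b] by simp
 then show "squarefree b" using squarefree_squarefree_part[of b] by simp
qed

text \<open>In a^2 b^3 with b squarefree the exponent of a prime is 2u + 3v with v <= 1, so its
  parity is v and b is the squarefree part. Conversely, write n = b s^2 with b squarefree. In a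
  squarefull n no exponent is 1, so an odd exponent is at least 3; hence b divides s, and a = s /
  b.\<close>

lemma squarefull_decomposition:
 "bij_betw (%(a, b). a ^ 2 * b ^ 3) {(a, b). a >= 1 & b >= 1 & squarefree b} {n. squarefull n}"
proof (rule bij_betw_imageI)
 have mult: "multiplicity p (a ^ 2 * b ^ 3) = 2 * multiplicity p a + 3 * multiplicity p b" if "prime p" "a >= 1" "b >= 1" for p a b :: nat
  using that by (simp add: prime_elem_multiplicity_mult_distrib prime_elem_multiplicity_power_distrib)
 have inj: "b = squarefree_part (a ^ 2 * b ^ 3)" if "a >= 1" "b >= 1" "squarefree b" for a b :: nat
 proof (rule multiplicity_eq_nat)
  fix p :: nat assume p: "prime p"
  have "multiplicity p b <= 1" using that p by (simp add: squarefree_factorial_semiring'')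
  moreover have "(2 * u + 3 * v) mod 2 = v" if "v <= 1" for u v :: nat using that by presburger
  ultimately show "multiplicity p b = multiplicity p (squarefree_part (a ^ 2 * b ^ 3))"
   by (simp add: prime_multiplicity_squarefree_part[OF p] mult[OF p that(1,2)])
 qed (use that in \<open>auto intro!: Nat.gr0I\<close>)
 show "inj_on (%(a, b). a ^ 2 * b ^ 3) {(a, b). a >= 1 & b >= 1 & squarefree (b::nat)}"
 proof (rule inj_onI, clarify)
  fix a b a' b' :: nat
  assume h: "1 <= a" "1 <= b" "squarefree b" "1 <= a'" "1 <= b'" "squarefree b'" "a ^ 2 * b ^ 3 = a' ^ 2 * b' ^ 3"
  have "b = b'" using inj[of a b] inj[of a' b'] h by simp
  moreover from this have "a ^ 2 = a' ^ 2" using h by simp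
  then have "a = a'" using power2_eq_imp_eq by blast
  ultimately show "a = a' & b = b'" by simp
 qed
 show "(%(a, b). a ^ 2 * b ^ 3) ` {(a, b). a >= 1 & b >= 1 & squarefree b} = {n. squarefull n}"
 proof (intro equalityI subsetI)
  fix n assume "n \<in> (%(a, b). a ^ 2 * b ^ 3) ` {(a, b). a >= 1 & b >= 1 & squarefree (b::nat)}"
  then obtain a b :: nat where n: "n = a ^ 2 * b ^ 3" "a >= 1" "b >= 1" by auto
  have "p ^ 2 dvd n" if p: "prime p" "p dvd n" for p
  proof -
   from p n have "p dvd a \<or> p dvd b" by (auto simp: prime_dvd_mult_iff prime_dvd_power_iff)
   then show ?thesis
   proof
    assume "p dvd a"
    then show ?thesis unfolding n by (intro dvd_mult2 dvd_power_same)
   next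
    assume "p dvd b"
    then have "p ^ 2 dvd b ^ 2" by (rule dvd_power_same)
    also have "b ^ 2 dvd b ^ 3" by (rule le_imp_power_dvd) simp
    finally show ?thesis unfolding n by (rule dvd_mult)
   qed
  qed
  then show "n \<in> {n. squarefull n}" using n by (auto simp: squarefull_def)
 next
  fix n assume "n \<in> {n. squarefull n}"
  then have n: "n > 0" "\<And>p. prime p ==> p dvd n ==> p ^ 2 dvd n" by (auto simp: squarefull_def)
  define s where "s = square_part n"
  define b where "b = squarefree_part n"
  have s0: "s \<noteq> 0" using n by (simp add: s_def)
  have "b dvd s"
  proof (rule multiplicity_le_imp_dvd)
   show "b \<noteq> 0" by (simp add: b_def)
   fix p :: nat assume p: "prime p"
   have "multiplicity p n \<noteq> 1"
   proof
    assume m: "multiplicity p n = 1"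
    then have "p dvd n" using not_dvd_imp_multiplicity_0 by fastforce
    then have "p ^ 2 dvd n" using n p by blast
    then have "2 <= multiplicity p n" using n p by (intro multiplicity_geI) (auto simp: prime_gt_1_nat dest: prime_gt_1_nat)
    then show False using m by simp
   qed
   then have "multiplicity p n mod 2 <= multiplicity p n div 2" by presburger
   then show "multiplicity p b <= multiplicity p s"
    by (simp add: b_def s_def prime_multiplicity_squarefree_part[OF p] prime_multiplicity_square_part[OF p])
  qed
  then obtain a where a: "s = b * a" by (auto elim: dvdE)
  have "n = b * s ^ 2" using squarefree_decompose[of n] by (simp add: b_def s_def)
  then have "n = a ^ 2 * b ^ 3" by (simp add: a power2_eq_square power3_eq_cube)
  moreover have "a >= 1" using s0 a by (cases a) auto
  moreover have "b >= 1" "squarefree b" using squarefree_part_nonzero[of n] by (auto simp: b_def simp del: squarefree_part_nonzero)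
  ultimately show "n \<in> (%(a, b). a ^ 2 * b ^ 3) ` {(a, b). a >= 1 & b >= 1 & squarefree b}" by force
 qed
qed

text \<open>Writing b = m^2 c turns a^2 b^3 into m^6 a^2 c^3, so both the size and the residue are
  divided by m^6.\<close>

lemma card_divisible_pairs:
 fixes q m :: nat and l l' :: int and x :: real
 assumes m: "m > 0" "coprime m q" and l': "[l' * int m ^ 6 = l] (mod int q)"
 shows "card {(a, b). a >= 1 & b >= 1 & real (a ^ 2 * b ^ 3) <= x & [int (a ^ 2 * b ^ 3) = l] (mod int q) & m ^ 2 dvd b}
  = card (pairs q l' (x / real m ^ 6))"
proof (rule bij_betw_same_card[where f = "%(a, b). (int a, int (b div m ^ 2))"], rule bij_betwI[where g = "%(a, c). (nat a, m ^ 2 * nat c)"])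
 have key: "real (a ^ 2 * (m ^ 2 * c) ^ 3) <= x \<longleftrightarrow> of_int (int a ^ 2 * int c ^ 3) <= x / real m ^ 6"
  "[int (a ^ 2 * (m ^ 2 * c) ^ 3) = l] (mod int q) \<longleftrightarrow> [int a ^ 2 * int c ^ 3 = l'] (mod int q)" for a c :: nat
 proof -
  have e: "a ^ 2 * (m ^ 2 * c) ^ 3 = (a ^ 2 * c ^ 3) * m ^ 6" by (simp add: power_mult_distrib power_mult[symmetric])
  show "real (a ^ 2 * (m ^ 2 * c) ^ 3) <= x \<longleftrightarrow> of_int (int a ^ 2 * int c ^ 3) <= x / real m ^ 6"
   unfolding e using m by (simp add: pos_le_divide_eq)
  have "[int (a ^ 2 * (m ^ 2 * c) ^ 3) = l] (mod int q) \<longleftrightarrow> [(int a ^ 2 * int c ^ 3) * int m ^ 6 = l' * int m ^ 6] (mod int q)"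
   unfolding e using cong_trans[OF _ l'] cong_trans[OF _ cong_sym[OF l']] by (auto simp del: power_mult_distrib)
  also have "... \<longleftrightarrow> [int a ^ 2 * int c ^ 3 = l'] (mod int q)"
   using m by (intro cong_mult_rcancel) simp
  finally show "[int (a ^ 2 * (m ^ 2 * c) ^ 3) = l] (mod int q) \<longleftrightarrow> [int a ^ 2 * int c ^ 3 = l'] (mod int q)" .
 qed
 let ?S = "{(a, b). a >= 1 & b >= 1 & real (a ^ 2 * b ^ 3) <= x & [int (a ^ 2 * b ^ 3) = l] (mod int q) & m ^ 2 dvd b}"
 have fwd: "(int a, int c) \<in> pairs q l' (x / real m ^ 6)" if "(a, m ^ 2 * c) \<in> ?S" for a c
  using that unfolding mem_Collect_eq case_prod_conv key pairs_def by auto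
 have bwd: "(a, m ^ 2 * c) \<in> ?S" if "(int a, int c) \<in> pairs q l' (x / real m ^ 6)" for a c
  using that m unfolding mem_Collect_eq case_prod_conv key pairs_def by auto
 show "(%(a, b). (int a, int (b div m ^ 2))) \<in> ?S \<rightarrow> pairs q l' (x / real m ^ 6)"
 proof
  fix P assume P: "P \<in> ?S"
  obtain a b where ab: "P = (a, b)" by (cases P)
  then have "b = m ^ 2 * (b div m ^ 2)" using P by simp
  then show "(case P of (a, b) => (int a, int (b div m ^ 2))) \<in> pairs q l' (x / real m ^ 6)"
   using fwd[of a "b div m ^ 2"] P unfolding ab by (metis case_prod_conv)
 qed
 have nn: "\<exists>a' c'. P = (int a', int c')" if "P \<in> pairs q l' (x / real m ^ 6)" for P
  using that by (intro exI[of _ "nat (fst P)"] exI[of _ "nat (snd P)"]) (auto simp: pairs_def prod_eq_iff)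
 show "(%(a, c). (nat a, m ^ 2 * nat c)) \<in> pairs q l' (x / real m ^ 6) \<rightarrow> ?S"
 proof
  fix P assume P: "P \<in> pairs q l' (x / real m ^ 6)"
  then obtain a c where "P = (int a, int c)" using nn by blast
  then show "(case P of (a, c) => (nat a, m ^ 2 * nat c)) \<in> ?S" using bwd[of a c] P by simp
 qed
 show "(case (case P of (a, b) => (int a, int (b div m ^ 2))) of (a, c) => (nat a, m ^ 2 * nat c)) = P" if "P \<in> ?S" for P
  using that by auto
 show "(case (case P of (a, c) => (nat a, m ^ 2 * nat c)) of (a, b) => (int a, int (b div m ^ 2))) = P" if "P \<in> pairs q l' (x / real m ^ 6)" for P
  using nn[OF that] m by auto
qed

text \<open>Squarefreeness of b is detected by the sum of the Moebius function over m with m^2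
  dividing b. Such m are automatically coprime to q and at most x. The cutoff M is left arbitrary
  above x, so that it can tend to infinity in the main terms.\<close>

lemma squarefull_count_moebius:
 fixes q :: nat and l :: int and x :: real and lm :: "nat => int"
 assumes q: "q > 0" and l: "coprime l (int q)" and M: "x <= real M"
  and lm: "\<And>m. m > 0 ==> coprime m q ==> [lm m * int m ^ 6 = l] (mod int q)"
 shows "real (squarefull_count q x l) = (\<Sum>m\<in>{m \<in> {1..M}. coprime m q}. mob m * real (card (pairs q (lm m) (x / real m ^ 6))))"
proof -
 define W where "W = {(a, b). a >= 1 & b >= 1 & real (a ^ 2 * b ^ 3) <= x & [int (a ^ 2 * b ^ 3) = l] (mod int q)}"
 have WM: "a <= M & b <= M" if "(a, b) \<in> W" for a b
 proof -
  have ab: "a >= 1" "b >= 1" "real (a ^ 2 * b ^ 3) <= real M" using that M by (auto simp: W_def)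
  then have "a ^ 2 * b ^ 3 <= M" by (simp only: of_nat_le_iff)
  moreover have "a <= a ^ 2 * b ^ 3" using ab mult_le_mono[of a "a ^ 2" 1 "b ^ 3"] by (simp add: power2_eq_square)
  moreover have "b <= a ^ 2 * b ^ 3" using ab mult_le_mono[of 1 "a ^ 2" b "b ^ 3"] by (simp add: power3_eq_cube)
  ultimately show ?thesis by simp
 qed
 have finW: "finite W" by (rule finite_subset[of _ "{..M} \<times> {..M}"]) (use WM in auto)
 have "squarefull_count q x l = card {p \<in> W. squarefree (snd p)}"
  unfolding squarefull_count_def
 proof (rule bij_betw_same_card[symmetric])
  show "bij_betw (%(a, b). a ^ 2 * b ^ 3) {p \<in> W. squarefree (snd p)} {n. squarefull n & real n <= x & [int n = l] (mod int q)}"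
  proof (rule bij_betw_subset[OF squarefull_decomposition])
   show "{p \<in> W. squarefree (snd p)} \<subseteq> {(a, b). a >= 1 & b >= 1 & squarefree b}" by (auto simp: W_def)
   have im: "(%(a, b). a ^ 2 * b ^ 3) ` {(a, b). a >= 1 & b >= 1 & squarefree b} = {n. squarefull n}"
    using squarefull_decomposition by (rule bij_betw_imp_surj_on)
   have "(%(a, b). a ^ 2 * b ^ 3) ` {p \<in> W. squarefree (snd p)}
    = {n \<in> (%(a, b). a ^ 2 * b ^ 3) ` {(a, b). a >= 1 & b >= 1 & squarefree b}. real n <= x & [int n = l] (mod int q)}"
    by (auto simp: W_def)
   then show "(%(a, b). a ^ 2 * b ^ 3) ` {p \<in> W. squarefree (snd p)} = {n. squarefull n & real n <= x & [int n = l] (mod int q)}"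
    unfolding im by simp
  qed
 qed
 then have "real (squarefull_count q x l) = (\<Sum>p\<in>W. if squarefree (snd p) then 1 else 0)"
  unfolding sum.inter_filter[OF finW, symmetric] by simp
 also have "... = (\<Sum>p\<in>W. \<Sum>m\<in>{m \<in> {1..M}. coprime m q}. if m ^ 2 dvd snd p then mob m else 0)"
 proof (rule sum.cong[OF refl])
  fix p assume p: "p \<in> W"
  obtain a b where ab: "p = (a, b)" by (cases p)
  have b: "b >= 1" "b <= M" using p WM[of a b] by (auto simp: ab W_def)
  have "coprime (a ^ 2 * b ^ 3) q"
  proof -
   have c: "[int (a ^ 2 * b ^ 3) = l] (mod int q)" using p unfolding W_def ab by blast
   have "coprime (int (a ^ 2 * b ^ 3)) (int q)" by (rule cong_imp_coprime[OF cong_sym[OF c] l])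
   then show ?thesis by (simp only: coprime_int_iff)
  qed
  then have cb: "coprime b q" by simp
  have m: "m \<in> {1..M} & coprime m q" if "m ^ 2 dvd b" for m
  proof -
   have "m dvd b" using that dvd_mult_left[of m m b] by (simp add: power2_eq_square)
   moreover from this have "coprime m q" using coprime_divisors[OF _ dvd_refl cb] by blast
   moreover have "m > 0" using \<open>m dvd b\<close> b by (intro Nat.gr0I) auto
   ultimately show ?thesis using b dvd_imp_le[of m b] by simp
  qed
  have "(if squarefree b then 1 else 0) = (\<Sum>m | m dvd square_part b. mob m)"
  proof -
   have "square_part b > 0" using b by (intro Nat.gr0I) simp
   then show ?thesis unfolding sum_mob_divisors[OF \<open>square_part b > 0\<close>] using squarefree_iff_square_part[of b] b by simp
  qed
  also have "... = (\<Sum>m | m ^ 2 dvd b. mob m)" by (simp only: dvd_square_part_iff)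
  also have "... = (\<Sum>m\<in>{m \<in> {1..M}. coprime m q}. if m ^ 2 dvd b then mob m else 0)"
   using m by (intro sum.mono_neutral_cong_left) auto
  finally show "(if squarefree (snd p) then 1 else 0) = (\<Sum>m\<in>{m \<in> {1..M}. coprime m q}. if m ^ 2 dvd snd p then mob m else 0)" by (simp add: ab)
 qed
 also have "... = (\<Sum>m\<in>{m \<in> {1..M}. coprime m q}. \<Sum>p\<in>W. if m ^ 2 dvd snd p then mob m else 0)" by (rule sum.swap)
 also have "... = (\<Sum>m\<in>{m \<in> {1..M}. coprime m q}. mob m * real (card (pairs q (lm m) (x / real m ^ 6))))"
 proof (rule sum.cong[OF refl])
  fix m assume m: "m \<in> {m \<in> {1..M}. coprime m q}"
  have "(\<Sum>p\<in>W. if m ^ 2 dvd snd p then mob m else 0) = mob m * real (card {p \<in> W. m ^ 2 dvd snd p})"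
   unfolding sum.inter_filter[OF finW, symmetric] by simp
  also have "{p \<in> W. m ^ 2 dvd snd p} = {(a, b). a >= 1 & b >= 1 & real (a ^ 2 * b ^ 3) <= x & [int (a ^ 2 * b ^ 3) = l] (mod int q) & m ^ 2 dvd b}"
   by (auto simp: W_def)
  also have "card ... = card (pairs q (lm m) (x / real m ^ 6))" using m by (intro card_divisible_pairs lm) auto
  finally show "(\<Sum>p\<in>W. if m ^ 2 dvd snd p then mob m else 0) = mob m * real (card (pairs q (lm m) (x / real m ^ 6)))" .
 qed
 finally show ?thesis .
qed

section \<open>Euler products for the Moebius sums\<close>

lemma summable_on_inverse_powers:
 assumes "k >= 2"
 shows "(%n. 1 / real n ^ k) summable_on A"
proof -
 have "summable (%n. 1 / real n ^ k)" using inverse_power_summable[OF assms, where 'a = real] by (simp add: divide_inverse)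
 then have "(%n. 1 / real n ^ k) summable_on UNIV" by (intro norm_summable_imp_summable_on) simp
 then show ?thesis by (rule summable_on_subset_banach) simp
qed

text \<open>In the set already sieved by P, the multiples of a further prime p are exactly p times
  the set itself. Removing them multiplies the sum by 1 - p^(-k).\<close>

lemma infsum_prime_sieve:
 fixes P :: "nat set"
 assumes k: "k >= 2" and P: "finite P" "\<And>p. p \<in> P ==> prime p"
 shows "infsum (%n. 1 / real n ^ k) {n. n > 0 & (\<forall>p\<in>P. ~ p dvd n)} = (\<Prod>p\<in>P. 1 - 1 / real p ^ k) * zeta (real k)"
 using P
proof (induction P rule: finite_induct)
 case empty
 have "infsum (%n. 1 / real n ^ k) (range Suc) = infsum ((%n. 1 / real n ^ k) \<circ> Suc) UNIV"
  by (rule infsum_reindex) simp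
 also have "... = zeta (real k)"
 proof -
  have "((%n. 1 / real n ^ k) \<circ> Suc) summable_on UNIV"
   using summable_on_inverse_powers[OF k, of "range Suc"] by (subst summable_on_reindex[symmetric]) auto
  then have "((%n. 1 / real n ^ k) \<circ> Suc) sums infsum ((%n. 1 / real n ^ k) \<circ> Suc) UNIV"
   by (intro has_sum_imp_sums has_sum_infsum)
  then show ?thesis unfolding zeta_def by (simp add: sums_iff o_def powr_realpow)
 qed
 also have "range Suc = {n. n > 0}" by (auto simp: image_iff gr0_conv_Suc)
 finally show ?case by simp
next
 case (insert p P)
 define B where "B = {n. n > 0 & (\<forall>p\<in>P. ~ p dvd n)}"
 define S where "S = infsum (%n. 1 / real n ^ k) B"
 have p: "prime p" using insert by simp
 have sets: "B = {n. n > 0 & (\<forall>r\<in>insert p P. ~ r dvd n)} \<union> (%n. p * n) ` B"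
 proof (intro equalityI subsetI)
  fix n assume n: "n \<in> B"
  show "n \<in> {n. n > 0 & (\<forall>r\<in>insert p P. ~ r dvd n)} \<union> (%n. p * n) ` B"
  proof (cases "p dvd n")
   case True
   then obtain c where "n = p * c" by (auto elim: dvdE)
   moreover from this have "c \<in> B" using n by (auto simp: B_def)
   ultimately show ?thesis by blast
  qed (use n in \<open>auto simp: B_def\<close>)
 next
  fix n assume "n \<in> {n. n > 0 & (\<forall>r\<in>insert p P. ~ r dvd n)} \<union> (%n. p * n) ` B"
  moreover have "p * c \<in> B" if c: "c \<in> B" for c
  proof -
   have "~ r dvd p * c" if r: "r \<in> P" for r
   proof -
    have "prime r" "r \<noteq> p" using insert r by auto
    then have "~ r dvd p" using p primes_dvd_imp_eq by blast
    then show ?thesis using c r \<open>prime r\<close> by (auto simp: B_def prime_dvd_mult_iff)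
   qed
   then show ?thesis using c p by (auto simp: B_def prime_gt_0_nat)
  qed
  ultimately show "n \<in> B" by (auto simp: B_def)
 qed
 have "S = infsum (%n. 1 / real n ^ k) {n. n > 0 & (\<forall>r\<in>insert p P. ~ r dvd n)} + infsum (%n. 1 / real n ^ k) ((%n. p * n) ` B)"
  unfolding S_def by (subst sets, rule infsum_Un_disjoint) (auto intro: summable_on_inverse_powers[OF k])
 also have "infsum (%n. 1 / real n ^ k) ((%n. p * n) ` B) = infsum (%n. 1 / real p ^ k * (1 / real n ^ k)) B"
  using p by (subst infsum_reindex) (auto simp: inj_on_def o_def power_mult_distrib prime_gt_0_nat)
 also have "... = 1 / real p ^ k * S" unfolding S_def by (rule infsum_cmult_right')
 finally have "infsum (%n. 1 / real n ^ k) {n. n > 0 & (\<forall>r\<in>insert p P. ~ r dvd n)} = (1 - 1 / real p ^ k) * S"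
  by (simp add: left_diff_distrib)
 also have "S = (\<Prod>p\<in>P. 1 - 1 / real p ^ k) * zeta (real k)" unfolding S_def B_def using insert by blast
 finally show ?case using insert by (simp add: mult.assoc)
qed

text \<open>The product is the absolutely convergent double sum over pairs (m, n). Grouping it by
  the value of mn, which is again positive and coprime to q, leaves the divisor sums of the Moebius
  function.\<close>

lemma mob_inverse_powers:
 fixes q k :: nat
 assumes k: "k >= 2" and q: "q > 0"
 defines "A \<equiv> {n. n > 0 & coprime n q}"
 shows "infsum (%m. mob m / real m ^ k) A * infsum (%n. 1 / real n ^ k) A = 1" "(%m. mob m / real m ^ k) summable_on A"
proof -
 define g where "g = (%n::nat. 1 / real n ^ k)"
 define f where "f = (%n. mob n / real n ^ k)"
 have gA: "g summable_on B" for B unfolding g_def by (rule summable_on_inverse_powers[OF k])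
 have fg: "norm (f n) <= g n" for n unfolding f_def g_def using abs_mob[of n] by (simp add: divide_right_mono)
 have fA: "(%n. norm (f n)) summable_on B" for B by (rule Infinite_Sum.abs_summable_on_comparison_test'[OF gA fg])
 show "(%m. mob m / real m ^ k) summable_on A" using Infinite_Sum.abs_summable_summable[OF fA[of A]] by (simp add: f_def)
 have prod: "(%z. f (fst z) * g (snd z)) summable_on A \<times> A"
 proof (rule Infinite_Sum.abs_summable_summable, subst Infinite_Sum.abs_summable_on_Sigma_iff, intro conjI ballI)
  have n: "norm (f x * g y) = norm (f x) * g y" for x y by (simp add: g_def abs_mult)
  show "(%y. norm (f (fst (x, y)) * g (snd (x, y)))) summable_on A" for x
   unfolding fst_conv snd_conv n by (intro summable_on_cmult_right gA)
  have "(%x. norm (f x) * infsum g A) summable_on A" by (intro summable_on_cmult_left fA)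
  moreover have "0 <= infsum g A" by (intro infsum_nonneg) (simp add: g_def)
  ultimately show "(%x. norm (infsum (%y. norm (f (fst (x, y)) * g (snd (x, y)))) A)) summable_on A"
   unfolding fst_conv snd_conv n infsum_cmult_right' by (simp add: abs_mult)
 qed
 have "infsum f A * infsum g A = infsum (%x. infsum (%y. f x * g y) A) A"
  by (simp only: infsum_cmult_right' infsum_cmult_left')
 also have "... = infsum (%z. f (fst z) * g (snd z)) (A \<times> A)"
  using infsum_Sigma_banach[OF prod] by simp
 also have "... = infsum (%z. mob (snd z) * g (fst z)) (SIGMA n:A. {m. m dvd n})"
 proof -
  have bij: "bij_betw (%(m, n). (m * n, m)) (A \<times> A) (SIGMA n:A. {m. m dvd n})"
  proof (rule bij_betwI[where g = "%(n, m). (m, n div m)"])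
   show "(%(n, m). (m, n div m)) \<in> (SIGMA n:A. {m. m dvd n}) \<rightarrow> A \<times> A"
    by (auto simp: A_def elim!: dvdE)
  qed (auto simp: A_def elim!: dvdE)
  have "f (fst z) * g (snd z) = (%z. mob (snd z) * g (fst z)) ((%(m, n). (m * n, m)) z)" for z
   by (simp add: f_def g_def case_prod_unfold power_mult_distrib)
  then show ?thesis by (simp only: infsum_reindex_bij_betw[OF bij, of "%z. mob (snd z) * g (fst z)"])
 qed
 also have "... = infsum (%n. infsum (%m. mob m * g n) {m. m dvd n}) A"
 proof -
  have bij: "bij_betw (%(m, n). (m * n, m)) (A \<times> A) (SIGMA n:A. {m. m dvd n})"
  proof (rule bij_betwI[where g = "%(n, m). (m, n div m)"])
   show "(%(n, m). (m, n div m)) \<in> (SIGMA n:A. {m. m dvd n}) \<rightarrow> A \<times> A"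
    by (auto simp: A_def elim!: dvdE)
  qed (auto simp: A_def elim!: dvdE)
  have "f (fst z) * g (snd z) = (%z. mob (snd z) * g (fst z)) ((%(m, n). (m * n, m)) z)" for z
   by (simp add: f_def g_def case_prod_unfold power_mult_distrib)
  then have "(%z. mob (snd z) * g (fst z)) summable_on (SIGMA n:A. {m. m dvd n})"
   using prod summable_on_reindex_bij_betw[OF bij, of "%z. mob (snd z) * g (fst z)"] by (simp only:)
  from infsum_Sigma_banach[OF this] show ?thesis by simp
 qed
 also have "... = infsum (%n. if n = 1 then 1 else 0) A"
 proof (rule infsum_cong)
  fix n assume n: "n \<in> A"
  then have "infsum (%m. mob m * g n) {m. m dvd n} = (\<Sum>m | m dvd n. mob m) * g n"
   by (simp add: A_def sum_distrib_right)
  then show "infsum (%m. mob m * g n) {m. m dvd n} = (if n = 1 then 1 else 0)"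
   using n sum_mob_divisors[of n] by (simp add: A_def g_def)
 qed
 also have "... = infsum (%n. 1) {1::nat}" by (rule infsum_cong_neutral) (auto simp: A_def)
 finally show "infsum (%m. mob m / real m ^ k) A * infsum (%n. 1 / real n ^ k) A = 1" by (simp add: f_def g_def)
qed

lemma mob_series_limit:
 fixes q k :: nat
 assumes k: "k >= 2" and q: "q > 0"
 shows "(%M. \<Sum>m\<in>{m \<in> {1..M}. coprime m q}. mob m / real m ^ k)
  \<longlonglongrightarrow> 1 / zeta (real k) * (\<Prod>p\<in>prime_factors q. real p ^ k / (real p ^ k - 1))"
proof -
 define A where "A = {n. n > 0 & coprime n q}"
 define Z where "Z = infsum (%m. mob m / real m ^ k) A"
 have "coprime n q \<longleftrightarrow> (\<forall>p\<in>prime_factors q. ~ p dvd n)" for n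
 proof
  assume c: "coprime n q"
  show "\<forall>p\<in>prime_factors q. ~ p dvd n"
  proof (intro ballI notI)
   fix p assume p: "p \<in> prime_factors q" "p dvd n"
   then have "is_unit p" by (intro coprime_common_divisor[OF c]) auto
   then show False using p by (auto dest: in_prime_factors_imp_prime)
  qed
 next
  assume h: "\<forall>p\<in>prime_factors q. ~ p dvd n"
  show "coprime n q"
  proof (rule ccontr)
   assume "~ coprime n q"
   then have "gcd n q \<noteq> 1" using coprime_iff_gcd_eq_1 by blast
   then obtain p where "prime p" "p dvd gcd n q" using prime_factor_nat by blast
   then show False using h q by (auto simp: in_prime_factors_iff)
  qed
 qed
 then have A: "A = {n. n > 0 & (\<forall>p\<in>prime_factors q. ~ p dvd n)}" by (simp add: A_def)
 have Z1: "Z * ((\<Prod>p\<in>prime_factors q. 1 - 1 / real p ^ k) * zeta (real k)) = 1"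
  using mob_inverse_powers(1)[OF k q] infsum_prime_sieve[OF k, of "prime_factors q", OF finite_set_mset in_prime_factors_imp_prime] unfolding Z_def A_def[symmetric] A[symmetric] by simp
 have Z2: "(\<Prod>p\<in>prime_factors q. 1 - 1 / real p ^ k) * (\<Prod>p\<in>prime_factors q. real p ^ k / (real p ^ k - 1)) = 1"
  unfolding prod.distrib[symmetric]
 proof (rule prod.neutral, rule ballI)
  fix p assume "p \<in> prime_factors q"
  then have "prime p" by (rule in_prime_factors_imp_prime)
  then have "real p > 1" using prime_gt_1_nat by simp
  then have "real p ^ k > 1" using k by (intro one_less_power) auto
  moreover have "(1 - 1 / a) * (a / (a - 1)) = 1" if "a > 1" for a :: real using that by (simp add: field_simps)
  ultimately show "(1 - 1 / real p ^ k) * (real p ^ k / (real p ^ k - 1)) = 1" by blast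
 qed
 have cancel: "z = 1 / c * b" if "z * (a * c) = 1" "a * b = 1" for z a b c :: real
 proof -
  have "c \<noteq> 0" using that by auto
  have "z * c = (z * c) * (a * b)" using that(2) by simp
  also have "... = (z * (a * c)) * b" by (simp only: mult_ac)
  finally have "z * c = b" using that(1) by simp
  then show ?thesis using \<open>c \<noteq> 0\<close> by (simp add: field_simps)
 qed
 have Z: "Z = 1 / zeta (real k) * (\<Prod>p\<in>prime_factors q. real p ^ k / (real p ^ k - 1))"
  by (rule cancel[OF Z1 Z2])
 have "((%m. mob m / real m ^ k) has_sum Z) A"
  unfolding Z_def A_def by (intro has_sum_infsum mob_inverse_powers(2)[OF k q])
 then have "((%m. if m \<in> A then mob m / real m ^ k else 0) has_sum Z) UNIV"
  by (rule iffD1[OF has_sum_cong_neutral, rotated 3]) auto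
 then have "(%m. if m \<in> A then mob m / real m ^ k else 0) sums Z" by (rule has_sum_imp_sums)
 then have "(%M. \<Sum>m\<le>M. if m \<in> A then mob m / real m ^ k else 0) \<longlonglongrightarrow> Z" by (simp add: sums_def_le)
 moreover have "(\<Sum>m\<le>M. if m \<in> A then mob m / real m ^ k else 0) = (\<Sum>m\<in>{m \<in> {1..M}. coprime m q}. mob m / real m ^ k)" for M
  by (rule sum.mono_neutral_cong_right) (auto simp: A_def)
 ultimately show ?thesis by (simp only: Z)
qed

lemma unit_root_count_cong:
 assumes "[n = n'] (mod int q)"
 shows "unit_root_count k n q = unit_root_count k n' q"
proof -
 have "[x ^ k = n] (mod int q) \<longleftrightarrow> [x ^ k = n'] (mod int q)" for x :: int
  using assms by (meson cong_sym cong_trans)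
 then show ?thesis by (simp only: unit_root_count_def)
qed

text \<open>The residue l' is l / m^6, and m^6 is both a square and a cube. Hence N2 and N3, and
  with them C and D, do not change, and they can be taken out of the Moebius sum.\<close>

lemma coefficients_shift:
 fixes m :: int
 assumes q: "q > 0" and l': "coprime l' (int q)" and m: "coprime m (int q)" and eq: "[l' * m ^ 6 = l] (mod int q)"
 shows "C_coeff q l' = C_coeff q l" "D_coeff q l' = D_coeff q l"
proof -
 have "N2 (l' * b) q = N2 (l * b) q & N3 (l' * b) q = N3 (l * b) q" for b
 proof (cases "coprime b (int q)")
  case True
  have "[l' * m ^ 6 * b = l * b] (mod int q)" by (rule cong_mult[OF eq cong_refl])
  then have c: "[l * b = l' * (m ^ 6 * b)] (mod int q)" by (simp only: mult.assoc cong_sym)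
  have "N2 (l * b) q = card {x. 0 <= x & x < int q & [x ^ 2 * b ^ 3 = l'] (mod int q)}"
   unfolding unit_root_count_cong[OF c, of 2]
  proof (rule unit_root_count_fiber[OF q _ _ l', where u = "m ^ 3 * b ^ 2"])
   have "(m ^ 3 * b ^ 2) ^ 2 = b ^ 3 * (m ^ 6 * b)" by (simp add: eval_nat_numeral mult_ac)
   then show "[(m ^ 3 * b ^ 2) ^ 2 = b ^ 3 * (m ^ 6 * b)] (mod int q)" by (simp only: cong_refl)
  qed (use True m in auto)
  moreover have "N2 (l' * b) q = card {x. 0 <= x & x < int q & [x ^ 2 * b ^ 3 = l'] (mod int q)}"
  proof (rule unit_root_count_fiber[OF q _ _ l', where u = "b ^ 2"])
   have "(b ^ 2) ^ 2 = b ^ 3 * b" by (simp add: eval_nat_numeral mult_ac)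
   then show "[(b ^ 2) ^ 2 = b ^ 3 * b] (mod int q)" by (simp only: cong_refl)
  qed (use True in auto)
  moreover have "N3 (l * b) q = card {x. 0 <= x & x < int q & [x ^ 3 * b ^ 2 = l'] (mod int q)}"
   unfolding unit_root_count_cong[OF c, of 3]
  proof (rule unit_root_count_fiber[OF q _ _ l', where u = "m ^ 2 * b"])
   have "(m ^ 2 * b) ^ 3 = b ^ 2 * (m ^ 6 * b)" by (simp add: eval_nat_numeral mult_ac)
   then show "[(m ^ 2 * b) ^ 3 = b ^ 2 * (m ^ 6 * b)] (mod int q)" by (simp only: cong_refl)
  qed (use True m in auto)
  moreover have "N3 (l' * b) q = card {x. 0 <= x & x < int q & [x ^ 3 * b ^ 2 = l'] (mod int q)}"
  proof (rule unit_root_count_fiber[OF q _ _ l', where u = b])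
   have "b ^ 3 = b ^ 2 * b" by (simp add: eval_nat_numeral mult_ac)
   then show "[b ^ 3 = b ^ 2 * b] (mod int q)" by (simp only: cong_refl)
  qed (use True in auto)
  ultimately show ?thesis by simp
 next
  case False
  then show ?thesis by (simp add: unit_root_count_eq_0)
 qed
 then show "C_coeff q l' = C_coeff q l" "D_coeff q l' = D_coeff q l" by (simp_all only: C_coeff_def D_coeff_def)
qed

section \<open>Summation over the Moebius variable\<close>

lemma sum_powr_low:
 assumes \<sigma>: "0 < \<sigma>" "\<sigma> <= 1/2" and n: "n >= 1"
 shows "(\<Sum>m=1..n. real m powr (\<sigma> - 1)) <= 2 / \<sigma> * real n powr \<sigma>"
proof -
 have d: "DERIV (%x. x powr \<sigma> / \<sigma>) x :> x powr (\<sigma> - 1)" if "x >= real 1" for x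
  using that \<sigma> by (auto intro!: derivative_eq_intros)
 have "\<bar>(\<Sum>k=1+1..n. real k powr (\<sigma> - 1)) - (real n powr \<sigma> / \<sigma> - real 1 powr \<sigma> / \<sigma>)\<bar> <= real 1 powr (\<sigma> - 1)"
  by (rule sum_antideriv_bound[OF d _ _ n]) (use \<sigma> in \<open>auto intro!: powr_mono2'\<close>)
 then have "(\<Sum>k=1+1..n. real k powr (\<sigma> - 1)) <= 1 + real n powr \<sigma> / \<sigma> - 1 / \<sigma>" by simp
 moreover have "(\<Sum>m=1..n. real m powr (\<sigma> - 1)) = 1 + (\<Sum>k=1+1..n. real k powr (\<sigma> - 1))"
  using n by (simp add: sum.atLeast_Suc_atMost)
 moreover have "2 <= 1 / \<sigma>" using \<sigma> by (simp add: field_simps)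
 moreover have "0 <= real n powr \<sigma> / \<sigma>" using \<sigma> by simp
 ultimately have "(\<Sum>m=1..n. real m powr (\<sigma> - 1)) <= real n powr \<sigma> / \<sigma> + real n powr \<sigma> / \<sigma>" by linarith
 then show ?thesis by simp
qed

lemma sum_powr_tail:
 assumes N: "N >= 1"
 shows "(\<Sum>m=N+1..K. real m powr (-6/5)) <= 6 * real N powr (-1/5)"
proof (cases "N <= K")
 case True
 have d: "DERIV (%x. - 5 * x powr (-1/5)) x :> x powr (-6/5)" if "x >= real N" for x
  using that N by (auto intro!: derivative_eq_intros)
 have "\<bar>(\<Sum>k=N+1..K. real k powr (-6/5)) - (- 5 * real K powr (-1/5) - - 5 * real N powr (-1/5))\<bar> <= real N powr (-6/5)"
  by (rule sum_antideriv_bound[OF d _ _ True]) (use N in \<open>auto intro!: powr_mono2'\<close>)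
 moreover have "real N powr (-6/5) <= real N powr (-1/5)" using N by (intro powr_mono) auto
 moreover have "0 <= real K powr (-1/5)" by simp
 moreover have "s <= 6 * n" if "\<bar>s - (- 5 * k - - 5 * n)\<bar> <= a" "a <= n" "0 <= k" for s k n a :: real
  using that by linarith
 ultimately show ?thesis by blast
qed simp

lemma sum_powr_all: "(\<Sum>m=1..K. real m powr (-6/5)) <= 7"
proof (cases "K >= 1")
 case True
 then have "(\<Sum>m=1..K. real m powr (-6/5)) = 1 + (\<Sum>m=1+1..K. real m powr (-6/5))"
  by (simp add: sum.atLeast_Suc_atMost)
 then show ?thesis using sum_powr_tail[of 1 K] by simp
qed simp

text \<open>The exponent is below 1 for m <= M0 and above 1 beyond, so both ranges contribute a
  multiple of M0. With exponent 1 the first range would produce a logarithm of M0, here of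
  x.\<close>

lemma profile_sum:
 fixes \<sigma> M0 :: real
 assumes \<sigma>: "0 < \<sigma>" "\<sigma> <= 1/2" and M0: "M0 > 0"
 shows "(\<Sum>m=1..K. if real m <= M0 then (M0 / real m) powr (1 - \<sigma>) else (M0 / real m) powr (6/5)) <= (2 / \<sigma> + 12) * M0"
proof -
 define N where "N = nat \<lfloor>M0\<rfloor>"
 have N: "real N <= M0" "M0 < real N + 1" unfolding N_def using M0 by linarith+
 define h where "h = (%m. if real m <= M0 then (M0 / real m) powr (1 - \<sigma>) else (M0 / real m) powr (6/5))"
 have h0: "h m >= 0" for m by (simp add: h_def)
 have "(\<Sum>m=1..K. h m) <= (\<Sum>m\<in>{1..N} \<union> {N+1..K}. h m)" by (intro sum_mono2 h0) auto
 also have "... = (\<Sum>m=1..N. h m) + (\<Sum>m=N+1..K. h m)" by (rule sum.union_disjoint) auto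
 also have "... <= 2 / \<sigma> * M0 + 12 * M0"
 proof (rule add_mono)
  show "(\<Sum>m=1..N. h m) <= 2 / \<sigma> * M0"
  proof (cases "N >= 1")
   case True
   have "(\<Sum>m=1..N. h m) = (\<Sum>m=1..N. M0 powr (1 - \<sigma>) * real m powr (\<sigma> - 1))"
   proof (rule sum.cong[OF refl])
    fix m assume "m \<in> {1..N}"
    then have "real m <= M0" "real m > 0" using N by auto
    moreover have "real m powr (\<sigma> - 1) = 1 / real m powr (1 - \<sigma>)" using powr_minus_divide[of "real m" "1 - \<sigma>"] by simp
    ultimately show "h m = M0 powr (1 - \<sigma>) * real m powr (\<sigma> - 1)" using M0 by (simp add: h_def powr_divide)
   qed
   also have "... = M0 powr (1 - \<sigma>) * (\<Sum>m=1..N. real m powr (\<sigma> - 1))" by (simp add: sum_distrib_left)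
   also have "... <= M0 powr (1 - \<sigma>) * (2 / \<sigma> * real N powr \<sigma>)" by (intro mult_left_mono sum_powr_low[OF \<sigma> True]) simp
   also have "... <= M0 powr (1 - \<sigma>) * (2 / \<sigma> * M0 powr \<sigma>)" using N \<sigma> by (intro mult_left_mono powr_mono2) auto
   also have "... = 2 / \<sigma> * (M0 powr (1 - \<sigma>) * M0 powr \<sigma>)" by simp
   also have "M0 powr (1 - \<sigma>) * M0 powr \<sigma> = M0" using M0 by (simp add: powr_add[symmetric])
   finally show ?thesis .
  qed (use \<sigma> M0 in simp)
  have "(\<Sum>m=N+1..K. h m) = (\<Sum>m=N+1..K. M0 powr (6/5) * real m powr (-6/5))"
  proof (rule sum.cong[OF refl])
   fix m assume "m \<in> {N+1..K}"
   then have "~ real m <= M0" "real m > 0" using N by auto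
   then show "h m = M0 powr (6/5) * real m powr (-6/5)" using M0 by (simp add: h_def powr_divide powr_minus_divide)
  qed
  also have "... = M0 powr (6/5) * (\<Sum>m=N+1..K. real m powr (-6/5))" by (simp add: sum_distrib_left)
  also have "... <= 12 * M0"
  proof (cases "N >= 1")
   case True
   have "(\<Sum>m=N+1..K. real m powr (-6/5)) <= 6 * real N powr (-1/5)" by (rule sum_powr_tail[OF True])
   also have "real N powr (-1/5) <= (M0 / 2) powr (-1/5)" using N True M0 by (intro powr_mono2') auto
   also have "(M0 / 2) powr (-1/5) <= 2 * M0 powr (-1/5)"
   proof -
    have "(M0 / 2) powr (-1/5) = 2 powr (1/5) * M0 powr (-1/5)" using M0 by (simp add: powr_divide powr_minus_divide)
    also have "... <= 2 powr 1 * M0 powr (-1/5)" by (intro mult_right_mono powr_mono) auto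
    finally show ?thesis by simp
   qed
   finally have "M0 powr (6/5) * (\<Sum>m=N+1..K. real m powr (-6/5)) <= M0 powr (6/5) * (6 * (2 * M0 powr (-1/5)))"
    by (intro mult_left_mono) auto
   also have "... = 12 * (M0 powr (6/5) * M0 powr (-1/5))" by simp
   also have "M0 powr (6/5) * M0 powr (-1/5) = M0" using M0 by (simp add: powr_add[symmetric])
   finally show ?thesis .
  next
   case False
   then have "M0 < 1" "N = 0" using N by auto
   have "M0 powr (6/5) * (\<Sum>m=N+1..K. real m powr (-6/5)) <= M0 powr 1 * 7"
    unfolding \<open>N = 0\<close> add_0 using sum_powr_all[of K] \<open>M0 < 1\<close> M0 by (intro mult_mono powr_mono') (auto intro: sum_nonneg)
   then show ?thesis using M0 by simp
  qed
  finally show "(\<Sum>m=N+1..K. h m) <= 12 * M0" .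
 qed
 finally show ?thesis unfolding h_def by (simp add: distrib_right)
qed

text \<open>Here t = x^(1/6) / m and Y^(5/6) = t. For 1 <= t <= q^2 the loss t^\<sigma> is at most
  q^(2\<sigma>), so t may be replaced by t^(1 - \<sigma>). For t > q^2 the term Y q^(-1/5) dominates
  t q^(1/12). For t < 1 the bound is Y = t^(6/5) itself. This removes the logarithm of x from the
  final sum.\<close>

lemma profile_bound:
 fixes q :: nat and t \<sigma> :: real
 assumes q: "q > 0" and t: "t > 0" and \<sigma>: "0 < \<sigma>" "\<sigma> <= 1/2"
 defines "Y \<equiv> t powr (6/5)"
 shows "(if Y < sqrt q then Y else max (Y powr (5/6) * real q powr (1/12)) (Y * real q powr (-1/5)))
  <= real q powr (2 * \<sigma>) * (real q powr (1/12) * (if 1 <= t then t powr (1 - \<sigma>) else t powr (6/5)) + real q powr (-1/5) * Y)"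
proof -
 define p where "p = ln (real q)"
 define \<tau> where "\<tau> = ln t"
 have p0: "p >= 0" using q by (simp add: p_def)
 have qx: "real q powr a = exp (a * p)" for a using q by (simp add: powr_def p_def)
 have tx: "t powr a = exp (a * \<tau>)" for a using t by (simp add: powr_def \<tau>_def)
 have Yx: "Y = exp (6/5 * \<tau>)" unfolding Y_def tx ..
 have Y56: "Y powr (5/6) = exp \<tau>" unfolding Y_def using t by (simp add: powr_powr \<tau>_def)
 have sq: "sqrt q = exp (p / 2)" using q by (simp add: p_def powr_half_sqrt[symmetric] powr_def)
 define z where "z = \<sigma> * p"
 define w where "w = \<sigma> * \<tau>"
 have z0: "z >= 0" using \<sigma> p0 by (simp add: z_def)
 define a where "a = exp (2 * z + p / 12) * (if 1 <= t then exp (\<tau> - w) else exp (6/5 * \<tau>))"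
 define b where "b = exp (2 * z + (6/5 * \<tau> - p / 5))"
 have R: "real q powr (2 * \<sigma>) * (real q powr (1/12) * (if 1 <= t then t powr (1 - \<sigma>) else t powr (6/5)) + real q powr (-1/5) * Y) = a + b"
 proof -
  have r1: "real q powr (2 * \<sigma>) * real q powr (1/12) = exp (2 * z + p / 12)"
   unfolding qx exp_add[symmetric] by (rule arg_cong[where f = exp]) (simp add: z_def)
  have r2: "t powr (1 - \<sigma>) = exp (\<tau> - w)" unfolding tx by (simp add: w_def left_diff_distrib)
  have r4: "real q powr (2 * \<sigma>) * (real q powr (-1/5) * Y) = b"
   unfolding qx Yx exp_add[symmetric] b_def by (rule arg_cong[where f = exp]) (simp add: z_def)
  show ?thesis unfolding distrib_left r4 a_def r1[symmetric] r2 unfolding tx by (simp only: mult.assoc)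
 qed
 have ab: "a >= 0" "b >= 0" by (simp_all add: a_def b_def)
 have bb: "Y * real q powr (-1/5) <= b"
 proof -
  have "Y * real q powr (-1/5) = exp (6/5 * \<tau> - p / 5)" unfolding Yx qx by (simp add: exp_add[symmetric])
  then show ?thesis unfolding b_def using z0 by simp
 qed
 show ?thesis unfolding R
 proof (cases "1 <= t")
  case False
  then have tau: "\<tau> < 0" using t by (simp add: \<tau>_def)
  have "Y < sqrt q" unfolding Yx sq using tau p0 by simp
  moreover have "Y <= a"
  proof -
   have "1 * exp (6/5 * \<tau>) <= exp (2 * z + p / 12) * exp (6/5 * \<tau>)" using z0 p0 by (intro mult_right_mono) auto
   then show ?thesis using False by (simp add: a_def Yx)
  qed
  ultimately show "(if Y < sqrt q then Y else max (Y powr (5/6) * real q powr (1/12)) (Y * real q powr (-1/5))) <= a + b" using ab by simp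
 next
  case True
  then have tau: "\<tau> >= 0" by (simp add: \<tau>_def)
  have a: "a = exp (2 * z + p / 12 + (\<tau> - w))" using True by (simp add: a_def exp_add)
  have w_le: "w <= c * z" if "\<tau> <= c * p" for c
   using mult_left_mono[OF that, of \<sigma>] \<sigma> by (simp add: w_def z_def mult_ac)
  show "(if Y < sqrt q then Y else max (Y powr (5/6) * real q powr (1/12)) (Y * real q powr (-1/5))) <= a + b"
  proof (cases "Y < sqrt q")
   case c: True
   then have "6/5 * \<tau> < p / 2" unfolding Yx sq by (simp only: exp_less_cancel_iff)
   then have "\<tau> <= 5/12 * p" by argo
   then have "6/5 * \<tau> <= 2 * z + p / 12 + (\<tau> - w)" using w_le[of "5/12"] z0 by argo
   then have "Y <= a" unfolding Yx a by (simp only: exp_le_cancel_iff)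
   then show ?thesis using c ab by simp
  next
   case c: False
   have e: "Y powr (5/6) * real q powr (1/12) = exp (\<tau> + p / 12)" unfolding Y56 qx by (simp add: exp_add[symmetric])
   have "exp (\<tau> + p / 12) <= a + b"
   proof (cases "\<tau> <= 2 * p")
    case True
    then have "\<tau> + p / 12 <= 2 * z + p / 12 + (\<tau> - w)" using w_le[of 2] by argo
    then have "exp (\<tau> + p / 12) <= a" unfolding a by (simp only: exp_le_cancel_iff)
    then show ?thesis using ab by simp
   next
    case False
    then have "\<tau> + p / 12 <= 2 * z + (6/5 * \<tau> - p / 5)" using z0 p0 by argo
    then have "exp (\<tau> + p / 12) <= b" unfolding b_def by (simp only: exp_le_cancel_iff)
    then show ?thesis using ab by simp
   qed
   then show ?thesis using c ab bb e by simp
  qed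
 qed
qed

lemma floor_log_bound:
 assumes q: "q > 0" and \<epsilon>: "\<epsilon> > 0"
 shows "real (floor_log q + 1) <= (2 / \<epsilon> + 1) * real q powr \<epsilon>"
proof -
 have "2 ^ floor_log q <= q" by (rule floor_log_exp2_le[OF q])
 then have "real (2 ^ floor_log q) <= real q" by (simp only: of_nat_le_iff)
 then have "ln (2 ^ floor_log q) <= ln (real q)" using q by (intro ln_mono) auto
 then have a: "real (floor_log q) * ln 2 <= ln (real q)" by (simp add: ln_realpow)
 have "ln (1 / 2) <= 1 / 2 - (1::real)" by (rule ln_le_minus_one) simp
 then have "1 / 2 <= ln (2::real)" by (simp add: ln_div)
 then have "real (floor_log q) * (1 / 2) <= real (floor_log q) * ln 2" by (intro mult_left_mono) auto
 then have f: "real (floor_log q) <= 2 * ln (real q)" using a by linarith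
 have "ln (real q powr \<epsilon>) <= real q powr \<epsilon> - 1" using q by (intro ln_le_minus_one) auto
 then have "ln (real q) <= real q powr \<epsilon> / \<epsilon>" using q \<epsilon> by (simp add: ln_powr pos_le_divide_eq mult.commute)
 moreover have "1 <= real q powr \<epsilon>" using q \<epsilon> by (intro ge_one_powr_ge_zero) auto
 ultimately have "real (floor_log q) + 1 <= 2 * (real q powr \<epsilon> / \<epsilon>) + real q powr \<epsilon>" using f by linarith
 then show ?thesis by (simp add: distrib_right)
qed

theorem theorem2:
  fixes \<epsilon> :: real
  assumes "\<epsilon> > 0"
  shows "\<exists>K > 0. \<forall>(x::real) (q::nat) (l::int). x > 0 \<longrightarrow> q \<ge> 1 \<longrightarrow> coprime l (int q) \<longrightarrow>
    \<bar>real (squarefull_count q x l)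
       - (C_coeff q l / zeta 3 * (\<Prod>p\<in>prime_factors q. real p ^ 3 / (real p ^ 3 - 1))
            * (x powr (1/2) / real q)
          + D_coeff q l / zeta 2 * (\<Prod>p\<in>prime_factors q. real p ^ 2 / (real p ^ 2 - 1))
            * (x powr (1/3) / real q))\<bar>
    \<le> K * ((x powr (1/6) * real q powr (1/12) + x powr (1/5) / real q powr (1/5))
            * real q powr \<epsilon>)"
proof -
 \<comment> \<open>Five factors q^\<epsilon>1 occur, two from the square of \<open>G\<close> and
   three from the cube of the logarithm, and use \<epsilon>/2. The factor q^(2\<sigma>) of
   \<open>profile_bound\<close> uses the other half.\<close>
 define \<epsilon>1 where "\<epsilon>1 = \<epsilon> / 10"
 define \<sigma> where "\<sigma> = min (\<epsilon> / 4) (1/2)"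
 have e1: "\<epsilon>1 > 0" using assms by (simp add: \<epsilon>1_def)
 have \<sigma>: "0 < \<sigma>" "\<sigma> <= 1/2" "2 * \<sigma> <= \<epsilon> / 2" using assms by (auto simp: \<sigma>_def)
 obtain K0 where K0: "K0 >= 1" "\<And>q l. q > 0 ==> coprime l (int q) ==> modsys q l (K0 * real q powr \<epsilon>1)"
  using modsys_exists[OF e1] by blast
 define K1 where "K1 = 2000000 * K0\<^sup>2 * (2 / \<epsilon>1 + 1) ^ 3"
 have K1: "K1 > 0" using K0 e1 by (auto simp: K1_def intro!: mult_pos_pos add_pos_pos)
 define K where "K = K1 * (2 / \<sigma> + 12)"
 have "K > 0" using K1 \<sigma> by (auto simp: K_def intro!: mult_pos_pos add_pos_pos)
 moreover have "\<bar>real (squarefull_count q x l)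
    - (C_coeff q l / zeta 3 * (\<Prod>p\<in>prime_factors q. real p ^ 3 / (real p ^ 3 - 1))
      * (x powr (1/2) / real q)
     + D_coeff q l / zeta 2 * (\<Prod>p\<in>prime_factors q. real p ^ 2 / (real p ^ 2 - 1))
      * (x powr (1/3) / real q))\<bar>
  <= K * ((x powr (1/6) * real q powr (1/12) + x powr (1/5) / real q powr (1/5)) * real q powr \<epsilon>)"
  if x: "x > 0" and q1: "q >= 1" and l: "coprime l (int q)" for x :: real and q :: nat and l :: int
 proof -
  have q: "q > 0" "real q >= 1" using q1 by auto
  have "\<exists>l'. coprime l' (int q) & [l' * int m ^ 6 = l] (mod int q)" if "m > 0" "coprime m q" for m
  proof -
   have cm: "coprime (int m) (int q)" using that by simp
   obtain v where v: "[int m * v = 1] (mod int q)" using cong_solve_coprime_int[OF cm] by auto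
   have "coprime (int m * v) (int q)" using cong_imp_coprime[OF cong_sym[OF v]] by simp
   then have "coprime (l * v ^ 6) (int q)" using l by simp
   moreover have "[(l * v ^ 6) * int m ^ 6 = l] (mod int q)"
    using cong_mult[OF cong_refl cong_pow[OF v, of 6], of l] by (simp add: power_mult_distrib mult_ac)
   ultimately show ?thesis by blast
  qed
  then obtain lm where lm: "\<And>m. m > 0 ==> coprime m q ==> coprime (lm m) (int q) & [lm m * int m ^ 6 = l] (mod int q)"
   by metis
  define A where "A = (%M. {m \<in> {1..M}. coprime m q})"
  define E where "E = (%m. pair_error q (lm m) (x / real m ^ 6))"
  define C where "C = C_coeff q l * x powr (1/2) / real q"
  define D where "D = D_coeff q l * x powr (1/3) / real q"
  define W where "W = x powr (1/6) * real q powr (1/12) + x powr (1/5) / real q powr (1/5)"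
  have pairs: "mob m * real (card (pairs q (lm m) (x / real m ^ 6))) = C * (mob m / real m ^ 3) + D * (mob m / real m ^ 2) + mob m * E m"
   if m: "m > 0" "coprime m q" for m
  proof -
   have co: "C_coeff q (lm m) = C_coeff q l" "D_coeff q (lm m) = D_coeff q l"
    using coefficients_shift[OF q(1), of "lm m" "int m" l] lm[OF m] m by simp_all
   have "(x / real m ^ 6) powr (1/2) = x powr (1/2) / real m ^ 3" "(x / real m ^ 6) powr (1/3) = x powr (1/3) / real m ^ 2"
    using x m by (simp_all add: powr_divide powr_realpow[symmetric] powr_powr del: powr_realpow powr_numeral)
   then have "real (card (pairs q (lm m) (x / real m ^ 6))) = C / real m ^ 3 + D / real m ^ 2 + E m"
    unfolding E_def pair_error_def co C_def D_def by (simp add: add_divide_distrib)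
   then show ?thesis by (simp add: distrib_left mult.commute[of "mob m"])
  qed
  define K2 where "K2 = K1 * real q powr (\<epsilon> / 2)"
  have K2: "K2 >= 0" using K1 by (simp add: K2_def)
  define h where "h = (%m. if real m <= x powr (1/6) then (x powr (1/6) / real m) powr (1 - \<sigma>) else (x powr (1/6) / real m) powr (6/5))"
  have Em: "\<bar>E m\<bar> <= K2 * (real q powr (2 * \<sigma>) * (real q powr (1/12) * h m + real q powr (-1/5) * (x powr (1/5) * real m powr (-6/5))))"
   if m: "m > 0" "coprime m q" for m
  proof -
   interpret modsys q "lm m" "K0 * real q powr \<epsilon>1" using K0 lm[OF m] q by blast
   define t where "t = x powr (1/6) / real m"
   have t: "t > 0" using x m by (simp add: t_def)
   have Y1: "(x / real m ^ 6) powr (1/5) = t powr (6/5)"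
    using x m by (simp add: t_def powr_divide powr_powr powr_realpow[symmetric] del: powr_realpow powr_numeral)
   have Y2: "t powr (6/5) = x powr (1/5) * real m powr (-6/5)"
    using x m by (simp add: t_def powr_divide powr_powr powr_minus_divide)
   have h: "h m = (if 1 <= t then t powr (1 - \<sigma>) else t powr (6/5))" using m by (simp add: h_def t_def pos_le_divide_eq)
   have "2000000 * (K0 * real q powr \<epsilon>1)\<^sup>2 * real (floor_log q + 1) ^ 3 <= 2000000 * (K0 * real q powr \<epsilon>1)\<^sup>2 * ((2 / \<epsilon>1 + 1) * real q powr \<epsilon>1) ^ 3"
    by (intro mult_left_mono power_mono floor_log_bound q e1) auto
   also have "... = K1 * (real q powr \<epsilon>1) ^ 5" by (simp add: K1_def power_mult_distrib eval_nat_numeral)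
   also have "(real q powr \<epsilon>1) ^ 5 = real q powr (\<epsilon> / 2)" using q by (simp add: powr_power \<epsilon>1_def)
   finally have k: "2000000 * (K0 * real q powr \<epsilon>1)\<^sup>2 * real (floor_log q + 1) ^ 3 <= K2" by (simp only: K2_def)
   have y0: "x / real m ^ 6 > 0" using x m by simp
   show ?thesis unfolding E_def h Y2[symmetric]
    by (rule order_trans[OF pair_error_bound[OF y0, unfolded Y1]], rule mult_mono[OF k profile_bound[OF q(1) t \<sigma>(1,2)] K2], (use t in \<open>auto simp: le_max_iff_disj\<close>)?)
  qed
  have bound: "\<bar>\<Sum>m\<in>A M. mob m * E m\<bar> <= K * (W * real q powr \<epsilon>)" for M
  proof -
   have "\<bar>\<Sum>m\<in>A M. mob m * E m\<bar> <= (\<Sum>m\<in>A M. \<bar>E m\<bar>)"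
    using mult_right_mono[OF abs_mob, of "\<bar>E m\<bar>" for m] by (intro order_trans[OF sum_abs] sum_mono) (simp add: abs_mult)
   also have "... <= (\<Sum>m\<in>A M. K2 * (real q powr (2 * \<sigma>) * (real q powr (1/12) * h m + real q powr (-1/5) * (x powr (1/5) * real m powr (-6/5)))))"
    by (intro sum_mono Em) (auto simp: A_def)
   also have "... <= (\<Sum>m=1..M. K2 * (real q powr (2 * \<sigma>) * (real q powr (1/12) * h m + real q powr (-1/5) * (x powr (1/5) * real m powr (-6/5)))))"
    using K2 by (intro sum_mono2) (auto simp: A_def h_def intro!: mult_nonneg_nonneg add_nonneg_nonneg)
   also have "... = K2 * (real q powr (2 * \<sigma>) * (real q powr (1/12) * (\<Sum>m=1..M. h m) + real q powr (-1/5) * (x powr (1/5) * (\<Sum>m=1..M. real m powr (-6/5)))))"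
    by (simp only: sum_distrib_left[symmetric] sum.distrib)
   also have "... <= K2 * (real q powr (2 * \<sigma>) * (real q powr (1/12) * ((2 / \<sigma> + 12) * x powr (1/6)) + real q powr (-1/5) * (x powr (1/5) * (2 / \<sigma> + 12))))"
   proof (intro mult_left_mono add_mono K2)
    show "(\<Sum>m=1..M. h m) <= (2 / \<sigma> + 12) * x powr (1/6)" unfolding h_def by (rule profile_sum[OF \<sigma>(1,2)]) (use x in simp)
    have "0 <= 2 / \<sigma>" using \<sigma> by simp
    then show "(\<Sum>m=1..M. real m powr (-6/5)) <= 2 / \<sigma> + 12" using sum_powr_all[of M] by linarith
   qed auto
   also have "... = K * (W * (real q powr (\<epsilon> / 2) * real q powr (2 * \<sigma>)))"
   proof -
    have Wi: "W = x powr (1/6) * real q powr (1/12) + x powr (1/5) * real q powr (-1/5)"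
     unfolding W_def using powr_minus_divide[of "real q" "1/5"] by simp
    have "(k * e) * (g * (u * (c * v) + i * (y * c))) = (k * c) * ((v * u + y * i) * (e * g))" for k e g u c v i y :: real
     by (simp add: algebra_simps)
    then show ?thesis unfolding K_def K2_def Wi .
   qed
   also have "real q powr (\<epsilon> / 2) * real q powr (2 * \<sigma>) = real q powr (\<epsilon> / 2 + 2 * \<sigma>)" by (simp add: powr_add)
   also have "K * (W * real q powr (\<epsilon> / 2 + 2 * \<sigma>)) <= K * (W * real q powr \<epsilon>)"
    using \<open>K > 0\<close> q \<sigma> by (intro mult_left_mono powr_mono) (auto simp: W_def)
   finally show ?thesis .
  qed
  have approx: "\<bar>real (squarefull_count q x l) - (C * (\<Sum>m\<in>A M. mob m / real m ^ 3) + D * (\<Sum>m\<in>A M. mob m / real m ^ 2))\<bar> <= K * (W * real q powr \<epsilon>)"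
   if M: "x <= real M" for M
  proof -
   have "real (squarefull_count q x l) = (\<Sum>m\<in>A M. mob m * real (card (pairs q (lm m) (x / real m ^ 6))))"
    unfolding A_def by (rule squarefull_count_moebius[OF q(1) l M]) (use lm in blast)
   also have "... = (\<Sum>m\<in>A M. C * (mob m / real m ^ 3) + D * (mob m / real m ^ 2) + mob m * E m)"
    by (intro sum.cong refl pairs) (auto simp: A_def)
   also have "... = C * (\<Sum>m\<in>A M. mob m / real m ^ 3) + D * (\<Sum>m\<in>A M. mob m / real m ^ 2) + (\<Sum>m\<in>A M. mob m * E m)"
    by (simp only: sum.distrib sum_distrib_left)
   finally show ?thesis using bound[of M] by simp
  qed
  define Z where "Z = (%k. 1 / zeta (real k) * (\<Prod>p\<in>prime_factors q. real p ^ k / (real p ^ k - 1)))"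
  have lim: "(%M. \<Sum>m\<in>A M. mob m / real m ^ k) \<longlonglongrightarrow> Z k" if "k >= 2" for k
   unfolding A_def Z_def by (rule mob_series_limit[OF that q(1)])
  \<comment> \<open>The bound in \<open>approx\<close> is uniform in the cutoff M, so the truncated
    Moebius sums may be replaced by their limits, which are the Euler products of the
    statement.\<close>
  have "(%M. \<bar>real (squarefull_count q x l) - (C * (\<Sum>m\<in>A M. mob m / real m ^ 3) + D * (\<Sum>m\<in>A M. mob m / real m ^ 2))\<bar>)
    \<longlonglongrightarrow> \<bar>real (squarefull_count q x l) - (C * Z 3 + D * Z 2)\<bar>"
   by (intro tendsto_intros lim) auto
  moreover have "\<forall>\<^sub>F M in sequentially. \<bar>real (squarefull_count q x l) - (C * (\<Sum>m\<in>A M. mob m / real m ^ 3) + D * (\<Sum>m\<in>A M. mob m / real m ^ 2))\<bar> <= K * (W * real q powr \<epsilon>)"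
   using eventually_ge_at_top[of "nat \<lceil>x\<rceil>"]
  proof eventually_elim
   case (elim M)
   then have "x <= real M" by linarith
   then show ?case by (rule approx)
  qed
  ultimately have "\<bar>real (squarefull_count q x l) - (C * Z 3 + D * Z 2)\<bar> <= K * (W * real q powr \<epsilon>)"
   by (intro tendsto_upperbound) auto
  moreover have "C * Z 3 = C_coeff q l / zeta 3 * (\<Prod>p\<in>prime_factors q. real p ^ 3 / (real p ^ 3 - 1)) * (x powr (1/2) / real q)"
   "D * Z 2 = D_coeff q l / zeta 2 * (\<Prod>p\<in>prime_factors q. real p ^ 2 / (real p ^ 2 - 1)) * (x powr (1/3) / real q)"
   by (simp_all add: C_def D_def Z_def mult_ac)
  ultimately show ?thesis by (simp only: W_def)
 qed
 ultimately show ?thesis by blast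
qed

end
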